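(* Let $\mathcal{C}$ be a rigid 2-$C^*$-category with finite-dimensional centers. Let $X:\mathcal{N}\to\mathcal{M}$ and $\overline{X}:\mathcal{M}\to\mathcal{N}$ be conjugate 1-arrows in $\mathcal{C}$, and assume that they are connected. Then any solution $r_X,\overline{r}_X$ of the conjugate equations for $X$ and $\overline{X}$ fulfills $$\|\mathbf{1}_X\otimes(r_X^*\cdot r_X)\|\,\|(\overline{r}_X^*\cdot\overline{r}_X)\otimes\mathbf{1}_X\|\ge d_X^{\,2},$$ where the equality is attained if and only if the solution is standard.
   Context: 2-$C^*$-categories. A 2-$C^*$-category $\mathcal{C}$ is a strict 2-category with objects $\mathcal{N},\mathcal{M},\dots$, 1-arrows $X:\mathcal{N}\to\mathcal{M}$, and 2-arrows $t\in\mathrm{Hom}(X,Y)$ (for parallel $X,Y:\mathcal N\to\mathcal M$). The composite of $X:\mathcal{N}\to\mathcal{M}$ and $Y:\mathcal{M}\to\mathcal{L}$ is written $Y\otimes X:\mathcal{N}\to\mathcal{L}$; $I_{\mathcal{N}}$ is the unit 1-arrow, $\mathbf{1}_X$ the unit 2-arrow, $s\cdot r$ is vertical and $t\otimes s$ horizontal composition of 2-arrows ($\otimes$ is evaluated before $\cdot$). Each $\mathrm{Hom}(X,Y)$ is a complex Banach space, compositions are bilinear, there is an antilinear involution $*:\mathrm{Hom}(X,Y)\to\mathrm{Hom}(Y,X)$ with $(s\cdot r)^*=r^*\cdot s^*$, $(s\otimes r)^*=s^*\otimes r^*$, $\mathbf{1}_X^*=\mathbf{1}_X$, $t^*\cdot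 t$ positive in $\mathrm{Hom}(X,X)$, and the norms are submultiplicative with $\|t^*\cdot t\|=\|t\|^2$. So $\mathrm{Hom}(X,X)$ is a unital $C^*$-algebra and $\mathcal{Z}(\mathcal{N}):=\mathrm{Hom}(I_{\mathcal{N}},I_{\mathcal{N}})$ is commutative. $\mathcal{C}$ is assumed closed under finite direct sums ($Z=X\oplus Y$ via isometries $v\in\mathrm{Hom}(X,Z)$, $w\in\mathrm{Hom}(Y,Z)$ with $vv^*+ww^*=\mathbf{1}_Z$) and sub-1-arrows (every projection $p\in\mathrm{Hom}(T,T)$ is $uu^*$ with $u\in\mathrm{Hom}(S,T)$, $u^*u=\mathbf{1}_S$); zero 1-arrows are allowed. $\mathcal{C}$ is rigid if every $X:\mathcal{N}\to\mathcal{M}$ has a conjugate $\overline{X}:\mathcal{M}\to\mathcal{N}$ with $r_X\in\mathrm{Hom}(I_{\mathcal{N}},\overline{X}\otimes X)$, $\overline{r}_X\in\mathrm{Hom}(I_{\mathcal{M}},X\otimes\overline{X})$ solving the conjugate equations $\overline{r}_X^*\otimes\mathbf{1}_X\cdot\mathbf{1}_X\otimes r_X=\mathbf{1}_X$, $r_X^*\otimes\mathbf{1}_{\overline{X}}\cdot\mathbf{1}_{\overline{X}}\otimes\overline{r}_X=\mathbf{1}_{\overline{X}}$. $\mathcal{C}$ has finite-dimensional centers if every $\mathcal{Z}(\mathcal{N})$ is finite-dimensional. Left/right centers of $X:\mathcal{N}\to\mathcal{M}$: $\mathcal{Z}_l^X(\mathcal{N}):=\mathbf{1}_X\otimes\mathcal{Z}(\mathcal{N})$,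 $\mathcal{Z}_r^X(\mathcal{M}):=\mathcal{Z}(\mathcal{M})\otimes\mathbf{1}_X$, subalgebras of the center of $\mathrm{Hom}(X,X)$. $X$ is connected if $\mathcal{Z}_l^X(\mathcal{N})\cap\mathcal{Z}_r^X(\mathcal{M})=\mathbb{C}\mathbf{1}_X$, factorial if both left and right centers equal $\mathbb{C}\mathbf{1}_X$, simple if $\mathrm{Hom}(X,X)=\mathbb{C}\mathbf{1}_X$. Dimension. For simple $Y$, a solution $r_Y,\overline{r}_Y$ is normalized if $\|\mathbf{1}_Y\otimes r_Y\|=\|\overline{r}_Y\otimes\mathbf{1}_Y\|$, and $d_Y:=\|\mathbf{1}_Y\otimes r_Y\|^2$ for any normalized solution. For factorial $Y=\oplus_hY_h$, $\overline{Y}=\oplus_h\overline{Y}_h$ with $Y_h$ simple, via isometries $u_h,\overline{u}_h$, a standard solution is $r_Y=\sum_h\overline{u}_h\otimes u_h\cdot r_h$, $\overline{r}_Y=\sum_hu_h\otimes\overline{u}_h\cdot\overline{r}_h$ with $r_h,\overline{r}_h$ normalized solutions for $Y_h$, and $d_Y:=\|\mathbf{1}_Y\otimes r_Y\|^2=\sum_hd_{Y_h}$. For (nonzero) connected $X$, let $\mathbf{1}_X\otimes q_j$ ($j=1,\dots,n$, $q_j\in\mathcal Z(\mathcal N)$) and $p_i\otimes\mathbf{1}_X$ ($i=1,\dots,m$, $p_i\in\mathcal Z(\mathcal M)$) be the minimal projections of $\mathcal{Z}_l^X(\mathcal{N})$, $\mathcal{Z}_r^X(\mathcal{M})$, and $X_{ij}$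 the sub-1-arrow of $X$ for $p_i\otimes\mathbf{1}_X\otimes q_j$ (factorial, or zero). The matrix dimension $D_X$ is the $m\times n$ matrix with entries $d_{X_{ij}}$ ($0$ if $X_{ij}$ is zero), the scalar dimension is $d_X=\|D_X\|$ ($l^2$-operator norm), and $\nu_X^{1/2},\mu_X^{1/2}$ are the unique positive $l^2$-normalized eigenvectors $D_X^tD_X\nu_X^{1/2}=d_X^2\nu_X^{1/2}$, $D_XD_X^t\mu_X^{1/2}=d_X^2\mu_X^{1/2}$ (entries $\nu_{X,j}^{1/2}$, $\mu_{X,i}^{1/2}$). Standard solution for connected $X$: any solution of the form $$r_X=\sum_{i,j}\frac{\mu_{X,i}^{1/4}}{\nu_{X,j}^{1/4}}\,\overline{v}_{ij}\otimes v_{ij}\cdot r_{ij},\qquad\overline{r}_X=\sum_{i,j}\frac{\nu_{X,j}^{1/4}}{\mu_{X,i}^{1/4}}\,v_{ij}\otimes\overline{v}_{ij}\cdot\overline{r}_{ij},$$ with $v_{ij}\in\mathrm{Hom}(X_{ij},X)$, $\overline{v}_{ij}\in\mathrm{Hom}(\overline{X}_{ij},\overline{X})$ isometries with ranges $p_i\otimes\mathbf{1}_X\otimes q_j$, $q_j\otimes\mathbf{1}_{\overline{X}}\otimes p_i$, and $r_{ij},\overline{r}_{ij}$ a standard solution for the factorial $X_{ij},\overline{X}_{ij}$ (zero if $X_{ij}$ is zero).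
   Formalization: The equality clause is corrected: equality holds iff (c r_X, c^{-1} r̄_X) is standard for some real c>0, since the product of norms is invariant under this rescaling while standard solutions are normalized (e.g. X=I with trivial center, r=2, r̄=1/2 attains equality but is not standard). *)

theory Defs
  imports "HOL-Analysis.L2_Norm" "HOL-Algebra.Module" "HOL-Decision_Procs.Algebra_Aux"
begin

section \<open>2-C*-categories\<close>

text \<open>
  \<open>'o\<close>, \<open>'a\<close>, \<open>'t\<close> are the types of objects, 1-arrows and 2-arrows. The composite of
  \<open>X : N \<rightarrow> M\<close> and \<open>Y : M \<rightarrow> L\<close> is \<open>Y \<boxdot> X : N \<rightarrow> L\<close>; horizontal composition \<open>t \<boxtimes> s\<close> of
  2-arrows binds more tightly than vertical composition \<open>s \<cdot> r\<close> (first \<open>r\<close>, then \<open>s\<close>).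
\<close>

record ('o, 'a, 't) two_cstar =
  Obj :: "'o set"
  Arr1 :: "'a set"
  src :: "'a \<Rightarrow> 'o"
  tgt :: "'a \<Rightarrow> 'o"
  unit1 :: "'o \<Rightarrow> 'a" (\<open>\<^bold>I\<index>\<close>)
  comp1 :: "'a \<Rightarrow> 'a \<Rightarrow> 'a" (infixr \<open>\<boxdot>\<index>\<close> 75)
  Arr2 :: "'t set"
  dom2 :: "'t \<Rightarrow> 'a"
  cod2 :: "'t \<Rightarrow> 'a"
  unit2 :: "'a \<Rightarrow> 't" (\<open>\<^bold>1\<index>\<close>)
  vcomp :: "'t \<Rightarrow> 't \<Rightarrow> 't" (infixr \<open>\<cdot>\<index>\<close> 70)
  hcomp :: "'t \<Rightarrow> 't \<Rightarrow> 't" (infixr \<open>\<boxtimes>\<index>\<close> 75)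
  adj2 :: "'t \<Rightarrow> 't" (\<open>_\<^sup>\<dagger>\<index>\<close> [1000] 999)
  zero2 :: "'a \<Rightarrow> 'a \<Rightarrow> 't"
  add2 :: "'t \<Rightarrow> 't \<Rightarrow> 't"
  scale2 :: "complex \<Rightarrow> 't \<Rightarrow> 't"
  norm2 :: "'t \<Rightarrow> real"

definition arr1 :: "('o, 'a, 't) two_cstar \<Rightarrow> 'o \<Rightarrow> 'o \<Rightarrow> 'a set"
  where "arr1 C N M = {X \<in> Arr1 C. src C X = N \<and> tgt C X = M}"

definition Hom :: "('o, 'a, 't) two_cstar \<Rightarrow> 'a \<Rightarrow> 'a \<Rightarrow> 't set"
  where "Hom C X Y = {t \<in> Arr2 C. dom2 C t = X \<and> cod2 C t = Y}"

text \<open>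
  The complex vector space \<open>Hom(X, Y)\<close>; the fields \<^term>\<open>mult\<close> and \<^term>\<open>one\<close> are only
  meaningful for \<open>X = Y\<close>; the notion of a module does not refer to them.
\<close>

definition Hom_space :: "('o, 'a, 't) two_cstar \<Rightarrow> 'a \<Rightarrow> 'a \<Rightarrow> (complex, 't) module"
  where "Hom_space C X Y =
    \<lparr>carrier = Hom C X Y, mult = vcomp C, one = unit2 C X,
     zero = zero2 C X Y, add = add2 C, smult = scale2 C\<rparr>"

locale complex_banach_space =
  module "cring_class_ops :: complex ring" V for V :: "(complex, 't) module" (structure) +
  fixes nrm :: "'t \<Rightarrow> real"
  assumes nrm_nonneg: "x \<in> carrier V \<Longrightarrow> 0 \<le> nrm x"
    and nrm_eq_0: "x \<in> carrier V \<Longrightarrow> nrm x = 0 \<longleftrightarrow> x = \<zero>"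
    and nrm_smult: "x \<in> carrier V \<Longrightarrow> nrm (c \<odot> x) = cmod c * nrm x"
    and nrm_triangle: "x \<in> carrier V \<Longrightarrow> y \<in> carrier V \<Longrightarrow> nrm (x \<oplus> y) \<le> nrm x + nrm y"
    and complete:
      "\<lbrakk>\<And>n::nat. s n \<in> carrier V;
        \<And>e. e > 0 \<Longrightarrow> \<exists>K. \<forall>m\<ge>K. \<forall>n\<ge>K. nrm (s m \<ominus> s n) < e\<rbrakk>
       \<Longrightarrow> \<exists>x\<in>carrier V. (\<lambda>n. nrm (s n \<ominus> x)) \<longlonglongrightarrow> 0"

locale strict_2_category =
  fixes C :: "('o, 'a, 't) two_cstar" (structure)
  assumes src_tgt: "X \<in> Arr1 C \<Longrightarrow> src C X \<in> Obj C \<and> tgt C X \<in> Obj C"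
    and unit1_arr: "N \<in> Obj C \<Longrightarrow> \<^bold>I N \<in> arr1 C N N"
    and comp1_arr: "\<lbrakk>X \<in> arr1 C N M; Y \<in> arr1 C M L\<rbrakk> \<Longrightarrow> Y \<boxdot> X \<in> arr1 C N L"
    and comp1_assoc: "\<lbrakk>X \<in> arr1 C N M; Y \<in> arr1 C M L; Z \<in> arr1 C L K\<rbrakk>
      \<Longrightarrow> (Z \<boxdot> Y) \<boxdot> X = Z \<boxdot> (Y \<boxdot> X)"
    and comp1_unit: "X \<in> arr1 C N M \<Longrightarrow> X \<boxdot> \<^bold>I N = X \<and> \<^bold>I M \<boxdot> X = X"
    and dom_cod_parallel: "t \<in> Hom C X Y \<Longrightarrow>
      X \<in> Arr1 C \<and> Y \<in> Arr1 C \<and> src C X = src C Y \<and> tgt C X = tgt C Y"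
    and unit2_Hom: "X \<in> Arr1 C \<Longrightarrow> \<^bold>1 X \<in> Hom C X X"
    and vcomp_Hom: "\<lbrakk>r \<in> Hom C X Y; s \<in> Hom C Y Z\<rbrakk> \<Longrightarrow> s \<cdot> r \<in> Hom C X Z"
    and vcomp_assoc: "\<lbrakk>r \<in> Hom C X Y; s \<in> Hom C Y Z; t \<in> Hom C Z W\<rbrakk>
      \<Longrightarrow> (t \<cdot> s) \<cdot> r = t \<cdot> (s \<cdot> r)"
    and vcomp_unit: "t \<in> Hom C X Y \<Longrightarrow> t \<cdot> \<^bold>1 X = t \<and> \<^bold>1 Y \<cdot> t = t"
    and hcomp_Hom: "\<lbrakk>X \<in> arr1 C N M; Y \<in> arr1 C M L; s \<in> Hom C X X'; t \<in> Hom C Y Y'\<rbrakk>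
      \<Longrightarrow> t \<boxtimes> s \<in> Hom C (Y \<boxdot> X) (Y' \<boxdot> X')"
    and hcomp_assoc: "\<lbrakk>X \<in> arr1 C N M; Y \<in> arr1 C M L; Z \<in> arr1 C L K;
        r \<in> Hom C X X'; s \<in> Hom C Y Y'; t \<in> Hom C Z Z'\<rbrakk>
      \<Longrightarrow> (t \<boxtimes> s) \<boxtimes> r = t \<boxtimes> (s \<boxtimes> r)"
    and hcomp_unit: "\<lbrakk>X \<in> arr1 C N M; t \<in> Hom C X X'\<rbrakk>
      \<Longrightarrow> t \<boxtimes> \<^bold>1 (\<^bold>I N) = t \<and> \<^bold>1 (\<^bold>I M) \<boxtimes> t = t"
    and hcomp_unit2: "\<lbrakk>X \<in> arr1 C N M; Y \<in> arr1 C M L\<rbrakk> \<Longrightarrow> \<^bold>1 Y \<boxtimes> \<^bold>1 X = \<^bold>1 (Y \<boxdot> X)"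
    and interchange: "\<lbrakk>X \<in> arr1 C N M; Y \<in> arr1 C M L; s \<in> Hom C X X'; s' \<in> Hom C X' X'';
        t \<in> Hom C Y Y'; t' \<in> Hom C Y' Y''\<rbrakk>
      \<Longrightarrow> (t' \<boxtimes> s') \<cdot> (t \<boxtimes> s) = (t' \<cdot> t) \<boxtimes> (s' \<cdot> s)"

text \<open>\<open>S\<close> is the sub-1-arrow of \<open>T\<close> given by the range of the projection \<open>p\<close>, via \<open>u\<close>.\<close>

definition sub_1_arrow :: "('o, 'a, 't) two_cstar \<Rightarrow> 'a \<Rightarrow> 't \<Rightarrow> 'a \<Rightarrow> 't \<Rightarrow> bool"
  where "sub_1_arrow C S u T p \<longleftrightarrow> u \<in> Hom C S T \<and> u\<^sup>\<dagger> \<cdot> u = \<^bold>1 S \<and> u \<cdot> u\<^sup>\<dagger> = p"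
  for C (structure)

text \<open>
  Positivity of \<open>t\<^sup>\<dagger> \<cdot> t\<close> is expressed, as usual in a C*-algebra, by its being of the form
  \<open>s\<^sup>\<dagger> \<cdot> s\<close> with \<open>s\<close> in the algebra \<open>Hom(X, X)\<close>.
\<close>

locale two_cstar_category = strict_2_category +
  assumes banach: "\<lbrakk>X \<in> arr1 C N M; Y \<in> arr1 C N M\<rbrakk>
      \<Longrightarrow> complex_banach_space (Hom_space C X Y) (norm2 C)"
    and vcomp_add: "\<lbrakk>r \<in> Hom C X Y; r' \<in> Hom C X Y; s \<in> Hom C Y Z; s' \<in> Hom C Y Z\<rbrakk>
      \<Longrightarrow> s \<cdot> add2 C r r' = add2 C (s \<cdot> r) (s \<cdot> r') \<and>
          add2 C s s' \<cdot> r = add2 C (s \<cdot> r) (s' \<cdot> r)"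
    and vcomp_scale: "\<lbrakk>r \<in> Hom C X Y; s \<in> Hom C Y Z\<rbrakk>
      \<Longrightarrow> s \<cdot> scale2 C c r = scale2 C c (s \<cdot> r) \<and> scale2 C c s \<cdot> r = scale2 C c (s \<cdot> r)"
    and hcomp_add: "\<lbrakk>X \<in> arr1 C N M; Y \<in> arr1 C M L; s \<in> Hom C X X'; s' \<in> Hom C X X';
        t \<in> Hom C Y Y'; t' \<in> Hom C Y Y'\<rbrakk>
      \<Longrightarrow> t \<boxtimes> add2 C s s' = add2 C (t \<boxtimes> s) (t \<boxtimes> s') \<and>
          add2 C t t' \<boxtimes> s = add2 C (t \<boxtimes> s) (t' \<boxtimes> s)"
    and hcomp_scale: "\<lbrakk>X \<in> arr1 C N M; Y \<in> arr1 C M L; s \<in> Hom C X X'; t \<in> Hom C Y Y'\<rbrakk>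
      \<Longrightarrow> t \<boxtimes> scale2 C c s = scale2 C c (t \<boxtimes> s) \<and> scale2 C c t \<boxtimes> s = scale2 C c (t \<boxtimes> s)"
    and adj_Hom: "t \<in> Hom C X Y \<Longrightarrow> t\<^sup>\<dagger> \<in> Hom C Y X"
    and adj_adj: "t \<in> Hom C X Y \<Longrightarrow> (t\<^sup>\<dagger>)\<^sup>\<dagger> = t"
    and adj_add: "\<lbrakk>s \<in> Hom C X Y; t \<in> Hom C X Y\<rbrakk> \<Longrightarrow> (add2 C s t)\<^sup>\<dagger> = add2 C (s\<^sup>\<dagger>) (t\<^sup>\<dagger>)"
    and adj_scale: "t \<in> Hom C X Y \<Longrightarrow> (scale2 C c t)\<^sup>\<dagger> = scale2 C (cnj c) (t\<^sup>\<dagger>)"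
    and adj_vcomp: "\<lbrakk>r \<in> Hom C X Y; s \<in> Hom C Y Z\<rbrakk> \<Longrightarrow> (s \<cdot> r)\<^sup>\<dagger> = r\<^sup>\<dagger> \<cdot> s\<^sup>\<dagger>"
    and adj_hcomp: "\<lbrakk>X \<in> arr1 C N M; Y \<in> arr1 C M L; r \<in> Hom C X X'; s \<in> Hom C Y Y'\<rbrakk>
      \<Longrightarrow> (s \<boxtimes> r)\<^sup>\<dagger> = s\<^sup>\<dagger> \<boxtimes> r\<^sup>\<dagger>"
    and adj_unit2: "X \<in> Arr1 C \<Longrightarrow> (\<^bold>1 X)\<^sup>\<dagger> = \<^bold>1 X"
    and positive: "t \<in> Hom C X Y \<Longrightarrow> \<exists>s\<in>Hom C X X. t\<^sup>\<dagger> \<cdot> t = s\<^sup>\<dagger> \<cdot> s"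
    and norm_vcomp: "\<lbrakk>r \<in> Hom C X Y; s \<in> Hom C Y Z\<rbrakk>
      \<Longrightarrow> norm2 C (s \<cdot> r) \<le> norm2 C s * norm2 C r"
    and norm_hcomp: "\<lbrakk>X \<in> arr1 C N M; Y \<in> arr1 C M L; s \<in> Hom C X X'; t \<in> Hom C Y Y'\<rbrakk>
      \<Longrightarrow> norm2 C (t \<boxtimes> s) \<le> norm2 C t * norm2 C s"
    and cstar: "t \<in> Hom C X Y \<Longrightarrow> norm2 C (t\<^sup>\<dagger> \<cdot> t) = (norm2 C t)\<^sup>2"
    and direct_sums: "\<lbrakk>X \<in> arr1 C N M; Y \<in> arr1 C N M\<rbrakk>
      \<Longrightarrow> \<exists>Z v w. v \<in> Hom C X Z \<and> w \<in> Hom C Y Z \<and> v\<^sup>\<dagger> \<cdot> v = \<^bold>1 X \<and> w\<^sup>\<dagger> \<cdot> w = \<^bold>1 Y \<and>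
            add2 C (v \<cdot> v\<^sup>\<dagger>) (w \<cdot> w\<^sup>\<dagger>) = \<^bold>1 Z"
    and sub_1_arrows: "\<lbrakk>p \<in> Hom C T T; p \<cdot> p = p; p\<^sup>\<dagger> = p\<rbrakk> \<Longrightarrow> \<exists>S u. sub_1_arrow C S u T p"

text \<open>
  \<open>(r, rb)\<close> solves the conjugate equations for \<open>X : N \<rightarrow> M\<close> and \<open>Xb : M \<rightarrow> N\<close>, where
  \<open>r \<in> Hom(\<^bold>I N, Xb \<boxdot> X)\<close> and \<open>rb \<in> Hom(\<^bold>I M, X \<boxdot> Xb)\<close>.
\<close>

definition conjugate_solution ::
    "('o, 'a, 't) two_cstar \<Rightarrow> 'a \<Rightarrow> 'a \<Rightarrow> 't \<Rightarrow> 't \<Rightarrow> bool"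
  where "conjugate_solution C X Xb r rb \<longleftrightarrow>
    X \<in> Arr1 C \<and> Xb \<in> arr1 C (tgt C X) (src C X) \<and>
    r \<in> Hom C (\<^bold>I (src C X)) (Xb \<boxdot> X) \<and> rb \<in> Hom C (\<^bold>I (tgt C X)) (X \<boxdot> Xb) \<and>
    (rb\<^sup>\<dagger> \<boxtimes> \<^bold>1 X) \<cdot> (\<^bold>1 X \<boxtimes> r) = \<^bold>1 X \<and>
    (r\<^sup>\<dagger> \<boxtimes> \<^bold>1 Xb) \<cdot> (\<^bold>1 Xb \<boxtimes> rb) = \<^bold>1 Xb"
  for C (structure)

definition rigid :: "('o, 'a, 't) two_cstar \<Rightarrow> bool"
  where "rigid C \<longleftrightarrow> (\<forall>X\<in>Arr1 C. \<exists>Xb r rb. conjugate_solution C X Xb r rb)"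

definition center :: "('o, 'a, 't) two_cstar \<Rightarrow> 'o \<Rightarrow> 't set"
  where "center C N = Hom C (\<^bold>I N) (\<^bold>I N)"
  for C (structure)

definition finite_dimensional_centers :: "('o, 'a, 't) two_cstar \<Rightarrow> bool"
  where "finite_dimensional_centers C \<longleftrightarrow>
    (\<forall>N\<in>Obj C. \<exists>B. finite B \<and> B \<subseteq> center C N \<and>
      (\<forall>z\<in>center C N. \<exists>c. z = finsum (Hom_space C (\<^bold>I N) (\<^bold>I N)) (\<lambda>b. scale2 C (c b) b) B))"
  for C (structure)


section \<open>Left and right centers\<close>

definition left_center :: "('o, 'a, 't) two_cstar \<Rightarrow> 'a \<Rightarrow> 't set"
  where "left_center C X = {\<^bold>1 X \<boxtimes> z |z. z \<in> center C (src C X)}"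
  for C (structure)

definition right_center :: "('o, 'a, 't) two_cstar \<Rightarrow> 'a \<Rightarrow> 't set"
  where "right_center C X = {z \<boxtimes> \<^bold>1 X |z. z \<in> center C (tgt C X)}"
  for C (structure)

definition scalars :: "('o, 'a, 't) two_cstar \<Rightarrow> 'a \<Rightarrow> 't set"
  where "scalars C X = range (\<lambda>c. scale2 C c (\<^bold>1 X))"
  for C (structure)

definition connected_arr :: "('o, 'a, 't) two_cstar \<Rightarrow> 'a \<Rightarrow> bool"
  where "connected_arr C X \<longleftrightarrow> left_center C X \<inter> right_center C X = scalars C X"

definition factorial_arr :: "('o, 'a, 't) two_cstar \<Rightarrow> 'a \<Rightarrow> bool"
  where "factorial_arr C X \<longleftrightarrow> left_center C X = scalars C X \<and> right_center C X = scalars C X"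

definition simple_arr :: "('o, 'a, 't) two_cstar \<Rightarrow> 'a \<Rightarrow> bool"
  where "simple_arr C X \<longleftrightarrow> Hom C X X = scalars C X"

definition minimal_projections :: "('o, 'a, 't) two_cstar \<Rightarrow> 'a \<Rightarrow> 't set \<Rightarrow> 't set"
  where "minimal_projections C X A =
    (let P = {p \<in> A. p \<cdot> p = p \<and> p\<^sup>\<dagger> = p} in
     {p \<in> P. p \<noteq> zero2 C X X \<and> (\<forall>p'\<in>P. p \<cdot> p' = p' \<longrightarrow> p' = zero2 C X X \<or> p' = p)})"
  for C (structure)

abbreviation left_projections :: "('o, 'a, 't) two_cstar \<Rightarrow> 'a \<Rightarrow> 't set"
  where "left_projections C X \<equiv> minimal_projections C X (left_center C X)"

abbreviation right_projections :: "('o, 'a, 't) two_cstar \<Rightarrow> 'a \<Rightarrow> 't set"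
  where "right_projections C X \<equiv> minimal_projections C X (right_center C X)"


section \<open>Dimensions\<close>

definition normalized_solution ::
    "('o, 'a, 't) two_cstar \<Rightarrow> 'a \<Rightarrow> 'a \<Rightarrow> 't \<Rightarrow> 't \<Rightarrow> bool"
  where "normalized_solution C Y Yb r rb \<longleftrightarrow>
    conjugate_solution C Y Yb r rb \<and> norm2 C (\<^bold>1 Y \<boxtimes> r) = norm2 C (rb \<boxtimes> \<^bold>1 Y)"
  for C (structure)

definition direct_sum_decomposition ::
    "('o, 'a, 't) two_cstar \<Rightarrow> 'a \<Rightarrow> nat \<Rightarrow> (nat \<Rightarrow> 'a) \<Rightarrow> (nat \<Rightarrow> 't) \<Rightarrow> bool"
  where "direct_sum_decomposition C Y k Yh u \<longleftrightarrow>
    (\<forall>h<k. u h \<in> Hom C (Yh h) Y \<and> (u h)\<^sup>\<dagger> \<cdot> u h = \<^bold>1 (Yh h)) \<and>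
    finsum (Hom_space C Y Y) (\<lambda>h. u h \<cdot> (u h)\<^sup>\<dagger>) {..<k} = \<^bold>1 Y"
  for C (structure)

text \<open>
  For simple \<open>Y\<close> (one summand) the next two definitions specialize to normalized solutions
  and to the dimension of a simple 1-arrow.
\<close>

definition factorial_standard_solution ::
    "('o, 'a, 't) two_cstar \<Rightarrow> 'a \<Rightarrow> 'a \<Rightarrow> 't \<Rightarrow> 't \<Rightarrow> bool"
  where "factorial_standard_solution C Y Yb r rb \<longleftrightarrow>
    factorial_arr C Y \<and> conjugate_solution C Y Yb r rb \<and>
    (\<exists>k Yh Ybh u ub rh rbh.
      direct_sum_decomposition C Y k Yh u \<and>
      direct_sum_decomposition C Yb k Ybh ub \<and>
      (\<forall>h<k. simple_arr C (Yh h) \<and>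
             normalized_solution C (Yh h) (Ybh h) (rh h) (rbh h)) \<and>
      r = finsum (Hom_space C (\<^bold>I (src C Y)) (Yb \<boxdot> Y))
            (\<lambda>h. (ub h \<boxtimes> u h) \<cdot> rh h) {..<k} \<and>
      rb = finsum (Hom_space C (\<^bold>I (tgt C Y)) (Y \<boxdot> Yb))
            (\<lambda>h. (u h \<boxtimes> ub h) \<cdot> rbh h) {..<k})"
  for C (structure)

definition factorial_dim :: "('o, 'a, 't) two_cstar \<Rightarrow> 'a \<Rightarrow> real"
  where "factorial_dim C Y =
    (THE d. \<exists>Yb r rb. factorial_standard_solution C Y Yb r rb \<and> d = (norm2 C (\<^bold>1 Y \<boxtimes> r))\<^sup>2)"
  for C (structure)

text \<open>
  The rows of the matrix dimension are indexed by the minimal projections \<open>e = p\<^sub>i \<boxtimes> \<^bold>1 X\<close> of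
  the right center, the columns by the minimal projections \<open>f = \<^bold>1 X \<boxtimes> q\<^sub>j\<close> of the left
  center, themselves rather than by an enumeration of them; note that
  \<open>e \<cdot> f = p\<^sub>i \<boxtimes> \<^bold>1 X \<boxtimes> q\<^sub>j\<close>. The dimension of the sub-1-arrow does not depend on its choice.
\<close>

definition matrix_dim :: "('o, 'a, 't) two_cstar \<Rightarrow> 'a \<Rightarrow> 't \<Rightarrow> 't \<Rightarrow> real"
  where "matrix_dim C X e f =
    (if e \<cdot> f = zero2 C X X then 0
     else THE d. \<exists>S u. sub_1_arrow C S u X (e \<cdot> f) \<and> d = factorial_dim C S)"
  for C (structure)

text \<open>The operator norm \<open>l\<^sup>2(J) \<rightarrow> l\<^sup>2(I)\<close> of the \<open>I \<times> J\<close> matrix \<open>A\<close>, for finite \<open>I\<close>, \<open>J\<close>.\<close>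

definition l2_op_norm :: "'i set \<Rightarrow> 'j set \<Rightarrow> ('i \<Rightarrow> 'j \<Rightarrow> real) \<Rightarrow> real"
  where "l2_op_norm I J A =
    (SUP x\<in>{x. L2_set x J \<le> 1}. L2_set (\<lambda>i. \<Sum>j\<in>J. A i j * x j) I)"

text \<open>
  The positive \<open>l\<^sup>2\<close>-normalized eigenvector of the \<open>I \<times> I\<close> matrix \<open>A\<close> for the eigenvalue
  \<open>c\<close>, extended by 0 outside \<open>I\<close>.
\<close>

definition positive_eigenvector :: "'i set \<Rightarrow> ('i \<Rightarrow> 'i \<Rightarrow> real) \<Rightarrow> real \<Rightarrow> 'i \<Rightarrow> real"
  where "positive_eigenvector I A c =
    (THE x. (\<forall>i\<in>I. 0 < x i) \<and> (\<forall>i. i \<notin> I \<longrightarrow> x i = 0) \<and> L2_set x I = 1 \<and>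
            (\<forall>i\<in>I. (\<Sum>j\<in>I. A i j * x j) = c * x i))"

definition scalar_dim :: "('o, 'a, 't) two_cstar \<Rightarrow> 'a \<Rightarrow> real"
  where "scalar_dim C X =
    l2_op_norm (right_projections C X) (left_projections C X) (matrix_dim C X)"

text \<open>The eigenvectors \<open>\<nu>\<^sup>1\<^sup>/\<^sup>2\<close> and \<open>\<mu>\<^sup>1\<^sup>/\<^sup>2\<close> of \<open>D\<^sup>tD\<close> and \<open>DD\<^sup>t\<close>.\<close>

definition nu_half :: "('o, 'a, 't) two_cstar \<Rightarrow> 'a \<Rightarrow> 't \<Rightarrow> real"
  where "nu_half C X = positive_eigenvector (left_projections C X)
    (\<lambda>f f'. \<Sum>e\<in>right_projections C X. matrix_dim C X e f * matrix_dim C X e f')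
    ((scalar_dim C X)\<^sup>2)"

definition mu_half :: "('o, 'a, 't) two_cstar \<Rightarrow> 'a \<Rightarrow> 't \<Rightarrow> real"
  where "mu_half C X = positive_eigenvector (right_projections C X)
    (\<lambda>e e'. \<Sum>f\<in>left_projections C X. matrix_dim C X e f * matrix_dim C X e' f)
    ((scalar_dim C X)\<^sup>2)"


section \<open>Standard solutions for connected 1-arrows\<close>

text \<open>
  \<open>p e\<close> and \<open>q f\<close> are elements of the centers of the target and the source of \<open>X\<close> with
  \<open>e = p e \<boxtimes> \<^bold>1 X\<close> and \<open>f = \<^bold>1 X \<boxtimes> q f\<close>. The square roots of \<open>mu_half\<close> and \<open>nu_half\<close> are
  \<open>\<mu>\<^sup>1\<^sup>/\<^sup>4\<close> and \<open>\<nu>\<^sup>1\<^sup>/\<^sup>4\<close>.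
\<close>

definition standard_solution ::
    "('o, 'a, 't) two_cstar \<Rightarrow> 'a \<Rightarrow> 'a \<Rightarrow> 't \<Rightarrow> 't \<Rightarrow> bool"
  where "standard_solution C X Xb r rb \<longleftrightarrow>
    conjugate_solution C X Xb r rb \<and>
    (\<exists>p q Xij Xbij v vb rij rbij.
      (\<forall>e\<in>right_projections C X. p e \<in> center C (tgt C X) \<and> p e \<boxtimes> \<^bold>1 X = e) \<and>
      (\<forall>f\<in>left_projections C X. q f \<in> center C (src C X) \<and> \<^bold>1 X \<boxtimes> q f = f) \<and>
      (\<forall>e\<in>right_projections C X. \<forall>f\<in>left_projections C X.
        sub_1_arrow C (Xij e f) (v e f) X (p e \<boxtimes> \<^bold>1 X \<boxtimes> q f) \<and>
        sub_1_arrow C (Xbij e f) (vb e f) Xb (q f \<boxtimes> \<^bold>1 Xb \<boxtimes> p e) \<and>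
        (if p e \<boxtimes> \<^bold>1 X \<boxtimes> q f = zero2 C X X
         then rij e f = zero2 C (\<^bold>I (src C X)) (Xbij e f \<boxdot> Xij e f) \<and>
              rbij e f = zero2 C (\<^bold>I (tgt C X)) (Xij e f \<boxdot> Xbij e f)
         else factorial_standard_solution C (Xij e f) (Xbij e f) (rij e f) (rbij e f))) \<and>
      r = finsum (Hom_space C (\<^bold>I (src C X)) (Xb \<boxdot> X))
            (\<lambda>(e, f). scale2 C (complex_of_real (sqrt (mu_half C X e) / sqrt (nu_half C X f)))
                        ((vb e f \<boxtimes> v e f) \<cdot> rij e f))
            (right_projections C X \<times> left_projections C X) \<and>
      rb = finsum (Hom_space C (\<^bold>I (tgt C X)) (X \<boxdot> Xb))
            (\<lambda>(e, f). scale2 C (complex_of_real (sqrt (nu_half C X f) / sqrt (mu_half C X e)))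
                        ((v e f \<boxtimes> vb e f) \<cdot> rbij e f))
            (right_projections C X \<times> left_projections C X))"
  for C (structure)

end

theory Submission
  imports Defs "HOL-Computational_Algebra.Fundamental_Theorem_Algebra" "HOL-Analysis.Function_Topology"
begin

text \<open>
  Let \<open>Y\<close> be factorial. Any two conjugates of \<open>Y\<close> are related by an invertible \<open>w\<close>, and if one of
  the solutions is standard, its left and right traces agree. The squared norms of the other
  solution are then the traces of \<open>w\<^sup>\<dagger> w\<close> and of its inverse, so that Cauchy-Schwarz bounds their
  product from below by the squared dimension, with equality iff \<open>w\<close> is a multiple of a unitary.
  Such a standard solution exists since \<open>Y\<close> is a finite sum of simple arrows: by the conjugate
  equations the norm is dominated by the trace norm, which bounds the number of orthogonal
  projections and makes the even powers of a self-adjoint contraction converge.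

  For connected \<open>X\<close> with matrix dimension \<open>D\<close>, a solution restricts to solutions for the factorial
  blocks, with squared norms \<open>a e f\<close> and \<open>b e f\<close>, where \<open>(D e f)\<^sup>2 \<le> a e f * b e f\<close>. The two norms in the
  theorem bound the column sums of \<open>a\<close> and the row sums of \<open>b\<close>. Testing \<open>D\<close> against its positive
  singular vectors and applying Cauchy-Schwarz once more yields the inequality; equality forces \<open>a\<close>
  and \<open>b\<close> to be \<open>D\<close> weighted by ratios of the entries of these vectors, which is the shape of a
  standard solution.
\<close>

section \<open>Two-dimensional calculus\<close>

text \<open>The product of the two norms does not change when \<open>r\<close> is multiplied by
  \<open>c > 0\<close> and \<open>rb\<close> by \<open>1 / c\<close>, whereas a standard solution
  for a nonzero arrow has both norms equal to \<open>scalar_dim C X\<close>. Equality can therefore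
  detect a standard solution only up to this rescaling, and the factor that balances the two norms
  is the fourth root of their quotient. The dimension of a factorial arrow is a definite description
  over all its standard solutions. The inequality is thus proved relative to an arbitrary standard
  solution; applied to two standard solutions in both orders, it yields the uniqueness that the
  description requires. No spectral theory enters: positivity is handled by direct sums, projections
  arise as limits of powers, and the finite-dimensional centers are split by roots of complex
  polynomials. Zero arrows are connected as well, and they are treated apart because their dimension
  matrix is empty.\<close>

lemma Hom_iff: "t \<in> Hom C X Y \<longleftrightarrow> t \<in> Arr2 C \<and> dom2 C t = X \<and> cod2 C t = Y"
  by (simp add: Hom_def)

lemma arr1_iff: "X \<in> arr1 C N M \<longleftrightarrow> X \<in> Arr1 C \<and> src C X = N \<and> tgt C X = M"
  by (simp add: arr1_def)

section \<open>Typing and interchange in a strict 2-category\<close>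

context strict_2_category
begin

lemma src_Obj [simp]: "X \<in> Arr1 C \<Longrightarrow> src C X \<in> Obj C"
  and tgt_Obj [simp]: "X \<in> Arr1 C \<Longrightarrow> tgt C X \<in> Obj C"
  using src_tgt by auto

lemma unit1_simps [simp]:
  assumes "N \<in> Obj C"
  shows "\<^bold>I N \<in> Arr1 C" "src C (\<^bold>I N) = N" "tgt C (\<^bold>I N) = N"
  using unit1_arr[OF assms] by (auto simp: arr1_iff)

lemma comp1_simps [simp]:
  assumes "X \<in> Arr1 C" "Y \<in> Arr1 C" "src C Y = tgt C X"
  shows "Y \<boxdot> X \<in> Arr1 C" "src C (Y \<boxdot> X) = src C X" "tgt C (Y \<boxdot> X) = tgt C Y"
  using comp1_arr[of X "src C X" "tgt C X" Y "tgt C Y"] assms by (auto simp: arr1_iff)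

lemma comp1_assoc' [simp]:
  assumes "X \<in> Arr1 C" "Y \<in> Arr1 C" "Z \<in> Arr1 C" "src C Y = tgt C X" "src C Z = tgt C Y"
  shows "(Z \<boxdot> Y) \<boxdot> X = Z \<boxdot> Y \<boxdot> X"
  using comp1_assoc assms by (auto simp: arr1_iff)

lemma comp1_unit' [simp]:
  assumes "X \<in> Arr1 C"
  shows "N = src C X \<Longrightarrow> X \<boxdot> \<^bold>I N = X" "M = tgt C X \<Longrightarrow> \<^bold>I M \<boxdot> X = X"
  using comp1_unit assms by (auto simp: arr1_iff)

lemma Arr2_simps [simp]:
  assumes "t \<in> Arr2 C"
  shows "dom2 C t \<in> Arr1 C" "cod2 C t \<in> Arr1 C"
    "src C (cod2 C t) = src C (dom2 C t)" "tgt C (cod2 C t) = tgt C (dom2 C t)"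
  using dom_cod_parallel[of t "dom2 C t" "cod2 C t"] assms by (auto simp: Hom_iff)

lemma Hom_parallel:
  assumes "t \<in> Hom C X Y"
  shows "X \<in> Arr1 C" "Y \<in> Arr1 C" "src C Y = src C X" "tgt C Y = tgt C X"
  using dom_cod_parallel[OF assms] by auto

lemma unit2_simps [simp]:
  assumes "X \<in> Arr1 C"
  shows "\<^bold>1 X \<in> Arr2 C" "dom2 C (\<^bold>1 X) = X" "cod2 C (\<^bold>1 X) = X"
  using unit2_Hom[OF assms] by (auto simp: Hom_iff)

lemma vcomp_simps [simp]:
  assumes "r \<in> Arr2 C" "s \<in> Arr2 C" "dom2 C s = cod2 C r"
  shows "s \<cdot> r \<in> Arr2 C" "dom2 C (s \<cdot> r) = dom2 C r" "cod2 C (s \<cdot> r) = cod2 C s"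
  using vcomp_Hom[of r "dom2 C r" "cod2 C r" s "cod2 C s"] assms by (auto simp: Hom_iff)

lemma vcomp_assoc' [simp]:
  assumes "r \<in> Arr2 C" "s \<in> Arr2 C" "t \<in> Arr2 C" "dom2 C s = cod2 C r" "dom2 C t = cod2 C s"
  shows "(t \<cdot> s) \<cdot> r = t \<cdot> s \<cdot> r"
  using vcomp_assoc assms by (auto simp: Hom_iff)

lemma vcomp_unit' [simp]:
  assumes "t \<in> Arr2 C"
  shows "X = dom2 C t \<Longrightarrow> t \<cdot> \<^bold>1 X = t" "Y = cod2 C t \<Longrightarrow> \<^bold>1 Y \<cdot> t = t"
  using vcomp_unit assms by (auto simp: Hom_iff)

lemma hcomp_simps [simp]:
  assumes "s \<in> Arr2 C" "t \<in> Arr2 C" "src C (dom2 C t) = tgt C (dom2 C s)"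
  shows "t \<boxtimes> s \<in> Arr2 C" "dom2 C (t \<boxtimes> s) = dom2 C t \<boxdot> dom2 C s"
    "cod2 C (t \<boxtimes> s) = cod2 C t \<boxdot> cod2 C s"
  using hcomp_Hom[of "dom2 C s" "src C (dom2 C s)" "tgt C (dom2 C s)" "dom2 C t" "tgt C (dom2 C t)"
      s "cod2 C s" t "cod2 C t"] assms by (auto simp: Hom_iff arr1_iff)

lemma hcomp_assoc' [simp]:
  assumes "r \<in> Arr2 C" "s \<in> Arr2 C" "t \<in> Arr2 C"
    "src C (dom2 C s) = tgt C (dom2 C r)" "src C (dom2 C t) = tgt C (dom2 C s)"
  shows "(t \<boxtimes> s) \<boxtimes> r = t \<boxtimes> s \<boxtimes> r"
  by (rule hcomp_assoc[of "dom2 C r" "src C (dom2 C r)" "tgt C (dom2 C r)" "dom2 C s" "tgt C (dom2 C s)"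
        "dom2 C t" "tgt C (dom2 C t)"]) (use assms in \<open>auto simp: Hom_iff arr1_iff\<close>)

lemma hcomp_unit' [simp]:
  assumes "t \<in> Arr2 C"
  shows "N = src C (dom2 C t) \<Longrightarrow> t \<boxtimes> \<^bold>1 (\<^bold>I N) = t"
    "M = tgt C (dom2 C t) \<Longrightarrow> \<^bold>1 (\<^bold>I M) \<boxtimes> t = t"
  using hcomp_unit[of "dom2 C t" "src C (dom2 C t)" "tgt C (dom2 C t)"] assms
  by (auto simp: Hom_iff arr1_iff)

lemma hcomp_unit2':
  assumes "X \<in> Arr1 C" "Y \<in> Arr1 C" "src C Y = tgt C X"
  shows "\<^bold>1 Y \<boxtimes> \<^bold>1 X = \<^bold>1 (Y \<boxdot> X)"
  using hcomp_unit2 assms by (auto simp: arr1_iff)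

lemma interchange':
  assumes "s \<in> Arr2 C" "s' \<in> Arr2 C" "t \<in> Arr2 C" "t' \<in> Arr2 C"
    "dom2 C s' = cod2 C s" "dom2 C t' = cod2 C t" "src C (dom2 C t) = tgt C (dom2 C s)"
  shows "(t' \<boxtimes> s') \<cdot> (t \<boxtimes> s) = (t' \<cdot> t) \<boxtimes> (s' \<cdot> s)"
  by (rule interchange[of "dom2 C s" "src C (dom2 C s)" "tgt C (dom2 C s)" "dom2 C t" "tgt C (dom2 C t)"])
    (use assms in \<open>auto simp: Hom_iff arr1_iff\<close>)

text \<open>Vertical composites are kept associated to the right, so the two factors that
  interchange merges are usually followed by a further factor \<open>u\<close>.\<close>

lemma interchange_assoc:
  assumes "s \<in> Arr2 C" "s' \<in> Arr2 C" "t \<in> Arr2 C" "t' \<in> Arr2 C"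
    "dom2 C s' = cod2 C s" "dom2 C t' = cod2 C t" "src C (dom2 C t) = tgt C (dom2 C s)"
    "u \<in> Arr2 C" "cod2 C u = dom2 C t \<boxdot> dom2 C s"
  shows "(t' \<boxtimes> s') \<cdot> (t \<boxtimes> s) \<cdot> u = ((t' \<cdot> t) \<boxtimes> (s' \<cdot> s)) \<cdot> u"
  using interchange'[of s s' t t'] vcomp_assoc'[of u "t \<boxtimes> s" "t' \<boxtimes> s'"] assms by simp

lemmas merge = interchange' interchange_assoc

text \<open>Interchange with unit factors. Taken together, the two equations let 2-arrows on
  neighbouring strands pass one another, which is the basic move of all diagrammatic arguments
  below.\<close>

lemma slide:
  assumes "s \<in> Arr2 C" "t \<in> Arr2 C" "src C (dom2 C t) = tgt C (dom2 C s)"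
  shows "(t \<boxtimes> \<^bold>1 (cod2 C s)) \<cdot> (\<^bold>1 (dom2 C t) \<boxtimes> s) = t \<boxtimes> s"
    "(\<^bold>1 (cod2 C t) \<boxtimes> s) \<cdot> (t \<boxtimes> \<^bold>1 (dom2 C s)) = t \<boxtimes> s"
  using assms by (simp_all add: interchange')

lemma whisker_left:
  assumes "s \<in> Arr2 C" "r \<in> Arr2 C" "dom2 C s = cod2 C r" "Z \<in> Arr1 C" "src C Z = tgt C (dom2 C r)"
  shows "\<^bold>1 Z \<boxtimes> (s \<cdot> r) = (\<^bold>1 Z \<boxtimes> s) \<cdot> (\<^bold>1 Z \<boxtimes> r)"
  using assms by (simp add: interchange')

lemma whisker_right:
  assumes "s \<in> Arr2 C" "r \<in> Arr2 C" "dom2 C s = cod2 C r" "Z \<in> Arr1 C" "src C (dom2 C r) = tgt C Z"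
  shows "(s \<cdot> r) \<boxtimes> \<^bold>1 Z = (s \<boxtimes> \<^bold>1 Z) \<cdot> (r \<boxtimes> \<^bold>1 Z)"
  using assms by (simp add: interchange')

end

section \<open>Linear structure and involution on the spaces of 2-arrows\<close>

context two_cstar_category
begin

abbreviation plus2 (infixl \<open>\<^bold>+\<close> 65) where "s \<^bold>+ t \<equiv> add2 C s t"
abbreviation smult2 (infixr \<open>\<^bold>*\<close> 73) where "c \<^bold>* t \<equiv> scale2 C c t"
text \<open>Subtraction adds the multiple by -1, since the record has no field for additive
  inverses.\<close>

abbreviation minus2 (infixl \<open>\<^bold>-\<close> 65) where "s \<^bold>- t \<equiv> add2 C s (scale2 C (-1) t)"
abbreviation nrm where "nrm \<equiv> norm2 C"
abbreviation hsum where "hsum X Y f F \<equiv> finsum (Hom_space C X Y) f F"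

definition parallel where
  "parallel X Y \<longleftrightarrow> X \<in> Arr1 C \<and> Y \<in> Arr1 C \<and> src C X = src C Y \<and> tgt C X = tgt C Y"

lemma banach': "parallel X Y \<Longrightarrow> complex_banach_space (Hom_space C X Y) nrm"
  using banach by (auto simp: parallel_def arr1_iff)

lemma parallel_Hom: "t \<in> Hom C X Y \<Longrightarrow> parallel X Y"
  using dom_cod_parallel by (auto simp: parallel_def)

lemma Hom_linear:
  assumes "parallel X Y"
  shows "s \<in> Hom C X Y \<Longrightarrow> t \<in> Hom C X Y \<Longrightarrow> s \<^bold>+ t \<in> Hom C X Y"
    "t \<in> Hom C X Y \<Longrightarrow> c \<^bold>* t \<in> Hom C X Y"
    "zero2 C X Y \<in> Hom C X Y"
    "s \<in> Hom C X Y \<Longrightarrow> t \<in> Hom C X Y \<Longrightarrow> s \<^bold>+ t = t \<^bold>+ s"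
    "s \<in> Hom C X Y \<Longrightarrow> t \<in> Hom C X Y \<Longrightarrow> u \<in> Hom C X Y \<Longrightarrow> (s \<^bold>+ t) \<^bold>+ u = s \<^bold>+ (t \<^bold>+ u)"
    "s \<in> Hom C X Y \<Longrightarrow> s \<^bold>+ zero2 C X Y = s"
    "t \<in> Hom C X Y \<Longrightarrow> (a + b) \<^bold>* t = a \<^bold>* t \<^bold>+ b \<^bold>* t"
    "s \<in> Hom C X Y \<Longrightarrow> t \<in> Hom C X Y \<Longrightarrow> a \<^bold>* (s \<^bold>+ t) = a \<^bold>* s \<^bold>+ a \<^bold>* t"
    "t \<in> Hom C X Y \<Longrightarrow> a \<^bold>* b \<^bold>* t = (a * b) \<^bold>* t"
    "t \<in> Hom C X Y \<Longrightarrow> 1 \<^bold>* t = t"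
    "t \<in> Hom C X Y \<Longrightarrow> 0 \<^bold>* t = zero2 C X Y"
    "a \<^bold>* zero2 C X Y = zero2 C X Y"
proof -
  interpret V: complex_banach_space "Hom_space C X Y" nrm by (rule banach'[OF assms])
  note d = Hom_space_def cring_class_ops_def
  show "s \<in> Hom C X Y \<Longrightarrow> t \<in> Hom C X Y \<Longrightarrow> s \<^bold>+ t \<in> Hom C X Y"
    using V.M.add.m_closed[of s t] by (simp add: d)
  show "t \<in> Hom C X Y \<Longrightarrow> c \<^bold>* t \<in> Hom C X Y"
    using V.smult_closed[of c t] by (simp add: d)
  show "zero2 C X Y \<in> Hom C X Y"
    using V.M.zero_closed by (simp add: d)
  show "s \<in> Hom C X Y \<Longrightarrow> t \<in> Hom C X Y \<Longrightarrow> s \<^bold>+ t = t \<^bold>+ s"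
    using V.M.add.m_comm[of s t] by (simp add: d)
  show "s \<in> Hom C X Y \<Longrightarrow> t \<in> Hom C X Y \<Longrightarrow> u \<in> Hom C X Y \<Longrightarrow> (s \<^bold>+ t) \<^bold>+ u = s \<^bold>+ (t \<^bold>+ u)"
    using V.M.add.m_assoc[of s t u] by (simp add: d)
  show "s \<in> Hom C X Y \<Longrightarrow> s \<^bold>+ zero2 C X Y = s"
    using V.M.add.r_one[of s] by (simp add: d)
  show "t \<in> Hom C X Y \<Longrightarrow> (a + b) \<^bold>* t = a \<^bold>* t \<^bold>+ b \<^bold>* t"
    using V.smult_l_distr[of a b t] by (simp add: d)
  show "s \<in> Hom C X Y \<Longrightarrow> t \<in> Hom C X Y \<Longrightarrow> a \<^bold>* (s \<^bold>+ t) = a \<^bold>* s \<^bold>+ a \<^bold>* t"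
    using V.smult_r_distr[of a s t] by (simp add: d)
  show "t \<in> Hom C X Y \<Longrightarrow> a \<^bold>* b \<^bold>* t = (a * b) \<^bold>* t"
    using V.smult_assoc1[of a b t] by (simp add: d)
  show "t \<in> Hom C X Y \<Longrightarrow> 1 \<^bold>* t = t"
    using V.smult_one[of t] by (simp add: d)
  show "t \<in> Hom C X Y \<Longrightarrow> 0 \<^bold>* t = zero2 C X Y"
    using V.smult_l_null[of t] by (simp add: d)
  show "a \<^bold>* zero2 C X Y = zero2 C X Y"
    using V.smult_r_null[of a] by (simp add: d)
qed

lemma Hom_abelian: "parallel X Y \<Longrightarrow> abelian_group (Hom_space C X Y)"
  using banach' by (simp add: complex_banach_space_def module_def)

lemma carrier_Hom_space [simp]: "carrier (Hom_space C X Y) = Hom C X Y"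
  by (simp add: Hom_space_def)

lemma add_Hom_space [simp]: "add (Hom_space C X Y) = add2 C"
  by (simp add: Hom_space_def)

lemma zero_Hom_space [simp]: "zero (Hom_space C X Y) = zero2 C X Y"
  by (simp add: Hom_space_def)

lemma nrm_props:
  assumes "parallel X Y"
  shows "t \<in> Hom C X Y \<Longrightarrow> 0 \<le> nrm t"
    "t \<in> Hom C X Y \<Longrightarrow> nrm t = 0 \<longleftrightarrow> t = zero2 C X Y"
    "t \<in> Hom C X Y \<Longrightarrow> nrm (c \<^bold>* t) = cmod c * nrm t"
    "s \<in> Hom C X Y \<Longrightarrow> t \<in> Hom C X Y \<Longrightarrow> nrm (s \<^bold>+ t) \<le> nrm s + nrm t"
proof -
  interpret V: complex_banach_space "Hom_space C X Y" nrm by (rule banach'[OF assms])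
  have [simp]: "module.smult (Hom_space C X Y) = scale2 C" by (simp add: Hom_space_def)
  show "t \<in> Hom C X Y \<Longrightarrow> 0 \<le> nrm t"
    "t \<in> Hom C X Y \<Longrightarrow> nrm t = 0 \<longleftrightarrow> t = zero2 C X Y"
    "t \<in> Hom C X Y \<Longrightarrow> nrm (c \<^bold>* t) = cmod c * nrm t"
    "s \<in> Hom C X Y \<Longrightarrow> t \<in> Hom C X Y \<Longrightarrow> nrm (s \<^bold>+ t) \<le> nrm s + nrm t"
    using V.nrm_nonneg[of t] V.nrm_eq_0[of t] V.nrm_smult[of t c] V.nrm_triangle[of s t] by simp_all
qed

lemma minus_cancel:
  assumes "t \<in> Hom C X Y" shows "t \<^bold>- t = zero2 C X Y"
proof -
  have "t \<^bold>- t = 1 \<^bold>* t \<^bold>- t" using Hom_linear[OF parallel_Hom[OF assms]] assms by simp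
  also have "\<dots> = (1 + -1) \<^bold>* t" using Hom_linear(7)[OF parallel_Hom[OF assms] assms, of 1 "-1"] by simp
  finally show ?thesis using Hom_linear[OF parallel_Hom[OF assms]] assms by simp
qed

text \<open>Completeness is stated with the difference of the abelian group, the calculus with the
  multiple by -1; uniqueness of inverses identifies the two.\<close>

lemma a_minus_Hom_space:
  assumes "s \<in> Hom C X Y" "t \<in> Hom C X Y"
  shows "s \<ominus>\<^bsub>Hom_space C X Y\<^esub> t = s \<^bold>- t"
proof -
  note p = parallel_Hom[OF assms(1)]
  interpret V: abelian_group "Hom_space C X Y" by (rule Hom_abelian[OF p])
  have "(-1) \<^bold>* t = \<ominus>\<^bsub>Hom_space C X Y\<^esub> t"
    using V.minus_equality[of "(-1) \<^bold>* t" t] minus_cancel[OF assms(2)] assms(2) Hom_linear[OF p] by auto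
  then show ?thesis using assms by (simp add: a_minus_def)
qed

lemma Hom_complete:
  assumes "parallel X Y" "\<And>n::nat. s n \<in> Hom C X Y"
    "\<And>e. e > 0 \<Longrightarrow> \<exists>K. \<forall>m\<ge>K. \<forall>n\<ge>K. nrm (s m \<^bold>- s n) < e"
  obtains x where "x \<in> Hom C X Y" "(\<lambda>n. nrm (s n \<^bold>- x)) \<longlonglongrightarrow> 0"
proof -
  interpret V: complex_banach_space "Hom_space C X Y" nrm by (rule banach'[OF assms(1)])
  have "\<exists>x\<in>carrier (Hom_space C X Y). (\<lambda>n. nrm (s n \<ominus>\<^bsub>Hom_space C X Y\<^esub> x)) \<longlonglongrightarrow> 0"
    by (rule V.complete) (use assms a_minus_Hom_space in auto)
  then show ?thesis using that assms a_minus_Hom_space by auto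
qed

lemma add2_simps [simp]:
  assumes "s \<in> Arr2 C" "t \<in> Arr2 C" "dom2 C s = dom2 C t" "cod2 C s = cod2 C t"
  shows "s \<^bold>+ t \<in> Arr2 C" "dom2 C (s \<^bold>+ t) = dom2 C t" "cod2 C (s \<^bold>+ t) = cod2 C t"
  using Hom_linear(1)[of "dom2 C t" "cod2 C t" s t] assms by (auto simp: parallel_def Hom_iff)

lemma scale2_simps [simp]:
  assumes "t \<in> Arr2 C"
  shows "c \<^bold>* t \<in> Arr2 C" "dom2 C (c \<^bold>* t) = dom2 C t" "cod2 C (c \<^bold>* t) = cod2 C t"
    "a \<^bold>* b \<^bold>* t = (a * b) \<^bold>* t" "1 \<^bold>* t = t"
  using Hom_linear(2,9,10)[of "dom2 C t" "cod2 C t" t] assms by (auto simp: parallel_def Hom_iff)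

lemma zero2_simps [simp]:
  assumes "X \<in> Arr1 C" "Y \<in> Arr1 C" "src C X = src C Y" "tgt C X = tgt C Y"
  shows "zero2 C X Y \<in> Arr2 C" "dom2 C (zero2 C X Y) = X" "cod2 C (zero2 C X Y) = Y"
    "a \<^bold>* zero2 C X Y = zero2 C X Y"
  using Hom_linear(3,12)[of X Y] assms by (auto simp: parallel_def Hom_iff)

lemma add2_zero [simp]:
  assumes "s \<in> Arr2 C" "X = dom2 C s" "Y = cod2 C s"
  shows "s \<^bold>+ zero2 C X Y = s" "zero2 C X Y \<^bold>+ s = s"
  using Hom_linear(4,6)[of X Y s] Hom_linear(4)[of X Y s "zero2 C X Y"] assms
  by (auto simp: parallel_def Hom_iff)

lemma scale2_zero: "t \<in> Arr2 C \<Longrightarrow> 0 \<^bold>* t = zero2 C (dom2 C t) (cod2 C t)"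
  using Hom_linear(11)[of "dom2 C t" "cod2 C t" t] by (auto simp: parallel_def Hom_iff)

lemma add2_commute:
  assumes "s \<in> Arr2 C" "t \<in> Arr2 C" "dom2 C s = dom2 C t" "cod2 C s = cod2 C t"
  shows "s \<^bold>+ t = t \<^bold>+ s"
  using Hom_linear(4)[of "dom2 C t" "cod2 C t" s t] assms by (auto simp: parallel_def Hom_iff)

lemma add2_assoc:
  assumes "s \<in> Arr2 C" "t \<in> Arr2 C" "u \<in> Arr2 C" "dom2 C s = dom2 C t" "cod2 C s = cod2 C t"
    "dom2 C u = dom2 C t" "cod2 C u = cod2 C t"
  shows "(s \<^bold>+ t) \<^bold>+ u = s \<^bold>+ (t \<^bold>+ u)"
  using Hom_linear(5)[of "dom2 C t" "cod2 C t" s t u] assms by (auto simp: parallel_def Hom_iff)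

lemma add2_left_commute:
  assumes "s \<in> Arr2 C" "t \<in> Arr2 C" "u \<in> Arr2 C" "dom2 C s = dom2 C t" "cod2 C s = cod2 C t"
    "dom2 C u = dom2 C t" "cod2 C u = cod2 C t"
  shows "s \<^bold>+ (t \<^bold>+ u) = t \<^bold>+ (s \<^bold>+ u)"
  using add2_assoc[of s t u] add2_assoc[of t s u] add2_commute[of s t] assms by simp

lemmas add2_ac = add2_assoc add2_commute add2_left_commute

lemma scale2_distrib:
  "t \<in> Arr2 C \<Longrightarrow> (a + b) \<^bold>* t = a \<^bold>* t \<^bold>+ b \<^bold>* t"
  "\<lbrakk>s \<in> Arr2 C; t \<in> Arr2 C; dom2 C s = dom2 C t; cod2 C s = cod2 C t\<rbrakk>
    \<Longrightarrow> a \<^bold>* (s \<^bold>+ t) = a \<^bold>* s \<^bold>+ a \<^bold>* t"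
  using Hom_linear(7,8)[of "dom2 C t" "cod2 C t"] by (auto simp: parallel_def Hom_iff)

lemma adj2_simps [simp]:
  assumes "t \<in> Arr2 C"
  shows "t\<^sup>\<dagger> \<in> Arr2 C" "dom2 C (t\<^sup>\<dagger>) = cod2 C t" "cod2 C (t\<^sup>\<dagger>) = dom2 C t" "(t\<^sup>\<dagger>)\<^sup>\<dagger> = t"
    "(c \<^bold>* t)\<^sup>\<dagger> = cnj c \<^bold>* t\<^sup>\<dagger>"
  using adj_Hom[of t "dom2 C t" "cod2 C t"] adj_adj[of t "dom2 C t" "cod2 C t"]
    adj_scale[of t "dom2 C t" "cod2 C t"] assms by (auto simp: Hom_iff)

lemma adj2_unit [simp]: "X \<in> Arr1 C \<Longrightarrow> (\<^bold>1 X)\<^sup>\<dagger> = \<^bold>1 X"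
  by (rule adj_unit2)

lemma adj2_add [simp]:
  "\<lbrakk>s \<in> Arr2 C; t \<in> Arr2 C; dom2 C s = dom2 C t; cod2 C s = cod2 C t\<rbrakk>
    \<Longrightarrow> (s \<^bold>+ t)\<^sup>\<dagger> = s\<^sup>\<dagger> \<^bold>+ t\<^sup>\<dagger>"
  using adj_add[of s "dom2 C t" "cod2 C t" t] by (auto simp: Hom_iff)

lemma adj2_vcomp [simp]:
  "\<lbrakk>r \<in> Arr2 C; s \<in> Arr2 C; dom2 C s = cod2 C r\<rbrakk> \<Longrightarrow> (s \<cdot> r)\<^sup>\<dagger> = r\<^sup>\<dagger> \<cdot> s\<^sup>\<dagger>"
  using adj_vcomp by (auto simp: Hom_iff)

lemma adj2_hcomp [simp]:
  assumes "s \<in> Arr2 C" "t \<in> Arr2 C" "src C (dom2 C t) = tgt C (dom2 C s)"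
  shows "(t \<boxtimes> s)\<^sup>\<dagger> = t\<^sup>\<dagger> \<boxtimes> s\<^sup>\<dagger>"
  by (rule adj_hcomp[of "dom2 C s" "src C (dom2 C s)" "tgt C (dom2 C s)" "dom2 C t" "tgt C (dom2 C t)"])
    (use assms in \<open>auto simp: Hom_iff arr1_iff\<close>)

lemma vcomp_linear:
  assumes "r \<in> Arr2 C" "s \<in> Arr2 C" "dom2 C s = cod2 C r"
  shows "s \<cdot> c \<^bold>* r = c \<^bold>* (s \<cdot> r)" "c \<^bold>* s \<cdot> r = c \<^bold>* (s \<cdot> r)"
    "\<lbrakk>r' \<in> Arr2 C; dom2 C r' = dom2 C r; cod2 C r' = cod2 C r\<rbrakk> \<Longrightarrow> s \<cdot> (r \<^bold>+ r') = s \<cdot> r \<^bold>+ s \<cdot> r'"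
    "\<lbrakk>s' \<in> Arr2 C; dom2 C s' = dom2 C s; cod2 C s' = cod2 C s\<rbrakk> \<Longrightarrow> (s \<^bold>+ s') \<cdot> r = s \<cdot> r \<^bold>+ s' \<cdot> r"
  using assms vcomp_scale[of r "dom2 C r" "cod2 C r" s "cod2 C s"]
    vcomp_add[of r "dom2 C r" "cod2 C r" _ s "cod2 C s"]
  by (auto simp: Hom_iff)

lemma hcomp_linear:
  assumes "s \<in> Arr2 C" "t \<in> Arr2 C" "src C (dom2 C t) = tgt C (dom2 C s)"
  shows "t \<boxtimes> (c \<^bold>* s) = c \<^bold>* t \<boxtimes> s" "(c \<^bold>* t) \<boxtimes> s = c \<^bold>* t \<boxtimes> s"
    "\<lbrakk>s' \<in> Arr2 C; dom2 C s' = dom2 C s; cod2 C s' = cod2 C s\<rbrakk> \<Longrightarrow> t \<boxtimes> (s \<^bold>+ s') = t \<boxtimes> s \<^bold>+ t \<boxtimes> s'"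
    "\<lbrakk>t' \<in> Arr2 C; dom2 C t' = dom2 C t; cod2 C t' = cod2 C t\<rbrakk> \<Longrightarrow> (t \<^bold>+ t') \<boxtimes> s = t \<boxtimes> s \<^bold>+ t' \<boxtimes> s"
  using assms hcomp_scale[of "dom2 C s" "src C (dom2 C s)" "tgt C (dom2 C s)" "dom2 C t" "tgt C (dom2 C t)"]
    hcomp_add[of "dom2 C s" "src C (dom2 C s)" "tgt C (dom2 C s)" "dom2 C t" "tgt C (dom2 C t)"]
  by (auto simp: Hom_iff arr1_iff)

text \<open>The zero arrow is its own multiple by the scalar 0, and bilinearity moves that scalar
  out of the composite.\<close>

lemma vcomp_zero [simp]:
  assumes "s \<in> Arr2 C"
  shows "\<lbrakk>X \<in> Arr1 C; src C X = src C (dom2 C s); tgt C X = tgt C (dom2 C s); Y = dom2 C s\<rbrakk>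
      \<Longrightarrow> s \<cdot> zero2 C X Y = zero2 C X (cod2 C s)"
    "\<lbrakk>Z \<in> Arr1 C; src C Z = src C (dom2 C s); tgt C Z = tgt C (dom2 C s); Y = cod2 C s\<rbrakk>
      \<Longrightarrow> zero2 C Y Z \<cdot> s = zero2 C (dom2 C s) Z"
proof -
  assume X: "X \<in> Arr1 C" "src C X = src C (dom2 C s)" "tgt C X = tgt C (dom2 C s)" "Y = dom2 C s"
  have "s \<cdot> zero2 C X Y = s \<cdot> 0 \<^bold>* zero2 C X Y" using X assms by (simp add: scale2_zero)
  also have "\<dots> = 0 \<^bold>* (s \<cdot> zero2 C X Y)"
    by (rule vcomp_linear) (use X assms in auto)
  also have "\<dots> = zero2 C X (cod2 C s)" using X assms by (simp add: scale2_zero)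
  finally show "s \<cdot> zero2 C X Y = zero2 C X (cod2 C s)" .
next
  assume X: "Z \<in> Arr1 C" "src C Z = src C (dom2 C s)" "tgt C Z = tgt C (dom2 C s)" "Y = cod2 C s"
  have "zero2 C Y Z \<cdot> s = 0 \<^bold>* zero2 C Y Z \<cdot> s" using X assms by (simp add: scale2_zero)
  also have "\<dots> = 0 \<^bold>* (zero2 C Y Z \<cdot> s)"
    by (rule vcomp_linear) (use X assms in auto)
  also have "\<dots> = zero2 C (dom2 C s) Z" using X assms by (simp add: scale2_zero)
  finally show "zero2 C Y Z \<cdot> s = zero2 C (dom2 C s) Z" .
qed

lemma hcomp_zero [simp]:
  assumes "s \<in> Arr2 C" "X \<in> Arr1 C" "Y \<in> Arr1 C" "src C X = src C Y" "tgt C X = tgt C Y"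
  shows "src C (dom2 C s) = tgt C Y \<Longrightarrow> s \<boxtimes> zero2 C X Y = zero2 C (dom2 C s \<boxdot> X) (cod2 C s \<boxdot> Y)"
    "src C Y = tgt C (dom2 C s) \<Longrightarrow> zero2 C X Y \<boxtimes> s = zero2 C (X \<boxdot> dom2 C s) (Y \<boxdot> cod2 C s)"
proof -
  assume X: "src C (dom2 C s) = tgt C Y"
  have "s \<boxtimes> zero2 C X Y = s \<boxtimes> (0 \<^bold>* zero2 C X Y)" using X assms by (simp add: scale2_zero)
  also have "\<dots> = 0 \<^bold>* (s \<boxtimes> zero2 C X Y)"
    by (rule hcomp_linear) (use X assms in auto)
  also have "\<dots> = zero2 C (dom2 C s \<boxdot> X) (cod2 C s \<boxdot> Y)" using X assms by (simp add: scale2_zero)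
  finally show "s \<boxtimes> zero2 C X Y = zero2 C (dom2 C s \<boxdot> X) (cod2 C s \<boxdot> Y)" .
next
  assume X: "src C Y = tgt C (dom2 C s)"
  have "zero2 C X Y \<boxtimes> s = (0 \<^bold>* zero2 C X Y) \<boxtimes> s" using X assms by (simp add: scale2_zero)
  also have "\<dots> = 0 \<^bold>* (zero2 C X Y \<boxtimes> s)"
    by (rule hcomp_linear) (use X assms in auto)
  also have "\<dots> = zero2 C (X \<boxdot> dom2 C s) (Y \<boxdot> cod2 C s)" using X assms by (simp add: scale2_zero)
  finally show "zero2 C X Y \<boxtimes> s = zero2 C (X \<boxdot> dom2 C s) (Y \<boxdot> cod2 C s)" .
qed

lemma adj2_zero [simp]:
  assumes "X \<in> Arr1 C" "Y \<in> Arr1 C" "src C X = src C Y" "tgt C X = tgt C Y"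
  shows "(zero2 C X Y)\<^sup>\<dagger> = zero2 C Y X"
proof -
  have "(zero2 C X Y)\<^sup>\<dagger> = (0 \<^bold>* zero2 C X Y)\<^sup>\<dagger>" using assms by (simp add: scale2_zero)
  also have "\<dots> = 0 \<^bold>* (zero2 C X Y)\<^sup>\<dagger>" using assms by (subst adj2_simps) auto
  also have "\<dots> = zero2 C Y X" using assms by (simp add: scale2_zero)
  finally show ?thesis .
qed

end

section \<open>Sums, norms and positivity\<close>

context two_cstar_category
begin

section \<open>Finite sums of 2-arrows\<close>

lemma hsum_empty [simp]: "parallel X Y \<Longrightarrow> hsum X Y f {} = zero2 C X Y"
  using abelian_monoid.finsum_empty[of "Hom_space C X Y" f] Hom_abelian[of X Y]
  by (simp add: abelian_group_def)

lemma hsum_insert: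
  assumes "parallel X Y" "finite F" "i \<notin> F" "\<And>j. j \<in> insert i F \<Longrightarrow> f j \<in> Hom C X Y"
  shows "hsum X Y f (insert i F) = f i \<^bold>+ hsum X Y f F"
  using abelian_monoid.finsum_insert[of "Hom_space C X Y" F i f] Hom_abelian[of X Y] assms
  by (auto simp: abelian_group_def Pi_def)

lemma hsum_Hom:
  assumes "parallel X Y" "\<And>j. j \<in> F \<Longrightarrow> f j \<in> Hom C X Y"
  shows "hsum X Y f F \<in> Hom C X Y"
  using abelian_monoid.finsum_closed[of "Hom_space C X Y" f F] Hom_abelian[of X Y] assms
  by (auto simp: abelian_group_def Pi_def)

lemma hsum_cong:
  assumes "parallel X Y" "F = G" "\<And>j. j \<in> G \<Longrightarrow> f j = g j" "\<And>j. j \<in> G \<Longrightarrow> g j \<in> Hom C X Y"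
  shows "hsum X Y f F = hsum X Y g G"
  using abelian_monoid.finsum_cong'[of "Hom_space C X Y" F G g f] Hom_abelian[of X Y] assms
  by (auto simp: abelian_group_def Pi_def)

text \<open>The one induction behind the rules for finite sums: composition on either side,
  whiskering, involution, scaling and later the center-valued traces are all instances of
  \<phi>.\<close>

lemma hsum_map:
  assumes XY: "parallel X Y" "parallel X' Y'" and "finite F"
    and f: "\<And>j. j \<in> F \<Longrightarrow> f j \<in> Hom C X Y"
    and \<phi>: "\<And>t. t \<in> Hom C X Y \<Longrightarrow> \<phi> t \<in> Hom C X' Y'" "\<phi> (zero2 C X Y) = zero2 C X' Y'"
      "\<And>s t. s \<in> Hom C X Y \<Longrightarrow> t \<in> Hom C X Y \<Longrightarrow> \<phi> (s \<^bold>+ t) = \<phi> s \<^bold>+ \<phi> t"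
  shows "\<phi> (hsum X Y f F) = hsum X' Y' (\<lambda>j. \<phi> (f j)) F"
  using \<open>finite F\<close> f
proof (induction F rule: finite_induct)
  case empty
  then show ?case using XY \<phi> by simp
next
  case (insert i F)
  have "\<phi> (hsum X Y f (insert i F)) = \<phi> (f i \<^bold>+ hsum X Y f F)"
    using XY insert by (subst hsum_insert) auto
  also have "\<dots> = \<phi> (f i) \<^bold>+ \<phi> (hsum X Y f F)"
    using insert XY by (intro \<phi> hsum_Hom) auto
  also have "\<phi> (hsum X Y f F) = hsum X' Y' (\<lambda>j. \<phi> (f j)) F" using insert by auto
  also have "\<phi> (f i) \<^bold>+ hsum X' Y' (\<lambda>j. \<phi> (f j)) F = hsum X' Y' (\<lambda>j. \<phi> (f j)) (insert i F)"
    using XY insert \<phi>(1) by (subst hsum_insert) auto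
  finally show ?case .
qed

lemma vcomp_hsum:
  assumes "parallel X Y" "finite F" "\<And>j. j \<in> F \<Longrightarrow> f j \<in> Hom C X Y" "s \<in> Hom C Y Z"
  shows "s \<cdot> hsum X Y f F = hsum X Z (\<lambda>j. s \<cdot> f j) F"
  by (rule hsum_map) (use assms in \<open>auto simp: Hom_iff parallel_def vcomp_linear\<close>)

lemma hsum_vcomp:
  assumes "parallel X Y" "finite F" "\<And>j. j \<in> F \<Longrightarrow> f j \<in> Hom C X Y" "s \<in> Hom C Z X"
  shows "hsum X Y f F \<cdot> s = hsum Z Y (\<lambda>j. f j \<cdot> s) F"
  by (rule hsum_map[where \<phi> = "\<lambda>t. t \<cdot> s"]) (use assms in \<open>auto simp: Hom_iff parallel_def vcomp_linear\<close>)

lemma hcomp_hsum: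
  assumes "parallel X Y" "finite F" "\<And>j. j \<in> F \<Longrightarrow> f j \<in> Hom C X Y" "s \<in> Hom C Z W" "src C Z = tgt C X"
  shows "s \<boxtimes> hsum X Y f F = hsum (Z \<boxdot> X) (W \<boxdot> Y) (\<lambda>j. s \<boxtimes> f j) F"
  by (rule hsum_map) (use assms in \<open>auto simp: Hom_iff parallel_def hcomp_linear\<close>)

lemma hsum_hcomp:
  assumes "parallel X Y" "finite F" "\<And>j. j \<in> F \<Longrightarrow> f j \<in> Hom C X Y" "s \<in> Hom C Z W" "src C X = tgt C Z"
  shows "hsum X Y f F \<boxtimes> s = hsum (X \<boxdot> Z) (Y \<boxdot> W) (\<lambda>j. f j \<boxtimes> s) F"
  by (rule hsum_map[where \<phi> = "\<lambda>t. t \<boxtimes> s"]) (use assms in \<open>auto simp: Hom_iff parallel_def hcomp_linear\<close>)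

lemma adj_hsum:
  assumes "parallel X Y" "finite F" "\<And>j. j \<in> F \<Longrightarrow> f j \<in> Hom C X Y"
  shows "(hsum X Y f F)\<^sup>\<dagger> = hsum Y X (\<lambda>j. (f j)\<^sup>\<dagger>) F"
  by (rule hsum_map[where \<phi> = "\<lambda>t. t\<^sup>\<dagger>"]) (use assms in \<open>auto simp: Hom_iff parallel_def\<close>)

lemma scale_hsum:
  assumes "parallel X Y" "finite F" "\<And>j. j \<in> F \<Longrightarrow> f j \<in> Hom C X Y"
  shows "c \<^bold>* hsum X Y f F = hsum X Y (\<lambda>j. c \<^bold>* f j) F"
  by (rule hsum_map[where \<phi> = "\<lambda>t. c \<^bold>* t"]) (use assms in \<open>auto simp: Hom_iff parallel_def scale2_distrib\<close>)

lemma hsum_zero: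
  assumes "parallel X Y" "\<And>j. j \<in> F \<Longrightarrow> f j = zero2 C X Y"
  shows "hsum X Y f F = zero2 C X Y"
  using abelian_monoid.finsum_zero[of "Hom_space C X Y" F] Hom_abelian[of X Y] 
    hsum_cong[of X Y F F f "\<lambda>_. zero2 C X Y"] assms
  by (auto simp: abelian_group_def Hom_iff parallel_def)

lemma hsum_delta:
  assumes "parallel X Y" "finite F" "i \<in> F" "f i \<in> Hom C X Y"
    "\<And>j. j \<in> F \<Longrightarrow> j \<noteq> i \<Longrightarrow> f j = zero2 C X Y"
  shows "hsum X Y f F = f i"
proof -
  have F: "F = insert i (F - {i})" using assms by auto
  have "hsum X Y f (insert i (F - {i})) = f i \<^bold>+ hsum X Y f (F - {i})"
    by (rule hsum_insert) (use assms Hom_linear(3) in \<open>auto, metis\<close>)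
  also have "hsum X Y f (F - {i}) = zero2 C X Y" by (rule hsum_zero) (use assms in auto)
  finally show ?thesis using F assms Hom_linear[of X Y] by auto
qed

lemma hsum_scale_const:
  assumes "parallel X Y" "finite F" "t \<in> Hom C X Y"
  shows "hsum X Y (\<lambda>j. c j \<^bold>* t) F = (\<Sum>j\<in>F. c j) \<^bold>* t"
  using \<open>finite F\<close>
proof (induction F rule: finite_induct)
  case empty
  then show ?case using assms by (simp add: Hom_linear)
next
  case (insert i F)
  then show ?case using assms by (simp add: hsum_insert Hom_linear)
qed

lemma hsum_add:
  assumes "parallel X Y" "\<And>j. j \<in> F \<Longrightarrow> f j \<in> Hom C X Y" "\<And>j. j \<in> F \<Longrightarrow> g j \<in> Hom C X Y"
  shows "hsum X Y (\<lambda>j. f j \<^bold>+ g j) F = hsum X Y f F \<^bold>+ hsum X Y g F"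
  using abelian_monoid.finsum_addf[of "Hom_space C X Y" f F g] Hom_abelian[of X Y] assms
  by (auto simp: abelian_group_def Pi_def)

lemma hsum_reindex:
  assumes "parallel X Y" "inj_on h A" "\<And>j. j \<in> h ` A \<Longrightarrow> f j \<in> Hom C X Y"
  shows "hsum X Y f (h ` A) = hsum X Y (\<lambda>j. f (h j)) A"
  using abelian_monoid.finsum_reindex[of "Hom_space C X Y" f h A] Hom_abelian[of X Y] assms
  by (auto simp: abelian_group_def Pi_def)

lemma hsum_Times:
  assumes "parallel X Y" "finite A" "finite B" "\<And>i j. i \<in> A \<Longrightarrow> j \<in> B \<Longrightarrow> f i j \<in> Hom C X Y"
  shows "hsum X Y (\<lambda>(i, j). f i j) (A \<times> B) = hsum X Y (\<lambda>i. hsum X Y (f i) B) A"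
  using \<open>finite A\<close> assms(4)
proof (induction A rule: finite_induct)
  case empty
  then show ?case using assms by simp
next
  case (insert i A)
  interpret V: abelian_group "Hom_space C X Y" by (rule Hom_abelian) fact
  have eq: "insert i A \<times> B = Pair i ` B \<union> A \<times> B" by auto
  have "hsum X Y (\<lambda>(i, j). f i j) (insert i A \<times> B) =
      hsum X Y (\<lambda>(i, j). f i j) (Pair i ` B) \<^bold>+ hsum X Y (\<lambda>(i, j). f i j) (A \<times> B)"
    using V.finsum_Un_disjoint[of "Pair i ` B" "A \<times> B" "\<lambda>(i, j). f i j"] insert assms
    by (auto simp: eq Pi_def)
  also have "hsum X Y (\<lambda>(i, j). f i j) (Pair i ` B) = hsum X Y (f i) B"
    using hsum_reindex[of X Y "Pair i" B "\<lambda>(i, j). f i j"] assms insert by (auto simp: inj_on_def)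
  finally show ?case using insert assms by (simp add: hsum_insert hsum_Hom)
qed

section \<open>The norm, the C*-identity and positive elements\<close>

lemma nrm_zero_iff: "t \<in> Arr2 C \<Longrightarrow> nrm t = 0 \<longleftrightarrow> t = zero2 C (dom2 C t) (cod2 C t)"
  using nrm_props(2)[of "dom2 C t" "cod2 C t" t] by (auto simp: parallel_def Hom_iff)

lemma nrm_nonneg [simp]: "t \<in> Arr2 C \<Longrightarrow> 0 \<le> nrm t"
  using nrm_props(1)[of "dom2 C t" "cod2 C t" t] by (auto simp: parallel_def Hom_iff)

lemma nrm_scale [simp]: "t \<in> Arr2 C \<Longrightarrow> nrm (c \<^bold>* t) = cmod c * nrm t"
  using nrm_props(3)[of "dom2 C t" "cod2 C t" t] by (auto simp: parallel_def Hom_iff)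

lemma nrm_zero [simp]: "parallel X Y \<Longrightarrow> nrm (zero2 C X Y) = 0"
  using nrm_props(2)[of X Y "zero2 C X Y"] by (auto simp: Hom_linear)

lemma nrm_vcomp: "\<lbrakk>r \<in> Arr2 C; s \<in> Arr2 C; dom2 C s = cod2 C r\<rbrakk> \<Longrightarrow> nrm (s \<cdot> r) \<le> nrm s * nrm r"
  using norm_vcomp[of r "dom2 C r" "cod2 C r" s "cod2 C s"] by (auto simp: Hom_iff)

lemma nrm_hcomp:
  "\<lbrakk>s \<in> Arr2 C; t \<in> Arr2 C; src C (dom2 C t) = tgt C (dom2 C s)\<rbrakk> \<Longrightarrow> nrm (t \<boxtimes> s) \<le> nrm t * nrm s"
  by (rule norm_hcomp[of "dom2 C s" "src C (dom2 C s)" "tgt C (dom2 C s)" "dom2 C t" "tgt C (dom2 C t)"])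
    (auto simp: Hom_iff arr1_iff)

lemma nrm_star: "t \<in> Arr2 C \<Longrightarrow> nrm (t\<^sup>\<dagger> \<cdot> t) = (nrm t)\<^sup>2"
  using cstar[of t "dom2 C t" "cod2 C t"] by (auto simp: Hom_iff)

text \<open>The C*-identity and submultiplicativity bound the square of \<open>nrm s\<close> by the
  product of \<open>nrm s\<close> and the norm of its adjoint. After cancellation this is one
  inequality, and the adjoint supplies the other.\<close>

lemma nrm_adj [simp]:
  assumes "t \<in> Arr2 C" shows "nrm (t\<^sup>\<dagger>) = nrm t"
proof -
  have *: "nrm s \<le> nrm (s\<^sup>\<dagger>)" if s: "s \<in> Arr2 C" for s
  proof (cases "nrm s = 0")
    case True then show ?thesis using s by simp
  next
    case False
    then have "nrm s > 0" using s by (simp add: order_less_le)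
    moreover have "nrm s * nrm s \<le> nrm (s\<^sup>\<dagger>) * nrm s"
      using nrm_vcomp[of s "s\<^sup>\<dagger>"] nrm_star[of s] s by (simp add: power2_eq_square)
    ultimately show ?thesis by simp
  qed
  show ?thesis using *[of t] *[of "t\<^sup>\<dagger>"] assms by simp
qed

lemma nrm_unit: "X \<in> Arr1 C \<Longrightarrow> \<^bold>1 X \<noteq> zero2 C X X \<Longrightarrow> nrm (\<^bold>1 X) = 1"
  using nrm_star[of "\<^bold>1 X"] nrm_zero_iff[of "\<^bold>1 X"] by (simp add: power2_eq_square)

lemma nrm_unit_le: "X \<in> Arr1 C \<Longrightarrow> nrm (\<^bold>1 X) \<le> 1"
  using nrm_unit[of X] nrm_zero_iff[of "\<^bold>1 X"] by (cases "\<^bold>1 X = zero2 C X X") simp_all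

text \<open>An inequality, because the domain of the isometry may be a zero arrow, whose unit has
  norm 0.\<close>

lemma nrm_isometry_le:
  assumes "u \<in> Arr2 C" "u\<^sup>\<dagger> \<cdot> u = \<^bold>1 X" "X = dom2 C u"
  shows "nrm u \<le> 1"
proof -
  have "(nrm u)\<^sup>2 \<le> 1" using nrm_star[of u] nrm_unit_le[of X] assms by simp
  then show ?thesis using assms using power2_le_imp_le[of "nrm u" 1] by simp
qed

lemma star_zero:
  assumes "t \<in> Hom C X Y" "t\<^sup>\<dagger> \<cdot> t = zero2 C X X" shows "t = zero2 C X Y"
proof -
  have X: "X \<in> Arr1 C" using assms Hom_parallel by blast
  have "(nrm t)\<^sup>2 = 0" using nrm_star[of t] assms X nrm_zero[of X X] by (auto simp: Hom_iff parallel_def)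
  then show ?thesis using nrm_zero_iff[of t] assms by (auto simp: Hom_iff)
qed

lemma scale_cancel:
  assumes "a \<^bold>* t = b \<^bold>* t" "t \<in> Hom C X Y" "t \<noteq> zero2 C X Y"
  shows "a = b"
proof -
  have t: "t \<in> Arr2 C" using assms by (auto simp: Hom_iff)
  have "(a - b) \<^bold>* t = a \<^bold>* t \<^bold>- b \<^bold>* t" using t scale2_distrib(1)[of t a "-b"] by simp
  also have "\<dots> = zero2 C X Y" using minus_cancel[of "b \<^bold>* t" X Y] assms Hom_linear(2)[OF parallel_Hom[OF assms(2)] assms(2)]
    by simp
  finally have "cmod (a - b) * nrm t = 0"
    using nrm_scale[OF t, of "a - b"] nrm_zero[OF parallel_Hom[OF assms(2)]] by simp
  moreover have "nrm t \<noteq> 0" using nrm_zero_iff[OF t] assms by (auto simp: Hom_iff)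
  ultimately show ?thesis by simp
qed

text \<open>Direct sums make the positive cone convex without any functional calculus.\<close>

lemma positive_add:
  assumes "x \<in> Hom C X Y" "y \<in> Hom C X Z"
  obtains W u where "u \<in> Hom C X W" "x\<^sup>\<dagger> \<cdot> x \<^bold>+ y\<^sup>\<dagger> \<cdot> y = u\<^sup>\<dagger> \<cdot> u" "nrm x \<le> nrm u" "nrm y \<le> nrm u"
proof -
  have par: "Y \<in> arr1 C (src C X) (tgt C X)" "Z \<in> arr1 C (src C X) (tgt C X)" "X \<in> Arr1 C"
    using Hom_parallel[OF assms(1)] Hom_parallel[OF assms(2)] by (auto simp: arr1_iff)
  obtain W v w where W: "v \<in> Hom C Y W" "w \<in> Hom C Z W" "v\<^sup>\<dagger> \<cdot> v = \<^bold>1 Y" "w\<^sup>\<dagger> \<cdot> w = \<^bold>1 Z"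
    "v \<cdot> v\<^sup>\<dagger> \<^bold>+ w \<cdot> w\<^sup>\<dagger> = \<^bold>1 W" using direct_sums[OF par(1,2)] by blast
  have Y: "Y \<in> Arr1 C" "Z \<in> Arr1 C" "src C Y = src C Z" "tgt C Y = tgt C Z" using par by (auto simp: arr1_iff)
  have WW: "W \<in> Arr1 C" "src C W = src C Z" "tgt C W = tgt C Z" using Hom_parallel[OF W(2)] by auto
  have ts[simp]: "v \<in> Arr2 C" "w \<in> Arr2 C" "dom2 C v = Y" "cod2 C v = W" "dom2 C w = Z" "cod2 C w = W"
    using W by (auto simp: Hom_iff)
  \<comment> \<open>The ranges of \<open>v\<close> and \<open>w\<close> are orthogonal: multiplying
    the resolution of the unit of \<open>W\<close> by \<open>w\<^sup>\<dagger>\<close> on the left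
    and \<open>v\<close> on the right gives \<open>w\<^sup>\<dagger> \<cdot> v\<close> as twice
    itself.\<close>
  have wv: "w\<^sup>\<dagger> \<cdot> v = zero2 C Y Z"
  proof -
    have "v = v \<^bold>+ w \<cdot> w\<^sup>\<dagger> \<cdot> v"
    proof -
      have "v = (v \<cdot> v\<^sup>\<dagger> \<^bold>+ w \<cdot> w\<^sup>\<dagger>) \<cdot> v" using W(5) by simp
      also have "\<dots> = v \<^bold>+ w \<cdot> w\<^sup>\<dagger> \<cdot> v" by (simp add: vcomp_linear W(3))
      finally show ?thesis .
    qed
    then have "w\<^sup>\<dagger> \<cdot> v = w\<^sup>\<dagger> \<cdot> (v \<^bold>+ w \<cdot> w\<^sup>\<dagger> \<cdot> v)" by simp
    also have "\<dots> = w\<^sup>\<dagger> \<cdot> v \<^bold>+ (w\<^sup>\<dagger> \<cdot> w) \<cdot> w\<^sup>\<dagger> \<cdot> v" by (subst vcomp_linear) auto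
    also have "\<dots> = w\<^sup>\<dagger> \<cdot> v \<^bold>+ w\<^sup>\<dagger> \<cdot> v" by (subst W(4)) (use Y in simp)
    finally have "w\<^sup>\<dagger> \<cdot> v \<^bold>- w\<^sup>\<dagger> \<cdot> v = (w\<^sup>\<dagger> \<cdot> v \<^bold>+ w\<^sup>\<dagger> \<cdot> v) \<^bold>- w\<^sup>\<dagger> \<cdot> v" by simp
    also have "\<dots> = w\<^sup>\<dagger> \<cdot> v \<^bold>+ (w\<^sup>\<dagger> \<cdot> v \<^bold>- w\<^sup>\<dagger> \<cdot> v)" by (rule add2_assoc) auto
    finally show ?thesis using minus_cancel[of "w\<^sup>\<dagger> \<cdot> v" Y Z] Y by (simp add: Hom_iff)
  qed
  have vw: "v\<^sup>\<dagger> \<cdot> w = zero2 C Z Y"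
    using arg_cong[OF wv, of "adj2 C"] Y by simp
  have xs[simp]: "x \<in> Arr2 C" "y \<in> Arr2 C" "dom2 C x = X" "cod2 C x = Y" "dom2 C y = X" "cod2 C y = Z"
    using assms by (auto simp: Hom_iff)
  \<comment> \<open>The column with entries \<open>x\<close> and \<open>y\<close>, read as a single
    arrow into the direct sum.\<close>
  define u where "u = v \<cdot> x \<^bold>+ w \<cdot> y"
  have u: "u \<in> Hom C X W" by (simp add: u_def Hom_iff)
  have vu: "v\<^sup>\<dagger> \<cdot> u = x"
  proof -
    have "v\<^sup>\<dagger> \<cdot> u = (v\<^sup>\<dagger> \<cdot> v) \<cdot> x \<^bold>+ (v\<^sup>\<dagger> \<cdot> w) \<cdot> y" unfolding u_def by (subst vcomp_linear) auto
    then show ?thesis using W(3) vw Y par Hom_parallel[OF assms(2)] by simp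
  qed
  have wu: "w\<^sup>\<dagger> \<cdot> u = y"
  proof -
    have "w\<^sup>\<dagger> \<cdot> u = (w\<^sup>\<dagger> \<cdot> v) \<cdot> x \<^bold>+ (w\<^sup>\<dagger> \<cdot> w) \<cdot> y" unfolding u_def by (subst vcomp_linear) auto
    then show ?thesis using W(4) wv Y par Hom_parallel[OF assms(1)] by simp
  qed
  have "u\<^sup>\<dagger> \<cdot> u = x\<^sup>\<dagger> \<cdot> v\<^sup>\<dagger> \<cdot> u \<^bold>+ y\<^sup>\<dagger> \<cdot> w\<^sup>\<dagger> \<cdot> u"
    using u unfolding Hom_iff by (subst (1) u_def) (simp add: vcomp_linear)
  then have "u\<^sup>\<dagger> \<cdot> u = x\<^sup>\<dagger> \<cdot> x \<^bold>+ y\<^sup>\<dagger> \<cdot> y" using vu wu by simp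
  \<comment> \<open>Both entries are obtained from \<open>u\<close> by contractions. These estimates
    take the place of monotonicity of the norm on the positive cone.\<close>
  moreover have "nrm x \<le> nrm u" if "x = v\<^sup>\<dagger> \<cdot> u" "v \<in> Arr2 C" "cod2 C v = W" "nrm v \<le> 1" for v x
  proof -
    have ua: "u \<in> Arr2 C" "cod2 C u = W" using u by (auto simp: Hom_iff)
    have "nrm x \<le> nrm (v\<^sup>\<dagger>) * nrm u" unfolding that(1) by (rule nrm_vcomp) (use that ua in auto)
    also have "\<dots> \<le> 1 * nrm u" using that ua by (intro mult_right_mono) auto
    finally show ?thesis by simp
  qed
  note this[of x v] this[of y w]
  moreover have "nrm v \<le> 1" "nrm w \<le> 1"
    by (rule nrm_isometry_le[of _ Y], simp, rule W, simp, rule nrm_isometry_le[of _ Z], simp, rule W, simp)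
  ultimately show ?thesis using that[OF u] vu wu by simp
qed

text \<open>The norm estimate is carried through the induction so that a vanishing sum forces
  \<open>u\<close>, and with it every summand, to vanish.\<close>

lemma positive_hsum:
  assumes "finite F" "X \<in> Arr1 C" "\<And>i. i \<in> F \<Longrightarrow> x i \<in> Hom C X (Y i)"
  shows "\<exists>W u. u \<in> Hom C X W \<and> hsum X X (\<lambda>i. (x i)\<^sup>\<dagger> \<cdot> x i) F = u\<^sup>\<dagger> \<cdot> u \<and> (\<forall>i\<in>F. nrm (x i) \<le> nrm u)"
  using assms(1,3)
proof (induction F rule: finite_induct)
  case empty
  have "zero2 C X X \<in> Hom C X X" "parallel X X" using assms by (auto simp: Hom_iff parallel_def)
  then show ?case using assms by (intro exI[of _ X] exI[of _ "zero2 C X X"]) auto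
next
  case (insert i F)
  then obtain W u where u: "u \<in> Hom C X W" "hsum X X (\<lambda>i. (x i)\<^sup>\<dagger> \<cdot> x i) F = u\<^sup>\<dagger> \<cdot> u" "\<forall>i\<in>F. nrm (x i) \<le> nrm u"
    by auto
  obtain W' u' where u': "u' \<in> Hom C X W'" "(x i)\<^sup>\<dagger> \<cdot> x i \<^bold>+ u\<^sup>\<dagger> \<cdot> u = u'\<^sup>\<dagger> \<cdot> u'" "nrm (x i) \<le> nrm u'" "nrm u \<le> nrm u'"
    by (rule positive_add[OF insert(4)[of i] u(1)]) auto
  have "hsum X X (\<lambda>i. (x i)\<^sup>\<dagger> \<cdot> x i) (insert i F) = u'\<^sup>\<dagger> \<cdot> u'"
    by (subst hsum_insert) (use insert u u' assms in \<open>auto simp: Hom_iff parallel_def\<close>)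
  then show ?case using u u' by (intro exI[of _ W'] exI[of _ u']) force
qed

lemma positive_sum_zero:
  assumes "finite F" "X \<in> Arr1 C" "\<And>i. i \<in> F \<Longrightarrow> x i \<in> Hom C X (Y i)"
    "hsum X X (\<lambda>i. (x i)\<^sup>\<dagger> \<cdot> x i) F = zero2 C X X" "i \<in> F"
  shows "x i = zero2 C X (Y i)"
proof -
  obtain W u where u: "u \<in> Hom C X W" "hsum X X (\<lambda>i. (x i)\<^sup>\<dagger> \<cdot> x i) F = u\<^sup>\<dagger> \<cdot> u" "\<forall>i\<in>F. nrm (x i) \<le> nrm u"
    using positive_hsum[of F X x Y] assms by blast
  have "u = zero2 C X W" using star_zero[of u X W] u assms by simp
  then have "nrm u = 0" using u parallel_Hom[of u X W] by simp
  then have "nrm (x i) = 0" using u(3) assms(3)[OF assms(5)] assms(5) nrm_nonneg[of "x i"] by (auto simp: Hom_iff intro: antisym)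
  then show ?thesis using nrm_zero_iff[of "x i"] assms(3)[OF assms(5)] by (auto simp: Hom_iff)
qed

text \<open>Self-adjointness makes \<open>c\<close> real and the C*-identity gives its modulus,
  since a nonzero unit has norm 1; the substance is the sign. In this way squared norms are read off
  from 2-arrows known to be scalar.\<close>

lemma positive_scalar:
  assumes "t \<in> Hom C X Y" "t\<^sup>\<dagger> \<cdot> t = c \<^bold>* \<^bold>1 X" "\<^bold>1 X \<noteq> zero2 C X X"
  shows "c = complex_of_real ((nrm t)\<^sup>2)"
proof -
  have X: "X \<in> Arr1 C" using assms Hom_parallel by blast
  have t: "t \<in> Arr2 C" "dom2 C t = X" "cod2 C t = Y" using assms by (auto simp: Hom_iff)
  have h1: "\<^bold>1 X \<in> Hom C X X" using X by (simp add: Hom_iff)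
  have "cnj c \<^bold>* \<^bold>1 X = c \<^bold>* \<^bold>1 X" 
  proof -
    have "t\<^sup>\<dagger> \<cdot> t = (t\<^sup>\<dagger> \<cdot> t)\<^sup>\<dagger>" using t by simp
    then show ?thesis using X assms(2) by simp
  qed
  then have "cnj c = c" using scale_cancel h1 assms(3) by blast
  then obtain a where a: "c = complex_of_real a" by (metis Reals_cnj_iff Reals_cases)
  have n: "\<bar>a\<bar> = (nrm t)\<^sup>2" using nrm_star[of t] t assms nrm_unit[of X] X by (simp add: a)
  have "a \<ge> 0"
  proof (rule ccontr)
    assume neg: "\<not> a \<ge> 0"
    \<comment> \<open>A negative scalar \<open>a\<close> would be compensated by the square of
      \<open>y\<close>, which is \<open>- a\<close> times the unit. Two positive elements with sum
      zero have norm zero, contradicting \<open>a \<noteq> 0\<close>.\<close>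
    define y where "y = complex_of_real (sqrt (- a)) \<^bold>* \<^bold>1 X"
    have y: "y \<in> Hom C X X" using X by (simp add: y_def Hom_iff)
    have "t\<^sup>\<dagger> \<cdot> t \<^bold>+ y\<^sup>\<dagger> \<cdot> y = complex_of_real a \<^bold>* \<^bold>1 X \<^bold>+ complex_of_real (- a) \<^bold>* \<^bold>1 X"
      using X neg by (simp add: y_def assms a vcomp_linear flip: of_real_mult)
    also have "\<dots> = zero2 C X X" using scale2_distrib(1)[of "\<^bold>1 X" "complex_of_real a" "complex_of_real (- a)"] X
      by (simp add: scale2_zero)
    finally obtain W u where u: "u \<in> Hom C X W" "zero2 C X X = u\<^sup>\<dagger> \<cdot> u" "nrm t \<le> nrm u"
      using positive_add[OF assms(1) y] by metis
    then have "nrm u = 0" using star_zero[of u X W] nrm_zero_iff[of u] by (auto simp: Hom_iff)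
    then have "nrm t = 0" using u(3) t nrm_nonneg[of t] by (intro antisym) simp_all
    then show False using n neg by simp
  qed
  then show ?thesis using n a by simp
qed

end

section \<open>Conjugate equations\<close>

locale conj_pair = two_cstar_category C for C :: "('o, 'a, 't) two_cstar" (structure) +
  fixes N M :: 'o and X Xb :: 'a and r rb :: 't
  assumes sol: "conjugate_solution C X Xb r rb" and N: "src C X = N" and M: "tgt C X = M"
begin

lemma typing [simp]:
  "X \<in> Arr1 C" "src C X = N" "tgt C X = M" "Xb \<in> Arr1 C" "src C Xb = M" "tgt C Xb = N"
  "N \<in> Obj C" "M \<in> Obj C" "r \<in> Arr2 C" "dom2 C r = \<^bold>I N" "cod2 C r = Xb \<boxdot> X"
  "rb \<in> Arr2 C" "dom2 C rb = \<^bold>I M" "cod2 C rb = X \<boxdot> Xb"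
  using sol N M src_tgt[of X] by (auto simp: conjugate_solution_def Hom_iff arr1_iff)

lemma zig: "(rb\<^sup>\<dagger> \<boxtimes> \<^bold>1 X) \<cdot> (\<^bold>1 X \<boxtimes> r) = \<^bold>1 X"
  and zag: "(r\<^sup>\<dagger> \<boxtimes> \<^bold>1 Xb) \<cdot> (\<^bold>1 Xb \<boxtimes> rb) = \<^bold>1 Xb"
  using sol by (auto simp: conjugate_solution_def)

lemma zig_adj: "(\<^bold>1 X \<boxtimes> r\<^sup>\<dagger>) \<cdot> (rb \<boxtimes> \<^bold>1 X) = \<^bold>1 X"
  using arg_cong[OF zig, of "adj2 C"] by simp

lemma zag_adj: "(\<^bold>1 Xb \<boxtimes> rb\<^sup>\<dagger>) \<cdot> (r \<boxtimes> \<^bold>1 Xb) = \<^bold>1 Xb"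
  using arg_cong[OF zag, of "adj2 C"] by simp

text \<open>The conjugate equations are symmetric in the two arrows, so each statement about
  \<open>r\<close> yields its mirror image for \<open>rb\<close>.\<close>

lemma swapped: "conj_pair C M N Xb X rb r"
  by unfold_locales (use sol in \<open>auto simp: conjugate_solution_def Hom_iff arr1_iff\<close>)

end

lemma (in two_cstar_category) conj_pairI:
  "conjugate_solution C X Xb r rb \<Longrightarrow> src C X = N \<Longrightarrow> tgt C X = M \<Longrightarrow> conj_pair C N M X Xb r rb"
  by unfold_locales auto

context strict_2_category
begin

text \<open>Units on composites are split into single strands; otherwise associativity could not
  regroup whiskered arrows.\<close>

lemma unit2_hcomp:
  assumes "X \<in> Arr1 C" "Y \<in> Arr1 C" "src C Y = tgt C X" "t \<in> Arr2 C"
  shows "src C X = tgt C (dom2 C t) \<Longrightarrow> \<^bold>1 (Y \<boxdot> X) \<boxtimes> t = \<^bold>1 Y \<boxtimes> \<^bold>1 X \<boxtimes> t"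
    "src C (dom2 C t) = tgt C Y \<Longrightarrow> t \<boxtimes> \<^bold>1 (Y \<boxdot> X) = t \<boxtimes> \<^bold>1 Y \<boxtimes> \<^bold>1 X"
  using assms by (simp_all flip: hcomp_unit2')

end

section \<open>Frobenius reciprocity, comparison of conjugates and compression to blocks\<close>

context conj_pair
begin

text \<open>The cap \<open>rb\<^sup>\<dagger>\<close> and the arrow \<open>t\<close> sit on disjoint
  strands, so their order is immaterial.\<close>

lemma cap_slide:
  assumes "t \<in> Hom C X Z"
  shows "(rb\<^sup>\<dagger> \<boxtimes> \<^bold>1 Z) \<cdot> (\<^bold>1 X \<boxtimes> \<^bold>1 Xb \<boxtimes> t) = t \<cdot> (rb\<^sup>\<dagger> \<boxtimes> \<^bold>1 X)"
proof -
  have [simp]: "t \<in> Arr2 C" "dom2 C t = X" "cod2 C t = Z" using assms by (auto simp: Hom_iff)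
  have [simp]: "Z \<in> Arr1 C" "src C Z = N" "tgt C Z = M"
    using Hom_parallel[OF assms] by auto
  show ?thesis
    using slide(1)[of t "rb\<^sup>\<dagger>"] slide(2)[of t "rb\<^sup>\<dagger>"]
    by (simp add: unit2_hcomp)
qed

text \<open>Frobenius reciprocity: \<open>t\<close> is recovered from its bent form by sliding it
  past the cap and straightening the remaining zigzag.\<close>

lemma frobenius:
  assumes "t \<in> Hom C X Z"
  shows "t = (rb\<^sup>\<dagger> \<boxtimes> \<^bold>1 Z) \<cdot> (\<^bold>1 X \<boxtimes> ((\<^bold>1 Xb \<boxtimes> t) \<cdot> r))"
proof -
  have [simp]: "t \<in> Arr2 C" "dom2 C t = X" "cod2 C t = Z" using assms by (auto simp: Hom_iff)
  have [simp]: "Z \<in> Arr1 C" "src C Z = N" "tgt C Z = M"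
    using Hom_parallel[OF assms] by auto
  have "(rb\<^sup>\<dagger> \<boxtimes> \<^bold>1 Z) \<cdot> (\<^bold>1 X \<boxtimes> ((\<^bold>1 Xb \<boxtimes> t) \<cdot> r)) = ((rb\<^sup>\<dagger> \<boxtimes> \<^bold>1 Z) \<cdot> (\<^bold>1 X \<boxtimes> \<^bold>1 Xb \<boxtimes> t)) \<cdot> (\<^bold>1 X \<boxtimes> r)"
    by (simp add: whisker_left)
  also have "\<dots> = t \<cdot> (rb\<^sup>\<dagger> \<boxtimes> \<^bold>1 X) \<cdot> (\<^bold>1 X \<boxtimes> r)" by (simp add: cap_slide[OF assms])
  finally show ?thesis by (simp add: zig)
qed

text \<open>The bent form stays whiskered by \<open>X\<close>, because on a factorial
  \<open>X\<close> the central element obtained from it acts as a scalar; the last factor then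
  becomes the trace norm of \<open>t\<close>. The constant \<open>nrm rb\<close> is the price of the
  cap.\<close>

lemma norm_frobenius:
  assumes "t \<in> Hom C X Z"
  shows "nrm t \<le> nrm rb * nrm (\<^bold>1 X \<boxtimes> ((\<^bold>1 Xb \<boxtimes> t) \<cdot> r))"
proof -
  have [simp]: "t \<in> Arr2 C" "dom2 C t = X" "cod2 C t = Z" using assms by (auto simp: Hom_iff)
  have [simp]: "Z \<in> Arr1 C" "src C Z = N" "tgt C Z = M"
    using Hom_parallel[OF assms] by auto
  have "nrm t \<le> nrm (rb\<^sup>\<dagger> \<boxtimes> \<^bold>1 Z) * nrm (\<^bold>1 X \<boxtimes> ((\<^bold>1 Xb \<boxtimes> t) \<cdot> r))"
    by (subst (1) frobenius[OF assms], rule nrm_vcomp) auto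
  also have "nrm (rb\<^sup>\<dagger> \<boxtimes> \<^bold>1 Z) \<le> nrm (rb\<^sup>\<dagger>) * nrm (\<^bold>1 Z)"
    by (rule nrm_hcomp) auto
  also have "\<dots> \<le> nrm rb * 1"
    by (intro mult_mono nrm_unit_le) auto
  finally show ?thesis by (simp add: mult_right_mono)
qed

lemma frobenius_bar:
  assumes "x \<in> Hom C Xb Z"
  shows "x = (\<^bold>1 Z \<boxtimes> rb\<^sup>\<dagger>) \<cdot> (((x \<boxtimes> \<^bold>1 X) \<cdot> r) \<boxtimes> \<^bold>1 Xb)"
proof -
  have [simp]: "x \<in> Arr2 C" "dom2 C x = Xb" "cod2 C x = Z" using assms by (auto simp: Hom_iff)
  have [simp]: "Z \<in> Arr1 C" "src C Z = M" "tgt C Z = N"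
    using Hom_parallel[OF assms] by auto
  have 1: "(\<^bold>1 Z \<boxtimes> rb\<^sup>\<dagger>) \<cdot> (x \<boxtimes> \<^bold>1 X \<boxtimes> \<^bold>1 Xb) = x \<cdot> (\<^bold>1 Xb \<boxtimes> rb\<^sup>\<dagger>)"
    using slide(1)[of "rb\<^sup>\<dagger>" x] slide(2)[of "rb\<^sup>\<dagger>" x]
    by (simp add: unit2_hcomp)
  have "(\<^bold>1 Z \<boxtimes> rb\<^sup>\<dagger>) \<cdot> (((x \<boxtimes> \<^bold>1 X) \<cdot> r) \<boxtimes> \<^bold>1 Xb) = ((\<^bold>1 Z \<boxtimes> rb\<^sup>\<dagger>) \<cdot> (x \<boxtimes> \<^bold>1 X \<boxtimes> \<^bold>1 Xb)) \<cdot> (r \<boxtimes> \<^bold>1 Xb)"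
    by (simp add: whisker_right)
  also have "\<dots> = x \<cdot> (\<^bold>1 Xb \<boxtimes> rb\<^sup>\<dagger>) \<cdot> (r \<boxtimes> \<^bold>1 Xb)" unfolding 1 by simp
  finally show ?thesis by (simp add: zag_adj)
qed

text \<open>Bending is injective, so arrows out of \<open>Xb\<close> may be compared by their effect
  on \<open>r\<close>.\<close>

lemma frobenius_bar_eq:
  assumes "x \<in> Hom C Xb Z" "y \<in> Hom C Xb Z" "(x \<boxtimes> \<^bold>1 X) \<cdot> r = (y \<boxtimes> \<^bold>1 X) \<cdot> r"
  shows "x = y"
  using frobenius_bar[OF assms(1)] frobenius_bar[OF assms(2)] assms(3) by simp

text \<open>Bending is also surjective. With the \<open>r\<close> of a second solution in place of
  \<open>s\<close>, the bent arrow is the comparison between the two conjugates.\<close>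

lemma frobenius_bar_inverse:
  assumes "s \<in> Hom C (\<^bold>I N) (Z \<boxdot> X)" "Z \<in> arr1 C M N"
  shows "(((\<^bold>1 Z \<boxtimes> rb\<^sup>\<dagger>) \<cdot> (s \<boxtimes> \<^bold>1 Xb)) \<boxtimes> \<^bold>1 X) \<cdot> r = s"
proof -
  have [simp]: "s \<in> Arr2 C" "dom2 C s = \<^bold>I N" "cod2 C s = Z \<boxdot> X" "Z \<in> Arr1 C" "src C Z = M" "tgt C Z = N"
    using assms by (auto simp: Hom_iff arr1_iff)
  have 1: "(s \<boxtimes> \<^bold>1 Xb \<boxtimes> \<^bold>1 X) \<cdot> r = (\<^bold>1 Z \<boxtimes> \<^bold>1 X \<boxtimes> r) \<cdot> s"
    using slide(1)[of r s] slide(2)[of r s]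
    by (simp add: unit2_hcomp)
  have "(((\<^bold>1 Z \<boxtimes> rb\<^sup>\<dagger>) \<cdot> (s \<boxtimes> \<^bold>1 Xb)) \<boxtimes> \<^bold>1 X) \<cdot> r = (\<^bold>1 Z \<boxtimes> rb\<^sup>\<dagger> \<boxtimes> \<^bold>1 X) \<cdot> ((s \<boxtimes> \<^bold>1 Xb \<boxtimes> \<^bold>1 X) \<cdot> r)"
    by (simp add: whisker_right)
  also have "\<dots> = (\<^bold>1 Z \<boxtimes> ((rb\<^sup>\<dagger> \<boxtimes> \<^bold>1 X) \<cdot> (\<^bold>1 X \<boxtimes> r))) \<cdot> s"
    unfolding 1 by (simp add: whisker_left)
  finally show ?thesis by (simp add: zig hcomp_unit2')
qed

text \<open>The comparison arrow that carries \<open>s\<close> to \<open>r\<close> governs the other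
  half of the solutions as well, through its adjoint: sliding \<open>sb\<close> past
  \<open>rb\<close> leaves the adjoint zigzag of \<open>X\<close>.\<close>

lemma comparison_bar:
  assumes "conjugate_solution C X Yb s sb"
  shows "(\<^bold>1 X \<boxtimes> ((\<^bold>1 Xb \<boxtimes> sb\<^sup>\<dagger>) \<cdot> (r \<boxtimes> \<^bold>1 Yb))\<^sup>\<dagger>) \<cdot> rb = sb"
proof -
  interpret Y: conj_pair C N M X Yb s sb by (rule conj_pairI) (use assms in auto)
  have 1: "(\<^bold>1 X \<boxtimes> \<^bold>1 Xb \<boxtimes> sb) \<cdot> rb = (rb \<boxtimes> \<^bold>1 X \<boxtimes> \<^bold>1 Yb) \<cdot> sb"
    using slide(1)[of sb rb] slide(2)[of sb rb]
    by (simp add: unit2_hcomp)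
  have "(\<^bold>1 X \<boxtimes> ((\<^bold>1 Xb \<boxtimes> sb\<^sup>\<dagger>) \<cdot> (r \<boxtimes> \<^bold>1 Yb))\<^sup>\<dagger>) \<cdot> rb = (\<^bold>1 X \<boxtimes> r\<^sup>\<dagger> \<boxtimes> \<^bold>1 Yb) \<cdot> (\<^bold>1 X \<boxtimes> \<^bold>1 Xb \<boxtimes> sb) \<cdot> rb"
    by (simp add: whisker_left)
  also have "\<dots> = (((\<^bold>1 X \<boxtimes> r\<^sup>\<dagger>) \<cdot> (rb \<boxtimes> \<^bold>1 X)) \<boxtimes> \<^bold>1 Yb) \<cdot> sb"
    unfolding 1 by (simp add: whisker_right)
  finally show ?thesis by (simp add: zig_adj hcomp_unit2')
qed

text \<open>The right side involves \<open>z\<close> only through its action on \<open>X\<close>.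
  Hence an identity between central elements that holds on \<open>X\<close> also holds on the
  conjugate.\<close>

lemma center_transport:
  assumes "z \<in> center C M"
  shows "\<^bold>1 Xb \<boxtimes> z = (r\<^sup>\<dagger> \<boxtimes> \<^bold>1 Xb) \<cdot> (\<^bold>1 Xb \<boxtimes> (z \<boxtimes> \<^bold>1 X) \<boxtimes> \<^bold>1 Xb) \<cdot> (\<^bold>1 Xb \<boxtimes> rb)"
proof -
  have [simp]: "z \<in> Arr2 C" "dom2 C z = \<^bold>I M" "cod2 C z = \<^bold>I M"
    using assms by (auto simp: center_def Hom_iff)
  have 1: "(z \<boxtimes> \<^bold>1 X \<boxtimes> \<^bold>1 Xb) \<cdot> rb = rb \<cdot> z"
    using slide(1)[of rb z] slide(2)[of rb z]
    by (simp add: unit2_hcomp)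
  have "(\<^bold>1 Xb \<boxtimes> (z \<boxtimes> \<^bold>1 X) \<boxtimes> \<^bold>1 Xb) \<cdot> (\<^bold>1 Xb \<boxtimes> rb) = \<^bold>1 Xb \<boxtimes> ((z \<boxtimes> \<^bold>1 X \<boxtimes> \<^bold>1 Xb) \<cdot> rb)"
    by (simp add: whisker_left)
  also have "\<dots> = (\<^bold>1 Xb \<boxtimes> rb) \<cdot> (\<^bold>1 Xb \<boxtimes> z)" unfolding 1 by (simp add: whisker_left)
  finally have "(r\<^sup>\<dagger> \<boxtimes> \<^bold>1 Xb) \<cdot> (\<^bold>1 Xb \<boxtimes> (z \<boxtimes> \<^bold>1 X) \<boxtimes> \<^bold>1 Xb) \<cdot> (\<^bold>1 Xb \<boxtimes> rb) =
      ((r\<^sup>\<dagger> \<boxtimes> \<^bold>1 Xb) \<cdot> (\<^bold>1 Xb \<boxtimes> rb)) \<cdot> (\<^bold>1 Xb \<boxtimes> z)" by simp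
  then show ?thesis by (simp add: zag)
qed

text \<open>The assumption on \<open>r\<close> says that the two range projections correspond under
  conjugation. It moves the projection in the middle of the compressed zigzag onto the strand
  \<open>X\<close>, where \<open>v\<^sup>\<dagger>\<close> absorbs it, and the zigzag of
  \<open>X\<close> remains.\<close>

lemma block_zig:
  assumes v: "v \<in> Hom C S X" "v\<^sup>\<dagger> \<cdot> v = \<^bold>1 S" and vb: "vb \<in> Hom C Sb Xb" "vb\<^sup>\<dagger> \<cdot> vb = \<^bold>1 Sb"
    and r: "((vb \<cdot> vb\<^sup>\<dagger>) \<boxtimes> \<^bold>1 X) \<cdot> r = (\<^bold>1 Xb \<boxtimes> (v \<cdot> v\<^sup>\<dagger>)) \<cdot> r"
  shows "(((v\<^sup>\<dagger> \<boxtimes> vb\<^sup>\<dagger>) \<cdot> rb)\<^sup>\<dagger> \<boxtimes> \<^bold>1 S) \<cdot> (\<^bold>1 S \<boxtimes> ((vb\<^sup>\<dagger> \<boxtimes> v\<^sup>\<dagger>) \<cdot> r)) = \<^bold>1 S"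
proof -
  have [simp]: "v \<in> Arr2 C" "dom2 C v = S" "cod2 C v = X" "vb \<in> Arr2 C" "dom2 C vb = Sb" "cod2 C vb = Xb"
    using assms by (auto simp: Hom_iff)
  have [simp]: "S \<in> Arr1 C" "src C S = N" "tgt C S = M" "Sb \<in> Arr1 C" "src C Sb = M" "tgt C Sb = N"
    using Hom_parallel[OF v(1)] Hom_parallel[OF vb(1)] by auto
  have vvv: "v\<^sup>\<dagger> \<cdot> v \<cdot> v\<^sup>\<dagger> = v\<^sup>\<dagger>"
    using arg_cong[OF v(2), of "\<lambda>t. t \<cdot> v\<^sup>\<dagger>"] by simp
  have 1: "((vb \<cdot> vb\<^sup>\<dagger>) \<boxtimes> v\<^sup>\<dagger>) \<cdot> r = (\<^bold>1 Xb \<boxtimes> v\<^sup>\<dagger>) \<cdot> r"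
  proof -
    have "((vb \<cdot> vb\<^sup>\<dagger>) \<boxtimes> v\<^sup>\<dagger>) \<cdot> r = (\<^bold>1 Xb \<boxtimes> v\<^sup>\<dagger>) \<cdot> ((vb \<cdot> vb\<^sup>\<dagger>) \<boxtimes> \<^bold>1 X) \<cdot> r"
      by (simp add: merge)
    also have "\<dots> = (\<^bold>1 Xb \<boxtimes> v\<^sup>\<dagger>) \<cdot> r" unfolding r by (simp add: merge vvv)
    finally show ?thesis .
  qed
  have "(((v\<^sup>\<dagger> \<boxtimes> vb\<^sup>\<dagger>) \<cdot> rb)\<^sup>\<dagger> \<boxtimes> \<^bold>1 S) \<cdot> (\<^bold>1 S \<boxtimes> ((vb\<^sup>\<dagger> \<boxtimes> v\<^sup>\<dagger>) \<cdot> r))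
      = (rb\<^sup>\<dagger> \<boxtimes> \<^bold>1 S) \<cdot> ((v \<boxtimes> vb \<boxtimes> \<^bold>1 S) \<cdot> (\<^bold>1 S \<boxtimes> vb\<^sup>\<dagger> \<boxtimes> v\<^sup>\<dagger>)) \<cdot> (\<^bold>1 S \<boxtimes> r)"
    by (simp add: whisker_left whisker_right)
  also have "(v \<boxtimes> vb \<boxtimes> \<^bold>1 S) \<cdot> (\<^bold>1 S \<boxtimes> vb\<^sup>\<dagger> \<boxtimes> v\<^sup>\<dagger>) = v \<boxtimes> ((vb \<cdot> vb\<^sup>\<dagger>) \<boxtimes> v\<^sup>\<dagger>)"
    by (simp add: merge)
  also have "(v \<boxtimes> ((vb \<cdot> vb\<^sup>\<dagger>) \<boxtimes> v\<^sup>\<dagger>)) \<cdot> (\<^bold>1 S \<boxtimes> r) = v \<boxtimes> (((vb \<cdot> vb\<^sup>\<dagger>) \<boxtimes> v\<^sup>\<dagger>) \<cdot> r)"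
    by (simp add: merge)
  also have "\<dots> = (\<^bold>1 X \<boxtimes> \<^bold>1 Xb \<boxtimes> v\<^sup>\<dagger>) \<cdot> (\<^bold>1 X \<boxtimes> r) \<cdot> v"
    using slide(2)[of "r" v] unfolding 1 by (simp add: merge)
  also have "(rb\<^sup>\<dagger> \<boxtimes> \<^bold>1 S) \<cdot> \<dots> = ((rb\<^sup>\<dagger> \<boxtimes> \<^bold>1 S) \<cdot> (\<^bold>1 X \<boxtimes> \<^bold>1 Xb \<boxtimes> v\<^sup>\<dagger>)) \<cdot> (\<^bold>1 X \<boxtimes> r) \<cdot> v"
    by simp
  also have "\<dots> = v\<^sup>\<dagger> \<cdot> ((rb\<^sup>\<dagger> \<boxtimes> \<^bold>1 X) \<cdot> (\<^bold>1 X \<boxtimes> r)) \<cdot> v"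
    by (subst cap_slide) (auto simp: Hom_iff)
  finally show ?thesis by (simp add: zig v(2))
qed

text \<open>Serves twice: to cut a solution down to its blocks, and, with adjoints of unitaries in
  the roles of \<open>v\<close> and \<open>vb\<close>, to transport a solution.\<close>

lemma block_solution:
  assumes v: "v \<in> Hom C S X" "v\<^sup>\<dagger> \<cdot> v = \<^bold>1 S" and vb: "vb \<in> Hom C Sb Xb" "vb\<^sup>\<dagger> \<cdot> vb = \<^bold>1 Sb"
    and r: "((vb \<cdot> vb\<^sup>\<dagger>) \<boxtimes> \<^bold>1 X) \<cdot> r = (\<^bold>1 Xb \<boxtimes> (v \<cdot> v\<^sup>\<dagger>)) \<cdot> r"
    and rb: "((v \<cdot> v\<^sup>\<dagger>) \<boxtimes> \<^bold>1 Xb) \<cdot> rb = (\<^bold>1 X \<boxtimes> (vb \<cdot> vb\<^sup>\<dagger>)) \<cdot> rb"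
  shows "conjugate_solution C S Sb ((vb\<^sup>\<dagger> \<boxtimes> v\<^sup>\<dagger>) \<cdot> r) ((v\<^sup>\<dagger> \<boxtimes> vb\<^sup>\<dagger>) \<cdot> rb)"
proof -
  interpret B: conj_pair C M N Xb X rb r by (rule swapped)
  have [simp]: "v \<in> Arr2 C" "dom2 C v = S" "cod2 C v = X" "vb \<in> Arr2 C" "dom2 C vb = Sb" "cod2 C vb = Xb"
    using assms by (auto simp: Hom_iff)
  have [simp]: "S \<in> Arr1 C" "src C S = N" "tgt C S = M" "Sb \<in> Arr1 C" "src C Sb = M" "tgt C Sb = N"
    using Hom_parallel[OF v(1)] Hom_parallel[OF vb(1)] by auto
  show ?thesis unfolding conjugate_solution_def
    using block_zig[OF v vb r] B.block_zig[OF vb v rb] by (auto simp: Hom_iff arr1_iff)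
qed

lemma scaled_solution:
  assumes "c \<noteq> 0"
  shows "conjugate_solution C X Xb (complex_of_real c \<^bold>* r) (complex_of_real (1 / c) \<^bold>* rb)"
  using assms zig zag unfolding conjugate_solution_def
  by (auto simp: Hom_iff arr1_iff vcomp_linear hcomp_linear simp flip: of_real_mult)

end

section \<open>Resolutions of the identity by projections\<close>

context two_cstar_category
begin

lemma add2_cancel:
  assumes "s \<in> Hom C X Y" "t \<in> Hom C X Y" "s \<^bold>+ t = s"
  shows "t = zero2 C X Y"
proof -
  interpret V: abelian_group "Hom_space C X Y" by (rule Hom_abelian[OF parallel_Hom[OF assms(1)]])
  show ?thesis using V.add.l_cancel_one'[of s t] assms by simp
qed

lemma minus_zero_iff:
  assumes "s \<in> Hom C X Y" "t \<in> Hom C X Y"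
  shows "s \<^bold>- t = zero2 C X Y \<longleftrightarrow> s = t"
proof
  note [simp] = assms[unfolded Hom_iff]
  assume "s \<^bold>- t = zero2 C X Y"
  then have "(s \<^bold>- t) \<^bold>+ t = t" by simp
  also have "(s \<^bold>- t) \<^bold>+ t = s \<^bold>+ (t \<^bold>- t)" by (subst add2_assoc) (simp_all add: add2_commute)
  finally show "s = t" using minus_cancel[OF assms(2)] by simp
qed (use minus_cancel[OF assms(2)] in simp)

lemma lin_combine:
  "t \<in> Arr2 C \<Longrightarrow> a \<^bold>* t \<^bold>+ b \<^bold>* t = (a + b) \<^bold>* t"
  "t \<in> Arr2 C \<Longrightarrow> t \<^bold>+ b \<^bold>* t = (1 + b) \<^bold>* t"
  "t \<in> Arr2 C \<Longrightarrow> a \<^bold>* t \<^bold>+ t = (a + 1) \<^bold>* t"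
  "t \<in> Arr2 C \<Longrightarrow> t \<^bold>+ t = 2 \<^bold>* t"
  using scale2_distrib(1)[of t a b] scale2_distrib(1)[of t 1 b] scale2_distrib(1)[of t a 1]
    scale2_distrib(1)[of t 1 1] by simp_all

lemma decomposition_typing:
  assumes "direct_sum_decomposition C Y k Yh u" "h < k"
  shows "u h \<in> Hom C (Yh h) Y" "(u h)\<^sup>\<dagger> \<cdot> u h = \<^bold>1 (Yh h)"
    "u h \<in> Arr2 C" "dom2 C (u h) = Yh h" "cod2 C (u h) = Y" "Yh h \<in> Arr1 C"
    "src C (Yh h) = src C Y" "tgt C (Yh h) = tgt C Y"
  using assms Hom_parallel[of "u h" "Yh h" Y] by (auto simp: direct_sum_decomposition_def Hom_iff)

text \<open>Compressing the resolution of the unit by \<open>u j\<close>, the term with index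
  \<open>j\<close> already exhausts the unit of \<open>Yh j\<close>. The others form a positive sum
  equal to zero, so each of them vanishes.\<close>

lemma decomposition_orthogonal:
  assumes D: "direct_sum_decomposition C Y k Yh u" and i: "i < k" and j: "j < k" and "i \<noteq> j" and Y: "Y \<in> Arr1 C"
  shows "(u i)\<^sup>\<dagger> \<cdot> u j = zero2 C (Yh j) (Yh i)"
proof -
  note [simp] = decomposition_typing[OF D] Y
  have par: "parallel Y Y" "parallel (Yh j) (Yh j)" using j by (auto simp: parallel_def)
  have "\<^bold>1 (Yh j) = (u j)\<^sup>\<dagger> \<cdot> hsum Y Y (\<lambda>h. u h \<cdot> (u h)\<^sup>\<dagger>) {..<k} \<cdot> u j"
    using D j by (simp add: direct_sum_decomposition_def)
  also have "hsum Y Y (\<lambda>h. u h \<cdot> (u h)\<^sup>\<dagger>) {..<k} \<cdot> u j = hsum (Yh j) Y (\<lambda>h. (u h \<cdot> (u h)\<^sup>\<dagger>) \<cdot> u j) {..<k}"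
    by (rule hsum_vcomp) (use par j in \<open>auto simp: Hom_iff\<close>)
  also have "(u j)\<^sup>\<dagger> \<cdot> \<dots> = hsum (Yh j) (Yh j) (\<lambda>h. (u j)\<^sup>\<dagger> \<cdot> (u h \<cdot> (u h)\<^sup>\<dagger>) \<cdot> u j) {..<k}"
    by (rule vcomp_hsum) (use par j in \<open>auto simp: Hom_iff parallel_def\<close>)
  also have "\<dots> = hsum (Yh j) (Yh j) (\<lambda>h. ((u h)\<^sup>\<dagger> \<cdot> u j)\<^sup>\<dagger> \<cdot> ((u h)\<^sup>\<dagger> \<cdot> u j)) {..<k}"
    by (rule hsum_cong) (use par j in \<open>auto simp: Hom_iff\<close>)
  also have "{..<k} = insert j ({..<k} - {j})" using j by auto
  also have "hsum (Yh j) (Yh j) (\<lambda>h. ((u h)\<^sup>\<dagger> \<cdot> u j)\<^sup>\<dagger> \<cdot> ((u h)\<^sup>\<dagger> \<cdot> u j)) \<dots>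
      = \<^bold>1 (Yh j) \<^bold>+ hsum (Yh j) (Yh j) (\<lambda>h. ((u h)\<^sup>\<dagger> \<cdot> u j)\<^sup>\<dagger> \<cdot> ((u h)\<^sup>\<dagger> \<cdot> u j)) ({..<k} - {j})"
    using j decomposition_typing(2)[OF D j] par by (subst hsum_insert) (auto simp: Hom_iff)
  finally have "hsum (Yh j) (Yh j) (\<lambda>h. ((u h)\<^sup>\<dagger> \<cdot> u j)\<^sup>\<dagger> \<cdot> ((u h)\<^sup>\<dagger> \<cdot> u j)) ({..<k} - {j}) = zero2 C (Yh j) (Yh j)"
    using j par by (intro add2_cancel[of "\<^bold>1 (Yh j)"] hsum_Hom) (auto simp: Hom_iff)
  then show ?thesis
    by (rule positive_sum_zero[where Y = Yh, rotated 3]) (use i j \<open>i \<noteq> j\<close> in \<open>auto simp: Hom_iff\<close>)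
qed

text \<open>Zero projections are excluded so that \<open>card F\<close> measures how finely the unit
  is split.\<close>

definition resolution where
  "resolution X A F \<longleftrightarrow> finite F \<and> F \<subseteq> A \<and> (\<forall>p\<in>F. p \<cdot> p = p \<and> p\<^sup>\<dagger> = p \<and> p \<noteq> zero2 C X X) \<and>
    (\<forall>p\<in>F. \<forall>q\<in>F. p \<noteq> q \<longrightarrow> p \<cdot> q = zero2 C X X) \<and> hsum X X (\<lambda>p. p) F = \<^bold>1 X"

lemma resolution_unit:
  assumes "X \<in> Arr1 C" "\<^bold>1 X \<in> A" "\<^bold>1 X \<noteq> zero2 C X X"
  shows "resolution X A {\<^bold>1 X}"
proof -
  have "hsum X X (\<lambda>p. p) {\<^bold>1 X} = \<^bold>1 X"
    using hsum_delta[of X X "{\<^bold>1 X}" "\<^bold>1 X" "\<lambda>p. p"] assms by (auto simp: Hom_iff parallel_def)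
  then show ?thesis using assms by (simp add: resolution_def)
qed

text \<open>A projection strictly below \<open>p\<close> splits it into \<open>p'\<close> and the
  difference \<open>p''\<close>; both parts inherit orthogonality to the other members from
  \<open>p\<close>.\<close>

lemma resolution_split:
  assumes A: "A \<subseteq> Hom C X X" and sub: "\<And>s t. s \<in> A \<Longrightarrow> t \<in> A \<Longrightarrow> s \<^bold>- t \<in> A"
    and F: "resolution X A F" and p: "p \<in> F"
    and p': "p' \<in> A" "p' \<cdot> p' = p'" "p'\<^sup>\<dagger> = p'" "p \<cdot> p' = p'" "p' \<noteq> zero2 C X X" "p' \<noteq> p"
  obtains F' where "resolution X A F'" "card F < card F'"
proof -
  have pA: "p \<in> A" "p \<cdot> p = p" "p\<^sup>\<dagger> = p" "p \<noteq> zero2 C X X" using F p by (auto simp: resolution_def)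
  have [simp]: "q \<in> Arr2 C" "dom2 C q = X" "cod2 C q = X" if "q \<in> A" for q using that A by (auto simp: Hom_iff)
  have X [simp]: "X \<in> Arr1 C" using pA Arr2_simps[of p] by auto
  have par: "parallel X X" by (simp add: parallel_def)
  note [simp] = pA p'
  have p'p: "p' \<cdot> p = p'" using adj2_vcomp[of p' p] by simp
  define p'' where "p'' = p \<^bold>- p'"
  have p''A[simp]: "p'' \<in> A" unfolding p''_def by (rule sub) auto
  have sum: "p' \<^bold>+ p'' = p"
    unfolding p''_def by (subst add2_left_commute) (use minus_cancel[of p' X X] in \<open>auto simp: Hom_iff\<close>)
  have pp'': "p \<cdot> p'' = p''" "p'' \<cdot> p = p''" unfolding p''_def by (simp_all add: vcomp_linear p'p)
  have p'p'': "p' \<cdot> p'' = zero2 C X X" "p'' \<cdot> p' = zero2 C X X"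
    unfolding p''_def using minus_cancel[of p' X X] by (simp_all add: vcomp_linear p'p Hom_iff)
  have "p'' = p \<cdot> p''" by (simp add: pp'')
  also have "\<dots> = p' \<cdot> p'' \<^bold>+ p'' \<cdot> p''" unfolding sum[symmetric] by (rule vcomp_linear) auto
  also have "\<dots> = p'' \<cdot> p''" by (simp add: p'p'')
  finally have p''p'': "p'' \<cdot> p'' = p''" ..
  have p''adj: "p''\<^sup>\<dagger> = p''" unfolding p''_def by simp
  have p''0: "p'' \<noteq> zero2 C X X"
    using minus_zero_iff[of p X X p'] p'(6) by (auto simp: p''_def Hom_iff)
  have FA: "q \<in> A" if "q \<in> F" for q using F that by (auto simp: resolution_def)
  have orth: "p \<cdot> q = zero2 C X X" "q \<cdot> p = zero2 C X X" if "q \<in> F" "q \<noteq> p" for q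
    using F that p by (auto simp: resolution_def)
  have below: "t \<cdot> q = zero2 C X X" "q \<cdot> t = zero2 C X X"
    if "q \<in> F" "q \<noteq> p" "t \<in> A" "p \<cdot> t = t" "t \<cdot> p = t" for q t
  proof -
    have "t \<cdot> q = (t \<cdot> p) \<cdot> q" using that by simp
    also have "\<dots> = t \<cdot> p \<cdot> q" using that FA by (intro vcomp_assoc') auto
    finally show "t \<cdot> q = zero2 C X X" using orth that by simp
    have "q \<cdot> t = q \<cdot> (p \<cdot> t)" using that by simp
    also have "\<dots> = (q \<cdot> p) \<cdot> t" using that FA by (intro vcomp_assoc'[symmetric]) auto
    finally show "q \<cdot> t = zero2 C X X" using orth that by simp
  qed
  have notin: "t \<notin> F - {p}" if "t \<in> A" "p \<cdot> t = t" "t \<noteq> zero2 C X X" for t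
    using orth[of t] that by auto
  let ?F = "insert p' (insert p'' (F - {p}))"
  \<comment> \<open>The two parts must differ from each other and from the remaining members for the
    cardinality to grow.\<close>
  have n1: "p'' \<notin> F - {p}" "p' \<notin> F - {p}" using notin[of p''] notin[of p'] p''0 pp'' p'(1,4,5) p''A by blast+
  have n2: "p' \<noteq> p''" using p'p''(1) p'(2,5) by metis
  have fin: "finite F" using F by (simp add: resolution_def)
  have "hsum X X (\<lambda>p. p) ?F = p' \<^bold>+ hsum X X (\<lambda>p. p) (insert p'' (F - {p}))"
    by (rule hsum_insert) (use par fin n1 n2 FA in \<open>auto simp: Hom_iff\<close>)
  also have "hsum X X (\<lambda>p. p) (insert p'' (F - {p})) = p'' \<^bold>+ hsum X X (\<lambda>p. p) (F - {p})"
    by (rule hsum_insert) (use par fin n1 FA in \<open>auto simp: Hom_iff\<close>)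
  also have "p' \<^bold>+ \<dots> = p \<^bold>+ hsum X X (\<lambda>p. p) (F - {p})"
    using hsum_Hom[OF par, of "F - {p}" "\<lambda>p. p"] FA unfolding sum[symmetric]
    by (subst add2_assoc) (auto simp: Hom_iff)
  also have "\<dots> = hsum X X (\<lambda>p. p) (insert p (F - {p}))"
    by (rule hsum_insert[symmetric]) (use par fin FA in \<open>auto simp: Hom_iff\<close>)
  also have "insert p (F - {p}) = F" using p by auto
  finally have s: "hsum X X (\<lambda>p. p) ?F = \<^bold>1 X" using F by (simp add: resolution_def)
  have "resolution X A ?F"
    unfolding resolution_def
    using F s fin p''p'' p''adj p''0 p'p'' below[of _ p'] below[of _ p''] p'p pp''
    by (auto simp: resolution_def)
  moreover have "card ?F = Suc (card F)"
    using fin n1 n2 p by (simp add: card.insert_remove card_Diff_singleton) (metis Suc_pred card_gt_0_iff empty_iff)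
  ultimately show ?thesis using that by simp
qed

text \<open>The bound \<open>K\<close> admits a resolution of greatest cardinality, which cannot be
  split any further. If the unit is zero, it is not an admissible member, and the empty resolution
  takes its place.\<close>

lemma minimal_resolution:
  assumes X: "X \<in> Arr1 C" and A: "A \<subseteq> Hom C X X" "\<^bold>1 X \<in> A"
    and sub: "\<And>s t. s \<in> A \<Longrightarrow> t \<in> A \<Longrightarrow> s \<^bold>- t \<in> A"
    and bound: "\<And>F. resolution X A F \<Longrightarrow> card F \<le> K"
  obtains F where "resolution X A F" "F \<subseteq> minimal_projections C X A"
proof (cases "\<^bold>1 X = zero2 C X X")
  case True
  then have "resolution X A {}" using X by (simp add: resolution_def parallel_def)
  then show ?thesis using that by simp
next
  case False
  have "\<exists>F. resolution X A F \<and> (\<forall>G. resolution X A G \<longrightarrow> card G \<le> card F)"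
    by (rule ex_has_greatest_nat[of _ "{\<^bold>1 X}" _ "Suc K"])
      (use resolution_unit[OF X A(2) False] bound in \<open>auto simp: less_Suc_eq_le\<close>)
  then obtain F where F: "resolution X A F" "\<And>G. resolution X A G \<Longrightarrow> card G \<le> card F" by blast
  have "F \<subseteq> minimal_projections C X A"
  proof
    fix p assume p: "p \<in> F"
    have "p' = zero2 C X X \<or> p' = p" if p': "p' \<in> A" "p' \<cdot> p' = p'" "p'\<^sup>\<dagger> = p'" "p \<cdot> p' = p'" for p'
    proof (rule ccontr)
      assume "\<not> ?thesis"
      then obtain F' where "resolution X A F'" "card F < card F'"
        using resolution_split[OF A(1) sub F(1) p p'] by auto
      then show False using F(2)[of F'] by simp
    qed
    then show "p \<in> minimal_projections C X A"
      using F(1) p by (auto simp: minimal_projections_def resolution_def Let_def)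
  qed
  then show ?thesis using F that by blast
qed

end

section \<open>Arrows without nontrivial projections are simple\<close>

context two_cstar_category
begin

lemma Hom_lim_unique:
  assumes "\<And>n. x n \<in> Hom C X Y" "e \<in> Hom C X Y" "f \<in> Hom C X Y"
    "(\<lambda>n. nrm (x n \<^bold>- e)) \<longlonglongrightarrow> 0" "(\<lambda>n. nrm (x n \<^bold>- f)) \<longlonglongrightarrow> 0"
  shows "e = f"
proof -
  have t[simp]: "x n \<in> Arr2 C" "dom2 C (x n) = X" "cod2 C (x n) = Y" for n using assms by (auto simp: Hom_iff)
  have t'[simp]: "e \<in> Arr2 C" "dom2 C e = X" "cod2 C e = Y" "f \<in> Arr2 C" "dom2 C f = X" "cod2 C f = Y"
    using assms by (auto simp: Hom_iff)
  have "nrm (e \<^bold>- f) \<le> nrm (x n \<^bold>- e) + nrm (x n \<^bold>- f)" for n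
  proof -
    have "e \<^bold>- f = (-1) \<^bold>* (x n \<^bold>- e) \<^bold>+ (x n \<^bold>- f)"
    proof -
      have "(-1) \<^bold>* (x n \<^bold>- e) \<^bold>+ (x n \<^bold>- f) = e \<^bold>+ (((-1) \<^bold>* x n \<^bold>+ x n) \<^bold>- f)"
        by (simp add: scale2_distrib add2_ac)
      also have "(-1) \<^bold>* x n \<^bold>+ x n = zero2 C X Y"
        using minus_cancel[of "x n" X Y] by (simp add: add2_commute Hom_iff)
      finally show ?thesis using Arr2_simps[of e] t' by simp
    qed
    then have "nrm (e \<^bold>- f) \<le> nrm ((-1) \<^bold>* (x n \<^bold>- e)) + nrm (x n \<^bold>- f)"
      using nrm_props(4)[of X Y "(-1) \<^bold>* (x n \<^bold>- e)" "x n \<^bold>- f"] parallel_Hom[OF assms(2)]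
      by (simp add: Hom_iff)
    then show ?thesis by simp
  qed
  moreover have "(\<lambda>n. nrm (x n \<^bold>- e) + nrm (x n \<^bold>- f)) \<longlonglongrightarrow> 0"
    using tendsto_add[OF assms(4,5)] by simp
  ultimately have "nrm (e \<^bold>- f) \<le> 0" by (intro LIMSEQ_le_const) auto
  then have "nrm (e \<^bold>- f) = 0" by (intro antisym) simp_all
  then show ?thesis using minus_zero_iff[OF assms(2,3)] nrm_zero_iff[of "e \<^bold>- f"] by simp
qed

section \<open>Powers of a self-adjoint endomorphism\<close>

primrec vpow where
  "vpow s 0 = \<^bold>1 (dom2 C s)"
| "vpow s (Suc n) = s \<cdot> vpow s n"

context
  fixes X s
  assumes s: "s \<in> Hom C X X"
begin

lemma vpow_typing [simp]: "vpow s n \<in> Arr2 C" "dom2 C (vpow s n) = X" "cod2 C (vpow s n) = X"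
proof -
  have "vpow s n \<in> Arr2 C \<and> dom2 C (vpow s n) = X \<and> cod2 C (vpow s n) = X"
    using s Arr2_simps[of s] by (induction n) (auto simp: Hom_iff)
  then show "vpow s n \<in> Arr2 C" "dom2 C (vpow s n) = X" "cod2 C (vpow s n) = X" by auto
qed

lemma vpow_add: "vpow s (m + n) = vpow s m \<cdot> vpow s n"
  by (induction m) (use s vpow_typing in \<open>auto simp: Hom_iff simp del: vpow_typing\<close>)

lemma vpow_adj:
  assumes "s\<^sup>\<dagger> = s" shows "(vpow s n)\<^sup>\<dagger> = vpow s n"
proof (induction n)
  case 0 then show ?case using s Arr2_simps[of s] by (auto simp: Hom_iff)
next
  case (Suc n)
  have "vpow s (Suc n) = vpow s n \<cdot> s" using vpow_add[of n 1] s by (auto simp: Hom_iff)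
  then show ?case using s Suc assms by (auto simp: Hom_iff)
qed

text \<open>The C*-identity keeps the norm at 1 under repeated squaring. An arbitrary exponent
  \<open>n\<close> is reached as a factor of the power with exponent \<open>2 ^ n\<close>, whose
  complementary factor has norm at most 1.\<close>

lemma nrm_vpow:
  assumes "s\<^sup>\<dagger> = s" "nrm s = 1" shows "nrm (vpow s n) = 1"
proof -
  have st: "s \<in> Arr2 C" "dom2 C s = X" "cod2 C s = X" "X \<in> Arr1 C" using s Arr2_simps[of s] by (auto simp: Hom_iff)
  have le: "nrm (vpow s n) \<le> 1" for n
  proof (induction n)
    case 0 then show ?case using nrm_unit_le[of X] st by simp
  next
    case (Suc n) then show ?case using nrm_vcomp[of "vpow s n" s] st assms by simp
  qed
  have 2: "nrm (vpow s (2 ^ k)) = 1" for k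
  proof (induction k)
    case 0 then show ?case using st assms by simp
  next
    case (Suc k)
    have "nrm (vpow s (2 ^ Suc k)) = (nrm (vpow s (2 ^ k)))\<^sup>2"
      using vpow_add[of "2 ^ k" "2 ^ k"] nrm_star[of "vpow s (2 ^ k)"] vpow_adj[OF assms(1)] by (simp add: mult_2)
    then show ?case using Suc by simp
  qed
  have "n \<le> 2 ^ n" using less_exp[of n] by simp
  then obtain m where "2 ^ n = n + m" using le_Suc_ex by blast
  then have "1 \<le> nrm (vpow s n) * nrm (vpow s m)"
    using 2[of n] nrm_vcomp[of "vpow s m" "vpow s n"] by (simp add: vpow_add)
  also have "\<dots> \<le> nrm (vpow s n) * 1" by (intro mult_left_mono le) auto
  finally show ?thesis using le[of n] by simp
qed

end

declare vpow_typing [simp del]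

text \<open>Self-adjoint arrows are reduced to norm 1 by scaling, and arbitrary ones to self-adjoint
  ones by the Cartesian decomposition.\<close>

lemma simpleI:
  assumes X: "X \<in> Arr1 C"
    and sa: "\<And>s. s \<in> Hom C X X \<Longrightarrow> s\<^sup>\<dagger> = s \<Longrightarrow> nrm s = 1 \<Longrightarrow> s = \<^bold>1 X \<or> s = (-1) \<^bold>* \<^bold>1 X"
  shows "simple_arr C X"
proof -
  have selfadj: "\<exists>c. s = c \<^bold>* \<^bold>1 X" if s: "s \<in> Hom C X X" "s\<^sup>\<dagger> = s" for s
  proof (cases "nrm s = 0")
    case True
    then have "s = 0 \<^bold>* \<^bold>1 X" using s X nrm_zero_iff[of s] by (auto simp: Hom_iff scale2_zero)
    then show ?thesis by blast
  next
    case False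
    have st: "s \<in> Arr2 C" "dom2 C s = X" "cod2 C s = X" using s by (auto simp: Hom_iff)
    define t where "t = complex_of_real (1 / nrm s) \<^bold>* s"
    have "cmod (complex_of_real (1 / nrm s)) = 1 / nrm s"
      unfolding norm_of_real using st by (intro abs_of_nonneg) simp
    then have "nrm t = 1" using False st by (simp add: t_def del: of_real_divide)
    then have "t = \<^bold>1 X \<or> t = (-1) \<^bold>* \<^bold>1 X"
      by (intro sa) (use st s in \<open>auto simp: t_def Hom_iff\<close>)
    moreover have "s = complex_of_real (nrm s) \<^bold>* t" using False st by (simp add: t_def)
    ultimately show ?thesis using X by auto
  qed
  have "\<exists>c. t = c \<^bold>* \<^bold>1 X" if "t \<in> Hom C X X" for t
  proof -
    have [simp]: "t \<in> Arr2 C" "dom2 C t = X" "cod2 C t = X" using that by (auto simp: Hom_iff)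
    obtain a where a: "t \<^bold>+ t\<^sup>\<dagger> = a \<^bold>* \<^bold>1 X"
      using selfadj[of "t \<^bold>+ t\<^sup>\<dagger>"] by (auto simp: Hom_iff add2_commute)
    obtain b where b: "\<i> \<^bold>* t \<^bold>- \<i> \<^bold>* t\<^sup>\<dagger> = b \<^bold>* \<^bold>1 X"
      using selfadj[of "\<i> \<^bold>* t \<^bold>- \<i> \<^bold>* t\<^sup>\<dagger>"] by (auto simp: Hom_iff add2_commute)
    \<comment> \<open>Twice the decomposition of \<open>t\<close> into real and imaginary
      part.\<close>
    have "(t \<^bold>+ t\<^sup>\<dagger>) \<^bold>- \<i> \<^bold>* (\<i> \<^bold>* t \<^bold>- \<i> \<^bold>* t\<^sup>\<dagger>) = (t \<^bold>+ t) \<^bold>+ (t\<^sup>\<dagger> \<^bold>- t\<^sup>\<dagger>)"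
      by (simp add: scale2_distrib add2_ac)
    also have "\<dots> = 2 \<^bold>* t"
      using minus_cancel[of "t\<^sup>\<dagger>" X X] by (simp add: lin_combine Hom_iff)
    finally have "2 \<^bold>* t = (a - \<i> * b) \<^bold>* \<^bold>1 X"
      using X scale2_distrib(1)[of "\<^bold>1 X" a "- \<i> * b"] unfolding a b by simp
    moreover have "t = (1/2) \<^bold>* 2 \<^bold>* t" by simp
    ultimately have "t = (1/2) \<^bold>* (a - \<i> * b) \<^bold>* \<^bold>1 X" by simp
    then have "t = ((1/2) * (a - \<i> * b)) \<^bold>* \<^bold>1 X" using X by (simp only: scale2_simps unit2_simps)
    then show ?thesis by blast
  qed
  then show ?thesis using X by (auto simp: simple_arr_def scalars_def Hom_iff image_iff)
qed

end

section \<open>The left trace on a factorial arrow and its norm\<close>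

context conj_pair
begin

text \<open>The unnormalized left trace. The scalar exists for factorial \<open>X\<close>, whose
  left center is trivial, and it is unique as soon as the unit of \<open>X\<close> is
  nonzero.\<close>

definition ltr where "ltr t = (SOME c. \<^bold>1 X \<boxtimes> (r\<^sup>\<dagger> \<cdot> (\<^bold>1 Xb \<boxtimes> t) \<cdot> r) = c \<^bold>* \<^bold>1 X)"

lemma ltr:
  assumes "factorial_arr C X" "t \<in> Hom C X X"
  shows "\<^bold>1 X \<boxtimes> (r\<^sup>\<dagger> \<cdot> (\<^bold>1 Xb \<boxtimes> t) \<cdot> r) = ltr t \<^bold>* \<^bold>1 X"
proof -
  have "r\<^sup>\<dagger> \<cdot> (\<^bold>1 Xb \<boxtimes> t) \<cdot> r \<in> center C N"
    using assms(2) by (auto simp: center_def Hom_iff)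
  then have "\<^bold>1 X \<boxtimes> (r\<^sup>\<dagger> \<cdot> (\<^bold>1 Xb \<boxtimes> t) \<cdot> r) \<in> scalars C X"
    using assms(1) by (auto simp: factorial_arr_def left_center_def)
  then have "\<exists>c. \<^bold>1 X \<boxtimes> (r\<^sup>\<dagger> \<cdot> (\<^bold>1 Xb \<boxtimes> t) \<cdot> r) = c \<^bold>* \<^bold>1 X" by (auto simp: scalars_def)
  then show ?thesis unfolding ltr_def by (rule someI_ex)
qed

text \<open>The Hilbert-Schmidt norm that belongs to the functional \<open>ltr\<close>.\<close>

definition ltn where "ltn t = nrm (\<^bold>1 X \<boxtimes> ((\<^bold>1 Xb \<boxtimes> t) \<cdot> r))"

context
  assumes fact: "factorial_arr C X" and nz: "\<^bold>1 X \<noteq> zero2 C X X"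
begin

lemma unit_Hom: "\<^bold>1 X \<in> Hom C X X" by (simp add: Hom_iff)

lemma ltr_star:
  assumes "t \<in> Hom C X X" shows "ltr (t\<^sup>\<dagger> \<cdot> t) = complex_of_real ((ltn t)\<^sup>2)"
proof -
  have [simp]: "t \<in> Arr2 C" "dom2 C t = X" "cod2 C t = X" using assms by (auto simp: Hom_iff)
  have "(\<^bold>1 X \<boxtimes> ((\<^bold>1 Xb \<boxtimes> t) \<cdot> r))\<^sup>\<dagger> \<cdot> (\<^bold>1 X \<boxtimes> ((\<^bold>1 Xb \<boxtimes> t) \<cdot> r)) = ltr (t\<^sup>\<dagger> \<cdot> t) \<^bold>* \<^bold>1 X"
    using ltr[OF fact, of "t\<^sup>\<dagger> \<cdot> t"] by (simp add: merge Hom_iff)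
  then show ?thesis unfolding ltn_def
    by (intro positive_scalar[of _ X "X \<boxdot> Xb \<boxdot> X"]) (use nz in \<open>auto simp: Hom_iff\<close>)
qed

lemma ltr_add:
  assumes "s \<in> Hom C X X" "t \<in> Hom C X X" shows "ltr (s \<^bold>+ t) = ltr s + ltr t"
proof -
  have [simp]: "t \<in> Arr2 C" "dom2 C t = X" "cod2 C t = X" "s \<in> Arr2 C" "dom2 C s = X" "cod2 C s = X"
    using assms by (auto simp: Hom_iff)
  have "ltr (s \<^bold>+ t) \<^bold>* \<^bold>1 X = (ltr s + ltr t) \<^bold>* \<^bold>1 X"
    using ltr[OF fact, of "s \<^bold>+ t"] ltr[OF fact, of s] ltr[OF fact, of t]
    by (simp add: Hom_iff hcomp_linear vcomp_linear scale2_distrib)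
  then show ?thesis using scale_cancel unit_Hom nz by blast
qed

lemma ltr_scale:
  assumes "t \<in> Hom C X X" shows "ltr (c \<^bold>* t) = c * ltr t"
proof -
  have [simp]: "t \<in> Arr2 C" "dom2 C t = X" "cod2 C t = X" using assms by (auto simp: Hom_iff)
  have "ltr (c \<^bold>* t) \<^bold>* \<^bold>1 X = (c * ltr t) \<^bold>* \<^bold>1 X"
    using ltr[OF fact, of "c \<^bold>* t"] ltr[OF fact, of t]
    by (simp add: Hom_iff hcomp_linear vcomp_linear)
  then show ?thesis using scale_cancel unit_Hom nz by blast
qed

lemma ltr_hsum:
  assumes "finite F" "\<And>i. i \<in> F \<Longrightarrow> f i \<in> Hom C X X"
  shows "ltr (hsum X X f F) = (\<Sum>i\<in>F. ltr (f i))"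
  using assms
proof (induction F rule: finite_induct)
  case empty
  have "ltr (0 \<^bold>* \<^bold>1 X) = 0" using ltr_scale[of "\<^bold>1 X" 0] unit_Hom by simp
  then show ?case by (simp add: scale2_zero parallel_def)
next
  case (insert i F)
  have "ltr (hsum X X f (insert i F)) = ltr (f i \<^bold>+ hsum X X f F)"
    by (subst hsum_insert) (use insert in \<open>auto simp: parallel_def\<close>)
  then show ?case using insert by (simp add: ltr_add hsum_Hom parallel_def)
qed

lemma nrm_le_ltn:
  assumes "t \<in> Hom C X X" shows "nrm t \<le> nrm rb * ltn t"
  unfolding ltn_def by (rule norm_frobenius[OF assms])

text \<open>On the bent arrow, left multiplication is \<open>s\<close> whiskered by
  \<open>X \<boxdot> Xb\<close>, whose norm is at most \<open>nrm s\<close>.\<close>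

lemma ltn_vcomp:
  assumes "s \<in> Hom C X X" "t \<in> Hom C X X" shows "ltn (s \<cdot> t) \<le> nrm s * ltn t"
proof -
  have [simp]: "t \<in> Arr2 C" "dom2 C t = X" "cod2 C t = X" "s \<in> Arr2 C" "dom2 C s = X" "cod2 C s = X"
    using assms by (auto simp: Hom_iff)
  have "\<^bold>1 X \<boxtimes> ((\<^bold>1 Xb \<boxtimes> (s \<cdot> t)) \<cdot> r) = (\<^bold>1 (X \<boxdot> Xb) \<boxtimes> s) \<cdot> (\<^bold>1 X \<boxtimes> ((\<^bold>1 Xb \<boxtimes> t) \<cdot> r))"
    by (simp add: unit2_hcomp whisker_left)
  then have "ltn (s \<cdot> t) \<le> nrm (\<^bold>1 (X \<boxdot> Xb) \<boxtimes> s) * ltn t"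
    unfolding ltn_def using nrm_vcomp[of "\<^bold>1 X \<boxtimes> ((\<^bold>1 Xb \<boxtimes> t) \<cdot> r)" "\<^bold>1 (X \<boxdot> Xb) \<boxtimes> s"] by simp
  also have "\<dots> \<le> (1 * nrm s) * ltn t"
    by (intro mult_right_mono order_trans[OF nrm_hcomp] nrm_unit_le) (auto simp: ltn_def)
  finally show ?thesis by simp
qed

lemma nrm_rb_pos: "0 < nrm rb"
proof (rule ccontr)
  assume "\<not> ?thesis"
  then have "nrm rb = 0" by (intro antisym) simp_all
  then have "nrm (\<^bold>1 X) \<le> 0" using nrm_le_ltn[of "\<^bold>1 X"] unit_Hom by simp
  then show False using nrm_unit[of X] nz by simp
qed

text \<open>A nonzero projection has norm 1, so its squared trace norm is at least the inverse
  square of \<open>nrm rb\<close>. By orthogonality the squared trace norms of all members add up to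
  that of the unit.\<close>

lemma resolution_bound:
  assumes "resolution X (Hom C X X) F"
  shows "real (card F) \<le> (nrm rb * ltn (\<^bold>1 X))\<^sup>2"
proof -
  have F: "finite F" "\<And>p. p \<in> F \<Longrightarrow> p \<in> Hom C X X" "hsum X X (\<lambda>p. p) F = \<^bold>1 X"
    "\<And>p. p \<in> F \<Longrightarrow> p\<^sup>\<dagger> \<cdot> p = p" "\<And>p. p \<in> F \<Longrightarrow> p \<noteq> zero2 C X X"
    using assms by (auto simp: resolution_def)
  have "1 \<le> (nrm rb)\<^sup>2 * (ltn p)\<^sup>2" if p: "p \<in> F" for p
  proof -
    have pt: "p \<in> Arr2 C" "dom2 C p = X" "cod2 C p = X" using F(2)[OF p] by (auto simp: Hom_iff)
    have "nrm p = (nrm p)\<^sup>2" using nrm_star[of p] F(4)[OF p] pt by simp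
    moreover have "nrm p \<noteq> 0" using nrm_zero_iff[of p] pt F(5)[OF p] by simp
    ultimately have "nrm p = 1" by (simp add: power2_eq_square)
    then have "1 \<le> nrm rb * ltn p" using nrm_le_ltn[OF F(2)[OF p]] by simp
    then have "1\<^sup>2 \<le> (nrm rb * ltn p)\<^sup>2" by (intro power_mono) auto
    then show ?thesis by (simp add: power_mult_distrib)
  qed
  then have "(\<Sum>p\<in>F. 1) \<le> (\<Sum>p\<in>F. (nrm rb)\<^sup>2 * (ltn p)\<^sup>2)" by (intro sum_mono) auto
  also have "\<dots> = (nrm rb)\<^sup>2 * (\<Sum>p\<in>F. (ltn p)\<^sup>2)" by (simp add: sum_distrib_left)
  also have "(\<Sum>p\<in>F. (ltn p)\<^sup>2) = (ltn (\<^bold>1 X))\<^sup>2"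
  proof -
    have "complex_of_real (\<Sum>p\<in>F. (ltn p)\<^sup>2) = (\<Sum>p\<in>F. ltr p)"
      using ltr_star F(2,4) by (simp del: of_real_power) (metis (no_types, lifting) sum.cong)
    also have "\<dots> = ltr (\<^bold>1 X)" using ltr_hsum[of F "\<lambda>p. p"] F by simp
    also have "\<dots> = complex_of_real ((ltn (\<^bold>1 X))\<^sup>2)" using ltr_star[OF unit_Hom] by simp
    finally show ?thesis unfolding of_real_eq_iff .
  qed
  finally show ?thesis by (simp add: power_mult_distrib)
qed

text \<open>
  The even powers of \<open>s\<close> converge, since their values under the functional \<^term>\<open>ltr\<close> decrease;
  the limit is a nonzero projection fixed by \<open>s\<^sup>2\<close>.
\<close>

lemma selfadjoint_unit_norm:
  assumes noproj: "\<And>p. p \<in> Hom C X X \<Longrightarrow> p \<cdot> p = p \<Longrightarrow> p\<^sup>\<dagger> = p \<Longrightarrow> p = zero2 C X X \<or> p = \<^bold>1 X"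
    and s: "s \<in> Hom C X X" "s\<^sup>\<dagger> = s" "nrm s = 1"
  shows "s = \<^bold>1 X \<or> s = (-1) \<^bold>* \<^bold>1 X"
proof -
  note [simp] = vpow_typing[OF s(1)]
  have [simp]: "s \<in> Arr2 C" "dom2 C s = X" "cod2 C s = X" using s by (auto simp: Hom_iff)
  have par: "parallel X X" by (simp add: parallel_def)
  have vH: "vpow s n \<in> Hom C X X" for n by (simp add: Hom_iff)
  note adj = vpow_adj[OF s(1,2)]
  \<comment> \<open>The trace of the power of \<open>s\<close> with exponent \<open>n + n\<close>.
    It decreases because \<open>s\<close> is a contraction.\<close>
  define a where "a n = (ltn (vpow s n))\<^sup>2" for n
  have ltra: "ltr (vpow s (n + n)) = complex_of_real (a n)" for n
    using ltr_star[OF vH, of n] adj by (simp add: vpow_add[OF s(1)] a_def)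
  have "a (Suc n) \<le> a n" for n
    using ltn_vcomp[OF s(1) vH, of n] s(3) by (auto simp: a_def ltn_def intro!: power_mono)
  then have "decseq a" by (rule decseq_SucI)
  moreover have "0 \<le> a n" for n by (simp add: a_def)
  ultimately obtain L where L: "a \<longlonglongrightarrow> L" using decseq_convergent[of a 0] by blast
  \<comment> \<open>Only even powers are taken: their traces are nonnegative and decrease, whereas
    for \<open>s\<close> equal to minus the unit the sequence of all powers oscillates.\<close>
  define x where "x n = vpow s (2 * n)" for n
  have [simp]: "x n \<in> Arr2 C" "dom2 C (x n) = X" "cod2 C (x n) = X" for n by (simp_all add: x_def)
  have xH: "x n \<in> Hom C X X" for n by (simp add: x_def vH)
  have xadj [simp]: "(x n)\<^sup>\<dagger> = x n" for n by (simp add: x_def adj)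
  \<comment> \<open>Expanding the squared trace norm of the difference expresses it by three values
    of \<open>a\<close>, all of which approach the same limit.\<close>
  have diff: "(nrm (x m \<^bold>- x n))\<^sup>2 \<le> (nrm rb)\<^sup>2 * (a (2 * m) + a (2 * n) - 2 * a (m + n))" for m n
  proof -
    let ?d = "x m \<^bold>- x n"
    have dH: "?d \<in> Hom C X X" by (simp add: Hom_iff)
    have xx: "x i \<cdot> x j = vpow s ((i + j) + (i + j))" for i j
    proof -
      have "2 * i + 2 * j = (i + j) + (i + j)" by simp
      then show ?thesis unfolding x_def by (simp only: vpow_add[OF s(1), symmetric])
    qed
    have "?d\<^sup>\<dagger> \<cdot> ?d = (x m \<cdot> x m \<^bold>- x n \<cdot> x m) \<^bold>+ ((-1) \<^bold>* (x m \<cdot> x n) \<^bold>+ x n \<cdot> x n)"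
      by (simp add: vcomp_linear scale2_distrib)
    then have "ltr (?d\<^sup>\<dagger> \<cdot> ?d) = ltr ((x m \<cdot> x m \<^bold>- x n \<cdot> x m) \<^bold>+ ((-1) \<^bold>* (x m \<cdot> x n) \<^bold>+ x n \<cdot> x n))"
      by (rule arg_cong)
    also have "\<dots> = (ltr (x m \<cdot> x m) - ltr (x n \<cdot> x m)) + (- ltr (x m \<cdot> x n) + ltr (x n \<cdot> x n))"
      by (simp add: ltr_add ltr_scale Hom_iff)
    also have "\<dots> = complex_of_real (a (2 * m) + a (2 * n) - 2 * a (m + n))"
      unfolding xx ltra by (simp add: add.commute[of n m] flip: mult_2)
    finally have "ltr (?d\<^sup>\<dagger> \<cdot> ?d) = complex_of_real (a (2 * m) + a (2 * n) - 2 * a (m + n))" .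
    then have "complex_of_real ((ltn ?d)\<^sup>2) = complex_of_real (a (2 * m) + a (2 * n) - 2 * a (m + n))"
      using ltr_star[OF dH] by simp
    then have "(ltn ?d)\<^sup>2 = a (2 * m) + a (2 * n) - 2 * a (m + n)" unfolding of_real_eq_iff .
    moreover have "(nrm ?d)\<^sup>2 \<le> (nrm rb * ltn ?d)\<^sup>2"
      by (intro power_mono nrm_le_ltn dH) simp
    ultimately show ?thesis by (simp add: power_mult_distrib)
  qed
  have Cauchy: "\<exists>K. \<forall>m\<ge>K. \<forall>n\<ge>K. nrm (x m \<^bold>- x n) < e" if "e > 0" for e
  proof -
    \<comment> \<open>Two values of \<open>a\<close> and twice a third one enter, each within
      \<delta> of \<open>L\<close>, which accounts for the 4; the other factor undoes the constant
      of the norm estimate.\<close>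
    define \<delta> where "\<delta> = e\<^sup>2 / (4 * (nrm rb)\<^sup>2)"
    have "\<delta> > 0" using that nrm_rb_pos by (simp add: \<delta>_def)
    then obtain K where K: "\<And>n. n \<ge> K \<Longrightarrow> \<bar>a n - L\<bar> < \<delta>"
      using LIMSEQ_D[OF L \<open>\<delta> > 0\<close>] by auto
    have "nrm (x m \<^bold>- x n) < e" if mn: "m \<ge> K" "n \<ge> K" for m n
    proof -
      have "a (2 * m) + a (2 * n) - 2 * a (m + n) < 4 * \<delta>"
        using K[of "2 * m"] K[of "2 * n"] K[of "m + n"] mn by linarith
      then have "(nrm rb)\<^sup>2 * (a (2 * m) + a (2 * n) - 2 * a (m + n)) < (nrm rb)\<^sup>2 * (4 * \<delta>)"
        using nrm_rb_pos by (intro mult_strict_left_mono) auto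
      also have "\<dots> = e\<^sup>2" using nrm_rb_pos by (simp add: \<delta>_def)
      finally have "(nrm (x m \<^bold>- x n))\<^sup>2 < e\<^sup>2" by (rule le_less_trans[OF diff])
      then show ?thesis by (rule power2_less_imp_less) (use \<open>e > 0\<close> in simp)
    qed
    then show ?thesis by blast
  qed
  obtain e where e: "e \<in> Hom C X X" "(\<lambda>n. nrm (x n \<^bold>- e)) \<longlonglongrightarrow> 0"
    using Hom_complete[OF par xH Cauchy] by blast
  have [simp]: "e \<in> Arr2 C" "dom2 C e = X" "cod2 C e = X" using e by (auto simp: Hom_iff)
  have "e\<^sup>\<dagger> = e"
  proof (rule Hom_lim_unique[OF xH _ e(1) _ e(2)])
    have "nrm (x n \<^bold>- e\<^sup>\<dagger>) = nrm (x n \<^bold>- e)" for n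
      using nrm_adj[of "x n \<^bold>- e"] by simp
    then show "(\<lambda>n. nrm (x n \<^bold>- e\<^sup>\<dagger>)) \<longlonglongrightarrow> 0" using e by simp
  qed (simp add: Hom_iff)
  have mult_lim: "(\<lambda>n. nrm (t \<cdot> x n \<^bold>- t \<cdot> e)) \<longlonglongrightarrow> 0" "(\<lambda>n. nrm (x n \<cdot> t \<^bold>- e \<cdot> t)) \<longlonglongrightarrow> 0"
    if t: "t \<in> Hom C X X" for t
  proof -
    have [simp]: "t \<in> Arr2 C" "dom2 C t = X" "cod2 C t = X" using t by (auto simp: Hom_iff)
    have 1: "nrm (t \<cdot> x n \<^bold>- t \<cdot> e) \<le> nrm t * nrm (x n \<^bold>- e)" for n
      using nrm_vcomp[of "x n \<^bold>- e" t] by (simp add: vcomp_linear)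
    have 2: "nrm (x n \<cdot> t \<^bold>- e \<cdot> t) \<le> nrm t * nrm (x n \<^bold>- e)" for n
      using nrm_vcomp[of t "x n \<^bold>- e"] by (simp add: vcomp_linear mult.commute)
    have 3: "(\<lambda>n. nrm t * nrm (x n \<^bold>- e)) \<longlonglongrightarrow> 0" using tendsto_mult_right_zero[OF e(2)] by blast
    show "(\<lambda>n. nrm (t \<cdot> x n \<^bold>- t \<cdot> e)) \<longlonglongrightarrow> 0"
      by (rule tendsto_sandwich[OF _ _ tendsto_const 3]) (use 1 in auto)
    show "(\<lambda>n. nrm (x n \<cdot> t \<^bold>- e \<cdot> t)) \<longlonglongrightarrow> 0"
      by (rule tendsto_sandwich[OF _ _ tendsto_const 3]) (use 2 in auto)
  qed
  have xe: "x 1 \<cdot> e = e"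
  proof (rule Hom_lim_unique[OF _ _ e(1)])
    have eq: "x 1 \<cdot> x n = x (Suc n)" for n by (simp add: x_def flip: vpow_add[OF s(1)])
    show "(\<lambda>n. nrm (x 1 \<cdot> x n \<^bold>- x 1 \<cdot> e)) \<longlonglongrightarrow> 0" by (rule mult_lim) (rule xH)
    show "(\<lambda>n. nrm (x 1 \<cdot> x n \<^bold>- e)) \<longlonglongrightarrow> 0" unfolding eq using LIMSEQ_Suc[OF e(2)] by simp
  qed (auto simp: Hom_iff)
  have xne: "x n \<cdot> e = e" for n
  proof (induction n)
    case 0 then show ?case by (simp add: x_def)
  next
    case (Suc n)
    have "x (Suc n) \<cdot> e = (x 1 \<cdot> x n) \<cdot> e" by (simp add: x_def flip: vpow_add[OF s(1)])
    then show ?case using Suc xe by simp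
  qed
  have "e \<cdot> e = e"
    by (rule Hom_lim_unique[of "\<lambda>n. x n \<cdot> e" X X])
      (use mult_lim(2)[OF e(1)] minus_cancel[OF e(1)] par in \<open>auto simp: Hom_iff xne\<close>)
  \<comment> \<open>All powers of \<open>s\<close> have norm 1, so their limit cannot
    vanish.\<close>
  moreover have "e \<noteq> zero2 C X X"
  proof
    assume "e = zero2 C X X"
    then have "(\<lambda>n. nrm (x n)) \<longlonglongrightarrow> 0" using e(2) by simp
    then show False using nrm_vpow[OF s(1-3)] by (simp add: x_def LIMSEQ_const_iff)
  qed
  ultimately have "e = \<^bold>1 X" using noproj[OF e(1)] \<open>e\<^sup>\<dagger> = e\<close> by auto
  then have ss: "s \<cdot> s = \<^bold>1 X" using xe by (simp add: x_def numeral_2_eq_2)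
  \<comment> \<open>The projection onto the eigenvalue 1 of the symmetry \<open>s\<close>. If it is
    trivial, then \<open>s\<close> is plus or minus the unit.\<close>
  define p where "p = (1/2) \<^bold>* (\<^bold>1 X \<^bold>+ s)"
  have "p \<cdot> p = (1/2) \<^bold>* ((1/2) \<^bold>* (\<^bold>1 X \<^bold>+ s) \<^bold>+ (1/2) \<^bold>* (s \<^bold>+ \<^bold>1 X))"
    by (simp add: p_def vcomp_linear ss)
  also have "s \<^bold>+ \<^bold>1 X = \<^bold>1 X \<^bold>+ s" by (simp add: add2_commute)
  also have "(1/2) \<^bold>* ((1/2) \<^bold>* (\<^bold>1 X \<^bold>+ s) \<^bold>+ (1/2) \<^bold>* (\<^bold>1 X \<^bold>+ s)) = p" by (simp add: p_def lin_combine)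
  finally have "p = zero2 C X X \<or> p = \<^bold>1 X"
    by (intro noproj) (auto simp: p_def Hom_iff s(2))
  moreover have ps: "2 \<^bold>* p \<^bold>- \<^bold>1 X = s"
  proof -
    have "2 \<^bold>* p \<^bold>- \<^bold>1 X = s \<^bold>+ (\<^bold>1 X \<^bold>- \<^bold>1 X)" by (simp add: p_def add2_ac)
    then show ?thesis using minus_cancel[OF unit_Hom] by simp
  qed
  moreover have "2 \<^bold>* \<^bold>1 X \<^bold>- \<^bold>1 X = \<^bold>1 X" using scale2_distrib(1)[of "\<^bold>1 X" 2 "-1"] by simp
  ultimately show ?thesis by auto
qed

lemma simple_if_no_projections:
  assumes "\<And>p. p \<in> Hom C X X \<Longrightarrow> p \<cdot> p = p \<Longrightarrow> p\<^sup>\<dagger> = p \<Longrightarrow> p = zero2 C X X \<or> p = \<^bold>1 X"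
  shows "simple_arr C X"
  by (rule simpleI) (use assms selfadjoint_unit_norm in auto)

end

end

section \<open>Finite-dimensional commutative star algebras\<close>

text \<open>Gaussian elimination, one equation at a time: the unknown \<open>m\<close> with nonzero
  coefficient in the equation \<open>b\<close> is eliminated from the others, and its value in
  \<open>c'\<close> is then solved from \<open>b\<close>.\<close>

lemma underdetermined_system:
  fixes g :: "'k \<Rightarrow> 'b \<Rightarrow> complex"
  assumes "finite B" "finite K" "card B < card K"
  shows "\<exists>c. (\<exists>k\<in>K. c k \<noteq> 0) \<and> (\<forall>b\<in>B. (\<Sum>k\<in>K. c k * g k b) = 0)"
  using assms
proof (induction B arbitrary: K g rule: finite_induct)
  case empty
  then have "K \<noteq> {}" by auto
  then show ?case by (intro exI[of _ "\<lambda>_. 1"]) auto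
next
  case (insert b B)
  show ?case
  proof (cases "\<forall>k\<in>K. g k b = 0")
    case True
    then show ?thesis using insert.IH[of K g] insert by auto
  next
    case False
    then obtain m where m: "m \<in> K" "g m b \<noteq> 0" by auto
    let ?K = "K - {m}"
    have "card B < card ?K" using insert m by simp
    then have "\<exists>c. (\<exists>k\<in>?K. c k \<noteq> 0) \<and> (\<forall>b'\<in>B. (\<Sum>k\<in>?K. c k * (g k b' - g k b / g m b * g m b')) = 0)"
      by (intro insert.IH) (use insert in auto)
    then obtain c where c: "\<exists>k\<in>?K. c k \<noteq> 0"
      "\<And>b'. b' \<in> B \<Longrightarrow> (\<Sum>k\<in>?K. c k * (g k b' - g k b / g m b * g m b')) = 0" by blast
    define c' where "c' k = (if k = m then - (\<Sum>k\<in>?K. c k * g k b / g m b) else c k)" for k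
    have sum: "(\<Sum>k\<in>K. c' k * g k b') = - (\<Sum>k\<in>?K. c k * g k b / g m b) * g m b' + (\<Sum>k\<in>?K. c k * g k b')" for b'
    proof -
      have "(\<Sum>k\<in>K. c' k * g k b') = c' m * g m b' + (\<Sum>k\<in>?K. c' k * g k b')"
        using insert m by (simp add: sum.remove)
      also have "(\<Sum>k\<in>?K. c' k * g k b') = (\<Sum>k\<in>?K. c k * g k b')"
        by (intro sum.cong) (auto simp: c'_def)
      finally show ?thesis by (simp add: c'_def)
    qed
    have "(\<Sum>k\<in>K. c' k * g k b') = 0" if "b' \<in> insert b B" for b'
    proof (cases "b' = b")
      case True
      have "(\<Sum>k\<in>?K. c k * g k b / g m b) * g m b = (\<Sum>k\<in>?K. c k * g k b)"
        using m by (simp add: sum_distrib_right)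
      then show ?thesis using sum[of b] True by simp
    next
      case False
      then have "0 = (\<Sum>k\<in>?K. c k * (g k b' - g k b / g m b * g m b'))" using that c by simp
      also have "\<dots> = (\<Sum>k\<in>?K. c k * g k b') - (\<Sum>k\<in>?K. c k * g k b / g m b) * g m b'"
        by (simp add: sum_distrib_right sum_subtractf right_diff_distrib mult.assoc)
      finally show ?thesis using sum[of b'] by simp
    qed
    moreover have "\<exists>k\<in>K. c' k \<noteq> 0" using c(1) by (auto simp: c'_def)
    ultimately show ?thesis by blast
  qed
qed

section \<open>Linear dependence and polynomials in an endomorphism\<close>

context two_cstar_category
begin

text \<open>An indexed family rather than a set: it arises by whiskering a spanning set of a center,
  and whiskering need not be injective.\<close>

definition finitely_spanned where
  "finitely_spanned X A \<longleftrightarrow> (\<exists>(B :: 'c set) x. finite B \<and> (\<forall>b\<in>B. x b \<in> Hom C X X) \<and>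
    (\<forall>z\<in>A. \<exists>c. z = hsum X X (\<lambda>b. c b \<^bold>* x b) B))"

definition commutative_star_algebra where
  "commutative_star_algebra X A \<longleftrightarrow> X \<in> Arr1 C \<and> A \<subseteq> Hom C X X \<and> \<^bold>1 X \<in> A \<and>
    (\<forall>s\<in>A. \<forall>t\<in>A. s \<^bold>+ t \<in> A \<and> s \<cdot> t \<in> A \<and> s \<cdot> t = t \<cdot> s) \<and>
    (\<forall>s\<in>A. s\<^sup>\<dagger> \<in> A \<and> (\<forall>c. c \<^bold>* s \<in> A))"

lemma linear_combination_swap:
  assumes "parallel X Y" "finite K" "finite B" "\<And>b. b \<in> B \<Longrightarrow> x b \<in> Hom C X Y"
  shows "hsum X Y (\<lambda>k. c k \<^bold>* hsum X Y (\<lambda>b. g k b \<^bold>* x b) B) K = hsum X Y (\<lambda>b. (\<Sum>k\<in>K. c k * g k b) \<^bold>* x b) B"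
  using assms(2)
proof (induction K rule: finite_induct)
  case empty
  have "hsum X Y (\<lambda>b. 0 \<^bold>* x b) B = zero2 C X Y"
    by (rule hsum_zero) (use assms in \<open>auto simp: Hom_linear\<close>)
  then show ?case using assms by simp
next
  case (insert k K)
  note [simp] = Hom_linear(1-3)[OF assms(1)] assms hsum_Hom[OF assms(1)]
  have "hsum X Y (\<lambda>k. c k \<^bold>* hsum X Y (\<lambda>b. g k b \<^bold>* x b) B) (insert k K)
      = c k \<^bold>* hsum X Y (\<lambda>b. g k b \<^bold>* x b) B \<^bold>+ hsum X Y (\<lambda>k. c k \<^bold>* hsum X Y (\<lambda>b. g k b \<^bold>* x b) B) K"
    using insert by (subst hsum_insert) auto
  also have "\<dots> = hsum X Y (\<lambda>b. c k \<^bold>* g k b \<^bold>* x b) B \<^bold>+ hsum X Y (\<lambda>b. (\<Sum>k\<in>K. c k * g k b) \<^bold>* x b) B"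
    using insert by (subst scale_hsum) auto
  also have "\<dots> = hsum X Y (\<lambda>b. c k \<^bold>* g k b \<^bold>* x b \<^bold>+ (\<Sum>k\<in>K. c k * g k b) \<^bold>* x b) B"
    by (rule hsum_add[symmetric]) auto
  also have "\<dots> = hsum X Y (\<lambda>b. (\<Sum>k\<in>insert k K. c k * g k b) \<^bold>* x b) B"
    using insert by (intro hsum_cong) (auto simp: Hom_linear(7,9)[OF assms(1)])
  finally show ?case .
qed

text \<open>Expressed in the spanning family, a vanishing combination is a homogeneous system with
  more unknowns than equations. The family is left general, because both powers of one element and
  orthogonal projections are inserted.\<close>

lemma linear_dependence:
  assumes A: "finitely_spanned X A" and X: "X \<in> Arr1 C"
  obtains n where "\<And>(K :: 'k set) x. finite K \<Longrightarrow> n < card K \<Longrightarrow> (\<And>k. k \<in> K \<Longrightarrow> x k \<in> A)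
    \<Longrightarrow> \<exists>c. (\<exists>k\<in>K. c k \<noteq> 0) \<and> hsum X X (\<lambda>k. c k \<^bold>* x k) K = zero2 C X X"
proof -
  have par: "parallel X X" using X by (simp add: parallel_def)
  obtain B :: "'c set" and y where B: "finite B" "\<And>b. b \<in> B \<Longrightarrow> y b \<in> Hom C X X"
    "\<And>z. z \<in> A \<Longrightarrow> \<exists>c. z = hsum X X (\<lambda>b. c b \<^bold>* y b) B"
    using A unfolding finitely_spanned_def by blast
  have "\<exists>c. (\<exists>k\<in>K. c k \<noteq> 0) \<and> hsum X X (\<lambda>k. c k \<^bold>* x k) K = zero2 C X X"
    if K: "finite K" "card B < card K" and x: "\<And>k. k \<in> K \<Longrightarrow> x k \<in> A" for K :: "'k set" and x
  proof -
    have "\<forall>k\<in>K. \<exists>c. x k = hsum X X (\<lambda>b. c b \<^bold>* y b) B" using x B(3) by blast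
    then obtain g where g: "\<And>k. k \<in> K \<Longrightarrow> x k = hsum X X (\<lambda>b. g k b \<^bold>* y b) B" by metis
    obtain c where c: "\<exists>k\<in>K. c k \<noteq> 0" "\<And>b. b \<in> B \<Longrightarrow> (\<Sum>k\<in>K. c k * g k b) = 0"
      using underdetermined_system[OF B(1) K, of g] by blast
    have "hsum X X (\<lambda>k. c k \<^bold>* x k) K = hsum X X (\<lambda>k. c k \<^bold>* hsum X X (\<lambda>b. g k b \<^bold>* y b) B) K"
      by (rule hsum_cong) (use par B g in \<open>auto simp: Hom_linear hsum_Hom\<close>)
    also have "\<dots> = hsum X X (\<lambda>b. (\<Sum>k\<in>K. c k * g k b) \<^bold>* y b) B"
      by (rule linear_combination_swap) (use par B K in auto)
    also have "\<dots> = zero2 C X X"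
      by (rule hsum_zero) (use par B c in \<open>auto simp: Hom_linear\<close>)
    finally show ?thesis using c by blast
  qed
  then show ?thesis using that by blast
qed

text \<open>Horner's scheme. The endomorphisms of \<open>X\<close> form a ring only as a subset of
  the type of all 2-arrows, so the unit of \<open>X\<close> has to be supplied explicitly.\<close>

definition poly_eval where "poly_eval t p = fold_coeffs (\<lambda>a s. a \<^bold>* \<^bold>1 (dom2 C t) \<^bold>+ t \<cdot> s) p (zero2 C (dom2 C t) (dom2 C t))"

context
  fixes X t
  assumes t: "t \<in> Hom C X X"
begin

lemma endo_simps [simp]: "t \<in> Arr2 C" "dom2 C t = X" "cod2 C t = X" "X \<in> Arr1 C"
  using t Arr2_simps[of t] by (auto simp: Hom_iff)

lemma poly_eval_0 [simp]: "poly_eval t 0 = zero2 C X X"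
  by (simp add: poly_eval_def)

lemma poly_eval_pCons: "poly_eval t (pCons a p) = a \<^bold>* \<^bold>1 X \<^bold>+ t \<cdot> poly_eval t p"
proof (cases "p = 0 \<and> a = 0")
  case True
  then show ?thesis by (simp add: scale2_zero)
next
  case False
  then show ?thesis
    by (cases "p = 0") (auto simp: poly_eval_def fold_coeffs_def cCons_def)
qed

lemma poly_eval_typing [simp]: "poly_eval t p \<in> Arr2 C" "dom2 C (poly_eval t p) = X" "cod2 C (poly_eval t p) = X"
proof -
  have "poly_eval t p \<in> Arr2 C \<and> dom2 C (poly_eval t p) = X \<and> cod2 C (poly_eval t p) = X"
    by (induction p) (simp_all add: poly_eval_pCons)
  then show "poly_eval t p \<in> Arr2 C" "dom2 C (poly_eval t p) = X" "cod2 C (poly_eval t p) = X" by auto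
qed

lemma poly_eval_add: "poly_eval t (p + q) = poly_eval t p \<^bold>+ poly_eval t q"
proof (induction p q rule: poly_induct2)
  case (pCons a p b q)
  have "poly_eval t (pCons a p + pCons b q) = (a \<^bold>* \<^bold>1 X \<^bold>+ b \<^bold>* \<^bold>1 X) \<^bold>+ (t \<cdot> poly_eval t p \<^bold>+ t \<cdot> poly_eval t q)"
    by (simp add: poly_eval_pCons pCons vcomp_linear scale2_distrib(1))
  also have "\<dots> = poly_eval t (pCons a p) \<^bold>+ poly_eval t (pCons b q)"
    by (simp add: poly_eval_pCons add2_ac)
  finally show ?case .
qed simp

lemma poly_eval_smult: "poly_eval t (smult c p) = c \<^bold>* poly_eval t p"
  by (induction p) (simp_all add: poly_eval_pCons vcomp_linear scale2_distrib(2))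

lemma poly_eval_linear_factor: "poly_eval t ([:- l, 1:] * q) = t \<cdot> poly_eval t q \<^bold>+ (- l) \<^bold>* poly_eval t q"
proof -
  have "[:- l, 1:] * q = pCons 0 q + smult (- l) q" by simp
  also have "poly_eval t \<dots> = t \<cdot> poly_eval t q \<^bold>+ (- l) \<^bold>* poly_eval t q"
    by (simp only: poly_eval_add poly_eval_smult poly_eval_pCons) (simp add: scale2_zero)
  finally show ?thesis .
qed

lemma poly_eval_monom: "poly_eval t (monom c k) = c \<^bold>* vpow t k"
  by (induction k) (simp_all add: monom_0 monom_Suc poly_eval_pCons vpow_typing[OF t] vcomp_linear scale2_zero)

lemma poly_eval_sum: "finite K \<Longrightarrow> poly_eval t (\<Sum>k\<in>K. f k) = hsum X X (\<lambda>k. poly_eval t (f k)) K"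
proof (induction K rule: finite_induct)
  case (insert k K)
  then show ?case by (simp add: poly_eval_add, subst hsum_insert) (auto simp: parallel_def Hom_iff)
qed (simp add: parallel_def)

lemma poly_eval_eigen:
  assumes "y \<in> Hom C X X" "t \<cdot> y = l \<^bold>* y"
  shows "poly_eval t p \<cdot> y = poly p l \<^bold>* y"
proof (induction p)
  case 0 then show ?case using assms by (simp add: Hom_iff scale2_zero)
next
  case (pCons a p)
  have [simp]: "y \<in> Arr2 C" "dom2 C y = X" "cod2 C y = X" using assms by (auto simp: Hom_iff)
  show ?case by (simp add: poly_eval_pCons vcomp_linear pCons assms(2) lin_combine mult.commute)
qed

end

declare endo_simps [simp del] poly_eval_0 [simp del] poly_eval_typing [simp del]

lemma minimal_projectionD:
  assumes "f \<in> minimal_projections C X A"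
  shows "f \<in> A" "f \<cdot> f = f" "f\<^sup>\<dagger> = f" "f \<noteq> zero2 C X X"
    "p \<in> A \<Longrightarrow> p \<cdot> p = p \<Longrightarrow> p\<^sup>\<dagger> = p \<Longrightarrow> f \<cdot> p = p \<Longrightarrow> p = zero2 C X X \<or> p = f"
  using assms by (auto simp: minimal_projections_def Let_def)

lemma star_algebraD:
  assumes "commutative_star_algebra X A"
  shows "X \<in> Arr1 C" "t \<in> A \<Longrightarrow> t \<in> Hom C X X" "\<^bold>1 X \<in> A"
    "s \<in> A \<Longrightarrow> t \<in> A \<Longrightarrow> s \<^bold>+ t \<in> A" "s \<in> A \<Longrightarrow> t \<in> A \<Longrightarrow> s \<cdot> t \<in> A"
    "s \<in> A \<Longrightarrow> t \<in> A \<Longrightarrow> s \<cdot> t = t \<cdot> s" "s \<in> A \<Longrightarrow> s\<^sup>\<dagger> \<in> A" "s \<in> A \<Longrightarrow> c \<^bold>* s \<in> A"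
    "t \<in> A \<Longrightarrow> t \<in> Arr2 C" "t \<in> A \<Longrightarrow> dom2 C t = X" "t \<in> A \<Longrightarrow> cod2 C t = X"
proof -
  show H: "t \<in> A \<Longrightarrow> t \<in> Hom C X X" for t
    using assms unfolding commutative_star_algebra_def by blast
  show "t \<in> A \<Longrightarrow> t \<in> Arr2 C" "t \<in> A \<Longrightarrow> dom2 C t = X" "t \<in> A \<Longrightarrow> cod2 C t = X"
    using H[of t] unfolding Hom_iff by blast+
  have 1: "X \<in> Arr1 C" "\<^bold>1 X \<in> A" and 2: "\<forall>s\<in>A. \<forall>t\<in>A. s \<^bold>+ t \<in> A \<and> s \<cdot> t \<in> A \<and> s \<cdot> t = t \<cdot> s"
    and 3: "\<forall>s\<in>A. s\<^sup>\<dagger> \<in> A \<and> (\<forall>c. c \<^bold>* s \<in> A)"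
    using assms unfolding commutative_star_algebra_def by - ((elim conjE, assumption)+)
  show "X \<in> Arr1 C" "\<^bold>1 X \<in> A" by (rule 1)+
  show "s \<in> A \<Longrightarrow> t \<in> A \<Longrightarrow> s \<^bold>+ t \<in> A" "s \<in> A \<Longrightarrow> t \<in> A \<Longrightarrow> s \<cdot> t \<in> A"
    "s \<in> A \<Longrightarrow> t \<in> A \<Longrightarrow> s \<cdot> t = t \<cdot> s" by (drule (1) bspec[OF bspec[OF 2]], elim conjE, assumption)+
  show "s \<in> A \<Longrightarrow> s\<^sup>\<dagger> \<in> A" "s \<in> A \<Longrightarrow> c \<^bold>* s \<in> A"
    by (drule bspec[OF 3], elim conjE, (assumption | erule spec))+
qed

section \<open>Minimal projections of a commutative star algebra\<close>

context
  fixes X A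
  assumes A: "commutative_star_algebra X A"
begin

lemma normal_idempotent_selfadjoint:
  assumes e: "e \<in> A" "e \<cdot> e = e" shows "e\<^sup>\<dagger> = e"
proof -
  note [simp] = star_algebraD(1-5,7-)[OF A] e(1)
  have es: "e\<^sup>\<dagger> \<cdot> e\<^sup>\<dagger> = e\<^sup>\<dagger>" using arg_cong[OF e(2), of "adj2 C"] by simp
  define h where "h = e\<^sup>\<dagger> \<cdot> e"
  have hA [simp]: "h \<in> A" by (simp add: h_def)
  have 1: "e\<^sup>\<dagger> \<cdot> h = h" 
    unfolding h_def by (subst vcomp_assoc'[symmetric]) (auto simp: es)
  have 2: "h \<cdot> e = h" unfolding h_def by (simp add: e(2))
  have 3: "h \<cdot> h = h"
  proof -
    have "h \<cdot> h = e\<^sup>\<dagger> \<cdot> (e \<cdot> h)" by (simp add: h_def)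
    also have "e \<cdot> h = h \<cdot> e" by (rule star_algebraD(6)[OF A]) auto
    finally show ?thesis using 1 2 by simp
  qed
  have hh: "h\<^sup>\<dagger> = h" by (simp add: h_def)
  have "(e \<^bold>- h)\<^sup>\<dagger> \<cdot> (e \<^bold>- h) = (h \<^bold>- h) \<^bold>- (h \<^bold>- h)"
  proof -
    have "(e \<^bold>- h)\<^sup>\<dagger> \<cdot> (e \<^bold>- h) = (e\<^sup>\<dagger> \<cdot> e \<^bold>- h \<cdot> e) \<^bold>- (e\<^sup>\<dagger> \<cdot> h \<^bold>- h \<cdot> h)"
      by (simp add: hh vcomp_linear scale2_distrib)
    then show ?thesis unfolding 1 2 3 h_def[symmetric] .
  qed
  also have "\<dots> = zero2 C X X" using minus_cancel[of h X X] by simp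
  finally have "e \<^bold>- h = zero2 C X X" by (rule star_zero[where X = X and Y = X, rotated])
    (intro star_algebraD(2,4,5,7,8)[OF A] e hA)
  then have "e = h" using minus_zero_iff[of e X X h] by simp
  then show ?thesis using hh by simp
qed

text \<open>Since \<open>y\<close> commutes with its adjoint, the positive element
  \<open>y\<^sup>\<dagger> \<cdot> y\<close> has square zero. The C*-identity applies to it first
  and then to \<open>y\<close>.\<close>

lemma normal_nilpotent_zero:
  assumes y: "y \<in> A" "y \<cdot> y = zero2 C X X" shows "y = zero2 C X X"
proof -
  note [simp] = star_algebraD(1-5,7-)[OF A] y(1)
  have "(y\<^sup>\<dagger> \<cdot> y)\<^sup>\<dagger> \<cdot> (y\<^sup>\<dagger> \<cdot> y) = y\<^sup>\<dagger> \<cdot> (y \<cdot> y\<^sup>\<dagger>) \<cdot> y" by simp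
  also have "y \<cdot> y\<^sup>\<dagger> = y\<^sup>\<dagger> \<cdot> y" by (rule star_algebraD(6)[OF A]) auto
  also have "y\<^sup>\<dagger> \<cdot> (y\<^sup>\<dagger> \<cdot> y) \<cdot> y = zero2 C X X" by (simp add: y(2))
  finally have "y\<^sup>\<dagger> \<cdot> y = zero2 C X X" by (rule star_zero[where X = X and Y = X, rotated])
    (intro star_algebraD(2,4,5,7,8)[OF A] y)
  then show ?thesis by (rule star_zero[where X = X and Y = X, rotated]) (intro star_algebraD(2)[OF A] y)
qed

lemma poly_eval_in: "a \<in> A \<Longrightarrow> poly_eval a p \<in> A"
proof (induction p)
  case 0
  have "0 \<^bold>* \<^bold>1 X \<in> A" using star_algebraD[OF A] by simp
  then show ?case using star_algebraD(1)[OF A] poly_eval_0[OF star_algebraD(2)[OF A 0]] by (simp add: scale2_zero)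
next
  case (pCons c p)
  then show ?case unfolding poly_eval_pCons[OF star_algebraD(2)[OF A pCons(3)]] by (intro star_algebraD[OF A])
qed

text \<open>A root of \<open>p\<close> splits off a linear factor. Either the cofactor still
  annihilates \<open>f\<close> and the degree drops, or its value on \<open>f\<close> is a nonzero
  eigenvector of \<open>a\<close>; this is a multiple of an idempotent below \<open>f\<close>, hence
  of \<open>f\<close> itself.\<close>

lemma minimal_projection_eigen:
  assumes f: "f \<in> minimal_projections C X A" and a: "a \<in> A"
    and p: "p \<noteq> 0" "poly_eval a p \<cdot> f = zero2 C X X"
  shows "\<exists>l. a \<cdot> f = l \<^bold>* f"
  using p
proof (induction "degree p" arbitrary: p)
  case 0
  note [simp] = star_algebraD(1-5,7-)[OF A] a minimal_projectionD(1-4)[OF f]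
  obtain c where c: "p = [:c:]" using 0 by (metis degree_eq_zeroE)
  have "c \<^bold>* f = 0 \<^bold>* f" using 0 c by (simp add: poly_eval_pCons[of a X] poly_eval_0[of a X] vcomp_linear scale2_zero)
  then have "c = 0" by (rule scale_cancel[where X = X and Y = X]) auto
  then show ?case using c 0 by simp
next
  case (Suc n)
  note [simp] = star_algebraD(1-5,7-)[OF A] a minimal_projectionD(1-4)[OF f] poly_eval_in
  note comm = star_algebraD(6)[OF A]
  have "\<not> constant (poly p)" using Suc(2) by (simp add: constant_degree)
  then obtain l where "poly p l = 0" using fundamental_theorem_of_algebra by blast
  then obtain q where q: "p = [:- l, 1:] * q" by (metis dvdE poly_eq_0_iff_dvd)
  then have q0: "q \<noteq> 0" using Suc by auto
  define y where "y = poly_eval a q \<cdot> f"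
  have [simp]: "y \<in> A" by (simp add: y_def)
  have "a \<cdot> y \<^bold>- l \<^bold>* y = zero2 C X X"
    using Suc(4) unfolding q poly_eval_linear_factor[OF star_algebraD(2)[OF A a]]
    by (simp add: y_def vcomp_linear)
  then have ay: "a \<cdot> y = l \<^bold>* y" using minus_zero_iff[of "a \<cdot> y" X X "l \<^bold>* y"] by simp
  show ?case
  proof (cases "y = zero2 C X X")
    case True
    have "n = degree q" using Suc(2) degree_mult_eq[of "[:- l, 1:]" q] q0 unfolding q by simp
    then show ?thesis using Suc(1)[OF _ q0] True unfolding y_def by simp
  next
    case False
    have yf: "y \<cdot> f = y" by (simp add: y_def)
    then have fy: "f \<cdot> y = y" using comm[of f y] by simp
    define k where "k = poly q l"
    have yy: "y \<cdot> y = k \<^bold>* y"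
    proof -
      have "y \<cdot> y = poly_eval a q \<cdot> (f \<cdot> y)" by (subst y_def) simp
      also have "\<dots> = k \<^bold>* y" unfolding fy k_def by (rule poly_eval_eigen[where X = X]) (use ay in auto)
      finally show ?thesis .
    qed
    have k: "k \<noteq> 0"
    proof
      assume "k = 0"
      then have "y \<cdot> y = zero2 C X X" using yy by (simp add: scale2_zero)
      then show False using normal_nilpotent_zero[of y] False by simp
    qed
    \<comment> \<open>The square of \<open>y\<close> is \<open>k\<close> times \<open>y\<close>, and
      \<open>k\<close> is nonzero because the algebra contains no nilpotent elements; dividing by
      \<open>k\<close> gives an idempotent.\<close>
    define e where "e = (1 / k) \<^bold>* y"
    have [simp]: "e \<in> A" by (simp add: e_def)
    have ee: "e \<cdot> e = e" using k by (simp add: e_def vcomp_linear yy)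
    have ek: "y = k \<^bold>* e" using k by (simp add: e_def)
    have "e = f"
    proof -
      have "f \<cdot> e = e" by (simp add: e_def vcomp_linear fy)
      moreover have "e \<noteq> zero2 C X X" using ek False by auto
      ultimately show ?thesis
        using minimal_projectionD(5)[OF f, of e] ee normal_idempotent_selfadjoint[of e] by simp
    qed
    have "a \<cdot> e = (1 / k) \<^bold>* (a \<cdot> y)" by (simp add: e_def vcomp_linear)
    also have "\<dots> = l \<^bold>* e" by (simp add: ay e_def)
    finally show ?thesis using \<open>e = f\<close> by blast
  qed
qed

context
  assumes fin: "finitely_spanned X A"
begin

text \<open>The powers with exponents 0 to \<open>n\<close> are \<open>n + 1\<close> elements and
  thus linearly dependent, which provides a nonzero polynomial annihilating
  \<open>a\<close>.\<close>

lemma minimal_projection_scalar: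
  assumes f: "f \<in> minimal_projections C X A" and a: "a \<in> A"
  shows "\<exists>l. a \<cdot> f = l \<^bold>* f"
proof -
  note [simp] = star_algebraD(1-5,7-)[OF A] a minimal_projectionD(1-4)[OF f]
  obtain n where n: "\<And>(K :: nat set) x. finite K \<Longrightarrow> n < card K \<Longrightarrow> (\<And>k. k \<in> K \<Longrightarrow> x k \<in> A)
    \<Longrightarrow> \<exists>c. (\<exists>k\<in>K. c k \<noteq> 0) \<and> hsum X X (\<lambda>k. c k \<^bold>* x k) K = zero2 C X X"
    by (rule linear_dependence[OF fin]) auto
  have "vpow a k \<in> A" for k by (induction k) auto
  then obtain c where c: "\<exists>k\<in>{..n}. c k \<noteq> 0" "hsum X X (\<lambda>k. c k \<^bold>* vpow a k) {..n} = zero2 C X X"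
    using n[of "{..n}" "vpow a"] by auto
  define p where "p = (\<Sum>k\<in>{..n}. monom (c k) k)"
  have "coeff p k = c k" if "k \<le> n" for k
    using that by (simp add: p_def coeff_sum)
  then have "p \<noteq> 0" using c(1) by auto
  moreover have "poly_eval a p = zero2 C X X"
    using c(2) by (simp add: p_def poly_eval_sum[of a X] poly_eval_monom[of a X])
  ultimately show ?thesis by (intro minimal_projection_eigen[OF f a]) auto
qed

text \<open>Orthogonal nonzero projections are linearly independent, which bounds every resolution.
  A resolution into minimal projections then contains all of them, because a minimal projection
  cannot be orthogonal to every member.\<close>

lemma resolution_minimal_projections: "resolution X A (minimal_projections C X A)"
proof -
  note [simp] = star_algebraD(1,3)[OF A]
  note comm = star_algebraD(6)[OF A]
  have par: "parallel X X" by (simp add: parallel_def)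
  obtain n where n: "\<And>(K :: 'c set) x. finite K \<Longrightarrow> n < card K \<Longrightarrow> (\<And>k. k \<in> K \<Longrightarrow> x k \<in> A)
    \<Longrightarrow> \<exists>c. (\<exists>k\<in>K. c k \<noteq> 0) \<and> hsum X X (\<lambda>k. c k \<^bold>* x k) K = zero2 C X X"
    by (rule linear_dependence[OF fin star_algebraD(1)[OF A]]) blast
  have bound: "card F \<le> n" if F: "resolution X A F" for F
  proof (rule ccontr)
    assume neg: "\<not> ?thesis"
    have FD: "finite F" "\<And>p. p \<in> F \<Longrightarrow> p \<in> A" "\<And>p. p \<in> F \<Longrightarrow> p \<cdot> p = p" "\<And>p. p \<in> F \<Longrightarrow> p \<noteq> zero2 C X X"
      "\<And>p q. p \<in> F \<Longrightarrow> q \<in> F \<Longrightarrow> p \<noteq> q \<Longrightarrow> p \<cdot> q = zero2 C X X"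
      using F by (auto simp: resolution_def)
    have FDt: "p \<in> Arr2 C" "dom2 C p = X" "cod2 C p = X" if "p \<in> F" for p
      using star_algebraD(9-)[OF A FD(2)[OF that]] by auto
    obtain c k where c: "k \<in> F" "c k \<noteq> 0" "hsum X X (\<lambda>k. c k \<^bold>* k) F = zero2 C X X"
      using n[of F "\<lambda>p. p"] FD neg by auto
    \<comment> \<open>Multiplying the linear relation by its member \<open>k\<close> isolates the
      coefficient of \<open>k\<close>.\<close>
    have "zero2 C X X = k \<cdot> hsum X X (\<lambda>k. c k \<^bold>* k) F" unfolding c(3) using FDt[OF c(1)] by simp
    also have "\<dots> = hsum X X (\<lambda>j. k \<cdot> c j \<^bold>* j) F"
      by (rule vcomp_hsum) (use c(1) FD(1) FDt par in \<open>auto simp: Hom_iff\<close>)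
    also have "\<dots> = k \<cdot> c k \<^bold>* k"
      by (rule hsum_delta) (use c(1) FD(1,5) FDt par in \<open>auto simp: Hom_iff vcomp_linear\<close>)
    finally have "c k \<^bold>* k = 0 \<^bold>* k" using FD(3)[OF c(1)] FDt[OF c(1)] by (simp add: vcomp_linear scale2_zero)
    then have "c k = 0" by (rule scale_cancel[where X = X and Y = X]) (use FD(4)[OF c(1)] FDt[OF c(1)] in \<open>auto simp: Hom_iff\<close>)
    then show False using c by simp
  qed
  have "s \<^bold>- t \<in> A" if "s \<in> A" "t \<in> A" for s t
    using that by (intro star_algebraD(4,8)[OF A])
  moreover have "A \<subseteq> Hom C X X" using star_algebraD(2)[OF A] by blast
  ultimately obtain F where F: "resolution X A F" "F \<subseteq> minimal_projections C X A"
    using minimal_resolution[of X A n] bound star_algebraD(1,3)[OF A] by metis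
  have FD: "finite F" "\<And>p. p \<in> F \<Longrightarrow> p \<in> A" "hsum X X (\<lambda>p. p) F = \<^bold>1 X"
    using F by (auto simp: resolution_def)
  have FDt: "p \<in> Arr2 C" "dom2 C p = X" "cod2 C p = X" if "p \<in> F" for p
    using star_algebraD(9-)[OF A FD(2)[OF that]] by auto
  have "minimal_projections C X A \<subseteq> F"
  proof
    fix p assume p: "p \<in> minimal_projections C X A"
    note [simp] = minimal_projectionD(2,3)[OF p] star_algebraD(9-)[OF A minimal_projectionD(1)[OF p]]
    have "\<exists>q\<in>F. p \<cdot> q \<noteq> zero2 C X X"
    proof (rule ccontr)
      assume neg: "\<not> ?thesis"
      have "p = p \<cdot> hsum X X (\<lambda>p. p) F" by (simp add: FD)
      also have "\<dots> = hsum X X (\<lambda>q. p \<cdot> q) F"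
        by (rule vcomp_hsum) (use FD(1) FDt par in \<open>auto simp: Hom_iff\<close>)
      also have "\<dots> = zero2 C X X" by (rule hsum_zero) (use neg par in auto)
      finally show False using minimal_projectionD(4)[OF p] by simp
    qed
    then obtain q where q: "q \<in> F" "p \<cdot> q \<noteq> zero2 C X X" by blast
    then have qm: "q \<in> minimal_projections C X A" using F by auto
    note [simp] = minimal_projectionD(2,3)[OF qm] star_algebraD(9-)[OF A minimal_projectionD(1)[OF qm]]
    have pq: "q \<cdot> p = p \<cdot> q" by (rule comm[OF minimal_projectionD(1)[OF qm] minimal_projectionD(1)[OF p]])
    \<comment> \<open>The product of two commuting projections is a projection below both. As it is
      nonzero, minimality identifies it with \<open>p\<close> and with \<open>q\<close>.\<close>
    have 1: "p \<cdot> (p \<cdot> q) = p \<cdot> q" using vcomp_assoc'[of q p p] by simp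
    have 2: "q \<cdot> (p \<cdot> q) = p \<cdot> q" using vcomp_assoc'[of p q q] by (simp add: pq)
    have 3: "(p \<cdot> q) \<cdot> (p \<cdot> q) = p \<cdot> q" using 1 2 by simp
    have 4: "(p \<cdot> q)\<^sup>\<dagger> = p \<cdot> q" using pq by simp
    have pqA: "p \<cdot> q \<in> A" by (intro star_algebraD(5)[OF A] minimal_projectionD(1)[OF p] minimal_projectionD(1)[OF qm])
    have "p \<cdot> q = p" using minimal_projectionD(5)[OF p pqA 3 4 1] q(2) by blast
    moreover have "p \<cdot> q = q" using minimal_projectionD(5)[OF qm pqA 3 4 2] q(2) by blast
    ultimately show "p \<in> F" using q by simp
  qed
  then show ?thesis using F by (metis subset_antisym)
qed

end

end

end

section \<open>Centers and factorial arrows\<close>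

context two_cstar_category
begin

lemma center_iff: "z \<in> center C N \<longleftrightarrow> z \<in> Arr2 C \<and> dom2 C z = \<^bold>I N \<and> cod2 C z = \<^bold>I N"
  by (simp add: center_def Hom_iff)

text \<open>The Eckmann-Hilton argument: on a unit arrow both vertical composites agree with the
  horizontal one.\<close>

lemma center_commute:
  assumes "z \<in> center C N" "z' \<in> center C N" "N \<in> Obj C"
  shows "z \<cdot> z' = z' \<cdot> z"
  using slide[of z' z] assms by (simp add: center_iff)

lemma left_center_algebra:
  assumes X: "X \<in> Arr1 C" shows "commutative_star_algebra X (left_center C X)"
proof -
  let ?N = "src C X"
  have [simp]: "?N \<in> Obj C" using X by simp
  note ts = center_iff X hcomp_linear
  show ?thesis
    unfolding commutative_star_algebra_def
  proof (intro conjI ballI allI)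
    show "left_center C X \<subseteq> Hom C X X" by (auto simp: left_center_def Hom_iff ts)
    have "\<^bold>1 X = \<^bold>1 X \<boxtimes> \<^bold>1 (\<^bold>I ?N)" using X by simp
    then show "\<^bold>1 X \<in> left_center C X" unfolding left_center_def by (blast intro: iffD2[OF center_iff] unit2_simps unit1_simps X src_Obj)
  next
    fix s t assume "s \<in> left_center C X" "t \<in> left_center C X"
    then obtain y z where s: "s = \<^bold>1 X \<boxtimes> y" "y \<in> center C ?N" and t: "t = \<^bold>1 X \<boxtimes> z" "z \<in> center C ?N"
      by (auto simp: left_center_def)
    have "s \<^bold>+ t = \<^bold>1 X \<boxtimes> (y \<^bold>+ z)" "y \<^bold>+ z \<in> center C ?N" using s t by (simp_all add: ts)
    then show "s \<^bold>+ t \<in> left_center C X" by (auto simp: left_center_def)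
    have st: "s \<cdot> t = \<^bold>1 X \<boxtimes> (y \<cdot> z)" "y \<cdot> z \<in> center C ?N" using s t by (simp_all add: ts whisker_left)
    then show "s \<cdot> t \<in> left_center C X" by (auto simp: left_center_def)
    have "t \<cdot> s = \<^bold>1 X \<boxtimes> (z \<cdot> y)" using s t by (simp add: ts whisker_left)
    then show "s \<cdot> t = t \<cdot> s" using st center_commute[OF s(2) t(2)] by simp
  next
    fix s c assume "s \<in> left_center C X"
    then obtain y where s: "s = \<^bold>1 X \<boxtimes> y" "y \<in> center C ?N" by (auto simp: left_center_def)
    have "s\<^sup>\<dagger> = \<^bold>1 X \<boxtimes> y\<^sup>\<dagger>" "y\<^sup>\<dagger> \<in> center C ?N" "c \<^bold>* s = \<^bold>1 X \<boxtimes> (c \<^bold>* y)" "c \<^bold>* y \<in> center C ?N"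
      using s by (simp_all add: ts)
    then show "s\<^sup>\<dagger> \<in> left_center C X" "c \<^bold>* s \<in> left_center C X" by (auto simp: left_center_def)
  qed fact
qed

lemma right_center_algebra:
  assumes X: "X \<in> Arr1 C" shows "commutative_star_algebra X (right_center C X)"
proof -
  let ?M = "tgt C X"
  have [simp]: "?M \<in> Obj C" using X by simp
  note ts = center_iff X hcomp_linear
  show ?thesis
    unfolding commutative_star_algebra_def
  proof (intro conjI ballI allI)
    show "right_center C X \<subseteq> Hom C X X" by (auto simp: right_center_def Hom_iff ts)
    have "\<^bold>1 X = \<^bold>1 (\<^bold>I ?M) \<boxtimes> \<^bold>1 X" using X by simp
    then show "\<^bold>1 X \<in> right_center C X" unfolding right_center_def by (blast intro: iffD2[OF center_iff] unit2_simps unit1_simps X tgt_Obj)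
  next
    fix s t assume "s \<in> right_center C X" "t \<in> right_center C X"
    then obtain y z where s: "s = y \<boxtimes> \<^bold>1 X" "y \<in> center C ?M" and t: "t = z \<boxtimes> \<^bold>1 X" "z \<in> center C ?M"
      by (auto simp: right_center_def)
    have "s \<^bold>+ t = (y \<^bold>+ z) \<boxtimes> \<^bold>1 X" "y \<^bold>+ z \<in> center C ?M" using s t by (simp_all add: ts)
    then show "s \<^bold>+ t \<in> right_center C X" by (auto simp: right_center_def)
    have st: "s \<cdot> t = (y \<cdot> z) \<boxtimes> \<^bold>1 X" "y \<cdot> z \<in> center C ?M" using s t by (simp_all add: ts whisker_right)
    then show "s \<cdot> t \<in> right_center C X" by (auto simp: right_center_def)
    have "t \<cdot> s = (z \<cdot> y) \<boxtimes> \<^bold>1 X" using s t by (simp add: ts whisker_right)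
    then show "s \<cdot> t = t \<cdot> s" using st center_commute[OF s(2) t(2)] by simp
  next
    fix s c assume "s \<in> right_center C X"
    then obtain y where s: "s = y \<boxtimes> \<^bold>1 X" "y \<in> center C ?M" by (auto simp: right_center_def)
    have "s\<^sup>\<dagger> = y\<^sup>\<dagger> \<boxtimes> \<^bold>1 X" "y\<^sup>\<dagger> \<in> center C ?M" "c \<^bold>* s = (c \<^bold>* y) \<boxtimes> \<^bold>1 X" "c \<^bold>* y \<in> center C ?M"
      using s by (simp_all add: ts)
    then show "s\<^sup>\<dagger> \<in> right_center C X" "c \<^bold>* s \<in> right_center C X" by (auto simp: right_center_def)
  qed fact
qed

lemma left_center_spanned:
  assumes "finite_dimensional_centers C" and X: "X \<in> Arr1 C"
  shows "finitely_spanned X (left_center C X)"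
proof -
  let ?N = "src C X"
  have [simp]: "?N \<in> Obj C" using X by simp
  obtain B where B: "finite B" "B \<subseteq> center C ?N"
    "\<And>z. z \<in> center C ?N \<Longrightarrow> \<exists>c. z = hsum (\<^bold>I ?N) (\<^bold>I ?N) (\<lambda>b. c b \<^bold>* b) B"
    using assms unfolding finite_dimensional_centers_def by (meson src_Obj)
  have Bt: "b \<in> Arr2 C" "dom2 C b = \<^bold>I ?N" "cod2 C b = \<^bold>I ?N" if "b \<in> B" for b
    using B that by (auto simp: center_iff)
  have "\<exists>c. \<^bold>1 X \<boxtimes> z = hsum X X (\<lambda>b. c b \<^bold>* \<^bold>1 X \<boxtimes> b) B" if z: "z \<in> center C ?N" for z
  proof -
    obtain c where c: "z = hsum (\<^bold>I ?N) (\<^bold>I ?N) (\<lambda>b. c b \<^bold>* b) B" using B(3)[OF z] by blast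
    have "\<^bold>1 X \<boxtimes> z = hsum (X \<boxdot> \<^bold>I ?N) (X \<boxdot> \<^bold>I ?N) (\<lambda>b. \<^bold>1 X \<boxtimes> (c b \<^bold>* b)) B"
      unfolding c by (rule hcomp_hsum) (use B(1) Bt X in \<open>auto simp: parallel_def Hom_iff\<close>)
    also have "\<dots> = hsum X X (\<lambda>b. c b \<^bold>* \<^bold>1 X \<boxtimes> b) B"
      using X by simp (rule hsum_cong, use Bt X in \<open>auto simp: hcomp_linear parallel_def Hom_iff\<close>)
    finally show ?thesis by blast
  qed
  then show ?thesis
    unfolding finitely_spanned_def left_center_def using B(1) Bt X
    by (intro exI[of _ B] exI[of _ "\<lambda>b. \<^bold>1 X \<boxtimes> b"]) (auto simp: Hom_iff)
qed

lemma right_center_spanned: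
  assumes "finite_dimensional_centers C" and X: "X \<in> Arr1 C"
  shows "finitely_spanned X (right_center C X)"
proof -
  let ?M = "tgt C X"
  have [simp]: "?M \<in> Obj C" using X by simp
  obtain B where B: "finite B" "B \<subseteq> center C ?M"
    "\<And>z. z \<in> center C ?M \<Longrightarrow> \<exists>c. z = hsum (\<^bold>I ?M) (\<^bold>I ?M) (\<lambda>b. c b \<^bold>* b) B"
    using assms unfolding finite_dimensional_centers_def by (meson tgt_Obj)
  have Bt: "b \<in> Arr2 C" "dom2 C b = \<^bold>I ?M" "cod2 C b = \<^bold>I ?M" if "b \<in> B" for b
    using B that by (auto simp: center_iff)
  have "\<exists>c. z \<boxtimes> \<^bold>1 X = hsum X X (\<lambda>b. c b \<^bold>* b \<boxtimes> \<^bold>1 X) B" if z: "z \<in> center C ?M" for z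
  proof -
    obtain c where c: "z = hsum (\<^bold>I ?M) (\<^bold>I ?M) (\<lambda>b. c b \<^bold>* b) B" using B(3)[OF z] by blast
    have "z \<boxtimes> \<^bold>1 X = hsum (\<^bold>I ?M \<boxdot> X) (\<^bold>I ?M \<boxdot> X) (\<lambda>b. (c b \<^bold>* b) \<boxtimes> \<^bold>1 X) B"
      unfolding c by (rule hsum_hcomp) (use B(1) Bt X in \<open>auto simp: parallel_def Hom_iff\<close>)
    also have "\<dots> = hsum X X (\<lambda>b. c b \<^bold>* b \<boxtimes> \<^bold>1 X) B"
      using X by simp (rule hsum_cong, use Bt X in \<open>auto simp: hcomp_linear parallel_def Hom_iff\<close>)
    finally show ?thesis by blast
  qed
  then show ?thesis
    unfolding finitely_spanned_def right_center_def using B(1) Bt X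
    by (intro exI[of _ B] exI[of _ "\<lambda>b. b \<boxtimes> \<^bold>1 X"]) (auto simp: Hom_iff)
qed

lemma factorialI:
  assumes X: "X \<in> Arr1 C"
    and "\<And>z. z \<in> center C (src C X) \<Longrightarrow> \<exists>c. \<^bold>1 X \<boxtimes> z = c \<^bold>* \<^bold>1 X"
    and "\<And>z. z \<in> center C (tgt C X) \<Longrightarrow> \<exists>c. z \<boxtimes> \<^bold>1 X = c \<^bold>* \<^bold>1 X"
  shows "factorial_arr C X"
proof -
  have "c \<^bold>* \<^bold>1 X \<in> left_center C X" "c \<^bold>* \<^bold>1 X \<in> right_center C X" for c
    using star_algebraD(3,8)[OF left_center_algebra[OF X]] star_algebraD(3,8)[OF right_center_algebra[OF X]] by auto
  then show ?thesis using assms unfolding factorial_arr_def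
    by (fastforce simp: left_center_def right_center_def scalars_def)
qed

lemma factorialD:
  assumes "factorial_arr C X"
  shows "z \<in> center C (src C X) \<Longrightarrow> \<exists>c. \<^bold>1 X \<boxtimes> z = c \<^bold>* \<^bold>1 X"
    "z \<in> center C (tgt C X) \<Longrightarrow> \<exists>c. z \<boxtimes> \<^bold>1 X = c \<^bold>* \<^bold>1 X"
  using assms by (auto simp: factorial_arr_def left_center_def right_center_def scalars_def)

text \<open>Central elements are natural and slide past the isometry \<open>u\<close>, after which
  \<open>u\<^sup>\<dagger> \<cdot> u\<close> cancels.\<close>

lemma center_sub:
  assumes u: "u \<in> Hom C S X" "u\<^sup>\<dagger> \<cdot> u = \<^bold>1 S"
  shows "z \<in> center C (src C X) \<Longrightarrow> \<^bold>1 S \<boxtimes> z = u\<^sup>\<dagger> \<cdot> (\<^bold>1 X \<boxtimes> z) \<cdot> u"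
    "z \<in> center C (tgt C X) \<Longrightarrow> z \<boxtimes> \<^bold>1 S = u\<^sup>\<dagger> \<cdot> (z \<boxtimes> \<^bold>1 X) \<cdot> u"
proof -
  have [simp]: "u \<in> Arr2 C" "dom2 C u = S" "cod2 C u = X" using u by (auto simp: Hom_iff)
  have [simp]: "X \<in> Arr1 C" "S \<in> Arr1 C" "src C S = src C X" "tgt C S = tgt C X"
    using Hom_parallel[OF u(1)] by auto
  show "\<^bold>1 S \<boxtimes> z = u\<^sup>\<dagger> \<cdot> (\<^bold>1 X \<boxtimes> z) \<cdot> u" if "z \<in> center C (src C X)"
  proof -
    have [simp]: "z \<in> Arr2 C" "dom2 C z = \<^bold>I (src C X)" "cod2 C z = \<^bold>I (src C X)" using that by (auto simp: center_iff)
    have "(\<^bold>1 X \<boxtimes> z) \<cdot> u = u \<cdot> (\<^bold>1 S \<boxtimes> z)" using slide[of z u] by simp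
    then have "u\<^sup>\<dagger> \<cdot> (\<^bold>1 X \<boxtimes> z) \<cdot> u = (u\<^sup>\<dagger> \<cdot> u) \<cdot> (\<^bold>1 S \<boxtimes> z)" by simp
    then show ?thesis by (simp add: u(2))
  qed
  show "z \<boxtimes> \<^bold>1 S = u\<^sup>\<dagger> \<cdot> (z \<boxtimes> \<^bold>1 X) \<cdot> u" if "z \<in> center C (tgt C X)"
  proof -
    have [simp]: "z \<in> Arr2 C" "dom2 C z = \<^bold>I (tgt C X)" "cod2 C z = \<^bold>I (tgt C X)" using that by (auto simp: center_iff)
    have "(z \<boxtimes> \<^bold>1 X) \<cdot> u = u \<cdot> (z \<boxtimes> \<^bold>1 S)" using slide[of u z] by simp
    then have "u\<^sup>\<dagger> \<cdot> (z \<boxtimes> \<^bold>1 X) \<cdot> u = (u\<^sup>\<dagger> \<cdot> u) \<cdot> (z \<boxtimes> \<^bold>1 S)" by simp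
    then show ?thesis by (simp add: u(2))
  qed
qed

lemma sub_factorial:
  assumes "factorial_arr C X" and u: "u \<in> Hom C S X" "u\<^sup>\<dagger> \<cdot> u = \<^bold>1 S"
  shows "factorial_arr C S"
proof (rule factorialI)
  have [simp]: "u \<in> Arr2 C" "dom2 C u = S" "cod2 C u = X" using u by (auto simp: Hom_iff)
  have [simp]: "X \<in> Arr1 C" "S \<in> Arr1 C" "src C S = src C X" "tgt C S = tgt C X"
    using Hom_parallel[OF u(1)] by auto
  show "S \<in> Arr1 C" by simp
  have *: "u\<^sup>\<dagger> \<cdot> c \<^bold>* \<^bold>1 X \<cdot> u = c \<^bold>* \<^bold>1 S" for c
    by (simp add: vcomp_linear u(2))
  show "\<exists>c. \<^bold>1 S \<boxtimes> z = c \<^bold>* \<^bold>1 S" if "z \<in> center C (src C S)" for z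
    using center_sub(1)[OF u, of z] factorialD(1)[OF assms(1), of z] that * by auto
  show "\<exists>c. z \<boxtimes> \<^bold>1 S = c \<^bold>* \<^bold>1 S" if "z \<in> center C (tgt C S)" for z
    using center_sub(2)[OF u, of z] factorialD(2)[OF assms(1), of z] that * by auto
qed

text \<open>Conjugation by \<open>u\<close> turns a projection of \<open>S\<close> into one of
  \<open>X\<close> below \<open>p\<close>, so minimality of \<open>p\<close> among all endomorphisms
  rules out proper ones.\<close>

lemma minimal_sub_no_projections:
  assumes p: "p \<in> minimal_projections C X (Hom C X X)" and S: "sub_1_arrow C S u X p"
    and q: "q \<in> Hom C S S" "q \<cdot> q = q" "q\<^sup>\<dagger> = q"
  shows "q = zero2 C S S \<or> q = \<^bold>1 S"
proof -
  have u: "u \<in> Hom C S X" "u\<^sup>\<dagger> \<cdot> u = \<^bold>1 S" "u \<cdot> u\<^sup>\<dagger> = p" using S by (auto simp: sub_1_arrow_def)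
  have [simp]: "u \<in> Arr2 C" "dom2 C u = S" "cod2 C u = X" "q \<in> Arr2 C" "dom2 C q = S" "cod2 C q = S"
    using u q by (auto simp: Hom_iff)
  have [simp]: "X \<in> Arr1 C" "S \<in> Arr1 C" "src C S = src C X" "tgt C S = tgt C X"
    using Hom_parallel[OF u(1)] by auto
  have uu: "u\<^sup>\<dagger> \<cdot> u \<cdot> t = t" if "t \<in> Arr2 C" "cod2 C t = S" for t
    using vcomp_assoc'[of t u "u\<^sup>\<dagger>"] that u(2) by simp
  have qq: "q \<cdot> q \<cdot> t = q \<cdot> t" if "t \<in> Arr2 C" "cod2 C t = S" for t
    using vcomp_assoc'[of t q q] that q(2) by simp
  have "u \<cdot> q \<cdot> u\<^sup>\<dagger> = zero2 C X X \<or> u \<cdot> q \<cdot> u\<^sup>\<dagger> = p"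
    by (rule minimal_projectionD(5)[OF p])
      (simp_all add: Hom_iff uu qq q(2,3) flip: u(3))
  moreover have qe: "q = u\<^sup>\<dagger> \<cdot> (u \<cdot> q \<cdot> u\<^sup>\<dagger>) \<cdot> u" by (simp add: uu u(2))
  ultimately show ?thesis
  proof (elim disjE)
    assume z: "u \<cdot> q \<cdot> u\<^sup>\<dagger> = zero2 C X X"
    show ?thesis using qe unfolding z by simp
  next
    assume z: "u \<cdot> q \<cdot> u\<^sup>\<dagger> = p"
    show ?thesis using qe unfolding z by (simp add: uu u(2) flip: u(3))
  qed
qed

lemma sub_nonzero:
  assumes "sub_1_arrow C S u X p" "p \<noteq> zero2 C X X"
  shows "\<^bold>1 S \<noteq> zero2 C S S"
proof
  assume z: "\<^bold>1 S = zero2 C S S"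
  have u: "u \<in> Hom C S X" "u \<cdot> u\<^sup>\<dagger> = p" using assms(1) by (auto simp: sub_1_arrow_def)
  have [simp]: "u \<in> Arr2 C" "dom2 C u = S" "cod2 C u = X" using u by (auto simp: Hom_iff)
  have [simp]: "X \<in> Arr1 C" "S \<in> Arr1 C" "src C S = src C X" "tgt C S = tgt C X"
    using Hom_parallel[OF u(1)] by auto
  have "u = u \<cdot> \<^bold>1 S" by simp
  then have "u = zero2 C S X" unfolding z by simp
  then have "p = zero2 C S X \<cdot> u\<^sup>\<dagger>" using u(2) by simp
  then show False using assms(2) by simp
qed

lemma rigid_simple:
  assumes "rigid C" "S \<in> Arr1 C" "factorial_arr C S" "\<^bold>1 S \<noteq> zero2 C S S"
    "\<And>p. p \<in> Hom C S S \<Longrightarrow> p \<cdot> p = p \<Longrightarrow> p\<^sup>\<dagger> = p \<Longrightarrow> p = zero2 C S S \<or> p = \<^bold>1 S"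
  shows "simple_arr C S"
proof -
  obtain Sb r rb where sol: "conjugate_solution C S Sb r rb" using assms(1,2) unfolding rigid_def by blast
  obtain N M where "src C S = N" "tgt C S = M" by blast
  then interpret S: conj_pair C N M S Sb r rb by (intro conj_pairI[OF sol])
  show ?thesis by (rule S.simple_if_no_projections) (use assms in auto)
qed

text \<open>The ranges of a minimal resolution of the full endomorphism algebra are simple: they are
  again factorial and have no proper projections. Positivity of \<open>k\<close> is recorded for the
  later construction of direct sums, which starts from one summand.\<close>

lemma factorial_decomposition:
  assumes "rigid C" and X: "X \<in> Arr1 C" and fact: "factorial_arr C X" and nz: "\<^bold>1 X \<noteq> zero2 C X X"
  obtains k Yh u where "direct_sum_decomposition C X k Yh u" "\<And>h. h < k \<Longrightarrow> simple_arr C (Yh h)" "0 < k"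
proof -
  have par: "parallel X X" using X by (simp add: parallel_def)
  obtain Xb r rb where sol: "conjugate_solution C X Xb r rb" using assms by (auto simp: rigid_def)
  obtain N M where "src C X = N" "tgt C X = M" by blast
  then interpret X: conj_pair C N M X Xb r rb by (intro conj_pairI[OF sol])
  have "real (card F) \<le> (nrm rb * X.ltn (\<^bold>1 X))\<^sup>2" if "resolution X (Hom C X X) F" for F
    by (rule X.resolution_bound[OF fact nz that])
  then have "card F \<le> nat \<lfloor>(nrm rb * X.ltn (\<^bold>1 X))\<^sup>2\<rfloor>" if "resolution X (Hom C X X) F" for F
    using that by (simp add: le_nat_floor)
  then obtain F where F: "resolution X (Hom C X X) F" "F \<subseteq> minimal_projections C X (Hom C X X)"
    by (rule minimal_resolution[OF X, rotated 3]) (auto simp: Hom_iff X)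
  have fin: "finite F" using F by (simp add: resolution_def)
  have pH: "p \<in> Hom C X X" if "p \<in> F" for p using F that by (auto simp: resolution_def)
  have "\<exists>S u. sub_1_arrow C S u X p" if "p \<in> F" for p
    by (rule sub_1_arrows) (use F that in \<open>auto simp: resolution_def\<close>)
  then obtain S u where S: "\<And>p. p \<in> F \<Longrightarrow> sub_1_arrow C (S p) (u p) X p" by metis
  obtain h where h: "bij_betw h {0..<card F} F" using ex_bij_betw_nat_finite[OF fin] by blast
  have hF: "h i \<in> F" if "i < card F" for i using h that by (auto simp: bij_betw_def)
  have "direct_sum_decomposition C X (card F) (\<lambda>i. S (h i)) (\<lambda>i. u (h i))"
    unfolding direct_sum_decomposition_def
  proof (intro conjI allI impI)
    show "u (h i) \<in> Hom C (S (h i)) X" "(u (h i))\<^sup>\<dagger> \<cdot> u (h i) = \<^bold>1 (S (h i))" if "i < card F" for i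
      using S[OF hF[OF that]] by (auto simp: sub_1_arrow_def)
    have "hsum X X (\<lambda>i. u (h i) \<cdot> (u (h i))\<^sup>\<dagger>) {..<card F} = hsum X X (\<lambda>i. h i) {0..<card F}"
      by (rule hsum_cong) (use S hF pH par in \<open>auto simp: sub_1_arrow_def\<close>)
    also have "\<dots> = hsum X X (\<lambda>p. p) (h ` {0..<card F})"
      by (rule hsum_reindex[symmetric]) (use par h pH in \<open>auto simp: bij_betw_def\<close>)
    also have "\<dots> = \<^bold>1 X" using h F by (simp add: bij_betw_def resolution_def)
    finally show "hsum X X (\<lambda>i. u (h i) \<cdot> (u (h i))\<^sup>\<dagger>) {..<card F} = \<^bold>1 X" .
  qed
  moreover have "simple_arr C (S p)" if p: "p \<in> F" for p
  proof -
    have s: "u p \<in> Hom C (S p) X" "(u p)\<^sup>\<dagger> \<cdot> u p = \<^bold>1 (S p)"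
      using S[OF p] by (auto simp: sub_1_arrow_def)
    show ?thesis
    proof (rule rigid_simple)
      show "factorial_arr C (S p)" by (rule sub_factorial[OF fact s])
      show "\<^bold>1 (S p) \<noteq> zero2 C (S p) (S p)"
        by (rule sub_nonzero[OF S[OF p]]) (use F p in \<open>auto simp: resolution_def\<close>)
      show "q = zero2 C (S p) (S p) \<or> q = \<^bold>1 (S p)"
        if "q \<in> Hom C (S p) (S p)" "q \<cdot> q = q" "q\<^sup>\<dagger> = q" for q
        by (rule minimal_sub_no_projections[OF _ S[OF p] that]) (use F p in auto)
    qed (use assms(1) Hom_parallel(1)[OF s(1)] in auto)
  qed
  moreover have "0 < card F"
  proof (rule ccontr)
    assume "\<not> 0 < card F"
    then have "F = {}" using fin by simp
    then show False using F nz par by (simp add: resolution_def)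
  qed
  ultimately show ?thesis using that hF by blast
qed

end

section \<open>Traces of standard solutions\<close>

context conj_pair
begin

lemma frobenius_inverse:
  assumes "s \<in> Hom C (\<^bold>I N) (Xb \<boxdot> Z)" "Z \<in> arr1 C N M"
  shows "(\<^bold>1 Xb \<boxtimes> ((rb\<^sup>\<dagger> \<boxtimes> \<^bold>1 Z) \<cdot> (\<^bold>1 X \<boxtimes> s))) \<cdot> r = s"
proof -
  have [simp]: "s \<in> Arr2 C" "dom2 C s = \<^bold>I N" "cod2 C s = Xb \<boxdot> Z" "Z \<in> Arr1 C" "src C Z = N" "tgt C Z = M"
    using assms by (auto simp: Hom_iff arr1_iff)
  have 1: "(\<^bold>1 Xb \<boxtimes> \<^bold>1 X \<boxtimes> s) \<cdot> r = (r \<boxtimes> \<^bold>1 Xb \<boxtimes> \<^bold>1 Z) \<cdot> s"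
    using slide(1)[of s r] slide(2)[of s r] by (simp add: unit2_hcomp)
  have "(\<^bold>1 Xb \<boxtimes> ((rb\<^sup>\<dagger> \<boxtimes> \<^bold>1 Z) \<cdot> (\<^bold>1 X \<boxtimes> s))) \<cdot> r = (\<^bold>1 Xb \<boxtimes> rb\<^sup>\<dagger> \<boxtimes> \<^bold>1 Z) \<cdot> ((\<^bold>1 Xb \<boxtimes> \<^bold>1 X \<boxtimes> s) \<cdot> r)"
    by (simp add: whisker_left)
  also have "\<dots> = (((\<^bold>1 Xb \<boxtimes> rb\<^sup>\<dagger>) \<cdot> (r \<boxtimes> \<^bold>1 Xb)) \<boxtimes> \<^bold>1 Z) \<cdot> s"
    unfolding 1 by (simp add: whisker_right)
  finally show ?thesis by (simp add: zag_adj hcomp_unit2')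
qed

text \<open>Bending \<open>s\<close> around \<open>X\<close> produces an endomorphism
  \<open>t\<close> of the simple arrow with the same effect on \<open>r\<close>. It is scalar, and
  by injectivity of bending so is \<open>s\<close>.\<close>

lemma simple_conjugate:
  assumes "simple_arr C X" "s \<in> Hom C Xb Xb"
  shows "\<exists>c. s = c \<^bold>* \<^bold>1 Xb"
proof -
  have [simp]: "s \<in> Arr2 C" "dom2 C s = Xb" "cod2 C s = Xb" using assms by (auto simp: Hom_iff)
  define t where "t = (rb\<^sup>\<dagger> \<boxtimes> \<^bold>1 X) \<cdot> (\<^bold>1 X \<boxtimes> ((s \<boxtimes> \<^bold>1 X) \<cdot> r))"
  have "t \<in> Hom C X X" by (simp add: t_def Hom_iff)
  then obtain c where c: "t = c \<^bold>* \<^bold>1 X" using assms(1) by (auto simp: simple_arr_def scalars_def)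
  have "(s \<boxtimes> \<^bold>1 X) \<cdot> r = (\<^bold>1 Xb \<boxtimes> t) \<cdot> r"
    unfolding t_def by (rule frobenius_inverse[symmetric]) (auto simp: Hom_iff arr1_iff)
  also have "\<dots> = ((c \<^bold>* \<^bold>1 Xb) \<boxtimes> \<^bold>1 X) \<cdot> r" by (simp add: c hcomp_linear)
  finally have "s = c \<^bold>* \<^bold>1 Xb" by (rule frobenius_bar_eq[where Z = Xb, rotated 2]) (auto simp: Hom_iff)
  then show ?thesis by blast
qed

lemma center_transport_left:
  assumes "z \<in> center C N"
  shows "z \<boxtimes> \<^bold>1 Xb = (\<^bold>1 Xb \<boxtimes> rb\<^sup>\<dagger>) \<cdot> (\<^bold>1 Xb \<boxtimes> (\<^bold>1 X \<boxtimes> z) \<boxtimes> \<^bold>1 Xb) \<cdot> (r \<boxtimes> \<^bold>1 Xb)"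
proof -
  have [simp]: "z \<in> Arr2 C" "dom2 C z = \<^bold>I N" "cod2 C z = \<^bold>I N"
    using assms by (auto simp: center_iff)
  have 1: "(\<^bold>1 Xb \<boxtimes> \<^bold>1 X \<boxtimes> z) \<cdot> r = r \<cdot> z"
    using slide(1)[of z r] slide(2)[of z r] by (simp add: unit2_hcomp)
  have "(\<^bold>1 Xb \<boxtimes> (\<^bold>1 X \<boxtimes> z) \<boxtimes> \<^bold>1 Xb) \<cdot> (r \<boxtimes> \<^bold>1 Xb) = ((\<^bold>1 Xb \<boxtimes> \<^bold>1 X \<boxtimes> z) \<cdot> r) \<boxtimes> \<^bold>1 Xb"
    by (simp add: whisker_right)
  also have "\<dots> = (r \<boxtimes> \<^bold>1 Xb) \<cdot> (z \<boxtimes> \<^bold>1 Xb)" unfolding 1 by (simp add: whisker_right)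
  finally have "(\<^bold>1 Xb \<boxtimes> rb\<^sup>\<dagger>) \<cdot> (\<^bold>1 Xb \<boxtimes> (\<^bold>1 X \<boxtimes> z) \<boxtimes> \<^bold>1 Xb) \<cdot> (r \<boxtimes> \<^bold>1 Xb) =
      ((\<^bold>1 Xb \<boxtimes> rb\<^sup>\<dagger>) \<cdot> (r \<boxtimes> \<^bold>1 Xb)) \<cdot> (z \<boxtimes> \<^bold>1 Xb)" by simp
  then show ?thesis by (simp add: zag_adj)
qed

text \<open>Whiskering by \<open>X\<close> may kill nonzero 2-arrows in general. Here the square of
  the bent arrow is a central element, so its vanishing on \<open>X\<close> is transported to
  \<open>Xb\<close>, where bending back recovers \<open>x\<close>.\<close>

lemma left_null_imp_zero:
  assumes "x \<in> Hom C Xb Z" "\<^bold>1 X \<boxtimes> ((x \<boxtimes> \<^bold>1 X) \<cdot> r) = zero2 C X (X \<boxdot> Z \<boxdot> X)"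
  shows "x = zero2 C Xb Z"
proof -
  have [simp]: "x \<in> Arr2 C" "dom2 C x = Xb" "cod2 C x = Z" using assms by (auto simp: Hom_iff)
  have [simp]: "Z \<in> Arr1 C" "src C Z = M" "tgt C Z = N" using Hom_parallel[OF assms(1)] by auto
  define R where "R = (x \<boxtimes> \<^bold>1 X) \<cdot> r"
  have [simp]: "R \<in> Arr2 C" "dom2 C R = \<^bold>I N" "cod2 C R = Z \<boxdot> X" by (simp_all add: R_def)
  have z: "R\<^sup>\<dagger> \<cdot> R \<in> center C N" by (simp add: center_iff)
  have "\<^bold>1 X \<boxtimes> (R\<^sup>\<dagger> \<cdot> R) = (\<^bold>1 X \<boxtimes> R\<^sup>\<dagger>) \<cdot> (\<^bold>1 X \<boxtimes> R)" by (simp add: whisker_left)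
  also have "\<dots> = zero2 C X X" using assms(2) by (simp add: R_def[symmetric])
  finally have "(R\<^sup>\<dagger> \<cdot> R) \<boxtimes> \<^bold>1 Xb = zero2 C Xb Xb"
    by (subst center_transport_left[OF z]) simp
  then have "(R \<boxtimes> \<^bold>1 Xb)\<^sup>\<dagger> \<cdot> (R \<boxtimes> \<^bold>1 Xb) = zero2 C Xb Xb" by (simp add: whisker_right)
  then have "R \<boxtimes> \<^bold>1 Xb = zero2 C Xb (Z \<boxdot> X \<boxdot> Xb)" by (rule star_zero[where X = Xb, rotated]) (simp add: Hom_iff)
  then show ?thesis using frobenius_bar[OF assms(1)] by (simp add: R_def[symmetric])
qed

end

section \<open>Solutions assembled from simple summands and their traces\<close>

context two_cstar_category
begin

lemma zero_unit_comp:
  assumes "\<^bold>1 S = zero2 C S S" "S \<in> Arr1 C" "t \<in> Arr2 C"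
  shows "Sb \<in> Arr1 C \<Longrightarrow> src C Sb = tgt C S \<Longrightarrow> cod2 C t = Sb \<boxdot> S \<Longrightarrow> t = zero2 C (dom2 C t) (Sb \<boxdot> S)"
    "Sb \<in> Arr1 C \<Longrightarrow> src C S = tgt C Sb \<Longrightarrow> cod2 C t = S \<boxdot> Sb \<Longrightarrow> t = zero2 C (dom2 C t) (S \<boxdot> Sb)"
proof -
  assume b: "Sb \<in> Arr1 C" "src C Sb = tgt C S" "cod2 C t = Sb \<boxdot> S"
  have "\<^bold>1 (Sb \<boxdot> S) = \<^bold>1 Sb \<boxtimes> \<^bold>1 S" by (rule hcomp_unit2'[symmetric]) (use assms b in simp_all)
  also have "\<dots> = zero2 C (Sb \<boxdot> S) (Sb \<boxdot> S)" using assms b by simp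
  finally have z: "\<^bold>1 (Sb \<boxdot> S) = zero2 C (Sb \<boxdot> S) (Sb \<boxdot> S)" .
  have "t = \<^bold>1 (Sb \<boxdot> S) \<cdot> t" using assms b by simp
  then show "t = zero2 C (dom2 C t) (Sb \<boxdot> S)"
    unfolding z using assms b Arr2_simps[of t] by simp
next
  assume b: "Sb \<in> Arr1 C" "src C S = tgt C Sb" "cod2 C t = S \<boxdot> Sb"
  have "\<^bold>1 (S \<boxdot> Sb) = \<^bold>1 S \<boxtimes> \<^bold>1 Sb" by (rule hcomp_unit2'[symmetric]) (use assms b in simp_all)
  also have "\<dots> = zero2 C (S \<boxdot> Sb) (S \<boxdot> Sb)" using assms b by simp
  finally have z: "\<^bold>1 (S \<boxdot> Sb) = zero2 C (S \<boxdot> Sb) (S \<boxdot> Sb)" .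
  have "t = \<^bold>1 (S \<boxdot> Sb) \<cdot> t" using assms b by simp
  then show "t = zero2 C (dom2 C t) (S \<boxdot> Sb)"
    unfolding z using assms b Arr2_simps[of t] by simp
qed

text \<open>A central element acts on the factorial arrow \<open>Y\<close> by the same scalar as on
  its subarrow \<open>S\<close>, where the scalar is a squared norm. If \<open>S\<close> is zero,
  then so are both arrows of the solution and both norms.\<close>

lemma solution_scalars:
  assumes fact: "factorial_arr C Y" and u: "u \<in> Hom C S Y" "u\<^sup>\<dagger> \<cdot> u = \<^bold>1 S"
    and sol: "conjugate_solution C S Sb r rb"
  shows "\<^bold>1 Y \<boxtimes> (r\<^sup>\<dagger> \<cdot> r) = complex_of_real ((nrm (\<^bold>1 S \<boxtimes> r))\<^sup>2) \<^bold>* \<^bold>1 Y"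
    "(rb\<^sup>\<dagger> \<cdot> rb) \<boxtimes> \<^bold>1 Y = complex_of_real ((nrm (rb \<boxtimes> \<^bold>1 S))\<^sup>2) \<^bold>* \<^bold>1 Y"
proof -
  have [simp]: "u \<in> Arr2 C" "dom2 C u = S" "cod2 C u = Y" using u by (auto simp: Hom_iff)
  obtain N M where NM: "src C S = N" "tgt C S = M" by blast
  interpret S: conj_pair C N M S Sb r rb by (rule conj_pairI[OF sol NM])
  have [simp]: "Y \<in> Arr1 C" "src C Y = N" "tgt C Y = M"
    using Hom_parallel[OF u(1)] by auto
  have z: "r\<^sup>\<dagger> \<cdot> r \<in> center C N" "rb\<^sup>\<dagger> \<cdot> rb \<in> center C M" by (simp_all add: center_iff)
  obtain c where c: "\<^bold>1 Y \<boxtimes> (r\<^sup>\<dagger> \<cdot> r) = c \<^bold>* \<^bold>1 Y" using factorialD(1)[OF fact] z by auto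
  obtain d where d: "(rb\<^sup>\<dagger> \<cdot> rb) \<boxtimes> \<^bold>1 Y = d \<^bold>* \<^bold>1 Y" using factorialD(2)[OF fact] z by auto
  have cd: "\<^bold>1 Y \<boxtimes> (r\<^sup>\<dagger> \<cdot> r) = complex_of_real ((nrm (\<^bold>1 S \<boxtimes> r))\<^sup>2) \<^bold>* \<^bold>1 Y \<and>
    (rb\<^sup>\<dagger> \<cdot> rb) \<boxtimes> \<^bold>1 Y = complex_of_real ((nrm (rb \<boxtimes> \<^bold>1 S))\<^sup>2) \<^bold>* \<^bold>1 Y"
  proof (cases "\<^bold>1 S = zero2 C S S")
    case True
    have "r = zero2 C (\<^bold>I N) (Sb \<boxdot> S)" "rb = zero2 C (\<^bold>I M) (S \<boxdot> Sb)"
      using zero_unit_comp(1)[OF True _ S.typing(9), of Sb] zero_unit_comp(2)[OF True _ S.typing(12), of Sb] by auto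
    then show ?thesis by (simp add: scale2_zero parallel_def)
  next
    case False
    have "(\<^bold>1 S \<boxtimes> r)\<^sup>\<dagger> \<cdot> (\<^bold>1 S \<boxtimes> r) = \<^bold>1 S \<boxtimes> (r\<^sup>\<dagger> \<cdot> r)" by (simp add: whisker_left)
    also have "\<dots> = u\<^sup>\<dagger> \<cdot> (\<^bold>1 Y \<boxtimes> (r\<^sup>\<dagger> \<cdot> r)) \<cdot> u" using center_sub(1)[OF u] z by simp
    also have "\<dots> = c \<^bold>* \<^bold>1 S" unfolding c by (simp add: vcomp_linear u(2))
    finally have 1: "c = complex_of_real ((nrm (\<^bold>1 S \<boxtimes> r))\<^sup>2)"
      by (intro positive_scalar[of _ S "S \<boxdot> Sb \<boxdot> S"]) (use False in \<open>auto simp: Hom_iff\<close>)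
    have "(rb \<boxtimes> \<^bold>1 S)\<^sup>\<dagger> \<cdot> (rb \<boxtimes> \<^bold>1 S) = (rb\<^sup>\<dagger> \<cdot> rb) \<boxtimes> \<^bold>1 S" by (simp add: whisker_right)
    also have "\<dots> = u\<^sup>\<dagger> \<cdot> ((rb\<^sup>\<dagger> \<cdot> rb) \<boxtimes> \<^bold>1 Y) \<cdot> u" using center_sub(2)[OF u] z by simp
    also have "\<dots> = d \<^bold>* \<^bold>1 S" unfolding d by (simp add: vcomp_linear u(2))
    finally have 2: "d = complex_of_real ((nrm (rb \<boxtimes> \<^bold>1 S))\<^sup>2)"
      by (intro positive_scalar[of _ S "S \<boxdot> Sb \<boxdot> S"]) (use False in \<open>auto simp: Hom_iff\<close>)
    show ?thesis using c d 1 2 by simp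
  qed
  then show "\<^bold>1 Y \<boxtimes> (r\<^sup>\<dagger> \<cdot> r) = complex_of_real ((nrm (\<^bold>1 S \<boxtimes> r))\<^sup>2) \<^bold>* \<^bold>1 Y"
    "(rb\<^sup>\<dagger> \<cdot> rb) \<boxtimes> \<^bold>1 Y = complex_of_real ((nrm (rb \<boxtimes> \<^bold>1 S))\<^sup>2) \<^bold>* \<^bold>1 Y" by auto
qed

text \<open>Covers both traces at once: the arrows \<open>w h\<close> stand for
  \<open>ub h \<boxtimes> u h\<close> in the left trace and for \<open>u h \<boxtimes> ub h\<close>
  in the right one.\<close>

lemma diagonal_form:
  fixes k :: nat
  assumes par: "parallel I B" and x: "\<And>h. h < k \<Longrightarrow> x h \<in> Hom C I (Bh h)" and w: "\<And>h. h < k \<Longrightarrow> w h \<in> Hom C (Bh h) B"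
    and t: "t \<in> Hom C B B"
    and orth: "\<And>h j. h < k \<Longrightarrow> j < k \<Longrightarrow> h \<noteq> j \<Longrightarrow> (w h)\<^sup>\<dagger> \<cdot> t \<cdot> w j = zero2 C (Bh j) (Bh h)"
  shows "(hsum I B (\<lambda>h. w h \<cdot> x h) {..<k})\<^sup>\<dagger> \<cdot> t \<cdot> hsum I B (\<lambda>h. w h \<cdot> x h) {..<k} =
    hsum I I (\<lambda>h. (x h)\<^sup>\<dagger> \<cdot> ((w h)\<^sup>\<dagger> \<cdot> t \<cdot> w h) \<cdot> x h) {..<k}"
proof -
  have [simp]: "x h \<in> Arr2 C" "dom2 C (x h) = I" "cod2 C (x h) = Bh h"
    "w h \<in> Arr2 C" "dom2 C (w h) = Bh h" "cod2 C (w h) = B" if "h < k" for h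
    using x[OF that] w[OF that] by (auto simp: Hom_iff)
  have [simp]: "t \<in> Arr2 C" "dom2 C t = B" "cod2 C t = B" using t by (auto simp: Hom_iff)
  have [simp]: "I \<in> Arr1 C" "B \<in> Arr1 C" "src C B = src C I" "tgt C B = tgt C I" using par by (auto simp: parallel_def)
  have BhI: "Bh h \<in> Arr1 C" "src C (Bh h) = src C I" "tgt C (Bh h) = tgt C I" if "h < k" for h
    using Hom_parallel[OF x[OF that]] by auto
  let ?a = "hsum I B (\<lambda>h. w h \<cdot> x h) {..<k}"
  have a: "?a \<in> Hom C I B" by (rule hsum_Hom) (use par in \<open>auto simp: Hom_iff\<close>)
  have [simp]: "?a \<in> Arr2 C" "dom2 C ?a = I" "cod2 C ?a = B" using a by (auto simp: Hom_iff)
  have row: "(w h \<cdot> x h)\<^sup>\<dagger> \<cdot> t \<cdot> ?a = (x h)\<^sup>\<dagger> \<cdot> ((w h)\<^sup>\<dagger> \<cdot> t \<cdot> w h) \<cdot> x h" if h: "h < k" for h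
  proof -
    have "((w h \<cdot> x h)\<^sup>\<dagger> \<cdot> t) \<cdot> ?a = hsum I I (\<lambda>j. ((w h \<cdot> x h)\<^sup>\<dagger> \<cdot> t) \<cdot> w j \<cdot> x j) {..<k}"
      by (rule vcomp_hsum) (use h par in \<open>auto simp: Hom_iff\<close>)
    also have "\<dots> = ((w h \<cdot> x h)\<^sup>\<dagger> \<cdot> t) \<cdot> w h \<cdot> x h"
    proof (rule hsum_delta)
      show "((w h \<cdot> x h)\<^sup>\<dagger> \<cdot> t) \<cdot> w j \<cdot> x j = zero2 C I I" if "j \<in> {..<k}" "j \<noteq> h" for j
      proof -
        have "((w h \<cdot> x h)\<^sup>\<dagger> \<cdot> t) \<cdot> w j \<cdot> x j = (x h)\<^sup>\<dagger> \<cdot> ((w h)\<^sup>\<dagger> \<cdot> t \<cdot> w j) \<cdot> x j" using that h by simp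
        also have "\<dots> = zero2 C I I" using orth[of h j] that h BhI by simp
        finally show ?thesis .
      qed
    qed (use h in \<open>auto simp: Hom_iff parallel_def\<close>)
    finally show ?thesis using h by simp
  qed
  have "?a\<^sup>\<dagger> \<cdot> t \<cdot> ?a = hsum B I (\<lambda>h. (w h \<cdot> x h)\<^sup>\<dagger>) {..<k} \<cdot> (t \<cdot> ?a)"
    by (subst adj_hsum) (use par in \<open>auto simp: Hom_iff\<close>)
  also have "\<dots> = hsum I I (\<lambda>h. (w h \<cdot> x h)\<^sup>\<dagger> \<cdot> (t \<cdot> ?a)) {..<k}"
    by (rule hsum_vcomp) (auto simp: Hom_iff parallel_def)
  also have "\<dots> = hsum I I (\<lambda>h. (x h)\<^sup>\<dagger> \<cdot> ((w h)\<^sup>\<dagger> \<cdot> t \<cdot> w h) \<cdot> x h) {..<k}"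
    by (rule hsum_cong) (use row in \<open>auto simp: Hom_iff parallel_def\<close>)
  finally show ?thesis .
qed

text \<open>Sphericality of a solution. It is stated on endomorphisms of \<open>Yb\<close>, because
  the comparison with another conjugate of the same \<open>Y\<close> yields positive elements
  there.\<close>

definition tracial where
  "tracial Y Yb r rb \<longleftrightarrow> (\<forall>s\<in>Hom C Yb Yb. \<exists>c. \<^bold>1 Y \<boxtimes> (r\<^sup>\<dagger> \<cdot> (s \<boxtimes> \<^bold>1 Y) \<cdot> r) = c \<^bold>* \<^bold>1 Y \<and>
    (rb\<^sup>\<dagger> \<cdot> (\<^bold>1 Y \<boxtimes> s) \<cdot> rb) \<boxtimes> \<^bold>1 Y = c \<^bold>* \<^bold>1 Y)"

text \<open>Orthogonality removes the cross terms, and each compression of \<open>s\<close> to a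
  simple \<open>Ybh h\<close> is a scalar \<open>c h\<close>. Both traces are then the sum of the
  products of \<open>c h\<close> with the dimensions of the summands.\<close>

lemma standard_tracial:
  assumes std: "factorial_standard_solution C Y Yb r rb"
  shows "tracial Y Yb r rb"
  unfolding tracial_def
proof
  fix s assume s: "s \<in> Hom C Yb Yb"
  from std obtain k Yh Ybh u ub rh rbh where fact: "factorial_arr C Y" and sol: "conjugate_solution C Y Yb r rb"
    and D: "direct_sum_decomposition C Y k Yh u" and Db: "direct_sum_decomposition C Yb k Ybh ub"
    and simple: "\<And>h. h < k \<Longrightarrow> simple_arr C (Yh h)"
    and norm: "\<And>h. h < k \<Longrightarrow> normalized_solution C (Yh h) (Ybh h) (rh h) (rbh h)"
    and r: "r = hsum (\<^bold>I (src C Y)) (Yb \<boxdot> Y) (\<lambda>h. (ub h \<boxtimes> u h) \<cdot> rh h) {..<k}"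
    and rb: "rb = hsum (\<^bold>I (tgt C Y)) (Y \<boxdot> Yb) (\<lambda>h. (u h \<boxtimes> ub h) \<cdot> rbh h) {..<k}"
    unfolding factorial_standard_solution_def by blast
  obtain N M where NM: "src C Y = N" "tgt C Y = M" by blast
  interpret Y: conj_pair C N M Y Yb r rb by (rule conj_pairI[OF sol NM])
  have [simp]: "s \<in> Arr2 C" "dom2 C s = Yb" "cod2 C s = Yb" using s by (auto simp: Hom_iff)
  note dt [simp] = decomposition_typing(2-)[OF D] decomposition_typing(2-)[OF Db]
  have hs: "conjugate_solution C (Yh h) (Ybh h) (rh h) (rbh h)" if "h < k" for h
    using norm[OF that] by (auto simp: normalized_solution_def)
  have [simp]: "rh h \<in> Arr2 C" "dom2 C (rh h) = \<^bold>I N" "cod2 C (rh h) = Ybh h \<boxdot> Yh h"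
    "rbh h \<in> Arr2 C" "dom2 C (rbh h) = \<^bold>I M" "cod2 C (rbh h) = Yh h \<boxdot> Ybh h" if "h < k" for h
    using hs[OF that] that by (auto simp: conjugate_solution_def Hom_iff)
  have "\<exists>c. (ub h)\<^sup>\<dagger> \<cdot> s \<cdot> ub h = c \<^bold>* \<^bold>1 (Ybh h)" if h: "h < k" for h
  proof -
    interpret H: conj_pair C N M "Yh h" "Ybh h" "rh h" "rbh h" by (rule conj_pairI[OF hs[OF h]]) (use h in auto)
    show ?thesis by (rule H.simple_conjugate[OF simple[OF h]]) (use h in \<open>auto simp: Hom_iff\<close>)
  qed
  then obtain c where c: "\<And>h. h < k \<Longrightarrow> (ub h)\<^sup>\<dagger> \<cdot> s \<cdot> ub h = c h \<^bold>* \<^bold>1 (Ybh h)" by metis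
  have orth: "(u h)\<^sup>\<dagger> \<cdot> u j = zero2 C (Yh j) (Yh h)" if "h < k" "j < k" "h \<noteq> j" for h j
    by (rule decomposition_orthogonal[OF D]) (use that in auto)
  \<comment> \<open>Normalization is what gives the left and the right square of each summand the
    same scalar \<open>d h\<close>.\<close>
  define d where "d h = complex_of_real ((nrm (\<^bold>1 (Yh h) \<boxtimes> rh h))\<^sup>2)" for h
  have d: "\<^bold>1 Y \<boxtimes> ((rh h)\<^sup>\<dagger> \<cdot> rh h) = d h \<^bold>* \<^bold>1 Y" "((rbh h)\<^sup>\<dagger> \<cdot> rbh h) \<boxtimes> \<^bold>1 Y = d h \<^bold>* \<^bold>1 Y" if h: "h < k" for h
    using solution_scalars[OF fact decomposition_typing(1,2)[OF D h] hs[OF h]] norm[OF h]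
    by (auto simp: d_def normalized_solution_def)
  have "r\<^sup>\<dagger> \<cdot> (s \<boxtimes> \<^bold>1 Y) \<cdot> r = hsum (\<^bold>I N) (\<^bold>I N) (\<lambda>h. (rh h)\<^sup>\<dagger> \<cdot> ((ub h \<boxtimes> u h)\<^sup>\<dagger> \<cdot> (s \<boxtimes> \<^bold>1 Y) \<cdot> (ub h \<boxtimes> u h)) \<cdot> rh h) {..<k}"
    unfolding r NM by (rule diagonal_form[where Bh = "\<lambda>h. Ybh h \<boxdot> Yh h"]) (auto simp: Hom_iff parallel_def merge orth)
  also have "\<dots> = hsum (\<^bold>I N) (\<^bold>I N) (\<lambda>h. c h \<^bold>* ((rh h)\<^sup>\<dagger> \<cdot> rh h)) {..<k}"
    by (rule hsum_cong) (auto simp: Hom_iff parallel_def merge c hcomp_linear vcomp_linear hcomp_unit2')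
  finally have "\<^bold>1 Y \<boxtimes> (r\<^sup>\<dagger> \<cdot> (s \<boxtimes> \<^bold>1 Y) \<cdot> r) = hsum (Y \<boxdot> \<^bold>I N) (Y \<boxdot> \<^bold>I N) (\<lambda>h. \<^bold>1 Y \<boxtimes> (c h \<^bold>* ((rh h)\<^sup>\<dagger> \<cdot> rh h))) {..<k}"
    by (simp only:) (rule hcomp_hsum, auto simp: Hom_iff parallel_def)
  also have "\<dots> = hsum Y Y (\<lambda>h. (c h * d h) \<^bold>* \<^bold>1 Y) {..<k}"
    by simp (rule hsum_cong, auto simp: Hom_iff parallel_def hcomp_linear d)
  also have "\<dots> = (\<Sum>h<k. c h * d h) \<^bold>* \<^bold>1 Y" by (rule hsum_scale_const) (auto simp: parallel_def Hom_iff)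
  finally have 1: "\<^bold>1 Y \<boxtimes> (r\<^sup>\<dagger> \<cdot> (s \<boxtimes> \<^bold>1 Y) \<cdot> r) = (\<Sum>h<k. c h * d h) \<^bold>* \<^bold>1 Y" .
  have "rb\<^sup>\<dagger> \<cdot> (\<^bold>1 Y \<boxtimes> s) \<cdot> rb = hsum (\<^bold>I M) (\<^bold>I M) (\<lambda>h. (rbh h)\<^sup>\<dagger> \<cdot> ((u h \<boxtimes> ub h)\<^sup>\<dagger> \<cdot> (\<^bold>1 Y \<boxtimes> s) \<cdot> (u h \<boxtimes> ub h)) \<cdot> rbh h) {..<k}"
    unfolding rb NM by (rule diagonal_form[where Bh = "\<lambda>h. Yh h \<boxdot> Ybh h"]) (auto simp: Hom_iff parallel_def merge orth)
  also have "\<dots> = hsum (\<^bold>I M) (\<^bold>I M) (\<lambda>h. c h \<^bold>* ((rbh h)\<^sup>\<dagger> \<cdot> rbh h)) {..<k}"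
    by (rule hsum_cong) (auto simp: Hom_iff parallel_def merge c hcomp_linear vcomp_linear hcomp_unit2')
  finally have "(rb\<^sup>\<dagger> \<cdot> (\<^bold>1 Y \<boxtimes> s) \<cdot> rb) \<boxtimes> \<^bold>1 Y = hsum (\<^bold>I M \<boxdot> Y) (\<^bold>I M \<boxdot> Y) (\<lambda>h. (c h \<^bold>* ((rbh h)\<^sup>\<dagger> \<cdot> rbh h)) \<boxtimes> \<^bold>1 Y) {..<k}"
    by (simp only:) (rule hsum_hcomp, auto simp: Hom_iff parallel_def)
  also have "\<dots> = hsum Y Y (\<lambda>h. (c h * d h) \<^bold>* \<^bold>1 Y) {..<k}"
    by simp (rule hsum_cong, auto simp: Hom_iff parallel_def hcomp_linear d)
  also have "\<dots> = (\<Sum>h<k. c h * d h) \<^bold>* \<^bold>1 Y" by (rule hsum_scale_const) (auto simp: parallel_def Hom_iff)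
  finally show "\<exists>c. \<^bold>1 Y \<boxtimes> (r\<^sup>\<dagger> \<cdot> (s \<boxtimes> \<^bold>1 Y) \<cdot> r) = c \<^bold>* \<^bold>1 Y \<and> (rb\<^sup>\<dagger> \<cdot> (\<^bold>1 Y \<boxtimes> s) \<cdot> rb) \<boxtimes> \<^bold>1 Y = c \<^bold>* \<^bold>1 Y"
    using 1 by blast
qed

end

section \<open>Existence and minimality of standard solutions\<close>

context two_cstar_category
begin

text \<open>Indexed by \<open>Suc k\<close>, so that the induction starts from a single
  summand.\<close>

lemma direct_sum_exists:
  assumes "\<And>h. h < Suc k \<Longrightarrow> Yh h \<in> arr1 C N M"
  shows "\<exists>Z v. Z \<in> arr1 C N M \<and> direct_sum_decomposition C Z (Suc k) Yh v"
  using assms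
proof (induction k)
  case 0
  then have Y: "Yh 0 \<in> Arr1 C" by (simp add: arr1_iff)
  have "hsum (Yh 0) (Yh 0) (\<lambda>h. \<^bold>1 (Yh 0) \<cdot> (\<^bold>1 (Yh 0))\<^sup>\<dagger>) {..<Suc 0} = \<^bold>1 (Yh 0)"
    using Y by (subst hsum_delta[where i = 0]) (auto simp: parallel_def Hom_iff)
  then have "direct_sum_decomposition C (Yh 0) (Suc 0) Yh (\<lambda>_. \<^bold>1 (Yh 0))"
    using Y by (simp add: direct_sum_decomposition_def Hom_iff)
  then show ?case using 0 by blast
next
  case (Suc k)
  obtain Z v where Z: "Z \<in> arr1 C N M" and D: "direct_sum_decomposition C Z (Suc k) Yh v"
    using Suc by (metis less_SucI)
  obtain W a b where W: "a \<in> Hom C Z W" "b \<in> Hom C (Yh (Suc k)) W" "a\<^sup>\<dagger> \<cdot> a = \<^bold>1 Z" "b\<^sup>\<dagger> \<cdot> b = \<^bold>1 (Yh (Suc k))"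
    "a \<cdot> a\<^sup>\<dagger> \<^bold>+ b \<cdot> b\<^sup>\<dagger> = \<^bold>1 W"
    using direct_sums[OF Z Suc(2)[of "Suc k"]] by auto
  have [simp]: "a \<in> Arr2 C" "dom2 C a = Z" "cod2 C a = W" "b \<in> Arr2 C" "dom2 C b = Yh (Suc k)" "cod2 C b = W"
    using W by (auto simp: Hom_iff)
  have [simp]: "Z \<in> Arr1 C" "src C Z = N" "tgt C Z = M" using Z by (auto simp: arr1_iff)
  have [simp]: "W \<in> Arr1 C" "src C W = N" "tgt C W = M" using Hom_parallel[OF W(1)] by auto
  note dt [simp] = decomposition_typing(2-)[OF D]
  define v' where "v' h = (if h < Suc k then a \<cdot> v h else b)" for h
  have aa: "a\<^sup>\<dagger> \<cdot> a \<cdot> t = t" if "t \<in> Arr2 C" "cod2 C t = Z" for t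
    using vcomp_assoc'[of t a "a\<^sup>\<dagger>"] that W(3) by simp
  have iso: "v' h \<in> Hom C (Yh h) W" "(v' h)\<^sup>\<dagger> \<cdot> v' h = \<^bold>1 (Yh h)" if "h < Suc (Suc k)" for h
    using that W(4) by (auto simp: v'_def Hom_iff aa less_Suc_eq)
  have "hsum W W (\<lambda>h. v' h \<cdot> (v' h)\<^sup>\<dagger>) {..<Suc (Suc k)} = hsum W W (\<lambda>h. v' h \<cdot> (v' h)\<^sup>\<dagger>) (insert (Suc k) {..<Suc k})"
    by (simp add: lessThan_Suc)
  also have "\<dots> = v' (Suc k) \<cdot> (v' (Suc k))\<^sup>\<dagger> \<^bold>+ hsum W W (\<lambda>h. v' h \<cdot> (v' h)\<^sup>\<dagger>) {..<Suc k}"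
    by (rule hsum_insert) (auto simp: parallel_def Hom_iff v'_def)
  also have "hsum W W (\<lambda>h. v' h \<cdot> (v' h)\<^sup>\<dagger>) {..<Suc k} = hsum W W (\<lambda>h. a \<cdot> (v h \<cdot> (v h)\<^sup>\<dagger>) \<cdot> a\<^sup>\<dagger>) {..<Suc k}"
    by (rule hsum_cong) (auto simp: parallel_def Hom_iff v'_def)
  also have "\<dots> = a \<cdot> hsum W Z (\<lambda>h. (v h \<cdot> (v h)\<^sup>\<dagger>) \<cdot> a\<^sup>\<dagger>) {..<Suc k}"
    by (rule vcomp_hsum[symmetric]) (auto simp: parallel_def Hom_iff)
  also have "hsum W Z (\<lambda>h. (v h \<cdot> (v h)\<^sup>\<dagger>) \<cdot> a\<^sup>\<dagger>) {..<Suc k} = hsum Z Z (\<lambda>h. v h \<cdot> (v h)\<^sup>\<dagger>) {..<Suc k} \<cdot> a\<^sup>\<dagger>"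
    by (rule hsum_vcomp[symmetric]) (auto simp: parallel_def Hom_iff)
  also have "hsum Z Z (\<lambda>h. v h \<cdot> (v h)\<^sup>\<dagger>) {..<Suc k} = \<^bold>1 Z"
    using D by (simp add: direct_sum_decomposition_def)
  also have "v' (Suc k) \<cdot> (v' (Suc k))\<^sup>\<dagger> \<^bold>+ a \<cdot> \<^bold>1 Z \<cdot> a\<^sup>\<dagger> = \<^bold>1 W"
    using W(5) by (simp add: v'_def add2_commute)
  finally have "direct_sum_decomposition C W (Suc (Suc k)) Yh v'"
    using iso by (simp add: direct_sum_decomposition_def)
  then show ?case by (auto simp: arr1_iff intro!: exI[of _ W] exI[of _ v'])
qed

lemma direct_sum_component:
  assumes Y: "Y \<in> arr1 C N M" "Yb \<in> arr1 C M N"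
    and D: "direct_sum_decomposition C Y k Yh u" and Db: "direct_sum_decomposition C Yb k Ybh ub"
    and rh: "\<And>h. h < k \<Longrightarrow> rh h \<in> Hom C (\<^bold>I N) (Ybh h \<boxdot> Yh h)"
    and r: "r = hsum (\<^bold>I N) (Yb \<boxdot> Y) (\<lambda>h. (ub h \<boxtimes> u h) \<cdot> rh h) {..<k}" and j: "j < k"
  shows "((ub j)\<^sup>\<dagger> \<boxtimes> \<^bold>1 Y) \<cdot> r = (\<^bold>1 (Ybh j) \<boxtimes> u j) \<cdot> rh j"
proof -
  have [simp]: "Y \<in> Arr1 C" "src C Y = N" "tgt C Y = M" "Yb \<in> Arr1 C" "src C Yb = M" "tgt C Yb = N"
    using Y by (auto simp: arr1_iff)
  have [simp]: "N \<in> Obj C" using src_tgt[of Y] by auto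
  note dt [simp] = decomposition_typing(2-)[OF D] decomposition_typing(2-)[OF Db]
  have [simp]: "rh h \<in> Arr2 C" "dom2 C (rh h) = \<^bold>I N" "cod2 C (rh h) = Ybh h \<boxdot> Yh h" if "h < k" for h
    using rh[OF that] by (auto simp: Hom_iff)
  have orth: "(ub h)\<^sup>\<dagger> \<cdot> ub j = zero2 C (Ybh j) (Ybh h)" if "h < k" "j < k" "h \<noteq> j" for h j
    by (rule decomposition_orthogonal[OF Db]) (use that in auto)
  have "((ub j)\<^sup>\<dagger> \<boxtimes> \<^bold>1 Y) \<cdot> r = hsum (\<^bold>I N) (Ybh j \<boxdot> Y) (\<lambda>h. ((ub j)\<^sup>\<dagger> \<boxtimes> \<^bold>1 Y) \<cdot> (ub h \<boxtimes> u h) \<cdot> rh h) {..<k}"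
    unfolding r by (rule vcomp_hsum) (use j in \<open>auto simp: parallel_def Hom_iff\<close>)
  also have "\<dots> = ((ub j)\<^sup>\<dagger> \<boxtimes> \<^bold>1 Y) \<cdot> (ub j \<boxtimes> u j) \<cdot> rh j"
    by (rule hsum_delta) (use j in \<open>auto simp: parallel_def Hom_iff merge orth\<close>)
  also have "\<dots> = (\<^bold>1 (Ybh j) \<boxtimes> u j) \<cdot> rh j" using j by (simp add: merge)
  finally show ?thesis .
qed

text \<open>The zigzag \<open>?T\<close> is tested on each isometry \<open>u j\<close>. There only
  the component \<open>j\<close> of the solution survives, and its own zigzag returns
  \<open>u j\<close>; summation over \<open>j\<close> identifies \<open>?T\<close> with the
  unit.\<close>

lemma direct_sum_zig:
  assumes Y: "Y \<in> arr1 C N M" "Yb \<in> arr1 C M N"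
    and D: "direct_sum_decomposition C Y k Yh u" and Db: "direct_sum_decomposition C Yb k Ybh ub"
    and sol: "\<And>h. h < k \<Longrightarrow> conjugate_solution C (Yh h) (Ybh h) (rh h) (rbh h)"
    and r: "r = hsum (\<^bold>I N) (Yb \<boxdot> Y) (\<lambda>h. (ub h \<boxtimes> u h) \<cdot> rh h) {..<k}"
    and rb: "rb = hsum (\<^bold>I M) (Y \<boxdot> Yb) (\<lambda>h. (u h \<boxtimes> ub h) \<cdot> rbh h) {..<k}"
  shows "(rb\<^sup>\<dagger> \<boxtimes> \<^bold>1 Y) \<cdot> (\<^bold>1 Y \<boxtimes> r) = \<^bold>1 Y"
proof -
  have [simp]: "Y \<in> Arr1 C" "src C Y = N" "tgt C Y = M" "Yb \<in> Arr1 C" "src C Yb = M" "tgt C Yb = N"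
    using Y by (auto simp: arr1_iff)
  have [simp]: "N \<in> Obj C" "M \<in> Obj C" using src_tgt[of Y] by auto
  note dt [simp] = decomposition_typing(2-)[OF D] decomposition_typing(2-)[OF Db]
  have rht: "rh h \<in> Hom C (\<^bold>I N) (Ybh h \<boxdot> Yh h)" "rbh h \<in> Hom C (\<^bold>I M) (Yh h \<boxdot> Ybh h)" if "h < k" for h
    using sol[OF that] that by (auto simp: conjugate_solution_def)
  then have [simp]: "rh h \<in> Arr2 C" "dom2 C (rh h) = \<^bold>I N" "cod2 C (rh h) = Ybh h \<boxdot> Yh h"
    "rbh h \<in> Arr2 C" "dom2 C (rbh h) = \<^bold>I M" "cod2 C (rbh h) = Yh h \<boxdot> Ybh h" if "h < k" for h
    using that by (auto simp: Hom_iff)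
  have "r \<in> Hom C (\<^bold>I N) (Yb \<boxdot> Y)" "rb \<in> Hom C (\<^bold>I M) (Y \<boxdot> Yb)"
    unfolding r rb by (rule hsum_Hom; auto simp: parallel_def Hom_iff)+
  then have [simp]: "r \<in> Arr2 C" "dom2 C r = \<^bold>I N" "cod2 C r = Yb \<boxdot> Y" "rb \<in> Arr2 C" "dom2 C rb = \<^bold>I M" "cod2 C rb = Y \<boxdot> Yb"
    by (auto simp: Hom_iff)
  let ?T = "(rb\<^sup>\<dagger> \<boxtimes> \<^bold>1 Y) \<cdot> (\<^bold>1 Y \<boxtimes> r)"
  have row: "?T \<cdot> u j = u j" if j: "j < k" for j
  proof -
    interpret H: conj_pair C N M "Yh j" "Ybh j" "rh j" "rbh j" by (rule conj_pairI[OF sol[OF j]]) (use j in auto)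
    note [simp] = j
    have c1: "((ub j)\<^sup>\<dagger> \<boxtimes> \<^bold>1 Y) \<cdot> r = (\<^bold>1 (Ybh j) \<boxtimes> u j) \<cdot> rh j"
      by (rule direct_sum_component[OF Y D Db _ r j]) (use rht in auto)
    have "((u j)\<^sup>\<dagger> \<boxtimes> \<^bold>1 Yb) \<cdot> rb = (\<^bold>1 (Yh j) \<boxtimes> ub j) \<cdot> rbh j"
      by (rule direct_sum_component[OF Y(2,1) Db D _ rb j]) (use rht in auto)
    from arg_cong[OF this, of "adj2 C"] have c2: "rb\<^sup>\<dagger> \<cdot> (u j \<boxtimes> \<^bold>1 Yb) = (rbh j)\<^sup>\<dagger> \<cdot> (\<^bold>1 (Yh j) \<boxtimes> (ub j)\<^sup>\<dagger>)"
      by simp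
    have "(\<^bold>1 Y \<boxtimes> r) \<cdot> u j = (u j \<boxtimes> \<^bold>1 Yb \<boxtimes> \<^bold>1 Y) \<cdot> (\<^bold>1 (Yh j) \<boxtimes> r)"
      using slide(1)[of r "u j"] slide(2)[of r "u j"] by (simp add: unit2_hcomp)
    then have "?T \<cdot> u j = ((rb\<^sup>\<dagger> \<cdot> (u j \<boxtimes> \<^bold>1 Yb)) \<boxtimes> \<^bold>1 Y) \<cdot> (\<^bold>1 (Yh j) \<boxtimes> r)"
      by (simp add: whisker_right)
    also have "\<dots> = ((rbh j)\<^sup>\<dagger> \<boxtimes> \<^bold>1 Y) \<cdot> (\<^bold>1 (Yh j) \<boxtimes> (((ub j)\<^sup>\<dagger> \<boxtimes> \<^bold>1 Y) \<cdot> r))"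
      unfolding c2 by (simp add: whisker_right whisker_left)
    also have "\<dots> = (((rbh j)\<^sup>\<dagger> \<boxtimes> \<^bold>1 Y) \<cdot> (\<^bold>1 (Yh j) \<boxtimes> \<^bold>1 (Ybh j) \<boxtimes> u j)) \<cdot> (\<^bold>1 (Yh j) \<boxtimes> rh j)"
      unfolding c1 by (simp add: whisker_left)
    also have "\<dots> = u j \<cdot> ((rbh j)\<^sup>\<dagger> \<boxtimes> \<^bold>1 (Yh j)) \<cdot> (\<^bold>1 (Yh j) \<boxtimes> rh j)"
      by (subst H.cap_slide) (auto simp: Hom_iff)
    finally show ?thesis by (simp add: H.zig)
  qed
  have one: "hsum Y Y (\<lambda>h. u h \<cdot> (u h)\<^sup>\<dagger>) {..<k} = \<^bold>1 Y"
    using D by (simp add: direct_sum_decomposition_def)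
  have "?T = ?T \<cdot> hsum Y Y (\<lambda>h. u h \<cdot> (u h)\<^sup>\<dagger>) {..<k}" unfolding one by simp
  also have "\<dots> = hsum Y Y (\<lambda>h. ?T \<cdot> u h \<cdot> (u h)\<^sup>\<dagger>) {..<k}"
    by (rule vcomp_hsum) (auto simp: parallel_def Hom_iff)
  also have "\<dots> = hsum Y Y (\<lambda>h. u h \<cdot> (u h)\<^sup>\<dagger>) {..<k}"
  proof (rule hsum_cong)
    show "?T \<cdot> u h \<cdot> (u h)\<^sup>\<dagger> = u h \<cdot> (u h)\<^sup>\<dagger>" if "h \<in> {..<k}" for h
    proof -
      have "?T \<cdot> u h \<cdot> (u h)\<^sup>\<dagger> = (?T \<cdot> u h) \<cdot> (u h)\<^sup>\<dagger>" using that by simp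
      also have "\<dots> = u h \<cdot> (u h)\<^sup>\<dagger>" unfolding row[OF that[unfolded lessThan_iff]] ..
      finally show ?thesis .
    qed
  qed (auto simp: parallel_def Hom_iff)
  finally show ?thesis unfolding one .
qed

text \<open>By the conjugate equation, the two norms of a solution for a nonzero arrow have a
  product of at least 1; being positive, they can be balanced by rescaling.\<close>

lemma normalized_exists:
  assumes sol: "conjugate_solution C S Sb r rb"
  obtains r' rb' where "normalized_solution C S Sb r' rb'"
proof -
  obtain N M where "src C S = N" "tgt C S = M" by blast
  then interpret S: conj_pair C N M S Sb r rb by (rule conj_pairI[OF sol])
  let ?a = "nrm (\<^bold>1 S \<boxtimes> r)" and ?b = "nrm (rb \<boxtimes> \<^bold>1 S)"
  show ?thesis
  proof (cases "\<^bold>1 S = zero2 C S S")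
    case True
    have "r = zero2 C (\<^bold>I N) (Sb \<boxdot> S)" "rb = zero2 C (\<^bold>I M) (S \<boxdot> Sb)"
      using zero_unit_comp(1)[OF True _ S.typing(9), of Sb] zero_unit_comp(2)[OF True _ S.typing(12), of Sb] by auto
    then have "?a = ?b" by (simp add: parallel_def)
    then show ?thesis using that sol by (simp add: normalized_solution_def)
  next
    case False
    have "\<^bold>1 S = (rb\<^sup>\<dagger> \<boxtimes> \<^bold>1 S) \<cdot> (\<^bold>1 S \<boxtimes> r)" using S.zig by simp
    then have "1 \<le> nrm (rb\<^sup>\<dagger> \<boxtimes> \<^bold>1 S) * ?a"
      using nrm_unit[of S] False nrm_vcomp[of "\<^bold>1 S \<boxtimes> r" "rb\<^sup>\<dagger> \<boxtimes> \<^bold>1 S"] S.zig by simp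
    also have "nrm (rb\<^sup>\<dagger> \<boxtimes> \<^bold>1 S) = ?b" using nrm_adj[of "rb \<boxtimes> \<^bold>1 S"] by simp
    finally have ab: "1 \<le> ?b * ?a" .
    have a: "?a > 0" and b: "?b > 0"
      using ab nrm_nonneg[of "\<^bold>1 S \<boxtimes> r"] nrm_nonneg[of "rb \<boxtimes> \<^bold>1 S"]
      by (auto simp: order_less_le)
    \<comment> \<open>Chosen so that \<open>c * ?a\<close> equals \<open>?b / c\<close>.\<close>
    define c where "c = sqrt (?b / ?a)"
    have c: "c > 0" "c * c = ?b / ?a" using a b by (simp_all add: c_def)
    then have "c * ?a = (1 / c) * ?b" using a by (simp add: field_simps)
    then have "normalized_solution C S Sb (complex_of_real c \<^bold>* r) (complex_of_real (1 / c) \<^bold>* rb)"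
      using S.scaled_solution[of c] c by (simp add: normalized_solution_def hcomp_linear del: of_real_divide)
    then show ?thesis by (rule that)
  qed
qed

lemma standard_exists:
  assumes rigid: "rigid C" and Y: "Y \<in> Arr1 C" and fact: "factorial_arr C Y" and nz: "\<^bold>1 Y \<noteq> zero2 C Y Y"
  obtains Yb r rb where "factorial_standard_solution C Y Yb r rb"
proof -
  obtain k Yh u where D: "direct_sum_decomposition C Y k Yh u" and simple: "\<And>h. h < k \<Longrightarrow> simple_arr C (Yh h)" and "0 < k"
    using factorial_decomposition[OF rigid Y fact nz] by metis
  obtain N M where NM [simp]: "src C Y = N" "tgt C Y = M" by blast
  have [simp]: "N \<in> Obj C" "M \<in> Obj C" using src_tgt[of Y] Y by auto
  note dt [simp] = decomposition_typing(2-)[OF D] Y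
  have "\<exists>Yb r rb. normalized_solution C (Yh h) Yb r rb" if "h < k" for h
    using rigid normalized_exists that dt(5) unfolding rigid_def by metis
  then obtain Ybh rh rbh where norm: "\<And>h. h < k \<Longrightarrow> normalized_solution C (Yh h) (Ybh h) (rh h) (rbh h)"
    by metis
  then have sol: "conjugate_solution C (Yh h) (Ybh h) (rh h) (rbh h)" if "h < k" for h
    using that by (auto simp: normalized_solution_def)
  then have Ybh: "Ybh h \<in> arr1 C M N" if "h < k" for h
    using that by (auto simp: conjugate_solution_def)
  obtain Yb ub where Yb: "Yb \<in> arr1 C M N" and Db: "direct_sum_decomposition C Yb k Ybh ub"
    using direct_sum_exists[of "k - 1" Ybh M N] Ybh \<open>0 < k\<close> by auto
  have YNM: "Y \<in> arr1 C N M" by (simp add: arr1_iff)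
  define r where "r = hsum (\<^bold>I N) (Yb \<boxdot> Y) (\<lambda>h. (ub h \<boxtimes> u h) \<cdot> rh h) {..<k}"
  define rb where "rb = hsum (\<^bold>I M) (Y \<boxdot> Yb) (\<lambda>h. (u h \<boxtimes> ub h) \<cdot> rbh h) {..<k}"
  \<comment> \<open>With the two families exchanged, the argument for the first conjugate equation
    also yields the second.\<close>
  have sol': "conjugate_solution C (Ybh h) (Yh h) (rbh h) (rh h)" if "h < k" for h
  proof -
    interpret H: conj_pair C N M "Yh h" "Ybh h" "rh h" "rbh h" by (rule conj_pairI[OF sol[OF that]]) (use that in auto)
    show ?thesis using conj_pair.sol[OF H.swapped] .
  qed
  have [simp]: "Yb \<in> Arr1 C" "src C Yb = M" "tgt C Yb = N" using Yb by (auto simp: arr1_iff)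
  note [simp] = decomposition_typing(2-)[OF Db]
  have [simp]: "rh h \<in> Arr2 C" "dom2 C (rh h) = \<^bold>I N" "cod2 C (rh h) = Ybh h \<boxdot> Yh h"
    "rbh h \<in> Arr2 C" "dom2 C (rbh h) = \<^bold>I M" "cod2 C (rbh h) = Yh h \<boxdot> Ybh h" if "h < k" for h
    using sol[OF that] that by (auto simp: conjugate_solution_def Hom_iff)
  have "r \<in> Hom C (\<^bold>I N) (Yb \<boxdot> Y)" "rb \<in> Hom C (\<^bold>I M) (Y \<boxdot> Yb)"
    unfolding r_def rb_def by (rule hsum_Hom; auto simp: parallel_def Hom_iff)+
  then have "conjugate_solution C Y Yb r rb"
    unfolding conjugate_solution_def
    using Yb direct_sum_zig[OF YNM Yb D Db sol r_def rb_def] direct_sum_zig[OF Yb YNM Db D sol' rb_def r_def] by simp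
  then have "factorial_standard_solution C Y Yb r rb"
    unfolding factorial_standard_solution_def using fact D Db simple norm r_def rb_def NM by blast
  then show ?thesis by (rule that)
qed

text \<open>
  The Cauchy-Schwarz inequality for the trace, applied to the comparison \<open>w\<close> of two conjugates
  and to the adjoint of its inverse \<open>v\<close>.
\<close>

lemma dimension_inequality:
  assumes fact: "factorial_arr C Y" and nz: "\<^bold>1 Y \<noteq> zero2 C Y Y"
    and sol: "conjugate_solution C Y Yb r rb" and tr: "tracial Y Yb r rb"
    and sol': "conjugate_solution C Y Yb' r' rb'"
    and d: "\<^bold>1 Y \<boxtimes> (r\<^sup>\<dagger> \<cdot> r) = complex_of_real d \<^bold>* \<^bold>1 Y"
    and a: "\<^bold>1 Y \<boxtimes> (r'\<^sup>\<dagger> \<cdot> r') = complex_of_real a \<^bold>* \<^bold>1 Y"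
    and b: "(rb'\<^sup>\<dagger> \<cdot> rb') \<boxtimes> \<^bold>1 Y = complex_of_real b \<^bold>* \<^bold>1 Y"
  shows "d\<^sup>2 \<le> a * b" "0 < a" "0 < b" "0 < d"
    "\<exists>w v. w \<in> Hom C Yb Yb' \<and> v \<in> Hom C Yb' Yb \<and> v \<cdot> w = \<^bold>1 Yb \<and> w \<cdot> v = \<^bold>1 Yb' \<and>
      (w \<boxtimes> \<^bold>1 Y) \<cdot> r = r' \<and> (\<^bold>1 Y \<boxtimes> v\<^sup>\<dagger>) \<cdot> rb = rb' \<and>
      (a * b = d\<^sup>2 \<longrightarrow> w = complex_of_real (d / b) \<^bold>* v\<^sup>\<dagger>)"
proof -
  obtain N M where NM: "src C Y = N" "tgt C Y = M" by blast
  interpret Y: conj_pair C N M Y Yb r rb by (rule conj_pairI[OF sol NM])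
  interpret Y': conj_pair C N M Y Yb' r' rb' by (rule conj_pairI[OF sol' NM])
  define w where "w = (\<^bold>1 Yb' \<boxtimes> rb\<^sup>\<dagger>) \<cdot> (r' \<boxtimes> \<^bold>1 Yb)"
  define v where "v = (\<^bold>1 Yb \<boxtimes> rb'\<^sup>\<dagger>) \<cdot> (r \<boxtimes> \<^bold>1 Yb')"
  have [simp]: "w \<in> Arr2 C" "dom2 C w = Yb" "cod2 C w = Yb'" "v \<in> Arr2 C" "dom2 C v = Yb'" "cod2 C v = Yb"
    by (simp_all add: w_def v_def)
  have wr: "(w \<boxtimes> \<^bold>1 Y) \<cdot> r = r'" unfolding w_def by (rule Y.frobenius_bar_inverse) (auto simp: Hom_iff arr1_iff)
  have vr: "(v \<boxtimes> \<^bold>1 Y) \<cdot> r' = r" unfolding v_def by (rule Y'.frobenius_bar_inverse) (auto simp: Hom_iff arr1_iff)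
  have vrb: "(\<^bold>1 Y \<boxtimes> v\<^sup>\<dagger>) \<cdot> rb = rb'" unfolding v_def by (rule Y.comparison_bar[OF sol'])
  have vw: "v \<cdot> w = \<^bold>1 Yb"
  proof (rule Y.frobenius_bar_eq)
    have "((v \<cdot> w) \<boxtimes> \<^bold>1 Y) \<cdot> r = (v \<boxtimes> \<^bold>1 Y) \<cdot> (w \<boxtimes> \<^bold>1 Y) \<cdot> r" by (simp add: whisker_right)
    then show "((v \<cdot> w) \<boxtimes> \<^bold>1 Y) \<cdot> r = (\<^bold>1 Yb \<boxtimes> \<^bold>1 Y) \<cdot> r" by (simp add: wr vr hcomp_unit2')
  qed (auto simp: Hom_iff)
  have wv: "w \<cdot> v = \<^bold>1 Yb'"
  proof (rule Y'.frobenius_bar_eq)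
    have "((w \<cdot> v) \<boxtimes> \<^bold>1 Y) \<cdot> r' = (w \<boxtimes> \<^bold>1 Y) \<cdot> (v \<boxtimes> \<^bold>1 Y) \<cdot> r'" by (simp add: whisker_right)
    then show "((w \<cdot> v) \<boxtimes> \<^bold>1 Y) \<cdot> r' = (\<^bold>1 Yb' \<boxtimes> \<^bold>1 Y) \<cdot> r'" by (simp add: wr vr hcomp_unit2')
  qed (auto simp: Hom_iff)
  have oneH: "\<^bold>1 Y \<in> Hom C Y Y" by (simp add: Hom_iff)
  have pos: "0 < x" if "conjugate_solution C Y Yc s sb" "\<^bold>1 Y \<boxtimes> (s\<^sup>\<dagger> \<cdot> s) = complex_of_real x \<^bold>* \<^bold>1 Y" for Yc s sb x
  proof -
    interpret c: conj_pair C N M Y Yc s sb by (rule conj_pairI[OF that(1) NM])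
    have sq: "(\<^bold>1 Y \<boxtimes> s)\<^sup>\<dagger> \<cdot> (\<^bold>1 Y \<boxtimes> s) = complex_of_real x \<^bold>* \<^bold>1 Y" using that(2) by (simp add: whisker_left)
    have "complex_of_real x = complex_of_real ((nrm (\<^bold>1 Y \<boxtimes> s))\<^sup>2)"
      by (rule positive_scalar[OF _ sq nz]) (simp add: Hom_iff)
    then have x: "x = (nrm (\<^bold>1 Y \<boxtimes> s))\<^sup>2" unfolding of_real_eq_iff .
    have "nrm (\<^bold>1 Y \<boxtimes> s) \<noteq> 0"
    proof
      assume "nrm (\<^bold>1 Y \<boxtimes> s) = 0"
      then have "\<^bold>1 Y \<boxtimes> s = zero2 C Y (Y \<boxdot> Yc \<boxdot> Y)" using nrm_zero_iff[of "\<^bold>1 Y \<boxtimes> s"] by simp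
      then show False using c.zig nz by simp
    qed
    then show ?thesis using x by simp
  qed
  show "0 < a" using pos[OF sol' a] .
  show "0 < d" using pos[OF sol d] .
  show b0: "0 < b"
  proof -
    have sq: "(rb' \<boxtimes> \<^bold>1 Y)\<^sup>\<dagger> \<cdot> (rb' \<boxtimes> \<^bold>1 Y) = complex_of_real b \<^bold>* \<^bold>1 Y" using b by (simp add: whisker_right)
    have "complex_of_real b = complex_of_real ((nrm (rb' \<boxtimes> \<^bold>1 Y))\<^sup>2)"
      by (rule positive_scalar[OF _ sq nz]) (simp add: Hom_iff)
    then have x: "b = (nrm (rb' \<boxtimes> \<^bold>1 Y))\<^sup>2" unfolding of_real_eq_iff .
    have "nrm (rb' \<boxtimes> \<^bold>1 Y) \<noteq> 0"
    proof
      assume "nrm (rb' \<boxtimes> \<^bold>1 Y) = 0"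
      then have "rb' \<boxtimes> \<^bold>1 Y = zero2 C Y (Y \<boxdot> Yb' \<boxdot> Y)" using nrm_zero_iff[of "rb' \<boxtimes> \<^bold>1 Y"] by simp
      then show False using Y'.zig_adj nz by simp
    qed
    then show ?thesis using x by simp
  qed
  \<comment> \<open>The left trace of the given solution, with its values kept as 2-arrows on
    \<open>Y\<close>.\<close>
  define L where "L s = \<^bold>1 Y \<boxtimes> (r\<^sup>\<dagger> \<cdot> (s \<boxtimes> \<^bold>1 Y) \<cdot> r)" for s
  have L_typing [simp]: "L s \<in> Arr2 C" "dom2 C (L s) = Y" "cod2 C (L s) = Y"
    if "s \<in> Arr2 C" "dom2 C s = Yb" "cod2 C s = Yb" for s
    using that by (simp_all add: L_def)
  have L_add: "L (s \<^bold>+ t) = L s \<^bold>+ L t"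
    if "s \<in> Arr2 C" "dom2 C s = Yb" "cod2 C s = Yb" "t \<in> Arr2 C" "dom2 C t = Yb" "cod2 C t = Yb" for s t
    using that by (simp add: L_def hcomp_linear vcomp_linear)
  have L_scale: "L (c \<^bold>* s) = c \<^bold>* L s" if "s \<in> Arr2 C" "dom2 C s = Yb" "cod2 C s = Yb" for s c
    using that by (simp add: L_def hcomp_linear vcomp_linear)
  have La: "L (w\<^sup>\<dagger> \<cdot> w) = complex_of_real a \<^bold>* \<^bold>1 Y"
  proof -
    have "((w \<boxtimes> \<^bold>1 Y) \<cdot> r)\<^sup>\<dagger> \<cdot> ((w \<boxtimes> \<^bold>1 Y) \<cdot> r) = r\<^sup>\<dagger> \<cdot> ((w\<^sup>\<dagger> \<cdot> w) \<boxtimes> \<^bold>1 Y) \<cdot> r"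
      by (simp add: merge)
    then show ?thesis using a unfolding wr L_def by simp
  qed
  have Ld: "L (\<^bold>1 Yb) = complex_of_real d \<^bold>* \<^bold>1 Y" using d by (simp add: L_def hcomp_unit2')
  \<comment> \<open>The square of \<open>rb'\<close> is a right trace of
    \<open>v \<cdot> v\<^sup>\<dagger>\<close>; traciality turns it into a value of
    \<open>L\<close>, so that \<open>w\<close> and \<open>v\<close> can be compared by one
    functional.\<close>
  have Lb: "L (v \<cdot> v\<^sup>\<dagger>) = complex_of_real b \<^bold>* \<^bold>1 Y"
  proof -
    have "v \<cdot> v\<^sup>\<dagger> \<in> Hom C Yb Yb" by (simp add: Hom_iff)
    then obtain c where c: "L (v \<cdot> v\<^sup>\<dagger>) = c \<^bold>* \<^bold>1 Y" "(rb\<^sup>\<dagger> \<cdot> (\<^bold>1 Y \<boxtimes> (v \<cdot> v\<^sup>\<dagger>)) \<cdot> rb) \<boxtimes> \<^bold>1 Y = c \<^bold>* \<^bold>1 Y"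
      using tr unfolding tracial_def L_def by blast
    have "((\<^bold>1 Y \<boxtimes> v\<^sup>\<dagger>) \<cdot> rb)\<^sup>\<dagger> \<cdot> ((\<^bold>1 Y \<boxtimes> v\<^sup>\<dagger>) \<cdot> rb) = rb\<^sup>\<dagger> \<cdot> (\<^bold>1 Y \<boxtimes> (v \<cdot> v\<^sup>\<dagger>)) \<cdot> rb"
      by (simp add: merge)
    then have "c \<^bold>* \<^bold>1 Y = complex_of_real b \<^bold>* \<^bold>1 Y" using b c(2) unfolding vrb by simp
    then show ?thesis using c by simp
  qed
  \<comment> \<open>The minimizer of \<open>a + 2 * (l * d) + l * l * b\<close>, which is the trace
    of the square of \<open>x\<close>; the mixed terms give \<open>d\<close> because
    \<open>v\<close> inverts \<open>w\<close>. The minimum is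
    \<open>a - d\<^sup>2 / b\<close>.\<close>
  define l where "l = - d / b"
  define x where "x = w \<^bold>+ complex_of_real l \<^bold>* v\<^sup>\<dagger>"
  have [simp]: "x \<in> Arr2 C" "dom2 C x = Yb" "cod2 C x = Yb'" by (simp_all add: x_def)
  define T where "T = \<^bold>1 Y \<boxtimes> ((x \<boxtimes> \<^bold>1 Y) \<cdot> r)"
  have T: "T \<in> Hom C Y (Y \<boxdot> Yb' \<boxdot> Y)" by (simp add: T_def Hom_iff)
  have wv': "w\<^sup>\<dagger> \<cdot> v\<^sup>\<dagger> = \<^bold>1 Yb" using arg_cong[OF vw, of "adj2 C"] by simp
  have xx: "x\<^sup>\<dagger> \<cdot> x = (w\<^sup>\<dagger> \<cdot> w \<^bold>+ complex_of_real l \<^bold>* \<^bold>1 Yb) \<^bold>+ (complex_of_real l \<^bold>* \<^bold>1 Yb \<^bold>+ complex_of_real (l * l) \<^bold>* (v \<cdot> v\<^sup>\<dagger>))"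
    by (simp add: x_def vcomp_linear vw wv' scale2_distrib(2))
  have "T\<^sup>\<dagger> \<cdot> T = L (x\<^sup>\<dagger> \<cdot> x)" by (simp add: T_def L_def merge)
  also have "\<dots> = (complex_of_real a \<^bold>* \<^bold>1 Y \<^bold>+ complex_of_real l \<^bold>* complex_of_real d \<^bold>* \<^bold>1 Y) \<^bold>+
      (complex_of_real l \<^bold>* complex_of_real d \<^bold>* \<^bold>1 Y \<^bold>+ complex_of_real (l * l) \<^bold>* complex_of_real b \<^bold>* \<^bold>1 Y)"
    unfolding xx by (simp add: L_add L_scale La Lb Ld)
  also have "\<dots> = complex_of_real (a + 2 * (l * d) + l * l * b) \<^bold>* \<^bold>1 Y"
    by (simp add: lin_combine ac_simps)
  finally have TT: "T\<^sup>\<dagger> \<cdot> T = complex_of_real (a + 2 * (l * d) + l * l * b) \<^bold>* \<^bold>1 Y" .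
  have "complex_of_real (a + 2 * (l * d) + l * l * b) = complex_of_real ((nrm T)\<^sup>2)"
    by (rule positive_scalar[OF T TT nz])
  then have "a + 2 * (l * d) + l * l * b = (nrm T)\<^sup>2" unfolding of_real_eq_iff .
  moreover have "a + 2 * (l * d) + l * l * b = a - d\<^sup>2 / b"
    using b0 by (simp add: l_def field_simps power2_eq_square)
  ultimately have aT: "a - d\<^sup>2 / b = (nrm T)\<^sup>2" by simp
  then have "d\<^sup>2 / b \<le> a" by (metis diff_ge_0_iff_ge zero_le_power2)
  then show "d\<^sup>2 \<le> a * b" using b0 by (simp add: field_simps)
  \<comment> \<open>Equality makes the trace norm of \<open>x\<close> zero, and faithfulness of the
    left trace then gives \<open>x = 0\<close>.\<close>
  have "w = complex_of_real (d / b) \<^bold>* v\<^sup>\<dagger>" if "a * b = d\<^sup>2"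
  proof -
    have "(nrm T)\<^sup>2 = 0" using aT that b0 by (simp add: field_simps)
    then have "T = zero2 C Y (Y \<boxdot> Yb' \<boxdot> Y)" using nrm_zero_iff[of T] T by (simp add: Hom_iff)
    then have "x = zero2 C Yb Yb'" unfolding T_def by (intro Y.left_null_imp_zero) (auto simp: Hom_iff)
    moreover have "x = w \<^bold>- complex_of_real (d / b) \<^bold>* v\<^sup>\<dagger>" by (simp add: x_def l_def)
    ultimately show ?thesis
      using minus_zero_iff[of w Yb Yb' "complex_of_real (d / b) \<^bold>* v\<^sup>\<dagger>"] by (simp add: Hom_iff del: of_real_divide)
  qed
  then show "\<exists>w v. w \<in> Hom C Yb Yb' \<and> v \<in> Hom C Yb' Yb \<and> v \<cdot> w = \<^bold>1 Yb \<and> w \<cdot> v = \<^bold>1 Yb' \<and>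
      (w \<boxtimes> \<^bold>1 Y) \<cdot> r = r' \<and> (\<^bold>1 Y \<boxtimes> v\<^sup>\<dagger>) \<cdot> rb = rb' \<and>
      (a * b = d\<^sup>2 \<longrightarrow> w = complex_of_real (d / b) \<^bold>* v\<^sup>\<dagger>)"
    using vw wv wr vrb by (intro exI[of _ w] exI[of _ v]) (auto simp: Hom_iff)
qed

end

section \<open>The dimension of a factorial arrow\<close>

context two_cstar_category
begin

lemma decomposition_unitary:
  assumes D: "direct_sum_decomposition C Y k Yh u" and W: "W \<in> Hom C Y Y'" "W\<^sup>\<dagger> \<cdot> W = \<^bold>1 Y" "W \<cdot> W\<^sup>\<dagger> = \<^bold>1 Y'"
  shows "direct_sum_decomposition C Y' k Yh (\<lambda>h. W \<cdot> u h)"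
proof -
  have [simp]: "W \<in> Arr2 C" "dom2 C W = Y" "cod2 C W = Y'" using W by (auto simp: Hom_iff)
  have [simp]: "Y \<in> Arr1 C" "Y' \<in> Arr1 C" "src C Y' = src C Y" "tgt C Y' = tgt C Y" using Hom_parallel[OF W(1)] by auto
  note dt [simp] = decomposition_typing(2-)[OF D]
  have WW: "W\<^sup>\<dagger> \<cdot> W \<cdot> t = t" if "t \<in> Arr2 C" "cod2 C t = Y" for t
    using vcomp_assoc'[of t W "W\<^sup>\<dagger>"] that W(2) by simp
  have "hsum Y' Y' (\<lambda>h. (W \<cdot> u h) \<cdot> (W \<cdot> u h)\<^sup>\<dagger>) {..<k} = hsum Y' Y' (\<lambda>h. W \<cdot> (u h \<cdot> (u h)\<^sup>\<dagger>) \<cdot> W\<^sup>\<dagger>) {..<k}"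
    by (rule hsum_cong) (auto simp: parallel_def Hom_iff)
  also have "\<dots> = W \<cdot> hsum Y' Y (\<lambda>h. (u h \<cdot> (u h)\<^sup>\<dagger>) \<cdot> W\<^sup>\<dagger>) {..<k}"
    by (rule vcomp_hsum[symmetric]) (auto simp: parallel_def Hom_iff)
  also have "hsum Y' Y (\<lambda>h. (u h \<cdot> (u h)\<^sup>\<dagger>) \<cdot> W\<^sup>\<dagger>) {..<k} = hsum Y Y (\<lambda>h. u h \<cdot> (u h)\<^sup>\<dagger>) {..<k} \<cdot> W\<^sup>\<dagger>"
    by (rule hsum_vcomp[symmetric]) (auto simp: parallel_def Hom_iff)
  also have "hsum Y Y (\<lambda>h. u h \<cdot> (u h)\<^sup>\<dagger>) {..<k} = \<^bold>1 Y"
    using D by (simp add: direct_sum_decomposition_def)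
  finally show ?thesis
    using W(3) by (simp add: direct_sum_decomposition_def Hom_iff WW)
qed

text \<open>Solution and decompositions are transported together. A nontrivial \<open>U\<close> is
  later used to change the realization of a subarrow, a nontrivial \<open>W\<close> to change the
  conjugate.\<close>

lemma standard_solution_unitary:
  assumes std: "factorial_standard_solution C Y Yb r rb"
    and U: "U \<in> Hom C Y Y'" "U\<^sup>\<dagger> \<cdot> U = \<^bold>1 Y" "U \<cdot> U\<^sup>\<dagger> = \<^bold>1 Y'"
    and W: "W \<in> Hom C Yb Yb'" "W\<^sup>\<dagger> \<cdot> W = \<^bold>1 Yb" "W \<cdot> W\<^sup>\<dagger> = \<^bold>1 Yb'"
  shows "factorial_standard_solution C Y' Yb' ((W \<boxtimes> U) \<cdot> r) ((U \<boxtimes> W) \<cdot> rb)"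
proof -
  from std obtain k Yh Ybh u ub rh rbh where fact: "factorial_arr C Y" and sol: "conjugate_solution C Y Yb r rb"
    and D: "direct_sum_decomposition C Y k Yh u" and Db: "direct_sum_decomposition C Yb k Ybh ub"
    and simple: "\<And>h. h < k \<Longrightarrow> simple_arr C (Yh h)"
    and norm: "\<And>h. h < k \<Longrightarrow> normalized_solution C (Yh h) (Ybh h) (rh h) (rbh h)"
    and r: "r = hsum (\<^bold>I (src C Y)) (Yb \<boxdot> Y) (\<lambda>h. (ub h \<boxtimes> u h) \<cdot> rh h) {..<k}"
    and rb: "rb = hsum (\<^bold>I (tgt C Y)) (Y \<boxdot> Yb) (\<lambda>h. (u h \<boxtimes> ub h) \<cdot> rbh h) {..<k}"
    unfolding factorial_standard_solution_def by blast
  obtain N M where NM: "src C Y = N" "tgt C Y = M" by blast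
  interpret Y: conj_pair C N M Y Yb r rb by (rule conj_pairI[OF sol NM])
  have [simp]: "U \<in> Arr2 C" "dom2 C U = Y" "cod2 C U = Y'" "W \<in> Arr2 C" "dom2 C W = Yb" "cod2 C W = Yb'"
    using U W by (auto simp: Hom_iff)
  have [simp]: "Y' \<in> Arr1 C" "src C Y' = N" "tgt C Y' = M" "Yb' \<in> Arr1 C" "src C Yb' = M" "tgt C Yb' = N"
    using Hom_parallel[OF U(1)] Hom_parallel[OF W(1)] by auto
  note dt [simp] = decomposition_typing(2-)[OF D] decomposition_typing(2-)[OF Db]
  have [simp]: "rh h \<in> Arr2 C" "dom2 C (rh h) = \<^bold>I N" "cod2 C (rh h) = Ybh h \<boxdot> Yh h"
    "rbh h \<in> Arr2 C" "dom2 C (rbh h) = \<^bold>I M" "cod2 C (rbh h) = Yh h \<boxdot> Ybh h" if "h < k" for h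
    using norm[OF that] that by (auto simp: normalized_solution_def conjugate_solution_def Hom_iff)
  have "conjugate_solution C Y' Yb' (((W\<^sup>\<dagger>)\<^sup>\<dagger> \<boxtimes> (U\<^sup>\<dagger>)\<^sup>\<dagger>) \<cdot> r) (((U\<^sup>\<dagger>)\<^sup>\<dagger> \<boxtimes> (W\<^sup>\<dagger>)\<^sup>\<dagger>) \<cdot> rb)"
    by (rule Y.block_solution) (use U W in \<open>auto simp: Hom_iff\<close>)
  then have 1: "conjugate_solution C Y' Yb' ((W \<boxtimes> U) \<cdot> r) ((U \<boxtimes> W) \<cdot> rb)" by simp
  have 2: "factorial_arr C Y'"
    by (rule sub_factorial[OF fact, of "U\<^sup>\<dagger>"]) (use U in \<open>auto simp: Hom_iff\<close>)
  have "(W \<boxtimes> U) \<cdot> r = hsum (\<^bold>I N) (Yb' \<boxdot> Y') (\<lambda>h. (W \<boxtimes> U) \<cdot> (ub h \<boxtimes> u h) \<cdot> rh h) {..<k}"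
    unfolding r NM by (rule vcomp_hsum) (auto simp: parallel_def Hom_iff)
  also have "\<dots> = hsum (\<^bold>I N) (Yb' \<boxdot> Y') (\<lambda>h. ((W \<cdot> ub h) \<boxtimes> (U \<cdot> u h)) \<cdot> rh h) {..<k}"
    by (rule hsum_cong) (auto simp: parallel_def Hom_iff merge)
  finally have 3: "(W \<boxtimes> U) \<cdot> r = hsum (\<^bold>I (src C Y')) (Yb' \<boxdot> Y') (\<lambda>h. ((W \<cdot> ub h) \<boxtimes> (U \<cdot> u h)) \<cdot> rh h) {..<k}" by simp
  have "(U \<boxtimes> W) \<cdot> rb = hsum (\<^bold>I M) (Y' \<boxdot> Yb') (\<lambda>h. (U \<boxtimes> W) \<cdot> (u h \<boxtimes> ub h) \<cdot> rbh h) {..<k}"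
    unfolding rb NM by (rule vcomp_hsum) (auto simp: parallel_def Hom_iff)
  also have "\<dots> = hsum (\<^bold>I M) (Y' \<boxdot> Yb') (\<lambda>h. ((U \<cdot> u h) \<boxtimes> (W \<cdot> ub h)) \<cdot> rbh h) {..<k}"
    by (rule hsum_cong) (auto simp: parallel_def Hom_iff merge)
  finally have 4: "(U \<boxtimes> W) \<cdot> rb = hsum (\<^bold>I (tgt C Y')) (Y' \<boxdot> Yb') (\<lambda>h. ((U \<cdot> u h) \<boxtimes> (W \<cdot> ub h)) \<cdot> rbh h) {..<k}" by simp
  show ?thesis
    unfolding factorial_standard_solution_def
    using 1 2 3 4 simple norm decomposition_unitary[OF D U] decomposition_unitary[OF Db W] by blast
qed

lemma standard_solutionD:
  assumes "factorial_standard_solution C Y Yb r rb"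
  shows "factorial_arr C Y" "conjugate_solution C Y Yb r rb"
  using assms by (auto simp: factorial_standard_solution_def)

text \<open>Traciality at the unit of \<open>Yb\<close> equates the two scalars, so the left norm
  determines both.\<close>

lemma standard_dim:
  assumes std: "factorial_standard_solution C Y Yb r rb" and nz: "\<^bold>1 Y \<noteq> zero2 C Y Y"
  shows "\<^bold>1 Y \<boxtimes> (r\<^sup>\<dagger> \<cdot> r) = complex_of_real ((nrm (\<^bold>1 Y \<boxtimes> r))\<^sup>2) \<^bold>* \<^bold>1 Y"
    "(rb\<^sup>\<dagger> \<cdot> rb) \<boxtimes> \<^bold>1 Y = complex_of_real ((nrm (\<^bold>1 Y \<boxtimes> r))\<^sup>2) \<^bold>* \<^bold>1 Y"
proof -
  note fact = standard_solutionD(1)[OF std] and sol = standard_solutionD(2)[OF std]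
  obtain N M where NM: "src C Y = N" "tgt C Y = M" by blast
  interpret Y: conj_pair C N M Y Yb r rb by (rule conj_pairI[OF sol NM])
  have one: "\<^bold>1 Y \<in> Hom C Y Y" by (simp add: Hom_iff)
  show 1: "\<^bold>1 Y \<boxtimes> (r\<^sup>\<dagger> \<cdot> r) = complex_of_real ((nrm (\<^bold>1 Y \<boxtimes> r))\<^sup>2) \<^bold>* \<^bold>1 Y"
    by (rule solution_scalars(1)[OF fact one _ sol]) simp
  have "\<^bold>1 Yb \<in> Hom C Yb Yb" by (simp add: Hom_iff)
  then obtain c where "\<^bold>1 Y \<boxtimes> (r\<^sup>\<dagger> \<cdot> r) = c \<^bold>* \<^bold>1 Y" "(rb\<^sup>\<dagger> \<cdot> rb) \<boxtimes> \<^bold>1 Y = c \<^bold>* \<^bold>1 Y"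
    using standard_tracial[OF std] unfolding tracial_def by (fastforce simp: hcomp_unit2')
  moreover from this have "c = complex_of_real ((nrm (\<^bold>1 Y \<boxtimes> r))\<^sup>2)"
    using scale_cancel[OF _ one nz] 1 by metis
  ultimately show "(rb\<^sup>\<dagger> \<cdot> rb) \<boxtimes> \<^bold>1 Y = complex_of_real ((nrm (\<^bold>1 Y \<boxtimes> r))\<^sup>2) \<^bold>* \<^bold>1 Y" by simp
qed

text \<open>For a standard second solution both scalars in the dimension inequality are its own
  dimension, so the inequality compares the squares of the two dimensions. The roles are
  symmetric.\<close>

lemma standard_dim_unique:
  assumes std: "factorial_standard_solution C Y Yb r rb" and std': "factorial_standard_solution C Y Yb' r' rb'"
    and nz: "\<^bold>1 Y \<noteq> zero2 C Y Y"
  shows "(nrm (\<^bold>1 Y \<boxtimes> r))\<^sup>2 = (nrm (\<^bold>1 Y \<boxtimes> r'))\<^sup>2"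
proof -
  have le: "(nrm (\<^bold>1 Y \<boxtimes> r))\<^sup>2 \<le> (nrm (\<^bold>1 Y \<boxtimes> r'))\<^sup>2"
    if "factorial_standard_solution C Y Yb r rb" "factorial_standard_solution C Y Yb' r' rb'" for Yb Yb' r r' rb rb'
  proof -
    have "((nrm (\<^bold>1 Y \<boxtimes> r))\<^sup>2)\<^sup>2 \<le> (nrm (\<^bold>1 Y \<boxtimes> r'))\<^sup>2 * (nrm (\<^bold>1 Y \<boxtimes> r'))\<^sup>2"
      by (rule dimension_inequality(1)[OF standard_solutionD(1)[OF that(1)] nz standard_solutionD(2)[OF that(1)]
        standard_tracial[OF that(1)] standard_solutionD(2)[OF that(2)]
        standard_dim(1)[OF that(1) nz] standard_dim[OF that(2) nz]])
    then have "((nrm (\<^bold>1 Y \<boxtimes> r))\<^sup>2)\<^sup>2 \<le> ((nrm (\<^bold>1 Y \<boxtimes> r'))\<^sup>2)\<^sup>2" by (simp only: power2_eq_square)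
    then show ?thesis by (rule power2_le_imp_le) simp
  qed
  show ?thesis using le[OF std std'] le[OF std' std] by simp
qed

lemma factorial_dim_eq:
  assumes std: "factorial_standard_solution C Y Yb r rb" and nz: "\<^bold>1 Y \<noteq> zero2 C Y Y"
  shows "factorial_dim C Y = (nrm (\<^bold>1 Y \<boxtimes> r))\<^sup>2"
  unfolding factorial_dim_def
  by (rule the_equality) (use std standard_dim_unique[OF _ std nz] in blast)+

text \<open>Transport along \<open>U\<close> alone leaves the central element
  \<open>r\<^sup>\<dagger> \<cdot> r\<close> unchanged, and that element determines the
  dimension.\<close>

lemma factorial_dim_unitary:
  assumes rigid: "rigid C" and fact: "factorial_arr C S" and nz: "\<^bold>1 S \<noteq> zero2 C S S"
    and U: "U \<in> Hom C S S'" "U\<^sup>\<dagger> \<cdot> U = \<^bold>1 S" "U \<cdot> U\<^sup>\<dagger> = \<^bold>1 S'"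
  shows "factorial_dim C S' = factorial_dim C S"
proof -
  have [simp]: "U \<in> Arr2 C" "dom2 C U = S" "cod2 C U = S'" using U by (auto simp: Hom_iff)
  obtain N M where NM: "src C S = N" "tgt C S = M" by blast
  have SA: "S \<in> Arr1 C" using Hom_parallel[OF U(1)] by auto
  obtain Sb r rb where std: "factorial_standard_solution C S Sb r rb" using standard_exists[OF rigid SA fact nz] .
  interpret S: conj_pair C N M S Sb r rb by (rule conj_pairI[OF standard_solutionD(2)[OF std] NM])
  have [simp]: "S' \<in> Arr1 C" "src C S' = N" "tgt C S' = M" using Hom_parallel[OF U(1)] by auto
  have std': "factorial_standard_solution C S' Sb ((\<^bold>1 Sb \<boxtimes> U) \<cdot> r) ((U \<boxtimes> \<^bold>1 Sb) \<cdot> rb)"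
    by (rule standard_solution_unitary[OF std U]) (auto simp: Hom_iff)
  have nz': "\<^bold>1 S' \<noteq> zero2 C S' S'"
  proof
    assume z: "\<^bold>1 S' = zero2 C S' S'"
    have "\<^bold>1 S = U\<^sup>\<dagger> \<cdot> \<^bold>1 S' \<cdot> U" using U(2) by simp
    then show False using nz unfolding z by simp
  qed
  let ?r' = "(\<^bold>1 Sb \<boxtimes> U) \<cdot> r"
  have z: "r\<^sup>\<dagger> \<cdot> r \<in> center C (src C S)" by (simp add: center_iff)
  have rr: "?r'\<^sup>\<dagger> \<cdot> ?r' = r\<^sup>\<dagger> \<cdot> r" by (simp add: merge U(2) hcomp_unit2')
  have "\<^bold>1 S' \<boxtimes> (r\<^sup>\<dagger> \<cdot> r) = (U\<^sup>\<dagger>)\<^sup>\<dagger> \<cdot> (\<^bold>1 S \<boxtimes> (r\<^sup>\<dagger> \<cdot> r)) \<cdot> U\<^sup>\<dagger>"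
    by (rule center_sub(1)[OF _ _ z]) (use U in \<open>auto simp: Hom_iff\<close>)
  also have "\<dots> = complex_of_real ((nrm (\<^bold>1 S \<boxtimes> r))\<^sup>2) \<^bold>* \<^bold>1 S'"
    unfolding standard_dim(1)[OF std nz] by (simp add: vcomp_linear U(3))
  finally have "complex_of_real ((nrm (\<^bold>1 S' \<boxtimes> ?r'))\<^sup>2) \<^bold>* \<^bold>1 S' = complex_of_real ((nrm (\<^bold>1 S \<boxtimes> r))\<^sup>2) \<^bold>* \<^bold>1 S'"
    using standard_dim(1)[OF std' nz'] unfolding rr by simp
  then have "complex_of_real ((nrm (\<^bold>1 S' \<boxtimes> ?r'))\<^sup>2) = complex_of_real ((nrm (\<^bold>1 S \<boxtimes> r))\<^sup>2)"
    by (rule scale_cancel[of _ _ _ S' S']) (use nz' in \<open>auto simp: Hom_iff\<close>)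
  then have "(nrm (\<^bold>1 S' \<boxtimes> ?r'))\<^sup>2 = (nrm (\<^bold>1 S \<boxtimes> r))\<^sup>2" unfolding of_real_eq_iff .
  then show ?thesis by (simp add: factorial_dim_eq[OF std nz] factorial_dim_eq[OF std' nz'])
qed

text \<open>Two subarrows with the same range projection are related by the unitary
  \<open>u'\<^sup>\<dagger> \<cdot> u\<close>, so the definite description does not depend on the
  choice.\<close>

lemma matrix_dim_eq:
  assumes rigid: "rigid C" and S: "sub_1_arrow C S u X (e \<cdot> f)" and fact: "factorial_arr C S"
    and nz: "e \<cdot> f \<noteq> zero2 C X X"
  shows "matrix_dim C X e f = factorial_dim C S"
proof -
  have "factorial_dim C S' = factorial_dim C S" if S': "sub_1_arrow C S' u' X (e \<cdot> f)" for S' u'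
  proof (rule factorial_dim_unitary[OF rigid fact sub_nonzero[OF S nz]])
    note us = S[unfolded sub_1_arrow_def] S'[unfolded sub_1_arrow_def]
    have u: "u \<in> Hom C S X" "u' \<in> Hom C S' X" "u\<^sup>\<dagger> \<cdot> u = \<^bold>1 S" "u'\<^sup>\<dagger> \<cdot> u' = \<^bold>1 S'" and eq: "u \<cdot> u\<^sup>\<dagger> = u' \<cdot> u'\<^sup>\<dagger>"
      using us by auto
    have [simp]: "u \<in> Arr2 C" "dom2 C u = S" "cod2 C u = X" "u' \<in> Arr2 C" "dom2 C u' = S'" "cod2 C u' = X"
      using u by (auto simp: Hom_iff)
    have [simp]: "S \<in> Arr1 C" "S' \<in> Arr1 C" using Hom_parallel[OF u(1)] Hom_parallel[OF u(2)] by auto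
    show "u'\<^sup>\<dagger> \<cdot> u \<in> Hom C S S'" by (simp add: Hom_iff)
    have "(u'\<^sup>\<dagger> \<cdot> u)\<^sup>\<dagger> \<cdot> u'\<^sup>\<dagger> \<cdot> u = u\<^sup>\<dagger> \<cdot> (u' \<cdot> u'\<^sup>\<dagger>) \<cdot> u" by simp
    also have "\<dots> = (u\<^sup>\<dagger> \<cdot> u) \<cdot> (u\<^sup>\<dagger> \<cdot> u)" unfolding eq[symmetric] by simp
    finally show "(u'\<^sup>\<dagger> \<cdot> u)\<^sup>\<dagger> \<cdot> u'\<^sup>\<dagger> \<cdot> u = \<^bold>1 S" by (simp add: u)
    have "(u'\<^sup>\<dagger> \<cdot> u) \<cdot> (u'\<^sup>\<dagger> \<cdot> u)\<^sup>\<dagger> = u'\<^sup>\<dagger> \<cdot> (u \<cdot> u\<^sup>\<dagger>) \<cdot> u'" by simp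
    also have "\<dots> = (u'\<^sup>\<dagger> \<cdot> u') \<cdot> (u'\<^sup>\<dagger> \<cdot> u')" unfolding eq by simp
    finally show "(u'\<^sup>\<dagger> \<cdot> u) \<cdot> (u'\<^sup>\<dagger> \<cdot> u)\<^sup>\<dagger> = \<^bold>1 S'" by (simp add: u)
  qed
  then have "(THE d. \<exists>S u. sub_1_arrow C S u X (e \<cdot> f) \<and> d = factorial_dim C S) = factorial_dim C S"
    by (intro the_equality) (use S in blast)+
  then show ?thesis using nz by (simp add: matrix_dim_def)
qed

text \<open>The dimension inequality against some standard solution. In the equality case the
  comparison of the two conjugates is a positive multiple of a unitary, and dividing out this
  multiple exhibits the given solution as a transported standard one.\<close>

lemma factorial_dim_bound:
  assumes rigid: "rigid C" and fact: "factorial_arr C Y" and nz: "\<^bold>1 Y \<noteq> zero2 C Y Y"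
    and sol: "conjugate_solution C Y Yb r rb"
    and a: "\<^bold>1 Y \<boxtimes> (r\<^sup>\<dagger> \<cdot> r) = complex_of_real a \<^bold>* \<^bold>1 Y"
    and b: "(rb\<^sup>\<dagger> \<cdot> rb) \<boxtimes> \<^bold>1 Y = complex_of_real b \<^bold>* \<^bold>1 Y"
  shows "(factorial_dim C Y)\<^sup>2 \<le> a * b" "0 < a" "0 < b" "0 < factorial_dim C Y"
    "\<lbrakk>a * b = (factorial_dim C Y)\<^sup>2; 0 < l; l\<^sup>2 = factorial_dim C Y / b\<rbrakk>
      \<Longrightarrow> factorial_standard_solution C Y Yb (complex_of_real (1 / l) \<^bold>* r) (complex_of_real l \<^bold>* rb)"
proof -
  have YA: "Y \<in> Arr1 C" using sol by (simp add: conjugate_solution_def)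
  obtain Yc s sb where std: "factorial_standard_solution C Y Yc s sb" using standard_exists[OF rigid YA fact nz] .
  let ?d = "factorial_dim C Y"
  have d: "\<^bold>1 Y \<boxtimes> (s\<^sup>\<dagger> \<cdot> s) = complex_of_real ?d \<^bold>* \<^bold>1 Y"
    using standard_dim(1)[OF std nz] factorial_dim_eq[OF std nz] by simp
  note di = dimension_inequality[OF fact nz standard_solutionD(2)[OF std] standard_tracial[OF std] sol d a b]
  show "?d\<^sup>2 \<le> a * b" "0 < a" "0 < b" "0 < ?d" by (rule di)+
  assume ab: "a * b = ?d\<^sup>2" and l: "0 < l" "l\<^sup>2 = ?d / b"
  obtain w v where w: "w \<in> Hom C Yc Yb" "v \<in> Hom C Yb Yc" "v \<cdot> w = \<^bold>1 Yc" "w \<cdot> v = \<^bold>1 Yb"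
    "(w \<boxtimes> \<^bold>1 Y) \<cdot> s = r" "(\<^bold>1 Y \<boxtimes> v\<^sup>\<dagger>) \<cdot> sb = rb" "w = complex_of_real (?d / b) \<^bold>* v\<^sup>\<dagger>"
    using di(5) ab by blast
  have wv: "w = complex_of_real (l * l) \<^bold>* v\<^sup>\<dagger>" using w(7) l(2) by (simp add: power2_eq_square)
  obtain N M where NM: "src C Y = N" "tgt C Y = M" by blast
  interpret Y: conj_pair C N M Y Yc s sb by (rule conj_pairI[OF standard_solutionD(2)[OF std] NM])
  have [simp]: "w \<in> Arr2 C" "dom2 C w = Yc" "cod2 C w = Yb" "v \<in> Arr2 C" "dom2 C v = Yb" "cod2 C v = Yc"
    using w(1,2) by (auto simp: Hom_iff)
  have [simp]: "Yb \<in> Arr1 C" "src C Yb = M" "tgt C Yb = N" using Hom_parallel[OF w(1)] by auto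
  \<comment> \<open>Since \<open>w\<close> is \<open>l * l\<close> times the adjoint of its inverse
    \<open>v\<close>, the arrow \<open>w\<close> divided by \<open>l\<close> is unitary.\<close>
  define W where "W = complex_of_real (1 / l) \<^bold>* w"
  have [simp]: "W \<in> Arr2 C" "dom2 C W = Yc" "cod2 C W = Yb" by (simp_all add: W_def)
  have Wv: "W = complex_of_real l \<^bold>* v\<^sup>\<dagger>"
  proof -
    have "W = (complex_of_real (1 / l) * complex_of_real (l * l)) \<^bold>* v\<^sup>\<dagger>"
      unfolding W_def wv by (rule scale2_simps) simp
    also have "complex_of_real (1 / l) * complex_of_real (l * l) = complex_of_real l" using l by simp
    finally show ?thesis .
  qed
  have "W\<^sup>\<dagger> \<cdot> W = (complex_of_real l \<^bold>* v\<^sup>\<dagger>)\<^sup>\<dagger> \<cdot> complex_of_real (1 / l) \<^bold>* w" unfolding Wv[symmetric] W_def[symmetric] ..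
  also have "\<dots> = \<^bold>1 Yc" using l by (simp add: vcomp_linear w(3))
  finally have 1: "W\<^sup>\<dagger> \<cdot> W = \<^bold>1 Yc" .
  have "W \<cdot> W\<^sup>\<dagger> = (complex_of_real (1 / l) \<^bold>* w) \<cdot> (complex_of_real l \<^bold>* v\<^sup>\<dagger>)\<^sup>\<dagger>" unfolding Wv[symmetric] W_def[symmetric] ..
  also have "\<dots> = \<^bold>1 Yb" using l by (simp add: vcomp_linear w(4))
  finally have 2: "W \<cdot> W\<^sup>\<dagger> = \<^bold>1 Yb" .
  have "factorial_standard_solution C Y Yb ((W \<boxtimes> \<^bold>1 Y) \<cdot> s) ((\<^bold>1 Y \<boxtimes> W) \<cdot> sb)"
    by (rule standard_solution_unitary[OF std _ _ _ _ 1 2]) (auto simp: Hom_iff)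
  moreover have "(W \<boxtimes> \<^bold>1 Y) \<cdot> s = complex_of_real (1 / l) \<^bold>* r"
    unfolding W_def w(5)[symmetric] by (simp add: hcomp_linear vcomp_linear)
  moreover have "(\<^bold>1 Y \<boxtimes> W) \<cdot> sb = complex_of_real l \<^bold>* rb"
    unfolding Wv w(6)[symmetric] by (simp add: hcomp_linear vcomp_linear)
  ultimately show "factorial_standard_solution C Y Yb (complex_of_real (1 / l) \<^bold>* r) (complex_of_real l \<^bold>* rb)"
    by simp
qed

end

section \<open>Perron-Frobenius theory of rectangular matrices\<close>

text \<open>The last assumption is irreducibility of a rectangular matrix: the bipartite graph with
  vertex sets \<open>I\<close> and \<open>J\<close> and an edge for each nonzero entry is connected.
  A nonzero entry also ensures that \<open>I\<close> and \<open>J\<close> are nonempty.\<close>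

locale nonneg_matrix =
  fixes I :: "'i set" and J :: "'j set" and A :: "'i \<Rightarrow> 'j \<Rightarrow> real"
  assumes finI [simp]: "finite I" and finJ [simp]: "finite J"
    and A_nonneg: "i \<in> I \<Longrightarrow> j \<in> J \<Longrightarrow> 0 \<le> A i j"
    and A_nonzero: "\<exists>i\<in>I. \<exists>j\<in>J. A i j \<noteq> 0"
    and connected: "\<lbrakk>S \<subseteq> I; T \<subseteq> J; \<And>i j. i \<in> I \<Longrightarrow> j \<in> J \<Longrightarrow> A i j \<noteq> 0 \<Longrightarrow> i \<in> S \<longleftrightarrow> j \<in> T\<rbrakk>
      \<Longrightarrow> S = {} \<and> T = {} \<or> S = I \<and> T = J"
begin

text \<open>The actions of the matrix (\<open>app\<close>) and of its transpose (\<open>cap\<close>)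
  on vectors.\<close>

definition app where "app x i = (\<Sum>j\<in>J. A i j * x j)"
definition cap where "cap u j = (\<Sum>i\<in>I. A i j * u i)"
abbreviation d where "d \<equiv> l2_op_norm I J A"

lemma app_cong: "(\<And>j. j \<in> J \<Longrightarrow> x j = y j) \<Longrightarrow> app x i = app y i"
  by (simp add: app_def)

lemma L2_set_abs: "L2_set (\<lambda>k. \<bar>f k\<bar>) K = L2_set f K"
  by (simp add: L2_set_def)

lemma app_scale: "app (\<lambda>j. c * x j) i = c * app x i"
  by (simp add: app_def sum_distrib_left mult.left_commute)

lemma cap_scale: "cap (\<lambda>i. c * x i) j = c * cap x j"
  by (simp add: cap_def sum_distrib_left mult.left_commute)

lemma app_add: "app (\<lambda>j. x j + c * y j) i = app x i + c * app y i"
  by (simp add: app_def sum.distrib sum_distrib_left distrib_left mult.left_commute)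

lemma cap_add: "cap (\<lambda>i. x i + c * y i) j = cap x j + c * cap y j"
  by (simp add: cap_def sum.distrib sum_distrib_left distrib_left mult.left_commute)

lemma adjoint: "(\<Sum>i\<in>I. u i * app x i) = (\<Sum>j\<in>J. x j * cap u j)"
proof -
  have "(\<Sum>i\<in>I. u i * app x i) = (\<Sum>i\<in>I. \<Sum>j\<in>J. x j * (A i j * u i))"
    by (simp add: app_def sum_distrib_left ac_simps)
  also have "\<dots> = (\<Sum>j\<in>J. \<Sum>i\<in>I. x j * (A i j * u i))" by (rule sum.swap)
  finally show ?thesis by (simp add: cap_def sum_distrib_left)
qed

text \<open>Vectors are functions on a whole type, and the unit sphere over \<open>J\<close> need
  not be compact because values outside \<open>J\<close> are free. Setting these to 0 places it in a
  product of compact intervals.\<close>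

lemma sphere_maximum:
  obtains y where "L2_set y J = 1" "\<And>x. L2_set x J = 1 \<Longrightarrow> L2_set (app x) I \<le> L2_set (app y) I"
proof -
  define K where "K = PiE UNIV (\<lambda>j. if j \<in> J then {-1..1::real} else {0})"
  have "compactin (product_topology (\<lambda>_. euclidean) UNIV) K"
    unfolding K_def compactin_PiE by auto
  then have "compact K" by (simp add: euclidean_product_topology)
  have "continuous_on UNIV (\<lambda>x. L2_set x J)" "continuous_on UNIV (\<lambda>x. L2_set (app x) I)"
    unfolding L2_set_def app_def by (intro continuous_intros continuous_on_product_coordinates)+
  then have cont: "continuous_on S (\<lambda>x. L2_set x J)" "continuous_on S (\<lambda>x. L2_set (app x) I)" for S
    by (blast intro: continuous_on_subset)+
  define U where "U = K \<inter> {x. L2_set x J = 1}"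
  have "closed {x. L2_set x J = 1}"
    by (rule closed_Collect_eq[OF cont(1) continuous_on_const])
  then have "compact U" unfolding U_def using \<open>compact K\<close> by (rule compact_Int_closed[rotated])
  have inU: "(\<lambda>j. if j \<in> J then x j else 0) \<in> U" if "L2_set x J = 1" for x
  proof -
    have "\<bar>x j\<bar> \<le> 1" if "j \<in> J" for j
      using member_le_L2_set[of J j "\<lambda>j. \<bar>x j\<bar>"] that \<open>L2_set x J = 1\<close> by (simp add: L2_set_abs)
    then have "(\<lambda>j. if j \<in> J then x j else 0) \<in> K" by (auto simp: K_def abs_le_iff)
    moreover have "L2_set (\<lambda>j. if j \<in> J then x j else 0) J = 1" using that by (simp cong: L2_set_cong)
    ultimately show ?thesis by (simp add: U_def)
  qed
  obtain j0 where j0: "j0 \<in> J" using A_nonzero by auto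
  have "L2_set (\<lambda>j. if j = j0 then 1 else 0) J = 1"
    using j0 by (simp add: L2_set_def if_distrib[of "\<lambda>x. x^2"] cong: if_cong)
  then have "U \<noteq> {}" using inU by blast
  then obtain y where y: "y \<in> U" "\<And>x. x \<in> U \<Longrightarrow> L2_set (app x) I \<le> L2_set (app y) I"
    using continuous_attains_sup[OF \<open>compact U\<close> _ cont(2)] by blast
  show ?thesis
  proof (rule that)
    show "L2_set y J = 1" using y(1) by (simp add: U_def)
    fix x assume "L2_set x J = 1"
    then have "L2_set (app (\<lambda>j. if j \<in> J then x j else 0)) I \<le> L2_set (app y) I" by (intro y(2) inU)
    moreover have "app (\<lambda>j. if j \<in> J then x j else 0) = app x" by (rule ext, rule app_cong) simp
    ultimately show "L2_set (app x) I \<le> L2_set (app y) I" by simp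
  qed
qed

text \<open>By homogeneity the maximum over the sphere bounds the matrix on all vectors, and hence
  is the supremum over the ball.\<close>

lemma norm_attained: 
  shows "\<exists>y. L2_set y J = 1 \<and> L2_set (app y) I = d"
    and app_bound: "L2_set (app x) I \<le> d * L2_set x J"
proof -
  obtain y where y: "L2_set y J = 1" "\<And>x. L2_set x J = 1 \<Longrightarrow> L2_set (app x) I \<le> L2_set (app y) I"
    using sphere_maximum by blast
  have b: "L2_set (app x) I \<le> L2_set (app y) I * L2_set x J" for x
  proof (cases "L2_set x J = 0")
    case True
    then have "app x i = 0" for i by (simp add: app_def L2_set_eq_0_iff)
    then show ?thesis using True by (simp add: L2_set_0')
  next
    case False
    then have pos: "0 < L2_set x J" by (simp add: order_less_le)
    let ?c = "1 / L2_set x J"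
    have "L2_set (\<lambda>j. ?c * x j) J = 1" using pos L2_set_right_distrib[of ?c x J] by simp
    then have "L2_set (app (\<lambda>j. ?c * x j)) I \<le> L2_set (app y) I" by (rule y(2))
    moreover have "L2_set (app (\<lambda>j. ?c * x j)) I = ?c * L2_set (app x) I"
    proof -
      have "app (\<lambda>j. ?c * x j) = (\<lambda>i. ?c * app x i)" by (rule ext) (rule app_scale)
      then show ?thesis using L2_set_right_distrib[of ?c "app x" I] by simp
    qed
    ultimately have "?c * L2_set (app x) I \<le> L2_set (app y) I" by (simp only:)
    then show ?thesis using pos by (simp add: field_simps)
  qed
  have "d = L2_set (app y) I"
    unfolding l2_op_norm_def app_def[symmetric]
  proof (rule cSup_eq_maximum)
    show "L2_set (app y) I \<in> (\<lambda>x. L2_set (app x) I) ` {x. L2_set x J \<le> 1}" using y(1) by auto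
    fix z assume "z \<in> (\<lambda>x. L2_set (app x) I) ` {x. L2_set x J \<le> 1}"
    then obtain x where x: "z = L2_set (app x) I" "L2_set x J \<le> 1" by auto
    then show "z \<le> L2_set (app y) I" using b[of x] mult_left_mono[of "L2_set x J" 1 "L2_set (app y) I"] by simp
  qed
  then show "\<exists>y. L2_set y J = 1 \<and> L2_set (app y) I = d" "L2_set (app x) I \<le> d * L2_set x J"
    using y b by auto
qed

lemma sum_product_le: "(\<Sum>k\<in>K. f k * g k) \<le> L2_set f K * L2_set g K"
  by (rule order_trans[OF _ L2_set_mult_ineq]) (auto intro!: sum_mono simp: abs_mult[symmetric])

lemma L2_set_square: "(L2_set f K)\<^sup>2 = (\<Sum>k\<in>K. f k * f k)"
  by (simp add: L2_set_def sum_nonneg power2_eq_square)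

lemma d_pos: "0 < d"
proof -
  obtain i j where ij: "i \<in> I" "j \<in> J" "A i j \<noteq> 0" using A_nonzero by auto
  let ?x = "\<lambda>j'. if j' = j then 1 else 0 :: real"
  have "app ?x i = A i j" using ij by (simp add: app_def if_distrib cong: if_cong)
  then have "A i j \<le> L2_set (app ?x) I"
    using member_le_L2_set[of I i "\<lambda>i. \<bar>app ?x i\<bar>"] ij by (simp add: L2_set_abs)
  also have "\<dots> \<le> d * L2_set ?x J" by (rule app_bound)
  also have "L2_set ?x J = 1" using ij by (simp add: L2_set_def if_distrib[of "\<lambda>x. x^2"] cong: if_cong)
  finally show ?thesis using A_nonneg[OF ij(1,2)] ij(3) by simp
qed

text \<open>Duality: the squared length of \<open>cap u\<close> is the pairing of \<open>u\<close>
  with the matrix applied to \<open>cap u\<close>, to which Cauchy-Schwarz and the bound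
  \<open>d\<close> apply.\<close>

lemma cap_bound: "L2_set (cap u) J \<le> d * L2_set u I"
proof (cases "L2_set (cap u) J = 0")
  case True then show ?thesis using d_pos by simp
next
  case False
  then have pos: "0 < L2_set (cap u) J" by (simp add: order_less_le)
  have "L2_set (cap u) J * L2_set (cap u) J = (\<Sum>i\<in>I. u i * app (cap u) i)"
    using L2_set_square[of "cap u" J] by (simp add: adjoint power2_eq_square)
  also have "\<dots> \<le> L2_set u I * L2_set (app (cap u)) I" by (rule sum_product_le)
  also have "\<dots> \<le> L2_set u I * (d * L2_set (cap u) J)" by (intro mult_left_mono app_bound) simp
  finally have "L2_set (cap u) J * L2_set (cap u) J \<le> (d * L2_set u I) * L2_set (cap u) J" by (simp add: ac_simps)
  then show ?thesis using pos by simp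
qed

lemma transposed: "nonneg_matrix J I (\<lambda>j i. A i j)"
proof
  show "S = {} \<and> T = {} \<or> S = J \<and> T = I"
    if "S \<subseteq> J" "T \<subseteq> I" "\<And>i j. i \<in> J \<Longrightarrow> j \<in> I \<Longrightarrow> A j i \<noteq> 0 \<Longrightarrow> (i \<in> S) = (j \<in> T)" for S T
    using connected[of T S] that by blast
qed (use A_nonneg A_nonzero in auto)

lemma d_le_transposed: "l2_op_norm J I (\<lambda>j i. A i j) \<le> d"
proof -
  interpret T: nonneg_matrix J I "\<lambda>j i. A i j" by (rule transposed)
  obtain u where "L2_set u I = 1" "L2_set (T.app u) J = l2_op_norm J I (\<lambda>j i. A i j)"
    using T.norm_attained by blast
  moreover have "T.app u = cap u" by (rule ext) (simp add: T.app_def cap_def)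
  ultimately show ?thesis using cap_bound[of u] by simp
qed

text \<open>The supports of \<open>z\<close> and of \<open>app z\<close> are closed under the edges
  of the graph: nonnegativity passes positivity from \<open>J\<close> to \<open>I\<close>, the
  eigenvalue equation passes it back. Connectedness leaves only the full index sets.\<close>

lemma eigenvector_pos:
  assumes nn: "\<And>j. j \<in> J \<Longrightarrow> 0 \<le> z j" and ev: "\<And>j. j \<in> J \<Longrightarrow> cap (app z) j = d\<^sup>2 * z j"
    and nz: "\<exists>j\<in>J. z j \<noteq> 0"
  shows "\<And>j. j \<in> J \<Longrightarrow> 0 < z j" "\<And>i. i \<in> I \<Longrightarrow> 0 < app z i"
proof -
  define T where "T = {j\<in>J. 0 < z j}"
  define S where "S = {i\<in>I. 0 < app z i}"
  have app_nn: "0 \<le> app z i" if "i \<in> I" for i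
    unfolding app_def using nn A_nonneg that by (auto intro!: sum_nonneg)
  have "i \<in> S \<longleftrightarrow> j \<in> T" if ij: "i \<in> I" "j \<in> J" "A i j \<noteq> 0" for i j
  proof
    have Apos: "0 < A i j" using A_nonneg[OF ij(1,2)] ij(3) by simp
    show "j \<in> T" if "i \<in> S"
    proof -
      have "0 < A i j * app z i" using Apos that by (simp add: S_def)
      also have "\<dots> \<le> cap (app z) j"
        unfolding cap_def using ij app_nn A_nonneg by (intro member_le_sum) auto
      finally have "0 < z j" using ev ij d_pos by (simp add: zero_less_mult_iff)
      then show ?thesis using ij by (simp add: T_def)
    qed
    show "i \<in> S" if "j \<in> T"
    proof -
      have "0 < A i j * z j" using Apos that by (simp add: T_def)
      also have "\<dots> \<le> app z i"
        unfolding app_def using ij nn A_nonneg by (intro member_le_sum) auto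
      finally show ?thesis using ij by (simp add: S_def)
    qed
  qed
  then have "S = {} \<and> T = {} \<or> S = I \<and> T = J" by (intro connected) (auto simp: S_def T_def)
  moreover have "T \<noteq> {}" using nz nn by (force simp: T_def)
  ultimately have "S = I" "T = J" by auto
  then show "\<And>j. j \<in> J \<Longrightarrow> 0 < z j" "\<And>i. i \<in> I \<Longrightarrow> 0 < app z i" by (auto simp: S_def T_def)
qed

definition perron where
  "perron x \<longleftrightarrow> (\<forall>j\<in>J. 0 < x j) \<and> (\<forall>j. j \<notin> J \<longrightarrow> x j = 0) \<and> L2_set x J = 1 \<and>
    (\<forall>j\<in>J. cap (app x) j = d\<^sup>2 * x j)"

text \<open>As the entries are nonnegative, the moduli of a maximizing vector form a maximizing
  vector again. Maximality is equality in Cauchy-Schwarz and makes it an eigenvector, which is then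
  positive by connectedness.\<close>

lemma perron_exists: "\<exists>x. perron x"
proof -
  obtain y0 where y0: "L2_set y0 J = 1" "L2_set (app y0) I = d" using norm_attained by blast
  define y where "y j = (if j \<in> J then \<bar>y0 j\<bar> else 0)" for j
  have y1: "L2_set y J = 1" using y0(1) by (simp add: y_def L2_set_def)
  have "\<bar>app y0 i\<bar> \<le> app y i" if "i \<in> I" for i
  proof -
    have "\<bar>app y0 i\<bar> \<le> (\<Sum>j\<in>J. \<bar>A i j * y0 j\<bar>)" unfolding app_def by (rule sum_abs)
    also have "\<dots> = app y i" unfolding app_def
      by (rule sum.cong) (use that A_nonneg in \<open>auto simp: y_def abs_mult\<close>)
    finally show ?thesis .
  qed
  then have "L2_set (\<lambda>i. \<bar>app y0 i\<bar>) I \<le> L2_set (app y) I" by (intro L2_set_mono) auto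
  then have "d \<le> L2_set (app y) I" using y0(2) by (simp add: L2_set_abs)
  moreover have "L2_set (app y) I \<le> d" using app_bound[of y] y1 by simp
  ultimately have dy: "L2_set (app y) I = d" by simp
  define v where "v = cap (app y)"
  have "L2_set v J \<le> d * d" unfolding v_def using cap_bound[of "app y"] dy by simp
  then have "(L2_set v J)\<^sup>2 \<le> (d * d)\<^sup>2" by (intro power_mono) auto
  then have vv: "(\<Sum>j\<in>J. v j * v j) \<le> (d * d)\<^sup>2" by (simp add: L2_set_square)
  have yv: "(\<Sum>j\<in>J. y j * v j) = d\<^sup>2"
    using adjoint[of "app y" y] L2_set_square[of "app y" I] dy by (simp add: v_def)
  have yy: "(\<Sum>j\<in>J. y j * y j) = 1" using L2_set_square[of y J] y1 by simp
  \<comment> \<open>The distance of \<open>v\<close> to the multiple of \<open>y\<close>: the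
    pairing of \<open>y\<close> with \<open>v\<close> equals \<open>d\<^sup>2\<close> and the length
    of \<open>v\<close> is at most that, so the expanded square cannot be positive.\<close>
  have "(\<Sum>j\<in>J. (v j - d\<^sup>2 * y j)\<^sup>2) = (\<Sum>j\<in>J. v j * v j) - 2 * d\<^sup>2 * (\<Sum>j\<in>J. y j * v j) + (d\<^sup>2)\<^sup>2 * (\<Sum>j\<in>J. y j * y j)"
    by (simp add: power2_eq_square algebra_simps sum.distrib sum_subtractf sum_distrib_left)
  also have "\<dots> \<le> 0" unfolding yv yy using vv by (simp add: power2_eq_square)
  finally have "(\<Sum>j\<in>J. (v j - d\<^sup>2 * y j)\<^sup>2) = 0" by (intro antisym sum_nonneg) auto
  then have ev: "cap (app y) j = d\<^sup>2 * y j" if "j \<in> J" for j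
    using that by (simp add: sum_nonneg_eq_0_iff v_def)
  have "\<exists>j\<in>J. y j \<noteq> 0"
  proof (rule ccontr)
    assume "\<not> ?thesis"
    then have "L2_set y J = 0" by (simp add: L2_set_0')
    then show False using y1 by simp
  qed
  then have "0 < y j" if "j \<in> J" for j
    using eigenvector_pos(1)[of y j] ev that by (auto simp: y_def)
  then show ?thesis unfolding perron_def using ev y1 by (intro exI[of _ y]) (auto simp: y_def)
qed

text \<open>The largest multiple of \<open>x\<close> that keeps \<open>y\<close> nonnegative is
  subtracted. The remainder satisfies the same eigenvalue equation but has a zero entry, so it
  vanishes.\<close>

lemma perron_unique:
  assumes x: "perron x" and y: "perron y" shows "x = y"
proof -
  have J: "J \<noteq> {}" using A_nonzero by auto
  define m where "m = Min ((\<lambda>j. y j / x j) ` J)"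
  have px: "0 < x j" "0 < y j" if "j \<in> J" for j using x y that by (auto simp: perron_def)
  have m_le: "m \<le> y j / x j" if "j \<in> J" for j unfolding m_def using that by (intro Min_le) auto
  have "m \<in> (\<lambda>j. y j / x j) ` J" unfolding m_def using J by (intro Min_in) auto
  then obtain j0 where j0: "j0 \<in> J" "m = y j0 / x j0" by auto
  define z where "z j = y j + (- m) * x j" for j
  have z0: "z j0 = 0" using j0 px[of j0] by (simp add: z_def)
  have znn: "0 \<le> z j" if "j \<in> J" for j
    using m_le[OF that] px[OF that] by (simp add: z_def field_simps)
  have "app z = (\<lambda>i. app y i + (- m) * app x i)" unfolding z_def by (rule ext) (rule app_add)
  then have capz: "cap (app z) j = cap (app y) j + (- m) * cap (app x) j" for j by (simp only: cap_add)
  have ev: "cap (app z) j = d\<^sup>2 * z j" if "j \<in> J" for j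
  proof -
    have "cap (app x) j = d\<^sup>2 * x j" "cap (app y) j = d\<^sup>2 * y j" using x y that by (auto simp: perron_def)
    then show ?thesis unfolding capz z_def by (simp add: algebra_simps)
  qed
  have "\<not> (\<exists>j\<in>J. z j \<noteq> 0)"
    using eigenvector_pos(1)[OF znn ev _ j0(1)] z0 by auto
  then have yx: "y j = m * x j" if "j \<in> J" for j using that by (auto simp: z_def)
  have mpos: "0 < m" using j0 px by simp
  have "L2_set y J = L2_set (\<lambda>j. m * x j) J" by (rule L2_set_cong) (use yx in auto)
  also have "\<dots> = m * L2_set x J" using mpos by (simp add: L2_set_right_distrib)
  finally have "m = 1" using x y by (simp add: perron_def)
  show ?thesis
  proof
    show "x j = y j" for j
      using yx[of j] x y \<open>m = 1\<close> by (cases "j \<in> J") (auto simp: perron_def)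
  qed
qed

lemma positive_eigenvector_eq:
  assumes "perron x"
  shows "positive_eigenvector J (\<lambda>j j'. \<Sum>i\<in>I. A i j * A i j') (d\<^sup>2) = x"
proof -
  have "(\<Sum>j'\<in>J. (\<Sum>i\<in>I. A i j * A i j') * x j') = cap (app x) j" for j x
  proof -
    have "(\<Sum>j'\<in>J. (\<Sum>i\<in>I. A i j * A i j') * x j') = (\<Sum>j'\<in>J. \<Sum>i\<in>I. A i j * (A i j' * x j'))"
      by (simp add: sum_distrib_right mult.assoc)
    also have "\<dots> = (\<Sum>i\<in>I. \<Sum>j'\<in>J. A i j * (A i j' * x j'))" by (rule sum.swap)
    finally show ?thesis by (simp add: cap_def app_def sum_distrib_left)
  qed
  then have eq: "positive_eigenvector J (\<lambda>j j'. \<Sum>i\<in>I. A i j * A i j') (d\<^sup>2) = (THE x. perron x)"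
    by (simp add: positive_eigenvector_def perron_def)
  show ?thesis unfolding eq using assms perron_unique by blast
qed

end

lemma (in nonneg_matrix) d_transposed: "l2_op_norm J I (\<lambda>j i. A i j) = d"
  using d_le_transposed nonneg_matrix.d_le_transposed[OF transposed] by simp

text \<open>Beyond positivity, \<nu> and \<mu> are shown to be a pair of singular vectors: the
  matrix maps \<nu> to \<open>d\<close> times \<mu>, and the transpose maps \<mu> to
  \<open>d\<close> times \<nu>.\<close>

theorem (in nonneg_matrix) perron_frobenius:
  defines "\<nu> \<equiv> positive_eigenvector J (\<lambda>j j'. \<Sum>i\<in>I. A i j * A i j') (d\<^sup>2)"
    and "\<mu> \<equiv> positive_eigenvector I (\<lambda>i i'. \<Sum>j\<in>J. A i j * A i' j) (d\<^sup>2)"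
  shows "0 < d" "j \<in> J \<Longrightarrow> 0 < \<nu> j" "i \<in> I \<Longrightarrow> 0 < \<mu> i" "(\<Sum>j\<in>J. (\<nu> j)\<^sup>2) = 1" "(\<Sum>i\<in>I. (\<mu> i)\<^sup>2) = 1"
    "i \<in> I \<Longrightarrow> (\<Sum>j\<in>J. A i j * \<nu> j) = d * \<mu> i" "j \<in> J \<Longrightarrow> (\<Sum>i\<in>I. A i j * \<mu> i) = d * \<nu> j"
proof -
  interpret T: nonneg_matrix J I "\<lambda>j i. A i j" by (rule transposed)
  obtain x where x: "perron x" using perron_exists by blast
  have \<nu>: "\<nu> = x" unfolding \<nu>_def by (rule positive_eigenvector_eq[OF x])
  have xD: "\<And>j. j \<in> J \<Longrightarrow> 0 < x j" "L2_set x J = 1" "\<And>j. j \<in> J \<Longrightarrow> cap (app x) j = d\<^sup>2 * x j"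
    using x by (auto simp: perron_def)
  have J: "\<exists>j\<in>J. x j \<noteq> 0" using xD(1) A_nonzero by force
  have app_pos: "0 < app x i" if "i \<in> I" for i
    using eigenvector_pos(2)[of x] xD J that by (simp add: less_imp_le)
  have Tapp: "T.app = cap" "T.cap = app"
    by (auto simp: fun_eq_iff T.app_def T.cap_def app_def cap_def)
  \<comment> \<open>The normalized image of \<nu>. It meets the conditions that characterize \<mu>,
    and uniqueness makes it equal to \<mu>.\<close>
  define y where "y i = (if i \<in> I then app x i / d else 0)" for i
  have cy: "cap y j = d * x j" if "j \<in> J" for j
  proof -
    have "cap y j = cap (\<lambda>i. (1 / d) * app x i) j" unfolding cap_def by (rule sum.cong) (auto simp: y_def)
    also have "\<dots> = d * x j" unfolding cap_scale using xD(3)[OF that] d_pos by (simp add: power2_eq_square)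
    finally show ?thesis .
  qed
  have "T.perron y"
    unfolding T.perron_def Tapp d_transposed
  proof (intro conjI ballI allI impI)
    show "0 < y i" if "i \<in> I" for i using app_pos[OF that] d_pos that by (simp add: y_def)
    show "y i = 0" if "i \<notin> I" for i using that by (simp add: y_def)
    have "(L2_set (app x) I)\<^sup>2 = (\<Sum>j\<in>J. x j * cap (app x) j)"
      by (simp add: L2_set_square adjoint)
    also have "\<dots> = (\<Sum>j\<in>J. d\<^sup>2 * (x j * x j))" by (rule sum.cong) (auto simp: xD(3))
    also have "\<dots> = d\<^sup>2" using L2_set_square[of x J] xD(2) by (simp flip: sum_distrib_left)
    finally have "L2_set (app x) I = d" using d_pos by (simp add: power2_eq_iff_nonneg)
    moreover have "L2_set y I = (1 / d) * L2_set (app x) I"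
      using d_pos by (subst L2_set_right_distrib) (auto intro!: L2_set_cong simp: y_def)
    ultimately show "L2_set y I = 1" using d_pos by simp
    show "app (cap y) i = d\<^sup>2 * y i" if "i \<in> I" for i
    proof -
      have "app (cap y) i = app (\<lambda>j. d * x j) i" by (rule app_cong) (rule cy)
      then show ?thesis using that d_pos by (simp add: app_scale y_def power2_eq_square)
    qed
  qed
  then have \<mu>: "\<mu> = y" unfolding \<mu>_def using T.positive_eigenvector_eq[of y] by (simp add: d_transposed)
  show "0 < d" by (rule d_pos)
  show "j \<in> J \<Longrightarrow> 0 < \<nu> j" using xD by (simp add: \<nu>)
  show "i \<in> I \<Longrightarrow> 0 < \<mu> i" using app_pos d_pos by (simp add: \<mu> y_def)
  show "(\<Sum>j\<in>J. (\<nu> j)\<^sup>2) = 1" using L2_set_square[of x J] xD(2) by (simp add: \<nu> power2_eq_square)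
  show "(\<Sum>i\<in>I. (\<mu> i)\<^sup>2) = 1"
    using T.L2_set_square[of y I] \<open>T.perron y\<close> by (simp add: \<mu> T.perron_def power2_eq_square)
  show "i \<in> I \<Longrightarrow> (\<Sum>j\<in>J. A i j * \<nu> j) = d * \<mu> i" using d_pos by (simp add: \<nu> \<mu> y_def app_def)
  show "j \<in> J \<Longrightarrow> (\<Sum>i\<in>I. A i j * \<mu> i) = d * \<nu> j" using cy[of j] by (simp add: \<nu> \<mu> cap_def)
qed

text \<open>
  The equality case comes from the sum of squares of
  \<open>sqrt \<sigma> * \<nu> j * sqrt (a i j) - sqrt \<rho> * \<mu> i * sqrt (b i j)\<close>.
\<close>

lemma (in nonneg_matrix) weighted_bound:
  defines "\<nu> \<equiv> positive_eigenvector J (\<lambda>j j'. \<Sum>i\<in>I. A i j * A i j') (d\<^sup>2)"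
    and "\<mu> \<equiv> positive_eigenvector I (\<lambda>i i'. \<Sum>j\<in>J. A i j * A i' j) (d\<^sup>2)"
  assumes nn: "\<And>i j. i \<in> I \<Longrightarrow> j \<in> J \<Longrightarrow> 0 \<le> a i j" "\<And>i j. i \<in> I \<Longrightarrow> j \<in> J \<Longrightarrow> 0 \<le> b i j"
    and ab: "\<And>i j. i \<in> I \<Longrightarrow> j \<in> J \<Longrightarrow> (A i j)\<^sup>2 \<le> a i j * b i j"
    and \<rho>: "\<And>j. j \<in> J \<Longrightarrow> (\<Sum>i\<in>I. a i j) \<le> \<rho>" and \<sigma>: "\<And>i. i \<in> I \<Longrightarrow> (\<Sum>j\<in>J. b i j) \<le> \<sigma>"
    and "0 \<le> \<rho>" "0 \<le> \<sigma>"
  shows "d\<^sup>2 \<le> \<rho> * \<sigma>"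
    "\<lbrakk>\<rho> * \<sigma> = d\<^sup>2; i \<in> I; j \<in> J\<rbrakk> \<Longrightarrow> a i j * b i j = (A i j)\<^sup>2 \<and> b i j = sqrt (\<sigma> / \<rho>) * A i j * \<nu> j / \<mu> i"
proof -
  note pf = perron_frobenius[folded \<nu>_def \<mu>_def]
  \<comment> \<open>The squares of \<nu> and of \<mu> are probability weights, so averaging turns
    the bounds on column sums of \<open>a\<close> and row sums of \<open>b\<close> into bounds on
    the square sums of \<alpha> and \<beta>.\<close>
  define \<alpha> where "\<alpha> i j = \<nu> j * sqrt (a i j)" for i j
  define \<beta> where "\<beta> i j = \<mu> i * sqrt (b i j)" for i j
  let ?S = "\<lambda>f. \<Sum>i\<in>I. \<Sum>j\<in>J. f i j :: real"
  \<comment> \<open>The norm is attained at the pair of singular vectors.\<close>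
  have dsum: "d = ?S (\<lambda>i j. \<mu> i * \<nu> j * A i j)"
  proof -
    have "?S (\<lambda>i j. \<mu> i * \<nu> j * A i j) = (\<Sum>i\<in>I. \<mu> i * (\<Sum>j\<in>J. A i j * \<nu> j))"
      by (simp add: sum_distrib_left ac_simps)
    also have "\<dots> = (\<Sum>i\<in>I. d * (\<mu> i)\<^sup>2)" by (rule sum.cong) (auto simp: pf(6) power2_eq_square)
    also have "\<dots> = d" using pf(5) by (simp flip: sum_distrib_left)
    finally show ?thesis ..
  qed
  have term_le: "\<mu> i * \<nu> j * A i j \<le> \<alpha> i j * \<beta> i j" if "i \<in> I" "j \<in> J" for i j
  proof -
    have "A i j \<le> sqrt (a i j * b i j)" using ab[OF that] by (rule real_le_rsqrt)
    then have "\<mu> i * \<nu> j * A i j \<le> \<mu> i * \<nu> j * sqrt (a i j * b i j)"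
      using pf(2)[OF that(2)] pf(3)[OF that(1)] by (intro mult_left_mono) auto
    then show ?thesis by (simp add: \<alpha>_def \<beta>_def real_sqrt_mult ac_simps)
  qed
  then have d_le: "d \<le> ?S (\<lambda>i j. \<alpha> i j * \<beta> i j)" unfolding dsum by (intro sum_mono) auto
  have Q: "?S (\<lambda>i j. (\<alpha> i j)\<^sup>2) \<le> \<rho>"
  proof -
    have "?S (\<lambda>i j. (\<alpha> i j)\<^sup>2) = (\<Sum>j\<in>J. \<Sum>i\<in>I. (\<alpha> i j)\<^sup>2)" by (rule sum.swap)
    also have "\<dots> = (\<Sum>j\<in>J. (\<nu> j)\<^sup>2 * (\<Sum>i\<in>I. a i j))"
      by (simp add: sum_distrib_left \<alpha>_def power_mult_distrib nn)
    also have "\<dots> \<le> (\<Sum>j\<in>J. (\<nu> j)\<^sup>2 * \<rho>)" by (intro sum_mono mult_left_mono \<rho>) auto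
    also have "\<dots> = \<rho>" using pf(4) by (simp flip: sum_distrib_right)
    finally show ?thesis .
  qed
  have P: "?S (\<lambda>i j. (\<beta> i j)\<^sup>2) \<le> \<sigma>"
  proof -
    have "?S (\<lambda>i j. (\<beta> i j)\<^sup>2) = (\<Sum>i\<in>I. (\<mu> i)\<^sup>2 * (\<Sum>j\<in>J. b i j))"
      by (simp add: sum_distrib_left \<beta>_def power_mult_distrib nn)
    also have "\<dots> \<le> (\<Sum>i\<in>I. (\<mu> i)\<^sup>2 * \<sigma>)" by (intro sum_mono mult_left_mono \<sigma>) auto
    also have "\<dots> = \<sigma>" using pf(5) by (simp flip: sum_distrib_right)
    finally show ?thesis .
  qed
  define R where "R = sqrt \<rho>"
  define s where "s = sqrt \<sigma>"
  have Rs: "R * R = \<rho>" "s * s = \<sigma>" "0 \<le> R" "0 \<le> s" using assms(8,9) by (auto simp: R_def s_def)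
  have sq: "?S (\<lambda>i j. (s * \<alpha> i j - R * \<beta> i j)\<^sup>2) =
      \<sigma> * ?S (\<lambda>i j. (\<alpha> i j)\<^sup>2) + \<rho> * ?S (\<lambda>i j. (\<beta> i j)\<^sup>2) - 2 * (R * s) * ?S (\<lambda>i j. \<alpha> i j * \<beta> i j)"
    by (simp add: power2_eq_square algebra_simps sum.distrib sum_subtractf sum_distrib_left flip: Rs(1,2))
  have sq_nn: "0 \<le> ?S (\<lambda>i j. (s * \<alpha> i j - R * \<beta> i j)\<^sup>2)" by (intro sum_nonneg) auto
  have "\<sigma> * ?S (\<lambda>i j. (\<alpha> i j)\<^sup>2) \<le> \<sigma> * \<rho>" "\<rho> * ?S (\<lambda>i j. (\<beta> i j)\<^sup>2) \<le> \<rho> * \<sigma>"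
    using P Q assms(8,9) by (auto intro: mult_left_mono)
  then have key: "2 * (R * s) * ?S (\<lambda>i j. \<alpha> i j * \<beta> i j) + ?S (\<lambda>i j. (s * \<alpha> i j - R * \<beta> i j)\<^sup>2) \<le> 2 * (\<rho> * \<sigma>)"
    unfolding sq by (simp add: mult.commute)
  have RsRs: "\<rho> * \<sigma> = (R * s) * (R * s)" by (simp add: ac_simps flip: Rs(1,2))
  \<comment> \<open>Division by \<open>R * s\<close> is impossible if \<rho> or \<sigma> vanishes;
    then \<alpha> or \<beta> vanishes identically, and so does the sum that bounds
    \<open>d\<close>.\<close>
  have dRs: "d \<le> R * s"
  proof (cases "R * s = 0")
    case True
    have pos: "0 \<le> ?S (\<lambda>i j. (\<alpha> i j)\<^sup>2)" "0 \<le> ?S (\<lambda>i j. (\<beta> i j)\<^sup>2)" by (intro sum_nonneg; simp)+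
    have "\<rho> = 0 \<or> \<sigma> = 0" using True Rs by auto
    then have "?S (\<lambda>i j. (\<alpha> i j)\<^sup>2) = 0 \<or> ?S (\<lambda>i j. (\<beta> i j)\<^sup>2) = 0" using P Q pos by linarith
    then have "\<forall>i\<in>I. \<forall>j\<in>J. \<alpha> i j * \<beta> i j = 0"
      by (auto simp: sum_nonneg_eq_0_iff sum_nonneg)
    then have "?S (\<lambda>i j. \<alpha> i j * \<beta> i j) = 0" by (intro sum.neutral ballI) auto
    then show ?thesis using d_le True by linarith
  next
    case False
    then have Rs0: "0 < 2 * (R * s)" using Rs by (simp add: order_less_le)
    have "(2 * (R * s)) * ?S (\<lambda>i j. \<alpha> i j * \<beta> i j) \<le> (2 * (R * s)) * (R * s)"
      using key sq_nn unfolding RsRs by simp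
    then have "?S (\<lambda>i j. \<alpha> i j * \<beta> i j) \<le> R * s" using Rs0 by (rule mult_left_le_imp_le)
    then show ?thesis using d_le by simp
  qed
  then have "d * d \<le> (R * s) * (R * s)" using pf(1) by (intro mult_mono) auto
  then show "d\<^sup>2 \<le> \<rho> * \<sigma>" unfolding RsRs by (simp add: power2_eq_square)
  assume eq: "\<rho> * \<sigma> = d\<^sup>2" and ij: "i \<in> I" "j \<in> J"
  have Rsd: "R * s = d"
    using eq RsRs pf(1) Rs by (metis less_imp_le mult_nonneg_nonneg power2_eq_iff_nonneg power2_eq_square)
  have Rpos: "0 < R" "0 < s" using Rsd pf(1) Rs by (auto simp: order_less_le)
  let ?\<Sigma> = "?S (\<lambda>i j. \<alpha> i j * \<beta> i j)"
  have key': "2 * d * ?\<Sigma> + ?S (\<lambda>i j. (s * \<alpha> i j - R * \<beta> i j)\<^sup>2) \<le> 2 * d * d"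
    using key unfolding Rsd eq by (simp add: power2_eq_square)
  then have "(2 * d) * ?\<Sigma> \<le> (2 * d) * d" using sq_nn by simp
  then have "?\<Sigma> \<le> d" using pf(1) by simp
  then have \<Sigma>d: "?\<Sigma> = d" using d_le by simp
  then have "?S (\<lambda>i j. (s * \<alpha> i j - R * \<beta> i j)\<^sup>2) = 0" using key' sq_nn by simp
  then have "(\<Sum>j\<in>J. (s * \<alpha> i j - R * \<beta> i j)\<^sup>2) = 0"
    using ij by (subst (asm) sum_nonneg_eq_0_iff) (auto intro: sum_nonneg)
  then have 1: "s * \<alpha> i j = R * \<beta> i j" using ij by (simp add: sum_nonneg_eq_0_iff)
  \<comment> \<open>The second defect: the termwise gaps between \<open>a i j * b i j\<close> and
    the squared entry are nonnegative and now also sum to zero.\<close>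
  have "?S (\<lambda>i j. \<alpha> i j * \<beta> i j - \<mu> i * \<nu> j * A i j) = 0"
    using \<Sigma>d dsum by (simp add: sum_subtractf)
  then have "(\<Sum>j\<in>J. \<alpha> i j * \<beta> i j - \<mu> i * \<nu> j * A i j) = 0"
    using ij term_le by (subst (asm) sum_nonneg_eq_0_iff) (auto intro!: sum_nonneg)
  then have "\<alpha> i j * \<beta> i j = \<mu> i * \<nu> j * A i j"
    using ij term_le by (subst (asm) sum_nonneg_eq_0_iff) auto
  then have "\<mu> i * \<nu> j * (sqrt (a i j) * sqrt (b i j)) = \<mu> i * \<nu> j * A i j" by (simp add: \<alpha>_def \<beta>_def ac_simps)
  then have 2: "sqrt (a i j) * sqrt (b i j) = A i j" using pf(2)[OF ij(2)] pf(3)[OF ij(1)] by simp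
  have "(sqrt (a i j) * sqrt (b i j))\<^sup>2 = a i j * b i j" using nn ij by (simp add: power_mult_distrib)
  then have 3: "a i j * b i j = (A i j)\<^sup>2" using 2 by simp
  have "R * \<mu> i * b i j = (R * \<beta> i j) * sqrt (b i j)" using nn(2)[OF ij] by (simp add: \<beta>_def)
  also have "\<dots> = s * \<nu> j * A i j" unfolding 1[symmetric] 2[symmetric] by (simp add: \<alpha>_def)
  finally have "b i j = (s / R) * A i j * \<nu> j / \<mu> i" using Rpos pf(3)[OF ij(1)] by (simp add: field_simps)
  moreover have "s / R = sqrt (\<sigma> / \<rho>)" by (simp add: s_def R_def real_sqrt_divide)
  ultimately show "a i j * b i j = (A i j)\<^sup>2 \<and> b i j = sqrt (\<sigma> / \<rho>) * A i j * \<nu> j / \<mu> i" using 3 by simp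
qed

section \<open>Connected arrows\<close>

context conj_pair
begin

text \<open>\<open>p\<close> already sits between \<open>Xb\<close> and \<open>X\<close> on both
  sides. Only \<open>q\<close> has to travel: it passes from the left of \<open>r\<close> to its
  right through the unit arrow below.\<close>

lemma middle_slide:
  assumes p: "p \<in> center C M" and q: "q \<in> center C N"
  shows "((q \<boxtimes> \<^bold>1 Xb \<boxtimes> p) \<boxtimes> \<^bold>1 X) \<cdot> r = (\<^bold>1 Xb \<boxtimes> (p \<boxtimes> \<^bold>1 X \<boxtimes> q)) \<cdot> r"
proof -
  have [simp]: "p \<in> Arr2 C" "dom2 C p = \<^bold>I M" "cod2 C p = \<^bold>I M" "q \<in> Arr2 C" "dom2 C q = \<^bold>I N" "cod2 C q = \<^bold>I N"
    using p q by (auto simp: center_iff)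
  define m where "m = \<^bold>1 Xb \<boxtimes> p \<boxtimes> \<^bold>1 X"
  have [simp]: "m \<in> Arr2 C" "dom2 C m = Xb \<boxdot> X" "cod2 C m = Xb \<boxdot> X" by (simp_all add: m_def)
  have "((q \<boxtimes> \<^bold>1 Xb \<boxtimes> p) \<boxtimes> \<^bold>1 X) \<cdot> r = (q \<boxtimes> m) \<cdot> (\<^bold>1 (\<^bold>I N) \<boxtimes> r)" by (simp add: m_def)
  also have "\<dots> = q \<boxtimes> (m \<cdot> r)" by (subst interchange') auto
  also have "\<dots> = (m \<cdot> r) \<cdot> q" using slide(2)[of "m \<cdot> r" q] by simp
  also have "\<dots> = (m \<cdot> r) \<boxtimes> q" using slide(1)[of q "m \<cdot> r"] by simp
  also have "\<dots> = (m \<boxtimes> q) \<cdot> (r \<boxtimes> \<^bold>1 (\<^bold>I N))" by (subst interchange') auto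
  also have "\<dots> = (\<^bold>1 Xb \<boxtimes> (p \<boxtimes> \<^bold>1 X \<boxtimes> q)) \<cdot> r" by (simp add: m_def)
  finally show ?thesis .
qed

text \<open>How a central element acts on \<open>Xb\<close> depends only on how it acts on
  \<open>X\<close>, so the choice of preimages of the central projections is harmless.\<close>

lemma center_transport_cong:
  assumes "p \<in> center C M" "p' \<in> center C M" "p \<boxtimes> \<^bold>1 X = p' \<boxtimes> \<^bold>1 X"
  shows "\<^bold>1 Xb \<boxtimes> p = \<^bold>1 Xb \<boxtimes> p'"
  by (rule trans[OF center_transport[OF assms(1)] trans[OF _ center_transport[OF assms(2), symmetric]]])
    (simp only: assms(3))

lemma center_transport_left_cong:
  assumes "q \<in> center C N" "q' \<in> center C N" "\<^bold>1 X \<boxtimes> q = \<^bold>1 X \<boxtimes> q'"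
  shows "q \<boxtimes> \<^bold>1 Xb = q' \<boxtimes> \<^bold>1 Xb"
  by (rule trans[OF center_transport_left[OF assms(1)] trans[OF _ center_transport_left[OF assms(2), symmetric]]])
    (simp only: assms(3))

text \<open>\<open>p\<close> and \<open>q\<close> themselves need not be projections, only their
  actions on \<open>X\<close> are. The projection identities are therefore transported to
  \<open>Xb\<close> factor by factor.\<close>

lemma projection_transport:
  assumes p: "p \<in> center C M" "(p \<boxtimes> \<^bold>1 X) \<cdot> (p \<boxtimes> \<^bold>1 X) = p \<boxtimes> \<^bold>1 X" "(p \<boxtimes> \<^bold>1 X)\<^sup>\<dagger> = p \<boxtimes> \<^bold>1 X"
    and q: "q \<in> center C N" "(\<^bold>1 X \<boxtimes> q) \<cdot> (\<^bold>1 X \<boxtimes> q) = \<^bold>1 X \<boxtimes> q" "(\<^bold>1 X \<boxtimes> q)\<^sup>\<dagger> = \<^bold>1 X \<boxtimes> q"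
  shows "(q \<boxtimes> \<^bold>1 Xb \<boxtimes> p) \<cdot> (q \<boxtimes> \<^bold>1 Xb \<boxtimes> p) = q \<boxtimes> \<^bold>1 Xb \<boxtimes> p" "(q \<boxtimes> \<^bold>1 Xb \<boxtimes> p)\<^sup>\<dagger> = q \<boxtimes> \<^bold>1 Xb \<boxtimes> p"
proof -
  have [simp]: "p \<in> Arr2 C" "dom2 C p = \<^bold>I M" "cod2 C p = \<^bold>I M" "q \<in> Arr2 C" "dom2 C q = \<^bold>I N" "cod2 C q = \<^bold>I N"
    using p q by (auto simp: center_iff)
  have pp: "p \<cdot> p \<in> center C M" "p\<^sup>\<dagger> \<in> center C M" and qq: "q \<cdot> q \<in> center C N" "q\<^sup>\<dagger> \<in> center C N"
    by (simp_all add: center_iff)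
  have "(p \<cdot> p) \<boxtimes> \<^bold>1 X = p \<boxtimes> \<^bold>1 X" "p\<^sup>\<dagger> \<boxtimes> \<^bold>1 X = p \<boxtimes> \<^bold>1 X" using p(2,3) by (simp_all add: merge)
  then have p': "\<^bold>1 Xb \<boxtimes> (p \<cdot> p) = \<^bold>1 Xb \<boxtimes> p" "\<^bold>1 Xb \<boxtimes> p\<^sup>\<dagger> = \<^bold>1 Xb \<boxtimes> p"
    using center_transport_cong[OF pp(1) p(1)] center_transport_cong[OF pp(2) p(1)] by simp_all
  have "\<^bold>1 X \<boxtimes> (q \<cdot> q) = \<^bold>1 X \<boxtimes> q" "\<^bold>1 X \<boxtimes> q\<^sup>\<dagger> = \<^bold>1 X \<boxtimes> q" using q(2,3) by (simp_all add: merge)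
  then have q': "(q \<cdot> q) \<boxtimes> \<^bold>1 Xb = q \<boxtimes> \<^bold>1 Xb" "q\<^sup>\<dagger> \<boxtimes> \<^bold>1 Xb = q \<boxtimes> \<^bold>1 Xb"
    using center_transport_left_cong[OF qq(1) q(1)] center_transport_left_cong[OF qq(2) q(1)] by simp_all
  have "(q \<boxtimes> \<^bold>1 Xb \<boxtimes> p) \<cdot> (q \<boxtimes> \<^bold>1 Xb \<boxtimes> p) = (q \<cdot> q) \<boxtimes> (\<^bold>1 Xb \<boxtimes> (p \<cdot> p))" by (simp add: merge)
  also have "\<dots> = ((q \<cdot> q) \<boxtimes> \<^bold>1 Xb) \<boxtimes> p" unfolding p'(1) by simp
  finally show "(q \<boxtimes> \<^bold>1 Xb \<boxtimes> p) \<cdot> (q \<boxtimes> \<^bold>1 Xb \<boxtimes> p) = q \<boxtimes> \<^bold>1 Xb \<boxtimes> p" unfolding q'(1) by simp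
  have "(q \<boxtimes> \<^bold>1 Xb \<boxtimes> p)\<^sup>\<dagger> = q\<^sup>\<dagger> \<boxtimes> (\<^bold>1 Xb \<boxtimes> p\<^sup>\<dagger>)" by simp
  also have "\<dots> = (q\<^sup>\<dagger> \<boxtimes> \<^bold>1 Xb) \<boxtimes> p" unfolding p'(2) by simp
  finally show "(q \<boxtimes> \<^bold>1 Xb \<boxtimes> p)\<^sup>\<dagger> = q \<boxtimes> \<^bold>1 Xb \<boxtimes> p" unfolding q'(2) by simp
qed

end

section \<open>A nonzero connected arrow and its minimal central projections\<close>

locale connected_pair = conj_pair +
  assumes rigid: "rigid C" and fdc: "finite_dimensional_centers C"
    and conn: "connected_arr C X" and nz: "\<^bold>1 X \<noteq> zero2 C X X"
begin

abbreviation E where "E \<equiv> right_projections C X"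
abbreviation F where "F \<equiv> left_projections C X"
abbreviation D where "D \<equiv> matrix_dim C X"

lemmas right_algebra = right_center_algebra[OF typing(1)]
lemmas left_algebra = left_center_algebra[OF typing(1)]
lemmas right_span = right_center_spanned[OF fdc typing(1)]
lemmas left_span = left_center_spanned[OF fdc typing(1)]

lemma parXX: "parallel X X" by (simp add: parallel_def)

lemma E_props:
  "finite E" "hsum X X (\<lambda>e. e) E = \<^bold>1 X"
  "e \<in> E \<Longrightarrow> e \<in> Arr2 C" "e \<in> E \<Longrightarrow> dom2 C e = X" "e \<in> E \<Longrightarrow> cod2 C e = X"
  "e \<in> E \<Longrightarrow> e \<cdot> e = e" "e \<in> E \<Longrightarrow> e\<^sup>\<dagger> = e" "e \<in> E \<Longrightarrow> e \<noteq> zero2 C X X" "e \<in> E \<Longrightarrow> e \<in> right_center C X"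
  "e \<in> E \<Longrightarrow> e' \<in> E \<Longrightarrow> e \<noteq> e' \<Longrightarrow> e \<cdot> e' = zero2 C X X"
proof -
  note R = resolution_minimal_projections[OF right_algebra right_span]
  show "finite E" "hsum X X (\<lambda>e. e) E = \<^bold>1 X"
    "e \<in> E \<Longrightarrow> e' \<in> E \<Longrightarrow> e \<noteq> e' \<Longrightarrow> e \<cdot> e' = zero2 C X X"
    using R unfolding resolution_def by blast+
  assume e: "e \<in> E"
  note m = minimal_projectionD[OF e]
  show "e \<in> Arr2 C" "dom2 C e = X" "cod2 C e = X"
    by (rule star_algebraD(9-)[OF right_algebra m(1)])+
  show "e \<cdot> e = e" "e\<^sup>\<dagger> = e" "e \<noteq> zero2 C X X" "e \<in> right_center C X" by (rule m(1-4))+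
qed

lemma F_props:
  "finite F" "hsum X X (\<lambda>f. f) F = \<^bold>1 X"
  "f \<in> F \<Longrightarrow> f \<in> Arr2 C" "f \<in> F \<Longrightarrow> dom2 C f = X" "f \<in> F \<Longrightarrow> cod2 C f = X"
  "f \<in> F \<Longrightarrow> f \<cdot> f = f" "f \<in> F \<Longrightarrow> f\<^sup>\<dagger> = f" "f \<in> F \<Longrightarrow> f \<noteq> zero2 C X X" "f \<in> F \<Longrightarrow> f \<in> left_center C X"
  "f \<in> F \<Longrightarrow> f' \<in> F \<Longrightarrow> f \<noteq> f' \<Longrightarrow> f \<cdot> f' = zero2 C X X"
proof -
  note R = resolution_minimal_projections[OF left_algebra left_span]
  show "finite F" "hsum X X (\<lambda>f. f) F = \<^bold>1 X"
    "f \<in> F \<Longrightarrow> f' \<in> F \<Longrightarrow> f \<noteq> f' \<Longrightarrow> f \<cdot> f' = zero2 C X X"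
    using R unfolding resolution_def by blast+
  assume f: "f \<in> F"
  note m = minimal_projectionD[OF f]
  show "f \<in> Arr2 C" "dom2 C f = X" "cod2 C f = X"
    by (rule star_algebraD(9-)[OF left_algebra m(1)])+
  show "f \<cdot> f = f" "f\<^sup>\<dagger> = f" "f \<noteq> zero2 C X X" "f \<in> left_center C X" by (rule m(1-4))+
qed

lemma E_preimage: "e \<in> E \<Longrightarrow> \<exists>p\<in>center C M. p \<boxtimes> \<^bold>1 X = e"
  using E_props(9)[of e] by (auto simp: right_center_def)

lemma F_preimage: "f \<in> F \<Longrightarrow> \<exists>q\<in>center C N. \<^bold>1 X \<boxtimes> q = f"
  using F_props(9)[of f] by (auto simp: left_center_def)

lemma center_product:
  assumes "p \<in> center C M" "q \<in> center C N"
  shows "(p \<boxtimes> \<^bold>1 X) \<cdot> (\<^bold>1 X \<boxtimes> q) = p \<boxtimes> \<^bold>1 X \<boxtimes> q" "(\<^bold>1 X \<boxtimes> q) \<cdot> (p \<boxtimes> \<^bold>1 X) = p \<boxtimes> \<^bold>1 X \<boxtimes> q"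
  using assms slide[of "\<^bold>1 X \<boxtimes> q" p] by (simp_all add: center_iff)

lemma EF_commute: "e \<in> E \<Longrightarrow> f \<in> F \<Longrightarrow> f \<cdot> e = e \<cdot> f"
  using E_preimage[of e] F_preimage[of f] center_product by force

lemma nrm_E: "e \<in> E \<Longrightarrow> nrm e = 1" and nrm_F: "f \<in> F \<Longrightarrow> nrm f = 1"
proof -
  have *: "nrm p = 1" if "p \<in> Arr2 C" "dom2 C p = X" "cod2 C p = X" "p \<cdot> p = p" "p\<^sup>\<dagger> = p" "p \<noteq> zero2 C X X" for p
  proof -
    have "nrm p = (nrm p)\<^sup>2" using nrm_star[of p] that by simp
    moreover have "nrm p \<noteq> 0" using nrm_zero_iff[of p] that by simp
    ultimately show ?thesis by (simp add: power2_eq_square)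
  qed
  show "e \<in> E \<Longrightarrow> nrm e = 1" using *[of e] E_props(3-8)[of e] by blast
  show "f \<in> F \<Longrightarrow> nrm f = 1" using *[of f] F_props(3-8)[of f] by blast
qed

lemma E_nonempty: "E \<noteq> {}" and F_nonempty: "F \<noteq> {}"
  using E_props(2) F_props(2) nz parXX by auto

text \<open>If \<open>S\<close> and \<open>T\<close> are unions of connected components, then the sum over \<open>S\<close> equals the sum over
  \<open>T\<close>, so that it lies in both centers.\<close>

lemma irreducible:
  assumes ST: "S \<subseteq> E" "T \<subseteq> F" and closed: "\<And>e f. e \<in> E \<Longrightarrow> f \<in> F \<Longrightarrow> e \<cdot> f \<noteq> zero2 C X X \<Longrightarrow> e \<in> S \<longleftrightarrow> f \<in> T"
  shows "S = {} \<and> T = {} \<or> S = E \<and> T = F"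
proof -
  let ?z = "zero2 C X X"
  define g where "g e = (if e \<in> S then e else ?z)" for e
  define h where "h f = (if f \<in> T then f else ?z)" for f
  have gH: "g e \<in> Hom C X X" if "e \<in> E" for e using that E_props(3-5)[of e] by (auto simp: g_def Hom_iff)
  have hH: "h f \<in> Hom C X X" if "f \<in> F" for f using that F_props(3-5)[of f] by (auto simp: h_def Hom_iff)
  have EH: "e \<in> Hom C X X" if "e \<in> E" for e using that E_props(3-5)[of e] by (auto simp: Hom_iff)
  have FH: "f \<in> Hom C X X" if "f \<in> F" for f using that F_props(3-5)[of f] by (auto simp: Hom_iff)
  define s where "s = hsum X X g E"
  define t where "t = hsum X X h F"
  have sH: "s \<in> Hom C X X" unfolding s_def by (rule hsum_Hom[OF parXX gH])
  have tH: "t \<in> Hom C X X" unfolding t_def by (rule hsum_Hom[OF parXX hH])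
  have [simp]: "s \<in> Arr2 C" "dom2 C s = X" "cod2 C s = X" "t \<in> Arr2 C" "dom2 C t = X" "cod2 C t = X"
    using sH tH by (auto simp: Hom_iff)
  have es: "e \<cdot> s = g e" if e: "e \<in> E" for e
  proof -
    have "e \<cdot> s = hsum X X (\<lambda>e'. e \<cdot> g e') E"
      unfolding s_def by (rule vcomp_hsum[OF parXX E_props(1) gH EH[OF e]])
    also have "\<dots> = e \<cdot> g e"
      by (rule hsum_delta) (use e gH[OF e] E_props(1) E_props(3-5)[OF e] E_props(10)[OF e] parXX in \<open>auto simp: g_def Hom_iff\<close>)
    also have "\<dots> = g e" using E_props(3-6)[OF e] by (simp add: g_def)
    finally show ?thesis .
  qed
  have ft: "f \<cdot> t = h f" if f: "f \<in> F" for f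
  proof -
    have "f \<cdot> t = hsum X X (\<lambda>f'. f \<cdot> h f') F"
      unfolding t_def by (rule vcomp_hsum[OF parXX F_props(1) hH FH[OF f]])
    also have "\<dots> = f \<cdot> h f"
      by (rule hsum_delta) (use f hH[OF f] F_props(1) F_props(3-5)[OF f] F_props(10)[OF f] parXX in \<open>auto simp: h_def Hom_iff\<close>)
    also have "\<dots> = h f" using F_props(3-6)[OF f] by (simp add: h_def)
    finally show ?thesis .
  qed
  \<comment> \<open>For \<open>e\<close> in \<open>S\<close>, the products
    \<open>e \<cdot> f\<close> with \<open>f\<close> outside \<open>T\<close> vanish, so
    \<open>t\<close> acts on \<open>e\<close> like the full sum over \<open>F\<close>.\<close>
  have et: "g e \<cdot> t = g e" if e: "e \<in> E" for e
  proof (cases "e \<in> S")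
    case True
    have "e \<cdot> t = hsum X X (\<lambda>f. e \<cdot> h f) F"
      unfolding t_def by (rule vcomp_hsum[OF parXX F_props(1) hH EH[OF e]])
    also have "\<dots> = hsum X X (\<lambda>f. e \<cdot> f) F"
    proof (rule hsum_cong[OF parXX refl])
      show "e \<cdot> h f = e \<cdot> f" if "f \<in> F" for f
      proof (cases "f \<in> T")
        case False
        then have "e \<cdot> f = ?z" using closed[OF e that] True by blast
        then show ?thesis using False E_props(3-5)[OF e] by (simp add: h_def)
      qed (simp add: h_def)
      show "e \<cdot> f \<in> Hom C X X" if "f \<in> F" for f
        using E_props(3-5)[OF e] F_props(3-5)[OF that] by (simp add: Hom_iff)
    qed
    also have "\<dots> = e \<cdot> hsum X X (\<lambda>f. f) F"
      by (rule vcomp_hsum[OF parXX F_props(1) FH EH[OF e], symmetric])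
    also have "\<dots> = e" using F_props(2) E_props(3-5)[OF e] by simp
    finally show ?thesis using True by (simp add: g_def)
  qed (simp add: g_def)
  have sf: "s \<cdot> h f = h f" if f: "f \<in> F" for f
  proof (cases "f \<in> T")
    case True
    have "s \<cdot> f = hsum X X (\<lambda>e. g e \<cdot> f) E"
      unfolding s_def by (rule hsum_vcomp[OF parXX E_props(1) gH FH[OF f]])
    also have "\<dots> = hsum X X (\<lambda>e. e \<cdot> f) E"
    proof (rule hsum_cong[OF parXX refl])
      show "g e \<cdot> f = e \<cdot> f" if "e \<in> E" for e
      proof (cases "e \<in> S")
        case False
        then have "e \<cdot> f = ?z" using closed[OF that f] True by blast
        then show ?thesis using False F_props(3-5)[OF f] by (simp add: g_def)
      qed (simp add: g_def)
      show "e \<cdot> f \<in> Hom C X X" if "e \<in> E" for e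
        using E_props(3-5)[OF that] F_props(3-5)[OF f] by (simp add: Hom_iff)
    qed
    also have "\<dots> = hsum X X (\<lambda>e. e) E \<cdot> f"
      by (rule hsum_vcomp[OF parXX E_props(1) EH FH[OF f], symmetric])
    also have "\<dots> = f" using E_props(2) F_props(3-5)[OF f] by simp
    finally show ?thesis using True by (simp add: h_def)
  qed (simp add: h_def)
  \<comment> \<open>Evaluated along \<open>E\<close> the product is \<open>s\<close>, along
    \<open>F\<close> it is \<open>t\<close>.\<close>
  have "s \<cdot> t = hsum X X (\<lambda>e. g e \<cdot> t) E"
    by (subst (1) s_def) (rule hsum_vcomp[OF parXX E_props(1) gH tH])
  also have "\<dots> = s" unfolding s_def by (rule hsum_cong[OF parXX refl et gH])
  finally have st: "s \<cdot> t = s" .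
  have "s \<cdot> t = hsum X X (\<lambda>f. s \<cdot> h f) F"
    by (subst (1) t_def) (rule vcomp_hsum[OF parXX F_props(1) hH sH])
  also have "\<dots> = t" unfolding t_def by (rule hsum_cong[OF parXX refl sf hH])
  finally have "s = t" using st by simp
  have alg_sum: "hsum X X k G \<in> A" if A: "commutative_star_algebra X A" and "finite G" "\<And>x. x \<in> G \<Longrightarrow> k x \<in> A" for k and G :: "'c set" and A
    using that(2,3)
  proof (induction G rule: finite_induct)
    case empty
    have "0 \<^bold>* \<^bold>1 X \<in> A" by (intro star_algebraD(3,8)[OF A])
    then show ?case using parXX by (simp add: scale2_zero)
  next
    case (insert x G)
    then show ?case
      by (subst hsum_insert[OF parXX]) (auto intro: star_algebraD(2,4)[OF A])
  qed
  have zero_in: "?z \<in> A" if A: "commutative_star_algebra X A" for A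
    using alg_sum[OF A, of "{}" "\<lambda>x. x"] parXX by simp
  have "s \<in> right_center C X" unfolding s_def
    by (rule alg_sum[OF right_algebra E_props(1)]) (use E_props(9) zero_in[OF right_algebra] in \<open>auto simp: g_def\<close>)
  moreover have "s \<in> left_center C X" unfolding \<open>s = t\<close> t_def
    by (rule alg_sum[OF left_algebra F_props(1)]) (use F_props(9) zero_in[OF left_algebra] in \<open>auto simp: h_def\<close>)
  ultimately have "s \<in> scalars C X" using conn by (auto simp: connected_arr_def)
  then obtain c where c: "s = c \<^bold>* \<^bold>1 X" by (auto simp: scalars_def)
  \<comment> \<open>The scalar \<open>c\<close> is 1 on members of \<open>S\<close> and 0 on the
    others; being one number for all of \<open>E\<close> and \<open>F\<close>, it leaves only the
    two extreme cases.\<close>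
  have eS: "c = (if e \<in> S then 1 else 0)" if e: "e \<in> E" for e
  proof -
    have "c \<^bold>* e = (if e \<in> S then 1 else 0) \<^bold>* e"
      using es[OF e] E_props(3-5)[OF e] by (simp add: c vcomp_linear g_def scale2_zero split: if_splits)
    then show ?thesis by (rule scale_cancel[OF _ EH[OF e] E_props(8)[OF e]])
  qed
  have fT: "c = (if f \<in> T then 1 else 0)" if f: "f \<in> F" for f
  proof -
    have "c \<^bold>* f = (if f \<in> T then 1 else 0) \<^bold>* f"
      using ft[OF f] F_props(3-5)[OF f] unfolding \<open>s = t\<close>[symmetric] by (simp add: c vcomp_linear h_def scale2_zero split: if_splits)
    then show ?thesis by (rule scale_cancel[OF _ FH[OF f] F_props(8)[OF f]])
  qed
  have "e \<in> S \<longleftrightarrow> c = 1" if "e \<in> E" for e using eS[OF that] by (auto split: if_splits)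
  moreover have "f \<in> T \<longleftrightarrow> c = 1" if "f \<in> F" for f using fT[OF that] by (auto split: if_splits)
  ultimately show ?thesis using ST by (cases "c = 1") blast+
qed

end

section \<open>The blocks of a solution\<close>

context connected_pair
begin

lemma EF_typing:
  assumes "e \<in> E" "f \<in> F"
  shows "e \<in> Arr2 C" "dom2 C e = X" "cod2 C e = X" "f \<in> Arr2 C" "dom2 C f = X" "cod2 C f = X"
    "e \<cdot> e = e" "f \<cdot> f = f" "e\<^sup>\<dagger> = e" "f\<^sup>\<dagger> = f" "f \<cdot> e = e \<cdot> f"
  using E_props(3-7)[OF assms(1)] F_props(3-7)[OF assms(2)] EF_commute[OF assms] by auto

lemma EF_projection:
  assumes "e \<in> E" "f \<in> F"
  shows "(e \<cdot> f) \<cdot> (e \<cdot> f) = e \<cdot> f" "(e \<cdot> f)\<^sup>\<dagger> = e \<cdot> f" "e \<cdot> e \<cdot> f = e \<cdot> f" "f \<cdot> e \<cdot> f = e \<cdot> f"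
proof -
  note [simp] = EF_typing(1-10)[OF assms] and c = EF_typing(11)[OF assms]
  show 1: "e \<cdot> e \<cdot> f = e \<cdot> f" using vcomp_assoc'[of f e e] by simp
  have "f \<cdot> e \<cdot> f = (f \<cdot> e) \<cdot> f" by simp
  also have "\<dots> = e \<cdot> f" unfolding c by simp
  finally show 2: "f \<cdot> e \<cdot> f = e \<cdot> f" .
  show "(e \<cdot> f) \<cdot> (e \<cdot> f) = e \<cdot> f" by (simp add: 1 2)
  show "(e \<cdot> f)\<^sup>\<dagger> = e \<cdot> f" by (simp add: c)
qed

lemma left_slide:
  assumes "q \<in> center C N" shows "(\<^bold>1 Xb \<boxtimes> \<^bold>1 X \<boxtimes> q) \<cdot> r = r \<cdot> q"
proof -
  have [simp]: "q \<in> Arr2 C" "dom2 C q = \<^bold>I N" "cod2 C q = \<^bold>I N" using assms by (auto simp: center_iff)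
  show ?thesis using slide(1)[of q r] slide(2)[of q r] by (simp add: unit2_hcomp)
qed

lemma right_slide:
  assumes "p \<in> center C M" shows "(p \<boxtimes> \<^bold>1 X \<boxtimes> \<^bold>1 Xb) \<cdot> rb = rb \<cdot> p"
proof -
  have [simp]: "p \<in> Arr2 C" "dom2 C p = \<^bold>I M" "cod2 C p = \<^bold>I M" using assms by (auto simp: center_iff)
  show ?thesis using slide(1)[of rb p] slide(2)[of rb p] by (simp add: unit2_hcomp)
qed

text \<open>Center-valued traces: without factoriality the left trace takes values in the left
  center of \<open>X\<close> and the right trace in the right center. They become scalar after
  cutting by a minimal projection.\<close>

definition lmap where "lmap t = \<^bold>1 X \<boxtimes> (r\<^sup>\<dagger> \<cdot> (\<^bold>1 Xb \<boxtimes> t) \<cdot> r)"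
definition rmap where "rmap t = (rb\<^sup>\<dagger> \<cdot> (t \<boxtimes> \<^bold>1 Xb) \<cdot> rb) \<boxtimes> \<^bold>1 X"

text \<open>The projection comes from an element of a center, which slides through the solution and
  out of the trace.\<close>

lemma lmap_left: "f \<in> F \<Longrightarrow> t \<in> Hom C X X \<Longrightarrow> lmap (t \<cdot> f) = lmap t \<cdot> f"
  and rmap_right: "e \<in> E \<Longrightarrow> t \<in> Hom C X X \<Longrightarrow> rmap (t \<cdot> e) = rmap t \<cdot> e"
proof -
  assume f: "f \<in> F" and t: "t \<in> Hom C X X"
  have [simp]: "t \<in> Arr2 C" "dom2 C t = X" "cod2 C t = X" using t by (auto simp: Hom_iff)
  obtain q where q: "q \<in> center C N" "\<^bold>1 X \<boxtimes> q = f" using F_preimage[OF f] by blast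
  have [simp]: "q \<in> Arr2 C" "dom2 C q = \<^bold>I N" "cod2 C q = \<^bold>I N" using q(1) by (auto simp: center_iff)
  have "(\<^bold>1 Xb \<boxtimes> (t \<cdot> f)) \<cdot> r = (\<^bold>1 Xb \<boxtimes> t) \<cdot> r \<cdot> q"
    unfolding q(2)[symmetric] using left_slide[OF q(1)] by (simp add: whisker_left)
  then show "lmap (t \<cdot> f) = lmap t \<cdot> f" unfolding lmap_def q(2)[symmetric] by (simp add: whisker_left)
next
  assume e: "e \<in> E" and t: "t \<in> Hom C X X"
  have [simp]: "t \<in> Arr2 C" "dom2 C t = X" "cod2 C t = X" using t by (auto simp: Hom_iff)
  obtain p where p: "p \<in> center C M" "p \<boxtimes> \<^bold>1 X = e" using E_preimage[OF e] by blast
  have [simp]: "p \<in> Arr2 C" "dom2 C p = \<^bold>I M" "cod2 C p = \<^bold>I M" using p(1) by (auto simp: center_iff)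
  have "((t \<cdot> e) \<boxtimes> \<^bold>1 Xb) \<cdot> rb = (t \<boxtimes> \<^bold>1 Xb) \<cdot> rb \<cdot> p"
    unfolding p(2)[symmetric] using right_slide[OF p(1)] by (simp add: whisker_right)
  then show "rmap (t \<cdot> e) = rmap t \<cdot> e" unfolding rmap_def p(2)[symmetric] by (simp add: whisker_right)
qed

lemma lmap_positive: 
  assumes "t \<in> Hom C X X" "t \<cdot> t = t" "t\<^sup>\<dagger> = t"
  shows "lmap t = (\<^bold>1 X \<boxtimes> ((\<^bold>1 Xb \<boxtimes> t) \<cdot> r))\<^sup>\<dagger> \<cdot> (\<^bold>1 X \<boxtimes> ((\<^bold>1 Xb \<boxtimes> t) \<cdot> r))"
    "rmap t = (((t \<boxtimes> \<^bold>1 Xb) \<cdot> rb) \<boxtimes> \<^bold>1 X)\<^sup>\<dagger> \<cdot> (((t \<boxtimes> \<^bold>1 Xb) \<cdot> rb) \<boxtimes> \<^bold>1 X)"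
proof -
  have [simp]: "t \<in> Arr2 C" "dom2 C t = X" "cod2 C t = X" using assms by (auto simp: Hom_iff)
  show "lmap t = (\<^bold>1 X \<boxtimes> ((\<^bold>1 Xb \<boxtimes> t) \<cdot> r))\<^sup>\<dagger> \<cdot> (\<^bold>1 X \<boxtimes> ((\<^bold>1 Xb \<boxtimes> t) \<cdot> r))"
    by (simp add: lmap_def merge assms(2,3))
  show "rmap t = (((t \<boxtimes> \<^bold>1 Xb) \<cdot> rb) \<boxtimes> \<^bold>1 X)\<^sup>\<dagger> \<cdot> (((t \<boxtimes> \<^bold>1 Xb) \<cdot> rb) \<boxtimes> \<^bold>1 X)"
    by (simp add: rmap_def merge assms(2,3))
qed

text \<open>On the subarrow given by \<open>p\<close> the multiple of \<open>p\<close> becomes a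
  multiple of the unit, where scalars of positive elements are squared norms.\<close>

lemma projection_multiple_nonneg:
  assumes p: "p \<in> Hom C X X" "p \<cdot> p = p" "p\<^sup>\<dagger> = p" "p \<noteq> zero2 C X X"
    and T: "T \<in> Hom C X Y" "T\<^sup>\<dagger> \<cdot> T = l \<^bold>* p"
  shows "\<exists>a\<ge>0. l = complex_of_real a"
proof -
  obtain S u where S: "sub_1_arrow C S u X p" using sub_1_arrows[OF p(1-3)] by blast
  have u: "u \<in> Hom C S X" "u\<^sup>\<dagger> \<cdot> u = \<^bold>1 S" "u \<cdot> u\<^sup>\<dagger> = p" using S by (auto simp: sub_1_arrow_def)
  have [simp]: "u \<in> Arr2 C" "dom2 C u = S" "cod2 C u = X" "p \<in> Arr2 C" "dom2 C p = X" "cod2 C p = X"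
    "T \<in> Arr2 C" "dom2 C T = X" "cod2 C T = Y" using u p T by (auto simp: Hom_iff)
  have [simp]: "S \<in> Arr1 C" using Hom_parallel(1)[OF u(1)] .
  have pu: "p \<cdot> u = u" unfolding u(3)[symmetric] by (simp add: u(2))
  have "(T \<cdot> u)\<^sup>\<dagger> \<cdot> (T \<cdot> u) = u\<^sup>\<dagger> \<cdot> (T\<^sup>\<dagger> \<cdot> T) \<cdot> u" by simp
  also have "\<dots> = l \<^bold>* \<^bold>1 S" unfolding T(2) by (simp add: vcomp_linear pu u(2))
  finally have "l = complex_of_real ((nrm (T \<cdot> u))\<^sup>2)"
    by (intro positive_scalar[of _ S Y] sub_nonzero[OF S p(4)]) (auto simp: Hom_iff)
  then show ?thesis by (intro exI[of _ "(nrm (T \<cdot> u))\<^sup>2"]) simp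
qed

text \<open>\<open>f\<close> moves out of the trace, \<open>lmap e\<close> lies in the left center,
  and \<open>f\<close> is minimal there, so the product is a multiple of \<open>f\<close>.\<close>

lemma left_block_scalar:
  assumes "e \<in> E" "f \<in> F" shows "\<exists>a\<ge>0. lmap (e \<cdot> f) = complex_of_real a \<^bold>* f"
proof -
  note [simp] = EF_typing(1-10)[OF assms] and P = EF_projection[OF assms]
  have eH: "e \<in> Hom C X X" by (simp add: Hom_iff)
  have "r\<^sup>\<dagger> \<cdot> (\<^bold>1 Xb \<boxtimes> e) \<cdot> r \<in> center C N" by (simp add: center_iff)
  then have "lmap e \<in> left_center C X" unfolding lmap_def left_center_def by auto
  then obtain l where l: "lmap e \<cdot> f = l \<^bold>* f" using minimal_projection_scalar[OF left_algebra left_span assms(2)] by blast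
  have "\<exists>a\<ge>0. l = complex_of_real a"
  proof (rule projection_multiple_nonneg[of f "\<^bold>1 X \<boxtimes> ((\<^bold>1 Xb \<boxtimes> (e \<cdot> f)) \<cdot> r)" "X \<boxdot> Xb \<boxdot> X"])
    show "(\<^bold>1 X \<boxtimes> ((\<^bold>1 Xb \<boxtimes> (e \<cdot> f)) \<cdot> r))\<^sup>\<dagger> \<cdot> (\<^bold>1 X \<boxtimes> ((\<^bold>1 Xb \<boxtimes> (e \<cdot> f)) \<cdot> r)) = l \<^bold>* f"
      by (subst lmap_positive(1)[symmetric]) (simp_all add: Hom_iff P[simplified] lmap_left[OF assms(2) eH] l EF_typing(11)[OF assms])
  qed (use F_props(8)[OF assms(2)] in \<open>auto simp: Hom_iff\<close>)
  then show ?thesis using l lmap_left[OF assms(2) eH] by auto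
qed

lemma right_block_scalar:
  assumes "e \<in> E" "f \<in> F" shows "\<exists>b\<ge>0. rmap (e \<cdot> f) = complex_of_real b \<^bold>* e"
proof -
  note [simp] = EF_typing(1-10)[OF assms] and P = EF_projection[OF assms] and c = EF_typing(11)[OF assms]
  have fH: "f \<in> Hom C X X" by (simp add: Hom_iff)
  have "rb\<^sup>\<dagger> \<cdot> (f \<boxtimes> \<^bold>1 Xb) \<cdot> rb \<in> center C M" by (simp add: center_iff)
  then have "rmap f \<in> right_center C X" unfolding rmap_def right_center_def by auto
  then obtain l where l: "rmap f \<cdot> e = l \<^bold>* e" using minimal_projection_scalar[OF right_algebra right_span assms(1)] by blast
  have ef: "rmap (e \<cdot> f) = l \<^bold>* e" using rmap_right[OF assms(1) fH] l unfolding c by simp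
  have "\<exists>a\<ge>0. l = complex_of_real a"
  proof (rule projection_multiple_nonneg[of e "((((e \<cdot> f) \<boxtimes> \<^bold>1 Xb) \<cdot> rb) \<boxtimes> \<^bold>1 X)" "X \<boxdot> Xb \<boxdot> X"])
    show "((((e \<cdot> f) \<boxtimes> \<^bold>1 Xb) \<cdot> rb) \<boxtimes> \<^bold>1 X)\<^sup>\<dagger> \<cdot> ((((e \<cdot> f) \<boxtimes> \<^bold>1 Xb) \<cdot> rb) \<boxtimes> \<^bold>1 X) = l \<^bold>* e"
      unfolding ef[symmetric] by (rule lmap_positive(2)[symmetric]) (use P(1,2) in \<open>auto simp: Hom_iff\<close>)
  qed (use E_props(8)[OF assms(1)] in \<open>auto simp: Hom_iff\<close>)
  then show ?thesis using ef by auto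
qed

text \<open>These are the numbers \<open>a e f\<close> and \<open>b e f\<close> of the overview. The
  left weight is a multiple of the column projection \<open>f\<close>, the right weight of the row
  projection \<open>e\<close>.\<close>

definition left_weight where "left_weight e f = (SOME x. 0 \<le> x \<and> lmap (e \<cdot> f) = complex_of_real x \<^bold>* f)"
definition right_weight where "right_weight e f = (SOME x. 0 \<le> x \<and> rmap (e \<cdot> f) = complex_of_real x \<^bold>* e)"

lemma weight_props:
  assumes "e \<in> E" "f \<in> F"
  shows "0 \<le> left_weight e f" "lmap (e \<cdot> f) = complex_of_real (left_weight e f) \<^bold>* f"
    "0 \<le> right_weight e f" "rmap (e \<cdot> f) = complex_of_real (right_weight e f) \<^bold>* e"
  using someI_ex[OF left_block_scalar[OF assms]] someI_ex[OF right_block_scalar[OF assms]]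
  unfolding left_weight_def right_weight_def by blast+

lemma map_hsum:
  assumes "finite G" "\<And>i. i \<in> G \<Longrightarrow> k i \<in> Hom C X X"
  shows "lmap (hsum X X k G) = hsum X X (\<lambda>i. lmap (k i)) G" "rmap (hsum X X k G) = hsum X X (\<lambda>i. rmap (k i)) G"
  by (rule hsum_map[OF parXX parXX assms]; auto simp: Hom_iff lmap_def rmap_def hcomp_linear vcomp_linear)+

lemma lmap_unit: "lmap (\<^bold>1 X) = \<^bold>1 X \<boxtimes> (r\<^sup>\<dagger> \<cdot> r)"
  and rmap_unit: "rmap (\<^bold>1 X) = (rb\<^sup>\<dagger> \<cdot> rb) \<boxtimes> \<^bold>1 X"
  by (simp_all add: lmap_def rmap_def hcomp_unit2')

lemma EH: "e \<in> E \<Longrightarrow> e \<in> Hom C X X" and FH: "f \<in> F \<Longrightarrow> f \<in> Hom C X X"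
  using E_props(3-5)[of e] F_props(3-5)[of f] by (auto simp: Hom_iff)

text \<open>\<open>f\<close> is the sum of its products with all \<open>e\<close>, and additivity of
  the trace adds up one column of weights.\<close>

lemma left_weight_sum:
  assumes f: "f \<in> F" shows "(\<^bold>1 X \<boxtimes> (r\<^sup>\<dagger> \<cdot> r)) \<cdot> f = complex_of_real (\<Sum>e\<in>E. left_weight e f) \<^bold>* f"
proof -
  note [simp] = F_props(3-5)[OF f]
  have "hsum X X (\<lambda>e. e \<cdot> f) E = f"
    using hsum_vcomp[of X X E "\<lambda>e. e" f X, OF parXX E_props(1) EH FH[OF f]] E_props(2) by simp
  then have "lmap f = hsum X X (\<lambda>e. lmap (e \<cdot> f)) E"
    using map_hsum(1)[OF E_props(1), of "\<lambda>e. e \<cdot> f"] E_props(3-5) by (auto simp: Hom_iff)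
  also have "\<dots> = hsum X X (\<lambda>e. complex_of_real (left_weight e f) \<^bold>* f) E"
    by (rule hsum_cong[OF parXX refl]) (use weight_props(2)[OF _ f] in \<open>auto simp: Hom_iff\<close>)
  also have "\<dots> = complex_of_real (\<Sum>e\<in>E. left_weight e f) \<^bold>* f"
    by (subst hsum_scale_const[OF parXX E_props(1) FH[OF f]]) simp
  finally show ?thesis using lmap_left[OF f, of "\<^bold>1 X"] lmap_unit by (simp add: Hom_iff)
qed

lemma right_weight_sum:
  assumes e: "e \<in> E" shows "((rb\<^sup>\<dagger> \<cdot> rb) \<boxtimes> \<^bold>1 X) \<cdot> e = complex_of_real (\<Sum>f\<in>F. right_weight e f) \<^bold>* e"
proof -
  note [simp] = E_props(3-5)[OF e]
  have "hsum X X (\<lambda>f. e \<cdot> f) F = e"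
    using vcomp_hsum[of X X F "\<lambda>f. f" e X, OF parXX F_props(1) FH EH[OF e]] F_props(2) by simp
  then have "rmap e = hsum X X (\<lambda>f. rmap (e \<cdot> f)) F"
    using map_hsum(2)[OF F_props(1), of "\<lambda>f. e \<cdot> f"] F_props(3-5) by (auto simp: Hom_iff)
  also have "\<dots> = hsum X X (\<lambda>f. complex_of_real (right_weight e f) \<^bold>* e) F"
    by (rule hsum_cong[OF parXX refl]) (use weight_props(4)[OF e] in \<open>auto simp: Hom_iff\<close>)
  also have "\<dots> = complex_of_real (\<Sum>f\<in>F. right_weight e f) \<^bold>* e"
    by (subst hsum_scale_const[OF parXX F_props(1) EH[OF e]]) simp
  finally show ?thesis using rmap_right[OF e, of "\<^bold>1 X"] rmap_unit by (simp add: Hom_iff)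
qed

lemma left_weight_sum_le: "f \<in> F \<Longrightarrow> (\<Sum>e\<in>E. left_weight e f) \<le> nrm (\<^bold>1 X \<boxtimes> (r\<^sup>\<dagger> \<cdot> r))"
  and right_weight_sum_le: "e \<in> E \<Longrightarrow> (\<Sum>f\<in>F. right_weight e f) \<le> nrm ((rb\<^sup>\<dagger> \<cdot> rb) \<boxtimes> \<^bold>1 X)"
proof -
  assume f: "f \<in> F"
  have "nrm ((\<^bold>1 X \<boxtimes> (r\<^sup>\<dagger> \<cdot> r)) \<cdot> f) \<le> nrm (\<^bold>1 X \<boxtimes> (r\<^sup>\<dagger> \<cdot> r)) * nrm f"
    using F_props(3-5)[OF f] by (intro nrm_vcomp) auto
  moreover have "nrm ((\<^bold>1 X \<boxtimes> (r\<^sup>\<dagger> \<cdot> r)) \<cdot> f) = \<bar>\<Sum>e\<in>E. left_weight e f\<bar> * nrm f"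
    unfolding left_weight_sum[OF f] using F_props(3)[OF f] by (simp del: of_real_sum)
  ultimately show "(\<Sum>e\<in>E. left_weight e f) \<le> nrm (\<^bold>1 X \<boxtimes> (r\<^sup>\<dagger> \<cdot> r))" using nrm_F[OF f] by simp
next
  assume e: "e \<in> E"
  have "nrm (((rb\<^sup>\<dagger> \<cdot> rb) \<boxtimes> \<^bold>1 X) \<cdot> e) \<le> nrm ((rb\<^sup>\<dagger> \<cdot> rb) \<boxtimes> \<^bold>1 X) * nrm e"
    using E_props(3-5)[OF e] by (intro nrm_vcomp) auto
  moreover have "nrm (((rb\<^sup>\<dagger> \<cdot> rb) \<boxtimes> \<^bold>1 X) \<cdot> e) = \<bar>\<Sum>f\<in>F. right_weight e f\<bar> * nrm e"
    unfolding right_weight_sum[OF e] using E_props(3)[OF e] by (simp del: of_real_sum)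
  ultimately show "(\<Sum>f\<in>F. right_weight e f) \<le> nrm ((rb\<^sup>\<dagger> \<cdot> rb) \<boxtimes> \<^bold>1 X)" using nrm_E[OF e] by simp
qed

text \<open>The data that a standard solution attaches to one pair of projections. The lemmas on
  blocks then serve both for data that are constructed and for data that come with a given standard
  solution.\<close>

definition block where
  "block e f p q S Sb v vb \<longleftrightarrow> p \<in> center C M \<and> p \<boxtimes> \<^bold>1 X = e \<and> q \<in> center C N \<and> \<^bold>1 X \<boxtimes> q = f \<and>
    sub_1_arrow C S v X (p \<boxtimes> \<^bold>1 X \<boxtimes> q) \<and> sub_1_arrow C Sb vb Xb (q \<boxtimes> \<^bold>1 Xb \<boxtimes> p)"

lemma block_exists:
  assumes "e \<in> E" "f \<in> F" "p \<in> center C M" "p \<boxtimes> \<^bold>1 X = e" "q \<in> center C N" "\<^bold>1 X \<boxtimes> q = f"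
  shows "\<exists>S Sb v vb. block e f p q S Sb v vb"
proof -
  note [simp] = EF_typing(1-6)[OF assms(1,2)]
  have [simp]: "p \<in> Arr2 C" "dom2 C p = \<^bold>I M" "cod2 C p = \<^bold>I M" "q \<in> Arr2 C" "dom2 C q = \<^bold>I N" "cod2 C q = \<^bold>I N"
    using assms by (auto simp: center_iff)
  have P: "p \<boxtimes> \<^bold>1 X \<boxtimes> q = e \<cdot> f" using center_product(1)[OF assms(3,5)] assms(4,6) by simp
  obtain S v where 1: "sub_1_arrow C S v X (p \<boxtimes> \<^bold>1 X \<boxtimes> q)"
    using sub_1_arrows[of "e \<cdot> f" X] EF_projection(1,2)[OF assms(1,2)] unfolding P by (auto simp: Hom_iff)
  have "q \<boxtimes> \<^bold>1 Xb \<boxtimes> p \<in> Hom C Xb Xb" by (simp add: Hom_iff)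
  moreover have "(q \<boxtimes> \<^bold>1 Xb \<boxtimes> p) \<cdot> (q \<boxtimes> \<^bold>1 Xb \<boxtimes> p) = q \<boxtimes> \<^bold>1 Xb \<boxtimes> p" "(q \<boxtimes> \<^bold>1 Xb \<boxtimes> p)\<^sup>\<dagger> = q \<boxtimes> \<^bold>1 Xb \<boxtimes> p"
    by (rule projection_transport; use EF_typing(7-10)[OF assms(1,2)] assms in simp)+
  ultimately obtain Sb vb where "sub_1_arrow C Sb vb Xb (q \<boxtimes> \<^bold>1 Xb \<boxtimes> p)"
    using sub_1_arrows by blast
  then show ?thesis using 1 assms unfolding block_def by blast
qed

context
  fixes e f p q S Sb v vb
  assumes e: "e \<in> E" and f: "f \<in> F" and blk: "block e f p q S Sb v vb"
begin

lemma block_typing: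
  "v \<in> Arr2 C" "dom2 C v = S" "cod2 C v = X" "vb \<in> Arr2 C" "dom2 C vb = Sb" "cod2 C vb = Xb"
  "S \<in> Arr1 C" "src C S = N" "tgt C S = M" "Sb \<in> Arr1 C" "src C Sb = M" "tgt C Sb = N"
  "v\<^sup>\<dagger> \<cdot> v = \<^bold>1 S" "vb\<^sup>\<dagger> \<cdot> vb = \<^bold>1 Sb" "v \<cdot> v\<^sup>\<dagger> = e \<cdot> f" "vb \<cdot> vb\<^sup>\<dagger> = q \<boxtimes> \<^bold>1 Xb \<boxtimes> p"
  "v \<in> Hom C S X" "vb \<in> Hom C Sb Xb"
  "p \<in> center C M" "q \<in> center C N" "p \<boxtimes> \<^bold>1 X \<boxtimes> q = e \<cdot> f" "sub_1_arrow C S v X (e \<cdot> f)"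
proof -
  have pq: "p \<in> center C M" "q \<in> center C N" "p \<boxtimes> \<^bold>1 X = e" "\<^bold>1 X \<boxtimes> q = f" using blk by (auto simp: block_def)
  show P: "p \<boxtimes> \<^bold>1 X \<boxtimes> q = e \<cdot> f" using center_product(1)[OF pq(1,2)] pq(3,4) by simp
  show s: "sub_1_arrow C S v X (e \<cdot> f)" using blk P by (simp add: block_def)
  have sb: "sub_1_arrow C Sb vb Xb (q \<boxtimes> \<^bold>1 Xb \<boxtimes> p)" using blk by (simp add: block_def)
  show v: "v \<in> Hom C S X" and vb: "vb \<in> Hom C Sb Xb" using s sb by (auto simp: sub_1_arrow_def)
  show "p \<in> center C M" "q \<in> center C N" by fact+
  show "v\<^sup>\<dagger> \<cdot> v = \<^bold>1 S" "vb\<^sup>\<dagger> \<cdot> vb = \<^bold>1 Sb" "v \<cdot> v\<^sup>\<dagger> = e \<cdot> f" "vb \<cdot> vb\<^sup>\<dagger> = q \<boxtimes> \<^bold>1 Xb \<boxtimes> p"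
    using s sb by (auto simp: sub_1_arrow_def)
  show "v \<in> Arr2 C" "dom2 C v = S" "cod2 C v = X" "vb \<in> Arr2 C" "dom2 C vb = Sb" "cod2 C vb = Xb"
    using v vb by (auto simp: Hom_iff)
  show "S \<in> Arr1 C" "src C S = N" "tgt C S = M" "Sb \<in> Arr1 C" "src C Sb = M" "tgt C Sb = N"
    using Hom_parallel[OF v] Hom_parallel[OF vb] by auto
qed

text \<open>The compatibility of range projections that compression of a solution requires; both
  equations are the passage of central elements across \<open>r\<close> and
  \<open>rb\<close>.\<close>

lemma block_swap:
  "((vb \<cdot> vb\<^sup>\<dagger>) \<boxtimes> \<^bold>1 X) \<cdot> r = (\<^bold>1 Xb \<boxtimes> (v \<cdot> v\<^sup>\<dagger>)) \<cdot> r"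
  "((v \<cdot> v\<^sup>\<dagger>) \<boxtimes> \<^bold>1 Xb) \<cdot> rb = (\<^bold>1 X \<boxtimes> (vb \<cdot> vb\<^sup>\<dagger>)) \<cdot> rb"
proof -
  interpret B: conj_pair C M N Xb X rb r by (rule swapped)
  show "((vb \<cdot> vb\<^sup>\<dagger>) \<boxtimes> \<^bold>1 X) \<cdot> r = (\<^bold>1 Xb \<boxtimes> (v \<cdot> v\<^sup>\<dagger>)) \<cdot> r"
    unfolding block_typing(15,16) block_typing(21)[symmetric] by (rule middle_slide[OF block_typing(19,20)])
  show "((v \<cdot> v\<^sup>\<dagger>) \<boxtimes> \<^bold>1 Xb) \<cdot> rb = (\<^bold>1 X \<boxtimes> (vb \<cdot> vb\<^sup>\<dagger>)) \<cdot> rb"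
    unfolding block_typing(15,16) block_typing(21)[symmetric] by (rule B.middle_slide[OF block_typing(20,19)])
qed

lemma block_conjugate: "conjugate_solution C S Sb ((vb\<^sup>\<dagger> \<boxtimes> v\<^sup>\<dagger>) \<cdot> r) ((v\<^sup>\<dagger> \<boxtimes> vb\<^sup>\<dagger>) \<cdot> rb)"
  by (rule block_solution[OF block_typing(17,13,18,14) block_swap])

text \<open>On \<open>r\<close> and \<open>rb\<close>, the block projection of \<open>Xb\<close>
  acts like that of \<open>X\<close>, so cutting on both strands equals cutting on one.\<close>

lemma block_recover:
  "(vb \<boxtimes> v) \<cdot> (vb\<^sup>\<dagger> \<boxtimes> v\<^sup>\<dagger>) \<cdot> r = (\<^bold>1 Xb \<boxtimes> (e \<cdot> f)) \<cdot> r"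
  "(v \<boxtimes> vb) \<cdot> (v\<^sup>\<dagger> \<boxtimes> vb\<^sup>\<dagger>) \<cdot> rb = ((e \<cdot> f) \<boxtimes> \<^bold>1 Xb) \<cdot> rb"
proof -
  note [simp] = block_typing(1-12) EF_typing(1-6)[OF e f]
  have pp: "(v \<cdot> v\<^sup>\<dagger>) \<cdot> (v \<cdot> v\<^sup>\<dagger>) = v \<cdot> v\<^sup>\<dagger>"
    using EF_projection(1)[OF e f] unfolding block_typing(15) .
  have "(vb \<boxtimes> v) \<cdot> (vb\<^sup>\<dagger> \<boxtimes> v\<^sup>\<dagger>) \<cdot> r = (\<^bold>1 Xb \<boxtimes> (v \<cdot> v\<^sup>\<dagger>)) \<cdot> ((vb \<cdot> vb\<^sup>\<dagger>) \<boxtimes> \<^bold>1 X) \<cdot> r"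
    by (simp add: merge)
  also have "\<dots> = (\<^bold>1 Xb \<boxtimes> ((v \<cdot> v\<^sup>\<dagger>) \<cdot> (v \<cdot> v\<^sup>\<dagger>))) \<cdot> r"
    unfolding block_swap(1) by (simp add: merge)
  finally show "(vb \<boxtimes> v) \<cdot> (vb\<^sup>\<dagger> \<boxtimes> v\<^sup>\<dagger>) \<cdot> r = (\<^bold>1 Xb \<boxtimes> (e \<cdot> f)) \<cdot> r"
    unfolding pp unfolding block_typing(15) .
  have "(v \<boxtimes> vb) \<cdot> (v\<^sup>\<dagger> \<boxtimes> vb\<^sup>\<dagger>) \<cdot> rb = ((v \<cdot> v\<^sup>\<dagger>) \<boxtimes> \<^bold>1 Xb) \<cdot> (\<^bold>1 X \<boxtimes> (vb \<cdot> vb\<^sup>\<dagger>)) \<cdot> rb"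
    by (simp add: merge)
  also have "\<dots> = (((v \<cdot> v\<^sup>\<dagger>) \<cdot> (v \<cdot> v\<^sup>\<dagger>)) \<boxtimes> \<^bold>1 Xb) \<cdot> rb"
    unfolding block_swap(2)[symmetric] by (simp add: merge)
  finally show "(v \<boxtimes> vb) \<cdot> (v\<^sup>\<dagger> \<boxtimes> vb\<^sup>\<dagger>) \<cdot> rb = ((e \<cdot> f) \<boxtimes> \<^bold>1 Xb) \<cdot> rb"
    unfolding pp unfolding block_typing(15) .
qed

lemma block_absorb: "f \<cdot> v = v" "e \<cdot> v = v"
proof -
  note [simp] = block_typing(1-12) EF_typing(1-6)[OF e f]
  have v: "v = (e \<cdot> f) \<cdot> v"
    unfolding block_typing(15)[symmetric] by (simp add: block_typing(13))
  have "f \<cdot> v = (f \<cdot> e \<cdot> f) \<cdot> v" by (subst v) simp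
  then show "f \<cdot> v = v" unfolding EF_projection(4)[OF e f] v[symmetric] .
  have "e \<cdot> v = (e \<cdot> e \<cdot> f) \<cdot> v" by (subst v) simp
  then show "e \<cdot> v = v" unfolding EF_projection(3)[OF e f] v[symmetric] .
qed

text \<open>The square of the compressed solution is the original one with
  \<open>e \<cdot> f\<close> inserted, that is, a center-valued trace; restricted to the block, its
  projection becomes the unit.\<close>

lemma block_scalars:
  defines "rS \<equiv> (vb\<^sup>\<dagger> \<boxtimes> v\<^sup>\<dagger>) \<cdot> r" and "rbS \<equiv> (v\<^sup>\<dagger> \<boxtimes> vb\<^sup>\<dagger>) \<cdot> rb"
  shows "\<^bold>1 S \<boxtimes> (rS\<^sup>\<dagger> \<cdot> rS) = complex_of_real (left_weight e f) \<^bold>* \<^bold>1 S" "(rbS\<^sup>\<dagger> \<cdot> rbS) \<boxtimes> \<^bold>1 S = complex_of_real (right_weight e f) \<^bold>* \<^bold>1 S"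
proof -
  note [simp] = block_typing(1-12) EF_typing(1-6)[OF e f]
  have "rS\<^sup>\<dagger> \<cdot> rS = r\<^sup>\<dagger> \<cdot> (vb \<boxtimes> v) \<cdot> (vb\<^sup>\<dagger> \<boxtimes> v\<^sup>\<dagger>) \<cdot> r" by (simp add: rS_def)
  then have z: "rS\<^sup>\<dagger> \<cdot> rS = r\<^sup>\<dagger> \<cdot> (\<^bold>1 Xb \<boxtimes> (e \<cdot> f)) \<cdot> r" unfolding block_recover(1) .
  have "rS\<^sup>\<dagger> \<cdot> rS \<in> center C (src C X)" unfolding z by (simp add: center_iff)
  then have "\<^bold>1 S \<boxtimes> (rS\<^sup>\<dagger> \<cdot> rS) = v\<^sup>\<dagger> \<cdot> (\<^bold>1 X \<boxtimes> (rS\<^sup>\<dagger> \<cdot> rS)) \<cdot> v" by (rule center_sub(1)[OF block_typing(17,13)])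
  also have "\<^bold>1 X \<boxtimes> (rS\<^sup>\<dagger> \<cdot> rS) = complex_of_real (left_weight e f) \<^bold>* f" unfolding z lmap_def[symmetric] by (rule weight_props(2)[OF e f])
  finally show "\<^bold>1 S \<boxtimes> (rS\<^sup>\<dagger> \<cdot> rS) = complex_of_real (left_weight e f) \<^bold>* \<^bold>1 S"
    by (simp add: vcomp_linear block_absorb block_typing(13))
  have "rbS\<^sup>\<dagger> \<cdot> rbS = rb\<^sup>\<dagger> \<cdot> (v \<boxtimes> vb) \<cdot> (v\<^sup>\<dagger> \<boxtimes> vb\<^sup>\<dagger>) \<cdot> rb" by (simp add: rbS_def)
  then have z: "rbS\<^sup>\<dagger> \<cdot> rbS = rb\<^sup>\<dagger> \<cdot> ((e \<cdot> f) \<boxtimes> \<^bold>1 Xb) \<cdot> rb" unfolding block_recover(2) .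
  have "rbS\<^sup>\<dagger> \<cdot> rbS \<in> center C (tgt C X)" unfolding z by (simp add: center_iff)
  then have "(rbS\<^sup>\<dagger> \<cdot> rbS) \<boxtimes> \<^bold>1 S = v\<^sup>\<dagger> \<cdot> ((rbS\<^sup>\<dagger> \<cdot> rbS) \<boxtimes> \<^bold>1 X) \<cdot> v" by (rule center_sub(2)[OF block_typing(17,13)])
  also have "(rbS\<^sup>\<dagger> \<cdot> rbS) \<boxtimes> \<^bold>1 X = complex_of_real (right_weight e f) \<^bold>* e" unfolding z rmap_def[symmetric] by (rule weight_props(4)[OF e f])
  finally show "(rbS\<^sup>\<dagger> \<cdot> rbS) \<boxtimes> \<^bold>1 S = complex_of_real (right_weight e f) \<^bold>* \<^bold>1 S"
    by (simp add: vcomp_linear block_absorb block_typing(13))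
qed

text \<open>The isometry \<open>v\<close> absorbs \<open>f\<close> and \<open>e\<close>, and a
  central element times a minimal projection is a multiple of it.\<close>

lemma block_factorial: "factorial_arr C S"
proof (rule factorialI)
  note [simp] = block_typing(1-12) EF_typing(1-6)[OF e f]
  show "S \<in> Arr1 C" by simp
  fix z
  show "\<exists>c. \<^bold>1 S \<boxtimes> z = c \<^bold>* \<^bold>1 S" if "z \<in> center C (src C S)"
  proof -
    have z: "z \<in> center C (src C X)" using that by simp
    have [simp]: "z \<in> Arr2 C" "dom2 C z = \<^bold>I N" "cod2 C z = \<^bold>I N" using z by (auto simp: center_iff)
    have "\<^bold>1 X \<boxtimes> z \<in> left_center C X" using z by (auto simp: left_center_def)
    then obtain l where l: "(\<^bold>1 X \<boxtimes> z) \<cdot> f = l \<^bold>* f" using minimal_projection_scalar[OF left_algebra left_span f] by blast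
    have "\<^bold>1 S \<boxtimes> z = v\<^sup>\<dagger> \<cdot> (\<^bold>1 X \<boxtimes> z) \<cdot> f \<cdot> v" unfolding block_absorb by (rule center_sub(1)[OF block_typing(17,13) z])
    also have "\<dots> = v\<^sup>\<dagger> \<cdot> ((\<^bold>1 X \<boxtimes> z) \<cdot> f) \<cdot> v" by simp
    also have "\<dots> = l \<^bold>* \<^bold>1 S" unfolding l by (simp add: vcomp_linear block_absorb block_typing(13))
    finally show ?thesis by blast
  qed
  show "\<exists>c. z \<boxtimes> \<^bold>1 S = c \<^bold>* \<^bold>1 S" if "z \<in> center C (tgt C S)"
  proof -
    have z: "z \<in> center C (tgt C X)" using that by simp
    have [simp]: "z \<in> Arr2 C" "dom2 C z = \<^bold>I M" "cod2 C z = \<^bold>I M" using z by (auto simp: center_iff)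
    have "z \<boxtimes> \<^bold>1 X \<in> right_center C X" using z by (auto simp: right_center_def)
    then obtain l where l: "(z \<boxtimes> \<^bold>1 X) \<cdot> e = l \<^bold>* e" using minimal_projection_scalar[OF right_algebra right_span e] by blast
    have "z \<boxtimes> \<^bold>1 S = v\<^sup>\<dagger> \<cdot> (z \<boxtimes> \<^bold>1 X) \<cdot> e \<cdot> v" unfolding block_absorb by (rule center_sub(2)[OF block_typing(17,13) z])
    also have "\<dots> = v\<^sup>\<dagger> \<cdot> ((z \<boxtimes> \<^bold>1 X) \<cdot> e) \<cdot> v" by simp
    also have "\<dots> = l \<^bold>* \<^bold>1 S" unfolding l by (simp add: vcomp_linear block_absorb block_typing(13))
    finally show ?thesis by blast
  qed
qed

lemma block_dim:
  assumes "e \<cdot> f \<noteq> zero2 C X X"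
  shows "\<^bold>1 S \<noteq> zero2 C S S" "D e f = factorial_dim C S"
  using sub_nonzero[OF block_typing(22) assms] matrix_dim_eq[OF rigid block_typing(22) block_factorial assms] by auto

end

lemma D_zero: "e \<cdot> f = zero2 C X X \<Longrightarrow> D e f = 0"
  by (simp add: matrix_dim_def)

lemma weight_zero:
  assumes "e \<in> E" "f \<in> F" "e \<cdot> f = zero2 C X X" shows "left_weight e f = 0" "right_weight e f = 0"
proof -
  note [simp] = EF_typing(1-6)[OF assms(1,2)]
  have "complex_of_real (left_weight e f) \<^bold>* f = 0 \<^bold>* f"
    using weight_props(2)[OF assms(1,2)] unfolding assms(3) by (simp add: lmap_def scale2_zero)
  then have "complex_of_real (left_weight e f) = 0" by (rule scale_cancel[OF _ FH[OF assms(2)] F_props(8)[OF assms(2)]])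
  then show "left_weight e f = 0" by simp
  have "complex_of_real (right_weight e f) \<^bold>* e = 0 \<^bold>* e"
    using weight_props(4)[OF assms(1,2)] unfolding assms(3) by (simp add: rmap_def scale2_zero)
  then have "complex_of_real (right_weight e f) = 0" by (rule scale_cancel[OF _ EH[OF assms(1)] E_props(8)[OF assms(1)]])
  then show "right_weight e f = 0" by simp
qed

text \<open>The bound is the dimension inequality for the compressed solution of the block. On zero
  blocks the matrix entry is 0 by definition, while the weights are nonnegative.\<close>

lemma D_bound:
  assumes "e \<in> E" "f \<in> F"
  shows "(D e f)\<^sup>2 \<le> left_weight e f * right_weight e f" "e \<cdot> f \<noteq> zero2 C X X \<Longrightarrow> 0 < D e f"
proof -
  obtain p q where "p \<in> center C M" "p \<boxtimes> \<^bold>1 X = e" "q \<in> center C N" "\<^bold>1 X \<boxtimes> q = f"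
    using E_preimage[OF assms(1)] F_preimage[OF assms(2)] by blast
  then obtain S Sb v vb where blk: "block e f p q S Sb v vb" using block_exists[OF assms] by blast
  have "(D e f)\<^sup>2 \<le> left_weight e f * right_weight e f \<and> 0 < D e f" if n: "e \<cdot> f \<noteq> zero2 C X X"
    using factorial_dim_bound(1,4)[OF rigid block_factorial[OF assms blk] block_dim(1)[OF assms blk n]
        block_conjugate[OF assms blk] block_scalars[OF assms blk]] block_dim(2)[OF assms blk n] by simp
  then show "(D e f)\<^sup>2 \<le> left_weight e f * right_weight e f" "e \<cdot> f \<noteq> zero2 C X X \<Longrightarrow> 0 < D e f"
    using weight_props(1,3)[OF assms] D_zero[of e f] by (cases "e \<cdot> f = zero2 C X X", auto)
qed

end

section \<open>The minimum of the norm product\<close>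

context connected_pair
begin

text \<open>Entries are positive exactly where \<open>e \<cdot> f\<close> is nonzero, so the graph
  of the matrix is the one that connectedness of \<open>X\<close> controls. A matrix of zeros would
  make \<open>e\<close>, the sum of its products with all \<open>f\<close>, vanish.\<close>

lemma dimension_matrix: "nonneg_matrix E F D"
proof
  show "finite E" "finite F" by (rule E_props(1), rule F_props(1))
  show "0 \<le> D e f" if "e \<in> E" "f \<in> F" for e f
    using D_bound(2)[OF that] D_zero[of e f] by fastforce
  show "\<exists>e\<in>E. \<exists>f\<in>F. D e f \<noteq> 0"
  proof (rule ccontr)
    assume neg: "\<not> ?thesis"
    obtain e where e: "e \<in> E" using E_nonempty by blast
    have "e = e \<cdot> hsum X X (\<lambda>f. f) F" using F_props(2) E_props(3-5)[OF e] by simp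
    also have "\<dots> = hsum X X (\<lambda>f. e \<cdot> f) F"
      by (rule vcomp_hsum[OF parXX F_props(1) FH EH[OF e]])
    also have "\<dots> = zero2 C X X"
    proof (rule hsum_zero[OF parXX])
      show "e \<cdot> f = zero2 C X X" if "f \<in> F" for f
        using D_bound(2)[OF e that] neg e that by fastforce
    qed
    finally show False using E_props(8)[OF e] by blast
  qed
  show "S = {} \<and> T = {} \<or> S = E \<and> T = F"
    if "S \<subseteq> E" "T \<subseteq> F" "\<And>e f. e \<in> E \<Longrightarrow> f \<in> F \<Longrightarrow> D e f \<noteq> 0 \<Longrightarrow> (e \<in> S) = (f \<in> T)" for S T
  proof (rule irreducible[OF that(1,2)])
    show "(e \<in> S) = (f \<in> T)" if "e \<in> E" "f \<in> F" "e \<cdot> f \<noteq> zero2 C X X" for e f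
      using D_bound(2)[OF that] \<open>\<And>e f. e \<in> E \<Longrightarrow> f \<in> F \<Longrightarrow> D e f \<noteq> 0 \<Longrightarrow> (e \<in> S) = (f \<in> T)\<close>[OF that(1,2)] by simp
  qed
qed

lemma scalar_dim_eq: "scalar_dim C X = l2_op_norm E F D"
  by (simp add: scalar_dim_def)

lemma nu_half_eq: "nu_half C X = positive_eigenvector F (\<lambda>f f'. \<Sum>e\<in>E. D e f * D e f') ((l2_op_norm E F D)\<^sup>2)"
  by (simp add: nu_half_def scalar_dim_def)

lemma mu_half_eq: "mu_half C X = positive_eigenvector E (\<lambda>e e'. \<Sum>f\<in>F. D e f * D e' f) ((l2_op_norm E F D)\<^sup>2)"
  by (simp add: mu_half_def scalar_dim_def)

lemmas perron = nonneg_matrix.perron_frobenius[OF dimension_matrix, folded nu_half_eq mu_half_eq scalar_dim_eq]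

text \<open>On a minimal projection, the central element of the solution acts by a column or row sum
  of weights, which its norm dominates. The two norms thus serve as the bounds \<rho> and \<sigma>
  of the matrix estimate.\<close>

lemma norm_product:
  defines "\<rho> \<equiv> nrm (\<^bold>1 X \<boxtimes> (r\<^sup>\<dagger> \<cdot> r))" and "\<sigma> \<equiv> nrm ((rb\<^sup>\<dagger> \<cdot> rb) \<boxtimes> \<^bold>1 X)"
  shows "(scalar_dim C X)\<^sup>2 \<le> \<rho> * \<sigma>"
    "\<lbrakk>\<rho> * \<sigma> = (scalar_dim C X)\<^sup>2; e \<in> E; f \<in> F\<rbrakk>
      \<Longrightarrow> left_weight e f * right_weight e f = (D e f)\<^sup>2 \<and> right_weight e f = sqrt (\<sigma> / \<rho>) * D e f * nu_half C X f / mu_half C X e"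
proof -
  have rs: "0 \<le> \<rho>" "0 \<le> \<sigma>" by (simp_all add: \<rho>_def \<sigma>_def)
  note wb = nonneg_matrix.weighted_bound[OF dimension_matrix weight_props(1,3) D_bound(1) _ _ rs,
      folded nu_half_eq mu_half_eq scalar_dim_eq]
  note le = left_weight_sum_le[folded \<rho>_def] right_weight_sum_le[folded \<sigma>_def]
  show "(scalar_dim C X)\<^sup>2 \<le> \<rho> * \<sigma>" by (rule wb(1)) (use le in auto)
  show "left_weight e f * right_weight e f = (D e f)\<^sup>2 \<and> right_weight e f = sqrt (\<sigma> / \<rho>) * D e f * nu_half C X f / mu_half C X e"
    if "\<rho> * \<sigma> = (scalar_dim C X)\<^sup>2" "e \<in> E" "f \<in> F"
    by (rule wb(2)) (use le that in auto)
qed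

lemma EF_sum: "hsum X X (\<lambda>(e, f). e \<cdot> f) (E \<times> F) = \<^bold>1 X"
proof -
  have t: "e \<cdot> f \<in> Hom C X X" if "e \<in> E" "f \<in> F" for e f
    using EF_typing(1-6)[OF that] by (simp add: Hom_iff)
  have "hsum X X (\<lambda>(e, f). e \<cdot> f) (E \<times> F) = hsum X X (\<lambda>e. hsum X X (\<lambda>f. e \<cdot> f) F) E"
    by (rule hsum_Times[OF parXX E_props(1) F_props(1) t])
  also have "\<dots> = hsum X X (\<lambda>e. e) E"
  proof (rule hsum_cong[OF parXX refl _ EH])
    show "hsum X X (\<lambda>f. e \<cdot> f) F = e" if e: "e \<in> E" for e
      using vcomp_hsum[of X X F "\<lambda>f. f" e X, OF parXX F_props(1) FH EH[OF e]] F_props(2) E_props(3-5)[OF e] by simp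
  qed
  finally show ?thesis using E_props(2) by simp
qed

text \<open>One resolution of the unit of \<open>X\<close> suffices: by
  \<open>block_recover\<close>, each term already lies in the matching block of \<open>Xb\<close>,
  so every solution is block diagonal.\<close>

lemma solution_as_sum:
  "c \<^bold>* r = hsum (\<^bold>I N) (Xb \<boxdot> X) (\<lambda>(e, f). c \<^bold>* ((\<^bold>1 Xb \<boxtimes> (e \<cdot> f)) \<cdot> r)) (E \<times> F)"
  "c \<^bold>* rb = hsum (\<^bold>I M) (X \<boxdot> Xb) (\<lambda>(e, f). c \<^bold>* (((e \<cdot> f) \<boxtimes> \<^bold>1 Xb) \<cdot> rb)) (E \<times> F)"
proof -
  have fin: "finite (E \<times> F)" using E_props(1) F_props(1) by simp
  have t: "(\<lambda>(e, f). e \<cdot> f) x \<in> Hom C X X" if "x \<in> E \<times> F" for x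
    using that EF_typing(1-6) by (auto simp: Hom_iff)
  have "c \<^bold>* ((\<^bold>1 Xb \<boxtimes> hsum X X (\<lambda>(e, f). e \<cdot> f) (E \<times> F)) \<cdot> r)
      = hsum (\<^bold>I N) (Xb \<boxdot> X) (\<lambda>x. c \<^bold>* ((\<^bold>1 Xb \<boxtimes> (case x of (e, f) \<Rightarrow> e \<cdot> f)) \<cdot> r)) (E \<times> F)"
    by (rule hsum_map[OF parXX _ fin t, where \<phi> = "\<lambda>t. c \<^bold>* ((\<^bold>1 Xb \<boxtimes> t) \<cdot> r)"])
      (auto simp: parallel_def Hom_iff hcomp_linear vcomp_linear scale2_distrib)
  then show "c \<^bold>* r = hsum (\<^bold>I N) (Xb \<boxdot> X) (\<lambda>(e, f). c \<^bold>* ((\<^bold>1 Xb \<boxtimes> (e \<cdot> f)) \<cdot> r)) (E \<times> F)"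
    unfolding EF_sum by (simp add: hcomp_unit2' case_prod_unfold)
  have "c \<^bold>* ((hsum X X (\<lambda>(e, f). e \<cdot> f) (E \<times> F) \<boxtimes> \<^bold>1 Xb) \<cdot> rb)
      = hsum (\<^bold>I M) (X \<boxdot> Xb) (\<lambda>x. c \<^bold>* (((case x of (e, f) \<Rightarrow> e \<cdot> f) \<boxtimes> \<^bold>1 Xb) \<cdot> rb)) (E \<times> F)"
    by (rule hsum_map[OF parXX _ fin t, where \<phi> = "\<lambda>t. c \<^bold>* ((t \<boxtimes> \<^bold>1 Xb) \<cdot> rb)"])
      (auto simp: parallel_def Hom_iff hcomp_linear vcomp_linear scale2_distrib)
  then show "c \<^bold>* rb = hsum (\<^bold>I M) (X \<boxdot> Xb) (\<lambda>(e, f). c \<^bold>* (((e \<cdot> f) \<boxtimes> \<^bold>1 Xb) \<cdot> rb)) (E \<times> F)"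
    unfolding EF_sum by (simp add: hcomp_unit2' case_prod_unfold)
qed

lemma equality_imp_standard:
  assumes eq: "nrm (\<^bold>1 X \<boxtimes> (r\<^sup>\<dagger> \<cdot> r)) * nrm ((rb\<^sup>\<dagger> \<cdot> rb) \<boxtimes> \<^bold>1 X) = (scalar_dim C X)\<^sup>2"
  shows "\<exists>c>0. standard_solution C X Xb (complex_of_real c \<^bold>* r) (complex_of_real (1 / c) \<^bold>* rb)"
proof -
  let ?\<mu> = "mu_half C X" and ?\<nu> = "nu_half C X"
  define \<rho> where "\<rho> = nrm (\<^bold>1 X \<boxtimes> (r\<^sup>\<dagger> \<cdot> r))"
  define \<sigma> where "\<sigma> = nrm ((rb\<^sup>\<dagger> \<cdot> rb) \<boxtimes> \<^bold>1 X)"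
  have eq': "\<rho> * \<sigma> = (scalar_dim C X)\<^sup>2" using eq by (simp add: \<rho>_def \<sigma>_def)
  have "0 \<le> \<rho>" "0 \<le> \<sigma>" by (simp_all add: \<rho>_def \<sigma>_def)
  moreover have "\<rho> * \<sigma> \<noteq> 0" unfolding eq' using perron(1) by simp
  ultimately have pos: "0 < \<rho>" "0 < \<sigma>" by (auto simp: order_less_le)
  note np = norm_product(2)[folded \<rho>_def \<sigma>_def, OF eq']
  \<comment> \<open>The fourth root makes \<open>c\<^sup>2 * \<rho>\<close> equal to
    \<open>\<sigma> / c\<^sup>2\<close>, so both norms of the rescaled solution coincide.\<close>
  define c where "c = sqrt (sqrt (\<sigma> / \<rho>))"
  have c: "0 < c" "c\<^sup>2 = sqrt (\<sigma> / \<rho>)" using pos by (simp_all add: c_def)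
  obtain p where p: "\<And>e. e \<in> E \<Longrightarrow> p e \<in> center C M" "\<And>e. e \<in> E \<Longrightarrow> p e \<boxtimes> \<^bold>1 X = e"
    using E_preimage by metis
  obtain q where q: "\<And>f. f \<in> F \<Longrightarrow> q f \<in> center C N" "\<And>f. f \<in> F \<Longrightarrow> \<^bold>1 X \<boxtimes> q f = f"
    using F_preimage by metis
  have "\<forall>e f. e \<in> E \<longrightarrow> f \<in> F \<longrightarrow> (\<exists>S Sb v vb. block e f (p e) (q f) S Sb v vb)"
    using block_exists p q by blast
  then obtain S Sb v vb where blk: "\<And>e f. e \<in> E \<Longrightarrow> f \<in> F \<Longrightarrow> block e f (p e) (q f) (S e f) (Sb e f) (v e f) (vb e f)"
    by metis
  \<comment> \<open>Standardness of a block requires the square of \<open>l e f\<close> to be the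
    dimension divided by the right weight. The equality case gives that weight as
    \<open>c\<^sup>2\<close> times the dimension times \<nu> over \<mu>, and the factor prescribed
    by the definition times \<open>1 / l e f\<close> is then \<open>c\<close>.\<close>
  define l where "l e f = sqrt (?\<mu> e) / sqrt (?\<nu> f) / c" for e f
  define rS where "rS e f = ((vb e f)\<^sup>\<dagger> \<boxtimes> (v e f)\<^sup>\<dagger>) \<cdot> r" for e f
  define rbS where "rbS e f = ((v e f)\<^sup>\<dagger> \<boxtimes> (vb e f)\<^sup>\<dagger>) \<cdot> rb" for e f
  define rij where "rij e f = (if e \<cdot> f = zero2 C X X then zero2 C (\<^bold>I N) (Sb e f \<boxdot> S e f)
    else complex_of_real (1 / l e f) \<^bold>* rS e f)" for e f
  define rbij where "rbij e f = (if e \<cdot> f = zero2 C X X then zero2 C (\<^bold>I M) (S e f \<boxdot> Sb e f)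
    else complex_of_real (l e f) \<^bold>* rbS e f)" for e f
  have lpos: "0 < l e f" if "e \<in> E" "f \<in> F" for e f
    using c perron(2)[OF that(2)] perron(3)[OF that(1)] by (simp add: l_def)
  have std: "factorial_standard_solution C (S e f) (Sb e f) (rij e f) (rbij e f)"
    if ef: "e \<in> E" "f \<in> F" and n: "e \<cdot> f \<noteq> zero2 C X X" for e f
  proof -
    note B = blk[OF ef]
    have dim: "D e f = factorial_dim C (S e f)" by (rule block_dim(2)[OF ef B n])
    have Dp: "0 < D e f" by (rule D_bound(2)[OF ef n])
    have mn: "0 < ?\<mu> e" "0 < ?\<nu> f" using perron(2,3) ef by auto
    have "right_weight e f = c\<^sup>2 * D e f * ?\<nu> f / ?\<mu> e" using np[OF ef] c(2) by simp
    then have l2: "(l e f)\<^sup>2 = D e f / right_weight e f"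
      using Dp mn c(1) by (simp add: l_def power_divide power_mult_distrib)
    have abD: "left_weight e f * right_weight e f = (D e f)\<^sup>2" using np[OF ef] by blast
    have "factorial_standard_solution C (S e f) (Sb e f) (complex_of_real (1 / l e f) \<^bold>* rS e f) (complex_of_real (l e f) \<^bold>* rbS e f)"
      unfolding rS_def rbS_def
      by (rule factorial_dim_bound(5)[OF rigid block_factorial[OF ef B] block_dim(1)[OF ef B n] block_conjugate[OF ef B]
          block_scalars[OF ef B] abD[unfolded dim] lpos[OF ef] l2[unfolded dim]])
    then show ?thesis using n by (simp add: rij_def rbij_def)
  qed
  have sum1: "complex_of_real c \<^bold>* r = hsum (\<^bold>I N) (Xb \<boxdot> X)
      (\<lambda>(e, f). complex_of_real (sqrt (?\<mu> e) / sqrt (?\<nu> f)) \<^bold>* ((vb e f \<boxtimes> v e f) \<cdot> rij e f)) (E \<times> F)"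
    unfolding solution_as_sum(1)[of "complex_of_real c"]
  proof (rule hsum_cong)
    fix x assume x: "x \<in> E \<times> F"
    obtain e f where ef: "x = (e, f)" "e \<in> E" "f \<in> F" using x by blast
    note [simp] = block_typing(1-12)[OF ef(2,3) blk[OF ef(2,3)]] EF_typing(1-6)[OF ef(2,3)]
    have t: "complex_of_real (sqrt (?\<mu> e) / sqrt (?\<nu> f)) \<^bold>* ((vb e f \<boxtimes> v e f) \<cdot> rij e f) \<in> Hom C (\<^bold>I N) (Xb \<boxdot> X)"
      by (simp add: Hom_iff rij_def rS_def del: of_real_divide)
    then show "(case x of (e, f) \<Rightarrow> complex_of_real (sqrt (?\<mu> e) / sqrt (?\<nu> f)) \<^bold>* ((vb e f \<boxtimes> v e f) \<cdot> rij e f)) \<in> Hom C (\<^bold>I N) (Xb \<boxdot> X)"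
      using ef by simp
    have "complex_of_real c \<^bold>* ((\<^bold>1 Xb \<boxtimes> (e \<cdot> f)) \<cdot> r) = complex_of_real (sqrt (?\<mu> e) / sqrt (?\<nu> f)) \<^bold>* ((vb e f \<boxtimes> v e f) \<cdot> rij e f)"
    proof (cases "e \<cdot> f = zero2 C X X")
      case True
      then show ?thesis by (simp add: rij_def)
    next
      case False
      have "(vb e f \<boxtimes> v e f) \<cdot> rij e f = complex_of_real (1 / l e f) \<^bold>* ((\<^bold>1 Xb \<boxtimes> (e \<cdot> f)) \<cdot> r)"
        using False block_recover(1)[OF ef(2,3) blk[OF ef(2,3)]] by (simp add: rij_def rS_def vcomp_linear del: of_real_divide)
      moreover have "complex_of_real (sqrt (?\<mu> e) / sqrt (?\<nu> f)) * complex_of_real (1 / l e f) = complex_of_real c"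
        unfolding of_real_mult[symmetric] of_real_eq_iff using perron(2)[OF ef(3)] perron(3)[OF ef(2)] c(1) by (simp add: l_def)
      ultimately show ?thesis by (simp del: of_real_divide)
    qed
    then show "(case x of (e, f) \<Rightarrow> complex_of_real c \<^bold>* ((\<^bold>1 Xb \<boxtimes> (e \<cdot> f)) \<cdot> r)) =
      (case x of (e, f) \<Rightarrow> complex_of_real (sqrt (?\<mu> e) / sqrt (?\<nu> f)) \<^bold>* ((vb e f \<boxtimes> v e f) \<cdot> rij e f))"
      using ef by simp
  qed (auto simp: parallel_def)
  have sum2: "complex_of_real (1 / c) \<^bold>* rb = hsum (\<^bold>I M) (X \<boxdot> Xb)
      (\<lambda>(e, f). complex_of_real (sqrt (?\<nu> f) / sqrt (?\<mu> e)) \<^bold>* ((v e f \<boxtimes> vb e f) \<cdot> rbij e f)) (E \<times> F)"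
    unfolding solution_as_sum(2)[of "complex_of_real (1 / c)"]
  proof (rule hsum_cong)
    fix x assume x: "x \<in> E \<times> F"
    obtain e f where ef: "x = (e, f)" "e \<in> E" "f \<in> F" using x by blast
    note [simp] = block_typing(1-12)[OF ef(2,3) blk[OF ef(2,3)]] EF_typing(1-6)[OF ef(2,3)]
    have t: "complex_of_real (sqrt (?\<nu> f) / sqrt (?\<mu> e)) \<^bold>* ((v e f \<boxtimes> vb e f) \<cdot> rbij e f) \<in> Hom C (\<^bold>I M) (X \<boxdot> Xb)"
      by (simp add: Hom_iff rbij_def rbS_def del: of_real_divide)
    then show "(case x of (e, f) \<Rightarrow> complex_of_real (sqrt (?\<nu> f) / sqrt (?\<mu> e)) \<^bold>* ((v e f \<boxtimes> vb e f) \<cdot> rbij e f)) \<in> Hom C (\<^bold>I M) (X \<boxdot> Xb)"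
      using ef by simp
    have "complex_of_real (1 / c) \<^bold>* (((e \<cdot> f) \<boxtimes> \<^bold>1 Xb) \<cdot> rb) = complex_of_real (sqrt (?\<nu> f) / sqrt (?\<mu> e)) \<^bold>* ((v e f \<boxtimes> vb e f) \<cdot> rbij e f)"
    proof (cases "e \<cdot> f = zero2 C X X")
      case True
      then show ?thesis by (simp add: rbij_def)
    next
      case False
      have "(v e f \<boxtimes> vb e f) \<cdot> rbij e f = complex_of_real (l e f) \<^bold>* (((e \<cdot> f) \<boxtimes> \<^bold>1 Xb) \<cdot> rb)"
        using False block_recover(2)[OF ef(2,3) blk[OF ef(2,3)]] by (simp add: rbij_def rbS_def vcomp_linear)
      moreover have "complex_of_real (sqrt (?\<nu> f) / sqrt (?\<mu> e)) * complex_of_real (l e f) = complex_of_real (1 / c)"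
        unfolding of_real_mult[symmetric] of_real_eq_iff using perron(2)[OF ef(3)] perron(3)[OF ef(2)] c(1) by (simp add: l_def)
      ultimately show ?thesis by (simp del: of_real_divide)
    qed
    then show "(case x of (e, f) \<Rightarrow> complex_of_real (1 / c) \<^bold>* (((e \<cdot> f) \<boxtimes> \<^bold>1 Xb) \<cdot> rb)) =
      (case x of (e, f) \<Rightarrow> complex_of_real (sqrt (?\<nu> f) / sqrt (?\<mu> e)) \<^bold>* ((v e f \<boxtimes> vb e f) \<cdot> rbij e f))"
      using ef by simp
  qed (auto simp: parallel_def)
  have "standard_solution C X Xb (complex_of_real c \<^bold>* r) (complex_of_real (1 / c) \<^bold>* rb)"
    unfolding standard_solution_def
  proof (intro conjI exI)
    show "conjugate_solution C X Xb (complex_of_real c \<^bold>* r) (complex_of_real (1 / c) \<^bold>* rb)"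
      using scaled_solution[of c] c(1) by simp
    show "\<forall>e\<in>E. p e \<in> center C (tgt C X) \<and> p e \<boxtimes> \<^bold>1 X = e" using p by simp
    show "\<forall>f\<in>F. q f \<in> center C (src C X) \<and> \<^bold>1 X \<boxtimes> q f = f" using q by simp
    show "complex_of_real c \<^bold>* r = hsum (\<^bold>I (src C X)) (Xb \<boxdot> X)
      (\<lambda>(e, f). complex_of_real (sqrt (?\<mu> e) / sqrt (?\<nu> f)) \<^bold>* ((vb e f \<boxtimes> v e f) \<cdot> rij e f)) (E \<times> F)"
      unfolding typing(2) by (rule sum1)
    show "complex_of_real (1 / c) \<^bold>* rb = hsum (\<^bold>I (tgt C X)) (X \<boxdot> Xb)
      (\<lambda>(e, f). complex_of_real (sqrt (?\<nu> f) / sqrt (?\<mu> e)) \<^bold>* ((v e f \<boxtimes> vb e f) \<cdot> rbij e f)) (E \<times> F)"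
      unfolding typing(3) by (rule sum2)
    show "\<forall>e\<in>E. \<forall>f\<in>F. sub_1_arrow C (S e f) (v e f) X (p e \<boxtimes> \<^bold>1 X \<boxtimes> q f) \<and>
        sub_1_arrow C (Sb e f) (vb e f) Xb (q f \<boxtimes> \<^bold>1 Xb \<boxtimes> p e) \<and>
        (if p e \<boxtimes> \<^bold>1 X \<boxtimes> q f = zero2 C X X
         then rij e f = zero2 C (\<^bold>I (src C X)) (Sb e f \<boxdot> S e f) \<and> rbij e f = zero2 C (\<^bold>I (tgt C X)) (S e f \<boxdot> Sb e f)
         else factorial_standard_solution C (S e f) (Sb e f) (rij e f) (rbij e f))"
    proof (intro ballI conjI)
      fix e f assume ef: "e \<in> E" "f \<in> F"
      show "sub_1_arrow C (S e f) (v e f) X (p e \<boxtimes> \<^bold>1 X \<boxtimes> q f)" "sub_1_arrow C (Sb e f) (vb e f) Xb (q f \<boxtimes> \<^bold>1 Xb \<boxtimes> p e)"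
        using blk[OF ef] by (auto simp: block_def)
      show "if p e \<boxtimes> \<^bold>1 X \<boxtimes> q f = zero2 C X X
         then rij e f = zero2 C (\<^bold>I (src C X)) (Sb e f \<boxdot> S e f) \<and> rbij e f = zero2 C (\<^bold>I (tgt C X)) (S e f \<boxdot> Sb e f)
         else factorial_standard_solution C (S e f) (Sb e f) (rij e f) (rbij e f)"
        unfolding block_typing(21)[OF ef blk[OF ef]] using std[OF ef] by (simp add: rij_def rbij_def)
    qed
  qed
  then show ?thesis using c(1) by blast
qed

lemma block_orthogonal:
  assumes ef: "e \<in> E" "f \<in> F" and ef': "e' \<in> E" "f' \<in> F" and n: "(e, f) \<noteq> (e', f')"
    and B: "block e f p q S Sb v vb" and B': "block e' f' p' q' S' Sb' v' vb'"
  shows "v\<^sup>\<dagger> \<cdot> v' = zero2 C S' S"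
proof -
  note [simp] = block_typing(1-12)[OF ef B] block_typing(1-12)[OF ef' B'] EF_typing(1-10)[OF ef] EF_typing(1-10)[OF ef']
  have "(e \<cdot> f) \<cdot> (e' \<cdot> f') = zero2 C X X"
  proof (cases "e = e'")
    case True
    then have "f \<cdot> f' = zero2 C X X" using n F_props(10)[OF ef(2) ef'(2)] by blast
    moreover have "(e \<cdot> f) \<cdot> (e' \<cdot> f') = e \<cdot> (f \<cdot> e') \<cdot> f'" by simp
    moreover have "f \<cdot> e' = e' \<cdot> f" by (rule EF_commute[OF ef'(1) ef(2)])
    ultimately show ?thesis by simp
  next
    case False
    then have "e \<cdot> e' = zero2 C X X" using E_props(10)[OF ef(1) ef'(1)] by blast
    have "(e \<cdot> f) \<cdot> (e' \<cdot> f') = e \<cdot> (f \<cdot> e') \<cdot> f'" by simp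
    also have "f \<cdot> e' = e' \<cdot> f" by (rule EF_commute[OF ef'(1) ef(2)])
    also have "e \<cdot> (e' \<cdot> f) \<cdot> f' = (e \<cdot> e') \<cdot> f \<cdot> f'" by simp
    finally show ?thesis using \<open>e \<cdot> e' = zero2 C X X\<close> by simp
  qed
  then have 0: "(v \<cdot> v\<^sup>\<dagger>) \<cdot> (v' \<cdot> v'\<^sup>\<dagger>) = zero2 C X X"
    unfolding block_typing(15)[OF ef B] block_typing(15)[OF ef' B'] .
  have "v\<^sup>\<dagger> \<cdot> v' = (v\<^sup>\<dagger> \<cdot> v) \<cdot> (v\<^sup>\<dagger> \<cdot> v') \<cdot> (v'\<^sup>\<dagger> \<cdot> v')"
    by (simp add: block_typing(13)[OF ef B] block_typing(13)[OF ef' B'])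
  also have "\<dots> = v\<^sup>\<dagger> \<cdot> ((v \<cdot> v\<^sup>\<dagger>) \<cdot> (v' \<cdot> v'\<^sup>\<dagger>)) \<cdot> v'" by simp
  also have "\<dots> = zero2 C S' S" unfolding 0 by simp
  finally show ?thesis .
qed

text \<open>The weights are read off from the blocks of the standard solution, and the singular
  vector equations make all column sums and all row sums of weights constant. Both squares of the
  solution are then scalar, and their norms have the product
  \<open>(scalar_dim C X)\<^sup>2\<close>.\<close>

lemma standard_imp_equality:
  assumes c: "c > 0" and std: "standard_solution C X Xb (complex_of_real c \<^bold>* r) (complex_of_real (1 / c) \<^bold>* rb)"
  shows "nrm (\<^bold>1 X \<boxtimes> (r\<^sup>\<dagger> \<cdot> r)) * nrm ((rb\<^sup>\<dagger> \<cdot> rb) \<boxtimes> \<^bold>1 X) = (scalar_dim C X)\<^sup>2"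
proof -
  let ?\<mu> = "mu_half C X" and ?\<nu> = "nu_half C X" and ?d = "scalar_dim C X"
  from std obtain p q S Sb v vb rij rbij where
    p: "\<forall>e\<in>E. p e \<in> center C M \<and> p e \<boxtimes> \<^bold>1 X = e" and q: "\<forall>f\<in>F. q f \<in> center C N \<and> \<^bold>1 X \<boxtimes> q f = f"
    and sub: "\<forall>e\<in>E. \<forall>f\<in>F. sub_1_arrow C (S e f) (v e f) X (p e \<boxtimes> \<^bold>1 X \<boxtimes> q f) \<and>
        sub_1_arrow C (Sb e f) (vb e f) Xb (q f \<boxtimes> \<^bold>1 Xb \<boxtimes> p e) \<and>
        (if p e \<boxtimes> \<^bold>1 X \<boxtimes> q f = zero2 C X X
         then rij e f = zero2 C (\<^bold>I N) (Sb e f \<boxdot> S e f) \<and> rbij e f = zero2 C (\<^bold>I M) (S e f \<boxdot> Sb e f)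
         else factorial_standard_solution C (S e f) (Sb e f) (rij e f) (rbij e f))"
    and sum1: "complex_of_real c \<^bold>* r = hsum (\<^bold>I N) (Xb \<boxdot> X)
      (\<lambda>(e, f). complex_of_real (sqrt (?\<mu> e) / sqrt (?\<nu> f)) \<^bold>* ((vb e f \<boxtimes> v e f) \<cdot> rij e f)) (E \<times> F)"
    and sum2: "complex_of_real (1 / c) \<^bold>* rb = hsum (\<^bold>I M) (X \<boxdot> Xb)
      (\<lambda>(e, f). complex_of_real (sqrt (?\<nu> f) / sqrt (?\<mu> e)) \<^bold>* ((v e f \<boxtimes> vb e f) \<cdot> rbij e f)) (E \<times> F)"
    unfolding standard_solution_def typing(2,3) by blast
  have blk: "block e f (p e) (q f) (S e f) (Sb e f) (v e f) (vb e f)" if "e \<in> E" "f \<in> F" for e f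
    using p q sub that by (simp add: block_def)
  have fin: "finite (E \<times> F)" using E_props(1) F_props(1) by simp
  have std: "factorial_standard_solution C (S e f) (Sb e f) (rij e f) (rbij e f)"
    if "e \<in> E" "f \<in> F" "e \<cdot> f \<noteq> zero2 C X X" for e f
    using sub that block_typing(21)[OF that(1,2) blk[OF that(1,2)]] by auto
  have rt: "rij e f \<in> Arr2 C" "dom2 C (rij e f) = \<^bold>I N" "cod2 C (rij e f) = Sb e f \<boxdot> S e f"
    "rbij e f \<in> Arr2 C" "dom2 C (rbij e f) = \<^bold>I M" "cod2 C (rbij e f) = S e f \<boxdot> Sb e f"
    if ef: "e \<in> E" "f \<in> F" for e f
  proof -
    note bt = block_typing(1-12)[OF ef blk[OF ef]]
    have "rij e f \<in> Hom C (\<^bold>I N) (Sb e f \<boxdot> S e f) \<and> rbij e f \<in> Hom C (\<^bold>I M) (S e f \<boxdot> Sb e f)"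
    proof (cases "e \<cdot> f = zero2 C X X")
      case True
      then have "rij e f = zero2 C (\<^bold>I N) (Sb e f \<boxdot> S e f)" "rbij e f = zero2 C (\<^bold>I M) (S e f \<boxdot> Sb e f)"
        using sub ef block_typing(21)[OF ef blk[OF ef]] by auto
      then show ?thesis using bt by (simp add: Hom_iff)
    next
      case False
      then show ?thesis using standard_solutionD(2)[OF std[OF ef False]] bt by (simp add: conjugate_solution_def)
    qed
    then show "rij e f \<in> Arr2 C" "dom2 C (rij e f) = \<^bold>I N" "cod2 C (rij e f) = Sb e f \<boxdot> S e f"
      "rbij e f \<in> Arr2 C" "dom2 C (rbij e f) = \<^bold>I M" "cod2 C (rbij e f) = S e f \<boxdot> Sb e f"
      by (auto simp: Hom_iff)
  qed
  \<comment> \<open>Compression to one pair removes all other summands, since distinct pairs have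
    orthogonal isometries; the block of the sum is its own standard solution with its
    coefficient.\<close>
  have compress: "complex_of_real c \<^bold>* (((vb e f)\<^sup>\<dagger> \<boxtimes> (v e f)\<^sup>\<dagger>) \<cdot> r) = complex_of_real (sqrt (?\<mu> e) / sqrt (?\<nu> f)) \<^bold>* rij e f"
    "complex_of_real (1 / c) \<^bold>* (((v e f)\<^sup>\<dagger> \<boxtimes> (vb e f)\<^sup>\<dagger>) \<cdot> rb) = complex_of_real (sqrt (?\<nu> f) / sqrt (?\<mu> e)) \<^bold>* rbij e f"
    if ef: "e \<in> E" "f \<in> F" for e f
  proof -
    note [simp] = block_typing(1-14)[OF ef blk[OF ef]] rt[OF ef]
    let ?g = "\<lambda>x. case x of (e, f) \<Rightarrow> complex_of_real (sqrt (?\<mu> e) / sqrt (?\<nu> f)) \<^bold>* ((vb e f \<boxtimes> v e f) \<cdot> rij e f)"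
    have gH: "?g x \<in> Hom C (\<^bold>I N) (Xb \<boxdot> X)" if "x \<in> E \<times> F" for x
      using that block_typing(1-12)[OF _ _ blk] rt by (auto simp: Hom_iff split: prod.splits simp del: of_real_divide)
    have "complex_of_real c \<^bold>* (((vb e f)\<^sup>\<dagger> \<boxtimes> (v e f)\<^sup>\<dagger>) \<cdot> r) = ((vb e f)\<^sup>\<dagger> \<boxtimes> (v e f)\<^sup>\<dagger>) \<cdot> complex_of_real c \<^bold>* r"
      by (simp add: vcomp_linear)
    also have "\<dots> = hsum (\<^bold>I N) (Sb e f \<boxdot> S e f) (\<lambda>x. ((vb e f)\<^sup>\<dagger> \<boxtimes> (v e f)\<^sup>\<dagger>) \<cdot> ?g x) (E \<times> F)"
      unfolding sum1 by (rule vcomp_hsum[OF _ fin gH]) (auto simp: parallel_def Hom_iff)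
    also have "\<dots> = ((vb e f)\<^sup>\<dagger> \<boxtimes> (v e f)\<^sup>\<dagger>) \<cdot> ?g (e, f)"
    proof (rule hsum_delta)
      fix x assume x: "x \<in> E \<times> F" "x \<noteq> (e, f)"
      obtain e' f' where x': "x = (e', f')" "e' \<in> E" "f' \<in> F" "(e, f) \<noteq> (e', f')" using x by blast
      note [simp] = block_typing(1-12)[OF x'(2,3) blk[OF x'(2,3)]] rt[OF x'(2,3)]
      have "(v e f)\<^sup>\<dagger> \<cdot> v e' f' = zero2 C (S e' f') (S e f)"
        by (rule block_orthogonal[OF ef x'(2-4) blk[OF ef] blk[OF x'(2,3)]])
      then show "((vb e f)\<^sup>\<dagger> \<boxtimes> (v e f)\<^sup>\<dagger>) \<cdot> ?g x = zero2 C (\<^bold>I N) (Sb e f \<boxdot> S e f)"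
        using x'(1) by (simp add: vcomp_linear merge del: of_real_divide)
    qed (use ef fin in \<open>auto simp: parallel_def Hom_iff simp del: of_real_divide\<close>)
    also have "\<dots> = complex_of_real (sqrt (?\<mu> e) / sqrt (?\<nu> f)) \<^bold>* rij e f"
      by (simp add: vcomp_linear merge hcomp_unit2' del: of_real_divide)
    finally show "complex_of_real c \<^bold>* (((vb e f)\<^sup>\<dagger> \<boxtimes> (v e f)\<^sup>\<dagger>) \<cdot> r) = complex_of_real (sqrt (?\<mu> e) / sqrt (?\<nu> f)) \<^bold>* rij e f" .
    let ?h = "\<lambda>x. case x of (e, f) \<Rightarrow> complex_of_real (sqrt (?\<nu> f) / sqrt (?\<mu> e)) \<^bold>* ((v e f \<boxtimes> vb e f) \<cdot> rbij e f)"
    have hH: "?h x \<in> Hom C (\<^bold>I M) (X \<boxdot> Xb)" if "x \<in> E \<times> F" for x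
      using that block_typing(1-12)[OF _ _ blk] rt by (auto simp: Hom_iff split: prod.splits simp del: of_real_divide)
    have "complex_of_real (1 / c) \<^bold>* (((v e f)\<^sup>\<dagger> \<boxtimes> (vb e f)\<^sup>\<dagger>) \<cdot> rb) = ((v e f)\<^sup>\<dagger> \<boxtimes> (vb e f)\<^sup>\<dagger>) \<cdot> complex_of_real (1 / c) \<^bold>* rb"
      by (simp add: vcomp_linear)
    also have "\<dots> = hsum (\<^bold>I M) (S e f \<boxdot> Sb e f) (\<lambda>x. ((v e f)\<^sup>\<dagger> \<boxtimes> (vb e f)\<^sup>\<dagger>) \<cdot> ?h x) (E \<times> F)"
      unfolding sum2 by (rule vcomp_hsum[OF _ fin hH]) (auto simp: parallel_def Hom_iff)
    also have "\<dots> = ((v e f)\<^sup>\<dagger> \<boxtimes> (vb e f)\<^sup>\<dagger>) \<cdot> ?h (e, f)"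
    proof (rule hsum_delta)
      fix x assume x: "x \<in> E \<times> F" "x \<noteq> (e, f)"
      obtain e' f' where x': "x = (e', f')" "e' \<in> E" "f' \<in> F" "(e, f) \<noteq> (e', f')" using x by blast
      note [simp] = block_typing(1-12)[OF x'(2,3) blk[OF x'(2,3)]] rt[OF x'(2,3)]
      have "(v e f)\<^sup>\<dagger> \<cdot> v e' f' = zero2 C (S e' f') (S e f)"
        by (rule block_orthogonal[OF ef x'(2-4) blk[OF ef] blk[OF x'(2,3)]])
      then show "((v e f)\<^sup>\<dagger> \<boxtimes> (vb e f)\<^sup>\<dagger>) \<cdot> ?h x = zero2 C (\<^bold>I M) (S e f \<boxdot> Sb e f)"
        using x'(1) by (simp add: vcomp_linear merge del: of_real_divide)
    qed (use ef fin in \<open>auto simp: parallel_def Hom_iff simp del: of_real_divide\<close>)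
    also have "\<dots> = complex_of_real (sqrt (?\<nu> f) / sqrt (?\<mu> e)) \<^bold>* rbij e f"
      by (simp add: vcomp_linear merge hcomp_unit2' del: of_real_divide)
    finally show "complex_of_real (1 / c) \<^bold>* (((v e f)\<^sup>\<dagger> \<boxtimes> (vb e f)\<^sup>\<dagger>) \<cdot> rb) = complex_of_real (sqrt (?\<nu> f) / sqrt (?\<mu> e)) \<^bold>* rbij e f" .
  qed
  \<comment> \<open>Both sides of the compressed identities are squared on the block: one side
    yields the weight with \<open>c\<^sup>2\<close> or its inverse, the other the dimension with the
    quotient of the vector entries. On a zero block everything vanishes.\<close>
  have ab: "left_weight e f = ?\<mu> e / ?\<nu> f * D e f / c\<^sup>2 \<and> right_weight e f = ?\<nu> f / ?\<mu> e * D e f * c\<^sup>2" if ef: "e \<in> E" "f \<in> F" for e f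
  proof (cases "e \<cdot> f = zero2 C X X")
    case True
    then show ?thesis using weight_zero[OF ef True] D_zero[OF True] by simp
  next
    case False
    note B = blk[OF ef]
    note [simp] = block_typing(1-14)[OF ef B] rt[OF ef]
    have mn: "0 < ?\<mu> e" "0 < ?\<nu> f" using perron(2,3) ef by auto
    note nzS = block_dim(1)[OF ef B False] and st = std[OF ef False]
    have DD: "D e f = (nrm (\<^bold>1 (S e f) \<boxtimes> rij e f))\<^sup>2"
      using block_dim(2)[OF ef B False] factorial_dim_eq[OF st nzS] by simp
    have oneS: "\<^bold>1 (S e f) \<in> Hom C (S e f) (S e f)" by (simp add: Hom_iff)
    let ?rS = "((vb e f)\<^sup>\<dagger> \<boxtimes> (v e f)\<^sup>\<dagger>) \<cdot> r"
    let ?rbS = "((v e f)\<^sup>\<dagger> \<boxtimes> (vb e f)\<^sup>\<dagger>) \<cdot> rb"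
    have [simp]: "?rS \<in> Arr2 C" "dom2 C ?rS = \<^bold>I N" "cod2 C ?rS = Sb e f \<boxdot> S e f"
      "?rbS \<in> Arr2 C" "dom2 C ?rbS = \<^bold>I M" "cod2 C ?rbS = S e f \<boxdot> Sb e f" by simp_all
    have sq: "\<^bold>1 (S e f) \<boxtimes> ((complex_of_real k \<^bold>* t)\<^sup>\<dagger> \<cdot> complex_of_real k \<^bold>* t) = complex_of_real (k * k) \<^bold>* (\<^bold>1 (S e f) \<boxtimes> (t\<^sup>\<dagger> \<cdot> t))"
      if "t \<in> Arr2 C" "dom2 C t = \<^bold>I N" for k t
      using that by (simp add: vcomp_linear hcomp_linear)
    have sq': "((complex_of_real k \<^bold>* t)\<^sup>\<dagger> \<cdot> complex_of_real k \<^bold>* t) \<boxtimes> \<^bold>1 (S e f) = complex_of_real (k * k) \<^bold>* ((t\<^sup>\<dagger> \<cdot> t) \<boxtimes> \<^bold>1 (S e f))"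
      if "t \<in> Arr2 C" "dom2 C t = \<^bold>I M" for k t
      using that by (simp add: vcomp_linear hcomp_linear)
    define m where "m = sqrt (?\<mu> e) / sqrt (?\<nu> f)"
    define n where "n = sqrt (?\<nu> f) / sqrt (?\<mu> e)"
    have mm: "m * m = ?\<mu> e / ?\<nu> f" "n * n = ?\<nu> f / ?\<mu> e" using mn by (simp_all add: m_def n_def)
    have "complex_of_real (c * c) \<^bold>* (\<^bold>1 (S e f) \<boxtimes> (?rS\<^sup>\<dagger> \<cdot> ?rS)) = complex_of_real (m * m) \<^bold>* (\<^bold>1 (S e f) \<boxtimes> ((rij e f)\<^sup>\<dagger> \<cdot> rij e f))"
      unfolding sq[symmetric, OF \<open>?rS \<in> Arr2 C\<close> \<open>dom2 C ?rS = \<^bold>I N\<close>] sq[symmetric, OF rt(1,2)[OF ef]] compress(1)[OF ef] m_def ..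
    then have "complex_of_real (c * c * left_weight e f) \<^bold>* \<^bold>1 (S e f) = complex_of_real (m * m * D e f) \<^bold>* \<^bold>1 (S e f)"
      unfolding block_scalars(1)[OF ef B] standard_dim(1)[OF st nzS] DD[symmetric] by simp
    then have "complex_of_real (c * c * left_weight e f) = complex_of_real (m * m * D e f)" by (rule scale_cancel[OF _ oneS nzS])
    then have 1: "c * c * left_weight e f = m * m * D e f" unfolding of_real_eq_iff .
    have "complex_of_real (1 / c * (1 / c)) \<^bold>* ((?rbS\<^sup>\<dagger> \<cdot> ?rbS) \<boxtimes> \<^bold>1 (S e f)) = complex_of_real (n * n) \<^bold>* (((rbij e f)\<^sup>\<dagger> \<cdot> rbij e f) \<boxtimes> \<^bold>1 (S e f))"
      unfolding sq'[symmetric, OF \<open>?rbS \<in> Arr2 C\<close> \<open>dom2 C ?rbS = \<^bold>I M\<close>] sq'[symmetric, OF rt(4,5)[OF ef]] compress(2)[OF ef] n_def ..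
    then have "complex_of_real (1 / c * (1 / c) * right_weight e f) \<^bold>* \<^bold>1 (S e f) = complex_of_real (n * n * D e f) \<^bold>* \<^bold>1 (S e f)"
      unfolding block_scalars(2)[OF ef B] standard_dim(2)[OF st nzS] DD[symmetric] by simp
    then have "complex_of_real (1 / c * (1 / c) * right_weight e f) = complex_of_real (n * n * D e f)" by (rule scale_cancel[OF _ oneS nzS])
    then have 2: "1 / c * (1 / c) * right_weight e f = n * n * D e f" unfolding of_real_eq_iff .
    show ?thesis using 1 2 c mn unfolding mm by (simp add: field_simps power2_eq_square)
  qed
  \<comment> \<open>The column sum of \<open>D\<close> weighted by \<mu> is
    \<open>scalar_dim C X\<close> times the entry of \<nu>, which cancels, so the result no longer
    depends on \<open>f\<close>.\<close>
  have sa: "(\<Sum>e\<in>E. left_weight e f) = ?d / c\<^sup>2" if f: "f \<in> F" for f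
  proof -
    have "(\<Sum>e\<in>E. left_weight e f) = (\<Sum>e\<in>E. (1 / (?\<nu> f * c\<^sup>2)) * (D e f * ?\<mu> e))"
      by (rule sum.cong) (use ab f in \<open>auto simp: field_simps\<close>)
    also have "\<dots> = (1 / (?\<nu> f * c\<^sup>2)) * (?d * ?\<nu> f)" unfolding sum_distrib_left[symmetric] perron(7)[OF f] ..
    finally show ?thesis using perron(2)[OF f] by simp
  qed
  have sb: "(\<Sum>f\<in>F. right_weight e f) = ?d * c\<^sup>2" if e: "e \<in> E" for e
  proof -
    have "(\<Sum>f\<in>F. right_weight e f) = (\<Sum>f\<in>F. (c\<^sup>2 / ?\<mu> e) * (D e f * ?\<nu> f))"
      by (rule sum.cong) (use ab e in \<open>auto simp: field_simps\<close>)
    also have "\<dots> = (c\<^sup>2 / ?\<mu> e) * (?d * ?\<mu> e)" unfolding sum_distrib_left[symmetric] perron(6)[OF e] ..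
    finally show ?thesis using perron(3)[OF e] by simp
  qed
  have n1: "nrm (complex_of_real x \<^bold>* \<^bold>1 X) = x" if "0 \<le> x" for x
    using nrm_unit[OF typing(1) nz] that by simp
  let ?R = "\<^bold>1 X \<boxtimes> (r\<^sup>\<dagger> \<cdot> r)" and ?Rb = "(rb\<^sup>\<dagger> \<cdot> rb) \<boxtimes> \<^bold>1 X"
  have RH: "?R \<in> Hom C X X" "?Rb \<in> Hom C X X" by (simp_all add: Hom_iff)
  have "?R = ?R \<cdot> hsum X X (\<lambda>f. f) F" unfolding F_props(2) by simp
  also have "\<dots> = hsum X X (\<lambda>f. ?R \<cdot> f) F" by (rule vcomp_hsum[OF parXX F_props(1) FH RH(1)])
  also have "\<dots> = hsum X X (\<lambda>f. complex_of_real (?d / c\<^sup>2) \<^bold>* f) F"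
    by (rule hsum_cong[OF parXX refl]) (use left_weight_sum sa FH in \<open>auto simp: Hom_iff simp del: of_real_divide of_real_sum\<close>)
  also have "\<dots> = complex_of_real (?d / c\<^sup>2) \<^bold>* \<^bold>1 X"
    unfolding F_props(2)[symmetric] by (rule scale_hsum[OF parXX F_props(1) FH, symmetric])
  finally have R: "nrm ?R = ?d / c\<^sup>2" using n1[of "?d / c\<^sup>2"] perron(1) by (simp del: of_real_divide)
  have "?Rb = ?Rb \<cdot> hsum X X (\<lambda>e. e) E" unfolding E_props(2) by simp
  also have "\<dots> = hsum X X (\<lambda>e. ?Rb \<cdot> e) E" by (rule vcomp_hsum[OF parXX E_props(1) EH RH(2)])
  also have "\<dots> = hsum X X (\<lambda>e. complex_of_real (?d * c\<^sup>2) \<^bold>* e) E"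
    by (rule hsum_cong[OF parXX refl]) (use right_weight_sum sb EH in \<open>auto simp: Hom_iff simp del: of_real_mult of_real_sum\<close>)
  also have "\<dots> = complex_of_real (?d * c\<^sup>2) \<^bold>* \<^bold>1 X"
    unfolding E_props(2)[symmetric] by (rule scale_hsum[OF parXX E_props(1) EH, symmetric])
  finally have Rb: "nrm ?Rb = ?d * c\<^sup>2" using n1[of "?d * c\<^sup>2"] perron(1) by (simp del: of_real_mult)
  show ?thesis unfolding R Rb using c by (simp add: power2_eq_square)
qed

end

section \<open>The zero arrow\<close>

context conj_pair
begin

text \<open>The centers of a zero arrow contain no minimal projection, so the dimension matrix is
  empty with norm 0, and the sums in the definition of a standard solution are empty like the
  solution is zero.\<close>

lemma zero_arrow_standard:
  assumes z: "\<^bold>1 X = zero2 C X X"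
  shows "scalar_dim C X = 0" "nrm (\<^bold>1 X \<boxtimes> (r\<^sup>\<dagger> \<cdot> r)) = 0" "standard_solution C X Xb r rb"
proof -
  have r0: "r = zero2 C (\<^bold>I N) (Xb \<boxdot> X)" "rb = zero2 C (\<^bold>I M) (X \<boxdot> Xb)"
    using zero_unit_comp(1)[OF z _ typing(9), of Xb] zero_unit_comp(2)[OF z _ typing(12), of Xb] by auto
  have all_zero: "t = zero2 C X X" if "t \<in> Hom C X X" for t
  proof -
    have t: "t \<in> Arr2 C" "dom2 C t = X" "cod2 C t = X" using that by (auto simp: Hom_iff)
    then have "t = \<^bold>1 X \<cdot> t" by simp
    then show ?thesis unfolding z using t by simp
  qed
  have LR: "left_center C X \<subseteq> Hom C X X" "right_center C X \<subseteq> Hom C X X"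
    by (auto simp: left_center_def right_center_def center_iff Hom_iff)
  have empty: "left_projections C X = {}" "right_projections C X = {}"
    using LR all_zero minimal_projectionD(1,4) by blast+
  show "scalar_dim C X = 0" by (simp add: scalar_dim_def l2_op_norm_def empty)
  have "\<^bold>1 X \<boxtimes> (r\<^sup>\<dagger> \<cdot> r) = zero2 C X X" by (rule all_zero) (simp add: Hom_iff)
  then show "nrm (\<^bold>1 X \<boxtimes> (r\<^sup>\<dagger> \<cdot> r)) = 0" by (simp add: parallel_def)
  have "parallel (\<^bold>I N) (Xb \<boxdot> X)" "parallel (\<^bold>I M) (X \<boxdot> Xb)" by (auto simp: parallel_def)
  note he = this[THEN hsum_empty]
  show "standard_solution C X Xb r rb"
    unfolding standard_solution_def empty using sol r0 by (simp add: he)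
qed

end

theorem theorem7p44:
  fixes C :: "('o, 'a, 't) two_cstar" (structure)
    and N M :: 'o and X Xb :: 'a and r rb :: 't
  assumes "two_cstar_category C"
    and "rigid C"
    and "finite_dimensional_centers C"
    and "X \<in> arr1 C N M"
    and "Xb \<in> arr1 C M N"
    and "connected_arr C X"
    and "connected_arr C Xb"
    and "conjugate_solution C X Xb r rb"
  shows "norm2 C (\<^bold>1 X \<boxtimes> (r\<^sup>\<dagger> \<cdot> r)) * norm2 C ((rb\<^sup>\<dagger> \<cdot> rb) \<boxtimes> \<^bold>1 X) \<ge> (scalar_dim C X)\<^sup>2 \<and>
    (norm2 C (\<^bold>1 X \<boxtimes> (r\<^sup>\<dagger> \<cdot> r)) * norm2 C ((rb\<^sup>\<dagger> \<cdot> rb) \<boxtimes> \<^bold>1 X) = (scalar_dim C X)\<^sup>2 \<longleftrightarrow>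
     (\<exists>c::real. c > 0 \<and>
        standard_solution C X Xb (scale2 C (complex_of_real c) r)
                                 (scale2 C (complex_of_real (1 / c)) rb)))"
proof -
  interpret two_cstar_category C by fact
  interpret conj_pair C N M X Xb r rb
    by (rule conj_pairI[OF assms(8)]) (use assms(4) in \<open>auto simp: arr1_iff\<close>)
  show ?thesis
  \<comment> \<open>Perron-Frobenius theory presupposes nonempty index sets. For a zero arrow both
    sides of the inequality are 0, and the solution is standard with \<open>c\<close> equal to
    1.\<close>
  proof (cases "\<^bold>1 X = zero2 C X X")
    case True
    have "standard_solution C X Xb (scale2 C (complex_of_real 1) r) (scale2 C (complex_of_real (1 / 1)) rb)"
      using zero_arrow_standard(3)[OF True] by simp
    then have "\<exists>c::real. c > 0 \<and> standard_solution C X Xb (scale2 C (complex_of_real c) r)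
        (scale2 C (complex_of_real (1 / c)) rb)" using zero_less_one by blast
    then show ?thesis using zero_arrow_standard(1,2)[OF True] by simp
  next
    case False
    interpret connected_pair C N M X Xb r rb
      by unfold_locales (use assms False in auto)
    show ?thesis using norm_product(1) equality_imp_standard standard_imp_equality by blast
  qed
qed

end
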